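(* Let $d\ge 3$ and let $W\subset\mathbb{R}^d$ be a convex body. Let $L_1,L_2,\ldots$ be independent, uniformly distributed (i.e. $\nu_d$-distributed) random planes in $\mathbf{G}_2(d)$, independent of the Poisson processes $\eta_t$, and let $m\in\mathbb{N}$ be arbitrary. Then the following hold: (i) if $t^4 r_t^{2d+2}\to 0$ as $t\to\infty$, then $\lim_{t\to\infty}\mathbb{P}(\mathrm{cr}(L_i)=0\text{ for some }i=1,\ldots,m)=1$; (ii) if $t^4 r_t^{2d+2}\to\infty$ as $t\to\infty$, then $\lim_{t\to\infty}\mathbb{P}(\mathrm{cr}(L_i)=0\text{ for some }i=1,\ldots,m)=0$; (iii) if $t^4 r_t^{2d+2}\to c\in(0,\infty)$ as $t\to\infty$, then $$\lim_{t\to\infty}\mathbb{P}(\mathrm{cr}(L_i)=0\text{ for some }i=1,\ldots,m)=1-(1-M)^m,$$ where $$M:=\lim_{t\to\infty}\int_{\mathbf{G}_2(d)}e^{-\mathbb{E}\,\mathrm{cr}(L)}\,\nu_d(\mathrm{d}L)$$ is a constant depending on the limit $c$ and the body $W$.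
   Context: A convex body is a compact convex set with nonempty interior. For $t>0$, $\eta_t$ is a homogeneous Poisson point process on $W$ with intensity $t$ (intensity measure $t$ times Lebesgue measure restricted to $W$), identified with its support. The connectivity radius $r_t>0$ is a deterministic function of $t$ with $r_t\to 0$ as $t\to\infty$. The random geometric graph has vertex set $\eta_t$ and edge set $\{\{v,w\}\subset\eta_t:\ 0<\|v-w\|\le r_t\}$, with $\|\cdot\|$ the Euclidean norm. $\mathbf{G}_2(d)$ is the Grassmannian of two-dimensional linear subspaces of $\mathbb{R}^d$, called planes, and $\nu_d$ is the uniform (rotation-invariant Haar) probability measure on it. $[v,w]$ is the line segment between $v$ and $w$, and $A|_L$ is the orthogonal projection of a point or set $A$ onto the plane $L$. For $L\in\mathbf{G}_2(d)$ define $$\begin{aligned}h_L(v_1,v_2,v_3,v_4)={}&\mathbb{1}\big(\|v_1-v_2\|\le r_t,\ \|v_3-v_4\|\le r_t,\ [v_1,v_2]|_L\cap[v_3,v_4]|_L\ne\emptyset\big)\\&+\mathbb{1}\big(\|v_1-v_3\|\le r_t,\ \|v_2-v_4\|\le r_t,\ [v_1,v_3]|_L\cap[v_2,v_4]|_L\ne\emptyset\big)\\&+\mathbb{1}\big(\|v_1-v_4\|\le r_t,\ \|v_2-v_3\|\le r_t,\ [v_1,v_4]|_L\cap[v_2,v_3]|_L\ne\emptyset\big).\end{aligned}$$ The number of crossings on $L$ is $$\mathrm{cr}(L)=\frac1{24}\sum_{(v_1,v_2,v_3,v_4)\in\eta_{t,\ne}^4}h_L(v_1,v_2,v_3,v_4),$$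 where $\eta_{t,\ne}^4$ is the set of $4$-tuples of pairwise distinct points of $\eta_t$. The dependence of $\mathrm{cr}(L)$ on $t$ is suppressed in the notation. In $\mathbb{E}\,\mathrm{cr}(L)$ the plane $L$ is fixed and the expectation is over $\eta_t$. *)

theory Defs
  imports "HOL-Probability.Probability"
begin

definition convex_body :: "'a::euclidean_space set \<Rightarrow> bool" where
  "convex_body W \<longleftrightarrow> compact W \<and> convex W \<and> interior W \<noteq> {}"

definition orth_proj :: "'a::euclidean_space set \<Rightarrow> 'a \<Rightarrow> 'a" where
  "orth_proj L x = (THE y. y \<in> L \<and> (\<forall>z\<in>L. orthogonal (x - y) z))"

lemma orth_proj_unique:
  assumes "subspace L" "y \<in> L" "\<And>z. z \<in> L \<Longrightarrow> orthogonal (x - y) z"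
  shows "orth_proj L x = y"
  unfolding orth_proj_def
proof (rule the_equality)
  show "y \<in> L \<and> (\<forall>z\<in>L. orthogonal (x - y) z)" using assms by blast
next
  fix y' assume y': "y' \<in> L \<and> (\<forall>z\<in>L. orthogonal (x - y') z)"
  have d: "y' - y \<in> L" using assms y' subspace_diff by blast
  have "(y' - y) \<bullet> (y' - y) = (x - y) \<bullet> (y' - y) - (x - y') \<bullet> (y' - y)"
    by (simp add: inner_diff_left)
  also have "\<dots> = 0" using assms(3)[OF d] y' d by (simp add: orthogonal_def)
  finally show "y' = y" by simp
qed

lemma
  assumes "subspace L"
  shows orth_proj_in: "orth_proj L x \<in> L"
    and orth_proj_orthogonal: "z \<in> L \<Longrightarrow> orthogonal (x - orth_proj L x) z"
proof -
  obtain y w where yw: "y \<in> span L" "\<And>z. z \<in> span L \<Longrightarrow> orthogonal w z" "x = y + w"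
    using orthogonal_subspace_decomp_exists[of L x] by metis
  have L: "span L = L" using assms by (simp add: span_eq_iff)
  have eq: "orth_proj L x = y"
    using yw by (intro orth_proj_unique[OF assms]) (auto simp: L)
  show "orth_proj L x \<in> L" "z \<in> L \<Longrightarrow> orthogonal (x - orth_proj L x) z"
    unfolding eq using yw(1) yw(2)[of z] by (simp_all add: L yw(3))
qed

lemma bounded_linear_orth_proj:
  assumes "subspace L"
  shows "bounded_linear (orth_proj L)"
proof -
  have "linear (orth_proj L)"
  proof (rule linearI)
    fix x y c
    show "orth_proj L (x + y) = orth_proj L x + orth_proj L y"
    proof (rule orth_proj_unique[OF assms])
      fix z assume "z \<in> L"
      then show "orthogonal (x + y - (orth_proj L x + orth_proj L y)) z"
        using orth_proj_orthogonal[OF assms, of z x] orth_proj_orthogonal[OF assms, of z y]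
        by (simp add: orthogonal_def algebra_simps)
    qed (use assms orth_proj_in subspace_add in blast)
    show "orth_proj L (c *\<^sub>R x) = c *\<^sub>R orth_proj L x"
    proof (rule orth_proj_unique[OF assms])
      fix z assume "z \<in> L"
      then show "orthogonal (c *\<^sub>R x - c *\<^sub>R orth_proj L x) z"
        using orth_proj_orthogonal[OF assms, of z x]
        by (simp add: orthogonal_def algebra_simps)
    qed (use assms orth_proj_in subspace_scale in blast)
  qed
  then show ?thesis by (simp add: linear_conv_bounded_linear)
qed

text \<open>
  The Grassmannian of planes with its Borel sets: its standard topology is the one
  induced by the operator norm distance of the orthogonal projections onto the planes.
\<close>

definition planes :: "'a::euclidean_space set set" where
  "planes = {L. subspace L \<and> dim L = 2}"

definition borel_planes :: "'a::euclidean_space set measure" where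
  "borel_planes = vimage_algebra planes (\<lambda>L. Blinfun (orth_proj L)) borel"

text \<open>
  The following predicate determines \<open>\<nu>\<close>: the orthogonal group acts transitively on the
  planes, so there is exactly one invariant probability measure.
\<close>

definition uniform_on_planes :: "'a::euclidean_space set measure \<Rightarrow> bool" where
  "uniform_on_planes \<nu> \<longleftrightarrow>
     prob_space \<nu> \<and> sets \<nu> = sets borel_planes \<and>
     (\<forall>Q. orthogonal_transformation Q \<longrightarrow> distr \<nu> borel_planes (\<lambda>L. Q ` L) = \<nu>)"

text \<open>
  As \<open>W\<close> will be compact, locally finite subsets of \<open>W\<close> are finite; point configurations
  carry the smallest sigma-algebra that makes the number of points in Borel sets measurable.
\<close>

definition configurations :: "'a::euclidean_space set \<Rightarrow> 'a set measure" where
  "configurations W =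
     sigma {S. finite S \<and> S \<subseteq> W}
       {{S. finite S \<and> S \<subseteq> W \<and> card (S \<inter> A) = k} | A k. A \<in> sets borel}"

definition poisson_process ::
  "'w measure \<Rightarrow> real \<Rightarrow> 'a::euclidean_space set \<Rightarrow> ('w \<Rightarrow> 'a set) \<Rightarrow> bool" where
  "poisson_process P t W \<eta> \<longleftrightarrow>
     \<eta> \<in> measurable P (configurations W) \<and>
     (\<forall>A\<in>sets borel.
        distr P (count_space UNIV) (\<lambda>\<omega>. card (\<eta> \<omega> \<inter> A))
          = measure_pmf (poisson_pmf (t * measure lborel (A \<inter> W)))) \<and>
     (\<forall>(A :: nat \<Rightarrow> 'a set) n.
        (\<forall>i<n. A i \<in> sets borel) \<and> disjoint_family_on A {..<n} \<longrightarrow>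
        prob_space.indep_vars P (\<lambda>_. count_space UNIV) (\<lambda>i \<omega>. card (\<eta> \<omega> \<inter> A i)) {..<n})"

definition crossing_pair ::
  "real \<Rightarrow> 'a::euclidean_space set \<Rightarrow> 'a \<Rightarrow> 'a \<Rightarrow> 'a \<Rightarrow> 'a \<Rightarrow> bool" where
  "crossing_pair r L v w x y \<longleftrightarrow>
     norm (v - w) \<le> r \<and> norm (x - y) \<le> r \<and>
     orth_proj L ` closed_segment v w \<inter> orth_proj L ` closed_segment x y \<noteq> {}"

definition crossing_kernel ::
  "real \<Rightarrow> 'a::euclidean_space set \<Rightarrow> 'a \<Rightarrow> 'a \<Rightarrow> 'a \<Rightarrow> 'a \<Rightarrow> real" where
  "crossing_kernel r L v1 v2 v3 v4 =
     of_bool (crossing_pair r L v1 v2 v3 v4)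
   + of_bool (crossing_pair r L v1 v3 v2 v4)
   + of_bool (crossing_pair r L v1 v4 v2 v3)"

definition crossings :: "real \<Rightarrow> 'a::euclidean_space set \<Rightarrow> 'a set \<Rightarrow> real" where
  "crossings r S L =
     1 / 24 * (\<Sum>(v1, v2, v3, v4) \<in>
         {(v1, v2, v3, v4). {v1, v2, v3, v4} \<subseteq> S \<and> distinct [v1, v2, v3, v4]}.
       crossing_kernel r L v1 v2 v3 v4)"

text \<open>
  The random planes are \<open>L 1, L 2, \<dots>\<close>. The last assumption is the independence of the
  sequence of planes and each single \<open>\<eta> t\<close>; nothing is assumed about the joint
  distribution of the \<open>\<eta> t\<close> for different \<open>t\<close>.
\<close>

locale projected_rgg = prob_space P
  for P :: "'w measure" +
  fixes W :: "'a::euclidean_space set"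
    and r :: "real \<Rightarrow> real"
    and \<eta> :: "real \<Rightarrow> 'w \<Rightarrow> 'a set"
    and \<nu> :: "'a set measure"
    and L :: "nat \<Rightarrow> 'w \<Rightarrow> 'a set"
  assumes radius_pos: "\<And>t. t > 0 \<Longrightarrow> r t > 0"
    and radius_tendsto: "(r \<longlongrightarrow> 0) at_top"
    and poisson: "\<And>t. t > 0 \<Longrightarrow> poisson_process P t W (\<eta> t)"
    and planes_distr: "\<And>i. i \<ge> 1 \<Longrightarrow> distr P borel_planes (L i) = \<nu>"
    and planes_indep: "indep_vars (\<lambda>_. borel_planes) L {1..}"
    and planes_process_indep: "\<And>t. t > 0 \<Longrightarrow>
      distr P (configurations W \<Otimes>\<^sub>M (\<Pi>\<^sub>M i\<in>{1..}. borel_planes))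
          (\<lambda>\<omega>. (\<eta> t \<omega>, \<lambda>i\<in>{1..}. L i \<omega>))
        = distr P (configurations W) (\<eta> t) \<Otimes>\<^sub>M
          distr P (\<Pi>\<^sub>M i\<in>{1..}. borel_planes) (\<lambda>\<omega>. \<lambda>i\<in>{1..}. L i \<omega>)"

end

theory Submission
  imports Defs
begin

text \<open>
  Fix a plane first. Up to the eight reorderings of a quadruple that keep its two segments,
  a crossing is a quadruple \<open>(v, w, x, y)\<close> with \<open>v, w\<close> and \<open>x, y\<close> at distance at most \<open>r\<close>,
  and with \<open>x - v\<close> of order \<open>r\<close> in the directions of the plane. The last condition confines
  two coordinates, so after the substitution \<open>w = v + r a\<close>, \<open>y = x + r b\<close> and with \<open>x - v\<close>
  obtained from \<open>u\<close> by contraction with the factor \<open>r\<close> inside the plane, the mean number of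
  crossings is \<open>t\<^sup>4 r\<^sup>2\<^sup>d\<^sup>+\<^sup>2\<close> times an integral with a limit by dominated convergence, the
  \<open>limit_rate\<close> (\<open>single_volume_limit\<close>); it is positive (\<open>limit_rate_pos\<close>).

  The number of crossings is asymptotically Poisson, so the probability of none is close to
  the exponential of minus the mean. The proof of this (\<open>poisson_approximation\<close>) puts a
  solution \<open>f\<close> of the Stein equation into the Mecke formula: inserting the points of a
  crossing into the process raises the number of crossings by one, unless the new points
  take part in further crossings, and the expected number of those tends to zero. Since \<open>f\<close>
  is decreasing on the positive reals and extra crossings only increase the count, one of
  the two bounds has no error term. The same estimate applies to the quadruples that cross
  on at least one of two distinct planes. In the coordinates adapted to the first plane,
  crossings on both planes have vanishing volume (\<open>double_volume_limit\<close>), so that the two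
  rates add up.

  Given the point process, the random planes are independent and identically distributed. If
  \<open>q\<close> is the conditional probability that one random plane shows no crossing, then the
  probability in question is the expectation of \<open>1 - (1 - q)\<^sup>m\<close> (\<open>probability_formula\<close>). The
  mean of \<open>q\<close> tends to the average \<open>M\<close> of \<open>exp (- (c * limit_rate))\<close> over all planes. Its
  second moment is the probability that two independent random planes show no crossing;
  these are almost surely distinct (\<open>uniform_on_planes_atomless\<close>), so it tends to \<open>M\<^sup>2\<close>.
  Hence \<open>q\<close> converges to the constant \<open>M\<close> in mean square, and the limit is \<open>1 - (1 - M)\<^sup>m\<close>.
  The case \<open>c = 0\<close>, where \<open>M = 1\<close>, is the first statement. The second one follows because a
  smaller radius gives fewer crossings: the radius can be lowered until \<open>c\<close> is any
  prescribed number.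
\<close>

section \<open>Measurable functionals of point configurations\<close>

lemma space_configurations: "space (configurations W) = {S. finite S \<and> S \<subseteq> W}"
  unfolding configurations_def by (rule space_measure_of) auto

lemma sets_configurations:
  "sets (configurations W) = sigma_sets {S. finite S \<and> S \<subseteq> W}
     {{S. finite S \<and> S \<subseteq> W \<and> card (S \<inter> A) = k} | A k. A \<in> sets borel}"
  unfolding configurations_def by (rule sets_measure_of) auto

lemma measurable_card_Int:
  assumes "A \<in> sets borel"
  shows "(\<lambda>S. card (S \<inter> A)) \<in> measurable (configurations W) (count_space UNIV)"
proof (rule measurable_count_space_eq2_countable[THEN iffD2])
  show "(\<lambda>S. card (S \<inter> A)) \<in> space (configurations W) \<rightarrow> UNIV \<and>
    (\<forall>a\<in>UNIV. (\<lambda>S. card (S \<inter> A)) -` {a} \<inter> space (configurations W) \<in> sets (configurations W))"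
  proof safe
    fix k
    have "(\<lambda>S. card (S \<inter> A)) -` {k} \<inter> space (configurations W)
        = {S. finite S \<and> S \<subseteq> W \<and> card (S \<inter> A) = k}"
      by (auto simp: space_configurations)
    also have "\<dots> \<in> sets (configurations W)"
      unfolding sets_configurations using assms by (intro sigma_sets.Basic) auto
    finally show "(\<lambda>S. card (S \<inter> A)) -` {k} \<inter> space (configurations W) \<in> sets (configurations W)" .
  qed auto
qed

lemma measurable_into_configurations:
  assumes "\<And>z. z \<in> space M \<Longrightarrow> finite (S z) \<and> S z \<subseteq> W"
    and "\<And>A. A \<in> sets borel \<Longrightarrow> (\<lambda>z. card (S z \<inter> A)) \<in> measurable M (count_space UNIV)"
  shows "S \<in> measurable M (configurations W)"
  unfolding configurations_def
proof (rule measurable_measure_of)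
  fix Y assume "Y \<in> {{S. finite S \<and> S \<subseteq> W \<and> card (S \<inter> A) = k} | A k. A \<in> sets borel}"
  then obtain A k where A: "A \<in> sets borel" and Y: "Y = {S. finite S \<and> S \<subseteq> W \<and> card (S \<inter> A) = k}" by auto
  have "S -` Y \<inter> space M = (\<lambda>z. card (S z \<inter> A)) -` {k} \<inter> space M"
    using assms(1) Y by auto
  then show "S -` Y \<inter> space M \<in> sets M"
    using measurable_sets[OF assms(2)[OF A], of "{k}"] by simp
qed (use assms(1) in auto)

text \<open>
  Sums over the points are treated with extended nonnegative real values, where monotone
  limits are available; this carries the result over to counts.
\<close>

lemma measurable_nat_of_ennreal:
  assumes "(\<lambda>z. of_nat (h z) :: ennreal) \<in> borel_measurable M"
  shows "h \<in> measurable M (count_space (UNIV :: nat set))"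
proof (rule measurable_count_space_eq2_countable[THEN iffD2], safe)
  fix k
  have "h -` {k} \<inter> space M = (\<lambda>z. of_nat (h z) :: ennreal) -` {of_nat k} \<inter> space M"
    by auto
  then show "h -` {k} \<inter> space M \<in> sets M"
    using measurable_sets[OF assms, of "{of_nat k}"] by simp
qed simp

text \<open>
  For the indicator of a rectangle the sum is a point count times an indicator. Complements
  are subtracted from the total number of points, which is finite, and the monotone class
  argument does the rest.
\<close>

lemma measurable_sum_points:
  fixes f :: "'a::euclidean_space \<Rightarrow> 'z \<Rightarrow> ennreal"
  assumes S: "S \<in> measurable M (configurations W)"
    and f: "(\<lambda>(x, z). f x z) \<in> borel_measurable (borel \<Otimes>\<^sub>M M)"
  shows "(\<lambda>z. \<Sum>x\<in>S z. f x z) \<in> borel_measurable M"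
proof -
  have fin: "finite (S z)" if "z \<in> space M" for z
    using measurable_space[OF S that] by (simp add: space_configurations)
  have card: "(\<lambda>z. of_nat (card (S z \<inter> A)) :: ennreal) \<in> borel_measurable M" if "A \<in> sets borel" for A
    using measurable_compose[OF measurable_compose[OF S measurable_card_Int[OF that]], of of_nat borel] by simp
  have main: "(\<lambda>z. \<Sum>x\<in>S z. g (x, z)) \<in> borel_measurable M"
    if "g \<in> borel_measurable (borel \<Otimes>\<^sub>M M)" for g :: "'a \<times> 'z \<Rightarrow> ennreal"
    using that
  proof (induction rule: borel_measurable_induct)
    case (cong f g)
    have "(\<Sum>x\<in>S z. f (x, z)) = (\<Sum>x\<in>S z. g (x, z))" if "z \<in> space M" for z
      using cong(3) that by (auto simp: space_pair_measure)
    then show ?case using cong(4) by (subst measurable_cong) auto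
  next
    case (set C)
    let ?G = "{a \<times> b | a b. a \<in> sets (borel :: 'a measure) \<and> b \<in> sets M}"
    have "Int_stable ?G" by (rule Int_stable_pair_measure_generator)
    moreover have "?G \<subseteq> Pow (space borel \<times> space M)" by (rule pair_measure_closed)
    moreover have "C \<in> sigma_sets (space borel \<times> space M) ?G" using set by (simp add: sets_pair_measure)
    ultimately show ?case
    proof (induction rule: sigma_sets_induct_disjoint)
      case (basic C)
      then obtain a b where ab: "a \<in> sets borel" "b \<in> sets M" "C = a \<times> b" by auto
      have "(\<Sum>x\<in>S z. indicator C (x, z)) = of_nat (card (S z \<inter> a)) * (indicator b z :: ennreal)"
        if "z \<in> space M" for z
        using fin[OF that] unfolding ab(3)
        by (auto simp: indicator_def sum.If_cases Int_def sum_distrib_right[symmetric])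
      moreover have "(\<lambda>z. of_nat (card (S z \<inter> a)) * (indicator b z :: ennreal)) \<in> borel_measurable M"
        using card[OF ab(1)] ab(2) by measurable
      ultimately show ?case by (subst measurable_cong) auto
    next
      case empty
      show ?case by simp
    next
      case (compl C)
      have "(\<Sum>x\<in>S z. indicator (space borel \<times> space M - C) (x, z))
          = of_nat (card (S z \<inter> UNIV)) - (\<Sum>x\<in>S z. indicator C (x, z) :: ennreal)"
        if "z \<in> space M" for z
      proof -
        have "of_nat (card (S z \<inter> UNIV))
            = (\<Sum>x\<in>S z. indicator (space borel \<times> space M - C) (x, z) + (indicator C (x, z) :: ennreal))"
          using that by (subst sum.cong[OF refl, of _ _ "\<lambda>_. 1"]) (auto simp: indicator_def)
        also have "\<dots> = (\<Sum>x\<in>S z. indicator (space borel \<times> space M - C) (x, z))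
           + (\<Sum>x\<in>S z. (indicator C (x, z) :: ennreal))" by (rule sum.distrib)
        finally show ?thesis
          by (simp add: ennreal_add_diff_cancel_right ennreal_indicator[symmetric] del: ennreal_indicator)
      qed
      moreover have "(\<lambda>z. of_nat (card (S z \<inter> UNIV)) - (\<Sum>x\<in>S z. indicator C (x, z) :: ennreal)) \<in> borel_measurable M"
        using card[of UNIV] compl by measurable
      ultimately show ?case by (subst measurable_cong) auto
    next
      case (union A)
      have "(\<Sum>x\<in>S z. indicator (\<Union>(range A)) (x, z)) = (\<Sum>i. \<Sum>x\<in>S z. indicator (A i) (x, z) :: ennreal)" for z
        by (subst suminf_sum) (auto simp: suminf_indicator[OF union(1)])
      moreover have "(\<lambda>z. \<Sum>i. \<Sum>x\<in>S z. indicator (A i) (x, z) :: ennreal) \<in> borel_measurable M"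
        using union(3) by measurable
      ultimately show ?case by simp
    qed
  next
    case (mult u c)
    have "(\<lambda>z. c * (\<Sum>x\<in>S z. u (x, z))) \<in> borel_measurable M" using mult by measurable
    then show ?case by (simp add: sum_distrib_left)
  next
    case (add u v)
    have "(\<lambda>z. (\<Sum>x\<in>S z. v (x, z)) + (\<Sum>x\<in>S z. u (x, z))) \<in> borel_measurable M" using add by measurable
    then show ?case by (simp add: sum.distrib)
  next
    case (seq U)
    have "(\<Sum>x\<in>S z. (SUP i. U i) (x, z)) = (SUP i. \<Sum>x\<in>S z. U i (x, z))" for z
    proof -
      have "(SUP i. \<Sum>x\<in>S z. U i (x, z)) = (\<Sum>x\<in>S z. SUP i. U i (x, z))"
        using \<open>incseq U\<close> by (intro ennreal_SUP_sum) (simp add: incseq_def le_fun_def)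
      then show ?thesis by (simp add: image_comp)
    qed
    moreover have "(\<lambda>z. SUP i. \<Sum>x\<in>S z. U i (x, z)) \<in> borel_measurable M"
      by (intro borel_measurable_SUP seq.IH) auto
    ultimately show ?case by simp
  qed
  show ?thesis using main[of "\<lambda>(x, z). f x z"] f by simp
qed

lemma measurable_sum_points_nat:
  fixes f :: "'a::euclidean_space \<Rightarrow> 'z \<Rightarrow> nat"
  assumes S: "S \<in> measurable M (configurations W)"
    and f: "(\<lambda>(x, z). f x z) \<in> measurable (borel \<Otimes>\<^sub>M M) (count_space UNIV)"
  shows "(\<lambda>z. \<Sum>x\<in>S z. f x z) \<in> measurable M (count_space UNIV)"
proof (rule measurable_nat_of_ennreal)
  have "(\<lambda>z. \<Sum>x\<in>S z. of_nat (f x z) :: ennreal) \<in> borel_measurable M"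
    using measurable_compose[OF f, of of_nat borel]
    by (intro measurable_sum_points[OF S]) (simp add: split_beta')
  then show "(\<lambda>z. of_nat (\<Sum>x\<in>S z. f x z) :: ennreal) \<in> borel_measurable M" by simp
qed

text \<open>
  Membership is a sum over the points, of the indicator of equality with \<open>x\<close>.
\<close>

lemma pred_mem_configuration:
  fixes x :: "'z \<Rightarrow> 'a::euclidean_space"
  assumes S: "S \<in> measurable M (configurations W)" and x: "x \<in> borel_measurable M"
  shows "Measurable.pred M (\<lambda>z. x z \<in> S z)"
proof -
  have "Measurable.pred (borel \<Otimes>\<^sub>M M) (\<lambda>(y, z). norm (y - x z) = 0)"
    using x by measurable
  then have "(\<lambda>(y, z). of_bool (y = x z) :: nat) \<in> measurable (borel \<Otimes>\<^sub>M M) (count_space UNIV)"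
    by (simp add: split_beta')
  then have "(\<lambda>z. \<Sum>y\<in>S z. of_bool (y = x z) :: nat) \<in> measurable M (count_space UNIV)"
    by (intro measurable_sum_points_nat[OF S])
  then have "Measurable.pred M (\<lambda>z. (\<Sum>y\<in>S z. of_bool (y = x z) :: nat) = 1)" by measurable
  moreover have "((\<Sum>y\<in>S z. of_bool (y = x z) :: nat) = 1) = (x z \<in> S z)" if "z \<in> space M" for z
    using measurable_space[OF S that]
    by (subst sum.cong[OF refl, of _ _ "\<lambda>y. if y = x z then 1 else 0"])
      (auto simp: space_configurations)
  ultimately show ?thesis by (subst measurable_cong) auto
qed

lemma measurable_remove_point:
  fixes x :: "'z \<Rightarrow> 'a::euclidean_space"
  assumes S: "S \<in> measurable M (configurations W)" and x: "x \<in> borel_measurable M"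
  shows "(\<lambda>z. S z - {x z}) \<in> measurable M (configurations W)"
proof (rule measurable_into_configurations)
  fix z assume "z \<in> space M"
  then show "finite (S z - {x z}) \<and> S z - {x z} \<subseteq> W"
    using measurable_space[OF S] by (fastforce simp: space_configurations)
next
  fix A :: "'a set" assume A: "A \<in> sets borel"
  have "card ((S z - {x z}) \<inter> A) = card (S z \<inter> A) - (if x z \<in> S z \<and> x z \<in> A then 1 else 0)"
    if "z \<in> space M" for z
  proof -
    have "(S z - {x z}) \<inter> A = (S z \<inter> A) - {x z}" by blast
    moreover have "finite (S z)" using measurable_space[OF S that] by (simp add: space_configurations)
    ultimately show ?thesis by (simp add: card_Diff_singleton_if)
  qed
  moreover have "(\<lambda>z. card (S z \<inter> A) - (if x z \<in> S z \<and> x z \<in> A then 1 else 0 :: nat)) \<in> measurable M (count_space UNIV)"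
    using measurable_compose[OF S measurable_card_Int[OF A]] pred_mem_configuration[OF S x] A x
    by measurable
  ultimately show "(\<lambda>z. card ((S z - {x z}) \<inter> A)) \<in> measurable M (count_space UNIV)"
    by (subst measurable_cong) auto
qed

section \<open>Joint laws of Poisson counts\<close>

text \<open>
  A partition into finitely many cells is encoded as a labelling of the space by natural
  numbers, so that passing to common refinements is arithmetic on labels.
\<close>

definition counts :: "('a \<Rightarrow> nat) \<Rightarrow> 'a set \<Rightarrow> nat \<Rightarrow> nat" where
  "counts l S i = card (S \<inter> l -` {i})"

locale poisson_points = prob_space P for P :: "'w measure" +
  fixes t :: real and W :: "'a::euclidean_space set" and \<eta> :: "'w \<Rightarrow> 'a set"
  assumes t_pos: "t > 0" and compact_W: "compact W" and W_pos: "measure lborel W > 0"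
    and process: "poisson_process P t W \<eta>"
begin

definition intensity :: "'a measure" where
  "intensity = density lborel (\<lambda>x. ennreal t * indicator W x)"

lemma W_borel [measurable]: "W \<in> sets borel"
  using compact_W by (simp add: compact_imp_closed borel_closed)

lemma sets_intensity [measurable_cong, simp]: "sets intensity = sets borel"
  by (simp add: intensity_def)

lemma space_intensity [simp]: "space intensity = UNIV"
  by (simp add: intensity_def)

lemma intensity_cong: "borel_measurable intensity = borel_measurable borel"
  by (rule measurable_cong_sets) simp_all

lemma finite_W: "emeasure lborel (A \<inter> W) < \<infinity>"
proof -
  have "emeasure lborel (A \<inter> W) \<le> emeasure lborel W"
    by (rule emeasure_mono) auto
  also have "\<dots> < \<infinity>" using compact_W by (rule emeasure_compact_finite)
  finally show ?thesis .
qed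

lemma emeasure_intensity:
  assumes "A \<in> sets borel"
  shows "emeasure intensity A = ennreal (t * measure lborel (A \<inter> W))"
proof -
  have "emeasure intensity A = (\<integral>\<^sup>+x. ennreal t * indicator W x * indicator A x \<partial>lborel)"
    unfolding intensity_def using assms by (subst emeasure_density) auto
  also have "\<dots> = (\<integral>\<^sup>+x. ennreal t * indicator (A \<inter> W) x \<partial>lborel)"
    by (intro nn_integral_cong) (auto simp: indicator_def)
  also have "\<dots> = ennreal t * emeasure lborel (A \<inter> W)"
    using assms by (subst nn_integral_cmult_indicator) auto
  also have "\<dots> = ennreal (t * measure lborel (A \<inter> W))"
    using finite_W[of A] t_pos by (simp add: emeasure_eq_ennreal_measure ennreal_mult)
  finally show ?thesis .
qed

sublocale intensity: finite_measure intensity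
  by standard (simp add: emeasure_intensity)

lemma measure_intensity: "A \<in> sets borel \<Longrightarrow> measure intensity A = t * measure lborel (A \<inter> W)"
  using t_pos by (simp add: measure_def emeasure_intensity)

lemma nn_integral_intensity:
  "f \<in> borel_measurable borel \<Longrightarrow> (\<integral>\<^sup>+x. f x \<partial>intensity) = ennreal t * (\<integral>\<^sup>+x\<in>W. f x \<partial>lborel)"
  unfolding intensity_def
  by (subst nn_integral_density) (auto simp: nn_integral_cmult[symmetric] mult_ac)

lemma \<eta>_measurable [measurable]: "\<eta> \<in> measurable P (configurations W)"
  using process by (simp add: poisson_process_def)

lemma \<eta>_finite: "\<omega> \<in> space P \<Longrightarrow> finite (\<eta> \<omega>)" and \<eta>_subset: "\<omega> \<in> space P \<Longrightarrow> \<eta> \<omega> \<subseteq> W"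
  using measurable_space[OF \<eta>_measurable] by (auto simp: space_configurations)

lemma card_measurable [measurable (raw)]:
  "A \<in> sets borel \<Longrightarrow> (\<lambda>\<omega>. card (\<eta> \<omega> \<inter> A)) \<in> measurable P (count_space UNIV)"
  by (rule measurable_compose[OF \<eta>_measurable measurable_card_Int])

lemma distr_card:
  "A \<in> sets borel \<Longrightarrow> distr P (count_space UNIV) (\<lambda>\<omega>. card (\<eta> \<omega> \<inter> A))
     = measure_pmf (poisson_pmf (t * measure lborel (A \<inter> W)))"
  using process by (simp add: poisson_process_def)

text \<open>
  The weights of \<open>poisson_pmf\<close> are characterised for positive rates only. In a null set the
  count is therefore found from two other counts: those of the complement and of the whole
  space have the same law, hence the same expectation of \<open>(1/2) ^ count\<close>, and since one of
  them is never larger than the other they are almost surely equal.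
\<close>

lemma null_set_no_points:
  assumes A: "A \<in> sets borel" and null: "measure lborel (A \<inter> W) = 0"
  shows "AE \<omega> in P. card (\<eta> \<omega> \<inter> A) = 0"
proof -
  let ?g = "\<lambda>B \<omega>. (1/2) ^ card (\<eta> \<omega> \<inter> B) :: real"
  have A': "- A \<in> sets borel" using A by auto
  have "measure lborel (- A \<inter> W) = measure lborel W"
  proof -
    have "measure lborel W = measure lborel ((A \<inter> W) \<union> (- A \<inter> W))"
      by (rule arg_cong[where f = "measure lborel"]) blast
    also have "\<dots> = measure lborel (A \<inter> W) + measure lborel (- A \<inter> W)"
      using A A' finite_W[of A] finite_W[of "- A"]
      by (intro measure_Union) auto
    finally show ?thesis using null by simp
  qed
  then have same: "distr P (count_space UNIV) (\<lambda>\<omega>. card (\<eta> \<omega> \<inter> - A))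
      = distr P (count_space UNIV) (\<lambda>\<omega>. card (\<eta> \<omega> \<inter> UNIV))"
    using A A' by (simp only: distr_card) (simp add: distr_card[of UNIV, simplified])
  have int: "integrable P (?g B)" if "B \<in> sets borel" for B
    using that by (intro integrable_const_bound[where B = 1]) (auto simp: power_le_one)
  have E: "(\<integral>\<omega>. ?g B \<omega> \<partial>P) = (\<integral>k. (1/2) ^ k \<partial>distr P (count_space UNIV) (\<lambda>\<omega>. card (\<eta> \<omega> \<inter> B)))"
    if "B \<in> sets borel" for B
    using that by (subst integral_distr) auto
  have le: "?g UNIV \<omega> \<le> ?g (- A) \<omega>" if "\<omega> \<in> space P" for \<omega>
    using \<eta>_finite[OF that] by (intro power_decreasing card_mono) auto
  have "(\<integral>\<omega>. ?g (- A) \<omega> - ?g UNIV \<omega> \<partial>P) = 0"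
    using int[OF A'] int[of UNIV] by (simp add: E[OF A'] E[of UNIV, simplified] same[simplified])
  moreover have "AE \<omega> in P. 0 \<le> ?g (- A) \<omega> - ?g UNIV \<omega>" using le by auto
  ultimately have "AE \<omega> in P. ?g (- A) \<omega> - ?g UNIV \<omega> = 0"
    using int[OF A'] int[of UNIV] by (subst (asm) integral_nonneg_eq_0_iff_AE) auto
  then show ?thesis
  proof (rule AE_mp[OF _ AE_I2], intro impI)
    fix \<omega> assume w: "\<omega> \<in> space P" and eq: "?g (- A) \<omega> - ?g UNIV \<omega> = 0"
    then have "card (\<eta> \<omega> \<inter> - A) = card (\<eta> \<omega>)"
      by (simp add: power_inject_exp' power_inject_exp)
    moreover have "card (\<eta> \<omega>) = card (\<eta> \<omega> \<inter> A) + card (\<eta> \<omega> \<inter> - A)"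
      using \<eta>_finite[OF w] by (subst card_Un_disjoint[symmetric]) (auto intro: arg_cong[where f = card])
    ultimately show "card (\<eta> \<omega> \<inter> A) = 0" by simp
  qed
qed

lemma prob_card:
  assumes A: "A \<in> sets borel"
  shows "prob {\<omega> \<in> space P. card (\<eta> \<omega> \<inter> A) = k}
    = measure intensity A ^ k / fact k * exp (- measure intensity A)"
proof (cases "measure lborel (A \<inter> W) = 0")
  case True
  have "prob {\<omega> \<in> space P. card (\<eta> \<omega> \<inter> A) = k} = (if k = 0 then 1 else 0)"
  proof (cases "k = 0")
    case k: True
    then show ?thesis using null_set_no_points[OF A True] A by (simp add: prob_Collect_eq_1 card_measurable)
  next
    case False
    have "AE \<omega> in P. \<not> card (\<eta> \<omega> \<inter> A) = k"
      using null_set_no_points[OF A True] False by (auto elim!: eventually_mono)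
    then show ?thesis using A False by (simp add: prob_Collect_eq_0 card_measurable)
  qed
  then show ?thesis using True A by (simp add: measure_intensity)
next
  case False
  then have pos: "t * measure lborel (A \<inter> W) > 0"
    using t_pos measure_nonneg[of lborel "A \<inter> W"] by (simp add: less_le)
  have "prob {\<omega> \<in> space P. card (\<eta> \<omega> \<inter> A) = k}
      = measure (distr P (count_space UNIV) (\<lambda>\<omega>. card (\<eta> \<omega> \<inter> A))) {k}"
    using A by (subst measure_distr) (auto intro!: arg_cong[where f = prob])
  also have "\<dots> = pmf (poisson_pmf (t * measure lborel (A \<inter> W))) k"
    using A by (simp add: distr_card pmf.rep_eq)
  finally show ?thesis using pos A by (simp add: measure_intensity)
qed

lemma prob_counts:
  assumes l: "l \<in> measurable borel (count_space UNIV)" and N: "N > 0"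
  shows "prob {\<omega> \<in> space P. \<forall>i<N. counts l (\<eta> \<omega>) i = k i}
    = (\<Prod>i<N. measure intensity (l -` {i}) ^ k i / fact (k i) * exp (- measure intensity (l -` {i})))"
proof -
  have lb: "l -` {i} \<in> sets borel" for i using measurable_sets[OF l, of "{i}"] by simp
  have ind: "indep_vars (\<lambda>_. count_space UNIV) (\<lambda>i \<omega>. card (\<eta> \<omega> \<inter> l -` {i})) {..<N}"
  proof -
    have "(\<forall>i<N. l -` {i} \<in> sets borel) \<and> disjoint_family_on (\<lambda>i. l -` {i}) {..<N}"
      using lb by (auto simp: disjoint_family_on_def)
    then show ?thesis
      using process[unfolded poisson_process_def, THEN conjunct2, THEN conjunct2,
          THEN spec, of "\<lambda>i. l -` {i}", THEN spec, of N] by blast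
  qed
  have "prob {\<omega> \<in> space P. \<forall>i<N. counts l (\<eta> \<omega>) i = k i}
      = prob (\<Inter>i\<in>{..<N}. (\<lambda>\<omega>. card (\<eta> \<omega> \<inter> l -` {i})) -` {k i} \<inter> space P)"
    using N by (intro arg_cong[where f = prob]) (auto simp: counts_def)
  also have "\<dots> = (\<Prod>i\<in>{..<N}. prob ((\<lambda>\<omega>. card (\<eta> \<omega> \<inter> l -` {i})) -` {k i} \<inter> space P))"
    using N by (intro indep_varsD_finite[OF ind]) auto
  also have "\<dots> = (\<Prod>i<N. prob {\<omega> \<in> space P. card (\<eta> \<omega> \<inter> l -` {i}) = k i})"
    by (intro prod.cong refl arg_cong[where f = prob]) auto
  finally show ?thesis by (simp add: prob_card lb)
qed

text \<open>
  The recursion \<open>(k + 1) p(k + 1) = \<mu> p(k)\<close> of the Poisson weights, in one of several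
  independent coordinates. This is what the Mecke formula says about counts.
\<close>

lemma prob_counts_Suc:
  assumes l: "l \<in> measurable borel (count_space UNIV)" and j: "j < N"
  shows "real (Suc (k j)) * prob {\<omega> \<in> space P. \<forall>i<N. counts l (\<eta> \<omega>) i = (k(j := Suc (k j))) i}
    = measure intensity (l -` {j}) * prob {\<omega> \<in> space P. \<forall>i<N. counts l (\<eta> \<omega>) i = k i}"
proof -
  let ?p = "\<lambda>i n. measure intensity (l -` {i}) ^ n / fact n * exp (- measure intensity (l -` {i}))"
  have N: "N > 0" using j by simp
  have "(\<Prod>i<N. ?p i ((k(j := Suc (k j))) i)) = ?p j (Suc (k j)) * (\<Prod>i\<in>{..<N} - {j}. ?p i (k i))"
    using j by (subst prod.remove[of _ j]) (auto intro!: prod.cong)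
  moreover have "(\<Prod>i<N. ?p i (k i)) = ?p j (k j) * (\<Prod>i\<in>{..<N} - {j}. ?p i (k i))"
    using j by (subst prod.remove[of _ j]) auto
  moreover have "real (Suc (k j)) * ?p j (Suc (k j)) = measure intensity (l -` {j}) * ?p j (k j)"
    by (simp add: fact_Suc field_simps del: of_nat_Suc)
  ultimately show ?thesis
    unfolding prob_counts[OF l N] by (metis (no_types, lifting) mult.assoc)
qed

end

section \<open>The Mecke formula\<close>

abbreviation count_vectors :: "nat \<Rightarrow> (nat \<Rightarrow> nat) set" where
  "count_vectors N \<equiv> {..<N} \<rightarrow>\<^sub>E UNIV"

lemma measurable_counts:
  assumes l: "l \<in> measurable borel (count_space UNIV)"
  shows "(\<lambda>S. \<lambda>i\<in>{..<N}. counts l S i) \<in> measurable (configurations W) (count_space (count_vectors N))"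
proof (rule measurable_count_space_eq_countable[THEN iffD2])
  show "countable (count_vectors N)" by (intro countable_PiE) auto
  show "(\<lambda>S. \<lambda>i\<in>{..<N}. counts l S i) \<in> space (configurations W) \<rightarrow> count_vectors N \<and>
    (\<forall>a\<in>count_vectors N. (\<lambda>S. \<lambda>i\<in>{..<N}. counts l S i) -` {a} \<inter> space (configurations W)
       \<in> sets (configurations W))"
  proof (intro conjI ballI)
    fix a assume a: "a \<in> count_vectors N"
    have lb: "l -` {i} \<in> sets borel" for i using measurable_sets[OF l, of "{i}"] by simp
    note [measurable] = measurable_card_Int[OF lb]
    have "(\<lambda>S. \<lambda>i\<in>{..<N}. counts l S i) -` {a} \<inter> space (configurations W)
      = {S \<in> space (configurations W). \<forall>i\<in>{..<N}. card (S \<inter> l -` {i}) = a i}"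
      using a by (auto simp: counts_def fun_eq_iff PiE_iff extensional_def)
    also have "\<dots> \<in> sets (configurations W)" by measurable
    finally show "(\<lambda>S. \<lambda>i\<in>{..<N}. counts l S i) -` {a} \<inter> space (configurations W)
       \<in> sets (configurations W)" .
  qed auto
qed

lemma sum_label:
  fixes F :: "nat \<Rightarrow> ennreal"
  assumes "finite S" "\<And>x. l x < N"
  shows "(\<Sum>x\<in>S. F (l x)) = (\<Sum>j<N. of_nat (counts l S j) * F j)"
proof -
  have "(\<Sum>x\<in>S. F (l x)) = (\<Sum>j<N. \<Sum>x\<in>{x. x \<in> S \<and> l x = j}. F (l x))"
    using assms by (intro sum.group[symmetric]) auto
  also have "\<dots> = (\<Sum>j<N. of_nat (counts l S j) * F j)"
    by (intro sum.cong refl) (auto simp: counts_def Int_def vimage_def)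
  finally show ?thesis .
qed

lemma counts_remove:
  assumes "finite S" "x \<in> S"
  shows "counts l (S - {x}) i = (if i = l x then counts l S i - 1 else counts l S i)"
proof -
  have "(S - {x}) \<inter> l -` {i} = (if i = l x then S \<inter> l -` {i} - {x} else S \<inter> l -` {i})" by auto
  then show ?thesis using assms by (auto simp: counts_def card_Diff_singleton_if)
qed

lemma counts_coarsen:
  assumes "finite S" "\<And>x. l x < N" "\<And>x. l' x = h (l x)"
  shows "counts l' S i = (\<Sum>k | k < N \<and> h k = i. counts l S k)"
proof -
  have "S \<inter> l' -` {i} = (\<Union>k\<in>{k. k < N \<and> h k = i}. S \<inter> l -` {k})" using assms by auto
  then show ?thesis unfolding counts_def using assms
    by (simp only: , subst card_UN_disjoint) auto
qed

text \<open>
  The events that depend on the counts of one finite partition. They generate the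
  \<open>\<sigma>\<close>-algebra of configurations and, in contrast to the events about a single count, they
  are stable under intersection: two partitions have a common refinement.
\<close>

definition label_events :: "'a::euclidean_space set \<Rightarrow> 'a set set set" where
  "label_events W = {{S \<in> space (configurations W). \<Phi> (\<lambda>i\<in>{..<N}. counts l S i)} | l N \<Phi>.
     l \<in> measurable borel (count_space UNIV) \<and> (\<forall>x. l x < N)}"

lemma label_events_measurable: "label_events W \<subseteq> sets (configurations W)"
proof
  fix E assume "E \<in> label_events W"
  then obtain l N \<Phi> where l: "l \<in> measurable borel (count_space UNIV)"
    and E: "E = {S \<in> space (configurations W). \<Phi> (\<lambda>i\<in>{..<N}. counts l S i)}"
    by (auto simp: label_events_def)
  have "Measurable.pred (configurations W) (\<lambda>S. \<Phi> (\<lambda>i\<in>{..<N}. counts l S i))"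
    by (rule measurable_compose[OF measurable_counts[OF l], of \<Phi>]) simp
  then show "E \<in> sets (configurations W)" unfolding E by measurable
qed

lemma sets_configurations_label_events:
  "sets (configurations W) = sigma_sets (space (configurations W)) (label_events W)"
proof
  show "sigma_sets (space (configurations W)) (label_events W) \<subseteq> sets (configurations W)"
    using label_events_measurable by (rule sets.sigma_sets_subset)
  show "sets (configurations W) \<subseteq> sigma_sets (space (configurations W)) (label_events W)"
    unfolding sets_configurations space_configurations
  proof (rule sigma_sets_mono, safe)
    fix A :: "'a set" and k assume A: "A \<in> sets borel"
    have "{S. finite S \<and> S \<subseteq> W \<and> card (S \<inter> A) = k} \<in> label_events W"
      unfolding label_events_def
    proof (intro CollectI exI conjI)
      show "(\<lambda>x. of_bool (x \<in> A)) \<in> measurable borel (count_space (UNIV :: nat set))"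
        using A by measurable
      show "\<forall>x. of_bool (x \<in> A) < (2 :: nat)" by simp
      have "(\<lambda>x. of_bool (x \<in> A)) -` {Suc 0} = A" by (auto split: if_splits simp: of_bool_def)
      then show "{S. finite S \<and> S \<subseteq> W \<and> card (S \<inter> A) = k} =
          {S \<in> space (configurations W). (\<lambda>c. c 1 = k)
             (\<lambda>i\<in>{..<2}. counts (\<lambda>x. of_bool (x \<in> A)) S i)}"
        by (auto simp: space_configurations counts_def)
    qed
    then show "{S. finite S \<and> S \<subseteq> W \<and> card (S \<inter> A) = k}
        \<in> sigma_sets {S. finite S \<and> S \<subseteq> W} (label_events W)" by (rule sigma_sets.Basic)
  qed
qed

lemma Int_stable_label_events: "Int_stable (label_events W)"
proof (rule Int_stableI)
  fix E1 E2 assume "E1 \<in> label_events W" "E2 \<in> label_events W"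
  then obtain l1 :: "'a \<Rightarrow> nat" and N1 \<Phi>1 and l2 :: "'a \<Rightarrow> nat" and N2 \<Phi>2
    where l1: "l1 \<in> measurable borel (count_space UNIV)" "\<And>x. l1 x < N1"
      and l2: "l2 \<in> measurable borel (count_space UNIV)" "\<And>x. l2 x < N2"
      and E1: "E1 = {S \<in> space (configurations W). \<Phi>1 (\<lambda>i\<in>{..<N1}. counts l1 S i)}"
      and E2: "E2 = {S \<in> space (configurations W). \<Phi>2 (\<lambda>i\<in>{..<N2}. counts l2 S i)}"
    unfolding label_events_def mem_Collect_eq by blast
  \<comment> \<open>a pair of labels as a single label, decoded by mod and div\<close>
  define l where "l x = l1 x + N1 * l2 x" for x
  define N where "N = N1 * N2"
  have lN: "l x < N" for x
  proof -
    have "l x < N1 + N1 * l2 x" using l1(2) by (simp add: l_def)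
    also have "\<dots> = N1 * Suc (l2 x)" by simp
    also have "\<dots> \<le> N" unfolding N_def using l2(2) by (intro mult_left_mono) (auto simp: Suc_le_eq)
    finally show ?thesis .
  qed
  have l1': "l1 x = l x mod N1" and l2': "l2 x = l x div N1" for x
    using l1(2)[of x] by (simp_all add: l_def)
  define \<Phi> where "\<Phi> c \<longleftrightarrow> \<Phi>1 (\<lambda>i\<in>{..<N1}. \<Sum>k | k < N \<and> k mod N1 = i. c k) \<and>
    \<Phi>2 (\<lambda>i\<in>{..<N2}. \<Sum>k | k < N \<and> k div N1 = i. c k)" for c :: "nat \<Rightarrow> nat"
  have "E1 \<inter> E2 = {S \<in> space (configurations W). \<Phi> (\<lambda>i\<in>{..<N}. counts l S i)}"
  proof -
    have "\<Phi> (\<lambda>i\<in>{..<N}. counts l S i) \<longleftrightarrow>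
        \<Phi>1 (\<lambda>i\<in>{..<N1}. counts l1 S i) \<and> \<Phi>2 (\<lambda>i\<in>{..<N2}. counts l2 S i)"
      if "S \<in> space (configurations W)" for S
    proof -
      have S: "finite S" using that by (simp add: space_configurations)
      show ?thesis
        unfolding \<Phi>_def counts_coarsen[of S l N, OF S lN, of l1 "\<lambda>k. k mod N1", OF l1']
          counts_coarsen[of S l N, OF S lN, of l2 "\<lambda>k. k div N1", OF l2']
        by (intro arg_cong2[where f = "(\<and>)"] arg_cong[where f = \<Phi>1] arg_cong[where f = \<Phi>2])
          (auto simp: fun_eq_iff intro!: sum.cong)
    qed
    then show ?thesis unfolding E1 E2 by auto
  qed
  moreover have "l \<in> measurable borel (count_space UNIV)"
    unfolding l_def using l1(1) l2(1) by measurable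
  ultimately show "E1 \<inter> E2 \<in> label_events W"
    unfolding label_events_def using lN by blast
qed

context poisson_points
begin

text \<open>
  There are only countably many count vectors, so an expectation of a function of the counts
  is a sum over them.
\<close>

lemma nn_integral_counts:
  assumes l: "l \<in> measurable borel (count_space UNIV)"
  shows "(\<integral>\<^sup>+\<omega>. h (\<lambda>i\<in>{..<N}. counts l (\<eta> \<omega>) i) \<partial>P)
    = (\<integral>\<^sup>+k. h k * ennreal (prob {\<omega> \<in> space P. \<forall>i<N. counts l (\<eta> \<omega>) i = k i}) \<partial>count_space (count_vectors N))"
proof -
  let ?c = "\<lambda>\<omega>. \<lambda>i\<in>{..<N}. counts l (\<eta> \<omega>) i"
  let ?E = "\<lambda>k. {\<omega> \<in> space P. \<forall>i<N. counts l (\<eta> \<omega>) i = k i}"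
  have cm: "?c \<in> measurable P (count_space (count_vectors N))"
    by (rule measurable_compose[OF \<eta>_measurable measurable_counts[OF l]])
  have E: "?E k = ?c -` {k} \<inter> space P" if "k \<in> count_vectors N" for k
    using that by (auto simp: fun_eq_iff PiE_iff extensional_def)
  have Em: "?E k \<in> sets P" if "k \<in> count_vectors N" for k
    unfolding E[OF that] using cm that by (intro measurable_sets[OF cm]) auto
  have "h (?c \<omega>) = (\<integral>\<^sup>+k. h k * indicator (?E k) \<omega> \<partial>count_space (count_vectors N))"
    if "\<omega> \<in> space P" for \<omega>
  proof -
    have "(\<integral>\<^sup>+k. h k * indicator (?E k) \<omega> \<partial>count_space (count_vectors N))
        = (\<Sum>k\<in>{?c \<omega>}. h k * indicator (?E k) \<omega>)"
      using that by (intro nn_integral_count_space') (auto simp: E)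
    then show ?thesis using that by simp
  qed
  then have "(\<integral>\<^sup>+\<omega>. h (?c \<omega>) \<partial>P)
      = (\<integral>\<^sup>+\<omega>. \<integral>\<^sup>+k. h k * indicator (?E k) \<omega> \<partial>count_space (count_vectors N) \<partial>P)"
    by (intro nn_integral_cong)
  also have "\<dots> = (\<integral>\<^sup>+k. \<integral>\<^sup>+\<omega>. h k * indicator (?E k) \<omega> \<partial>P \<partial>count_space (count_vectors N))"
  proof (rule nn_integral_count_space_nn_integral)
    show "countable (count_vectors N)" by (intro countable_PiE) auto
    show "(\<lambda>\<omega>. h k * indicator (?E k) \<omega>) \<in> borel_measurable P" if "k \<in> count_vectors N" for k
      by (rule borel_measurable_times_ennreal[OF borel_measurable_const borel_measurable_indicator[OF Em[OF that]]])
  qed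
  also have "\<dots> = (\<integral>\<^sup>+k. h k * ennreal (prob (?E k)) \<partial>count_space (count_vectors N))"
  proof (rule nn_integral_cong)
    fix k assume "k \<in> space (count_space (count_vectors N))"
    then have "?E k \<in> sets P" using Em[of k] by (simp only: space_count_space)
    then show "(\<integral>\<^sup>+\<omega>. h k * indicator (?E k) \<omega> \<partial>P) = h k * ennreal (prob (?E k))"
      by (simp only: nn_integral_cmult_indicator emeasure_eq_measure)
  qed
  finally show ?thesis .
qed

text \<open>
  In the sum over all count vectors the substitution of \<open>k(j := k j + 1)\<close> for \<open>k\<close> moves the
  factor \<open>k j\<close> into the recursion of the weights.
\<close>

lemma mecke_counts_class:
  assumes l: "l \<in> measurable borel (count_space UNIV)" and j: "j < N"
  shows "(\<integral>\<^sup>+\<omega>. of_nat (counts l (\<eta> \<omega>) j) *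
        g ((\<lambda>i\<in>{..<N}. counts l (\<eta> \<omega>) i)(j := counts l (\<eta> \<omega>) j - 1)) \<partial>P)
    = emeasure intensity (l -` {j}) * (\<integral>\<^sup>+\<omega>. g (\<lambda>i\<in>{..<N}. counts l (\<eta> \<omega>) i) \<partial>P)"
proof -
  let ?K = "count_vectors N"
  let ?c = "\<lambda>\<omega>. \<lambda>i\<in>{..<N}. counts l (\<eta> \<omega>) i"
  define p where "p k = ennreal (prob {\<omega> \<in> space P. \<forall>i<N. counts l (\<eta> \<omega>) i = k i})" for k
  define s where "s k = k(j := Suc (k j))" for k :: "nat \<Rightarrow> nat"
  have bij: "bij_betw s ?K {k \<in> ?K. k j \<noteq> 0}"
  proof (rule bij_betwI[where g = "\<lambda>k. k(j := k j - 1)"])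
    show "s \<in> ?K \<rightarrow> {k \<in> ?K. k j \<noteq> 0}" using j by (auto simp: s_def PiE_iff extensional_def)
    show "(\<lambda>k. k(j := k j - 1)) \<in> {k \<in> ?K. k j \<noteq> 0} \<rightarrow> ?K" using j by (auto simp: PiE_iff extensional_def)
  qed (auto simp: s_def)
  have ps: "of_nat (Suc (k j)) * p (s k) = emeasure intensity (l -` {j}) * p k" for k
  proof -
    have "of_nat (Suc (k j)) * p (s k) = ennreal (real (Suc (k j)) *
        prob {\<omega> \<in> space P. \<forall>i<N. counts l (\<eta> \<omega>) i = (k(j := Suc (k j))) i})"
      by (simp add: p_def s_def ennreal_mult ennreal_of_nat_eq_real_of_nat del: of_nat_Suc)
    also have "\<dots> = emeasure intensity (l -` {j}) * p k"
      unfolding prob_counts_Suc[where k = k, OF l j]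
      by (simp add: p_def ennreal_mult intensity.emeasure_eq_measure)
    finally show ?thesis .
  qed
  have "(\<integral>\<^sup>+\<omega>. of_nat (counts l (\<eta> \<omega>) j) * g ((?c \<omega>)(j := counts l (\<eta> \<omega>) j - 1)) \<partial>P)
      = (\<integral>\<^sup>+\<omega>. (\<lambda>k. of_nat (k j) * g (k(j := k j - 1))) (?c \<omega>) \<partial>P)"
    using j by simp
  also have "\<dots> = (\<integral>\<^sup>+k. of_nat (k j) * g (k(j := k j - 1)) * p k \<partial>count_space ?K)"
    unfolding p_def by (rule nn_integral_counts[OF l])
  also have "\<dots> = (\<integral>\<^sup>+k. of_nat (k j) * g (k(j := k j - 1)) * p k \<partial>count_space {k \<in> ?K. k j \<noteq> 0})"
    by (rule nn_integral_count_space_eq) auto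
  also have "\<dots> = (\<integral>\<^sup>+k. of_nat (s k j) * g ((s k)(j := s k j - 1)) * p (s k) \<partial>count_space ?K)"
    by (rule nn_integral_bij_count_space[OF bij, symmetric])
  also have "\<dots> = (\<integral>\<^sup>+k. emeasure intensity (l -` {j}) * (g k * p k) \<partial>count_space ?K)"
  proof (rule nn_integral_cong)
    fix k
    have "of_nat (s k j) * g ((s k)(j := s k j - 1)) * p (s k) = g k * (of_nat (Suc (k j)) * p (s k))"
      by (simp add: s_def mult_ac)
    then show "of_nat (s k j) * g ((s k)(j := s k j - 1)) * p (s k)
        = emeasure intensity (l -` {j}) * (g k * p k)"
      unfolding ps by (simp add: mult_ac)
  qed
  also have "\<dots> = emeasure intensity (l -` {j}) * (\<integral>\<^sup>+k. g k * p k \<partial>count_space ?K)"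
    by (rule nn_integral_cmult) simp
  also have "(\<integral>\<^sup>+k. g k * p k \<partial>count_space ?K) = (\<integral>\<^sup>+\<omega>. g (?c \<omega>) \<partial>P)"
    unfolding p_def by (rule nn_integral_counts[OF l, symmetric])
  finally show ?thesis .
qed

text \<open>
  Group the points by label: removing a point of label \<open>j\<close> lowers the count of \<open>j\<close> by one
  and leaves the others unchanged.
\<close>

lemma mecke_counts:
  assumes l: "l \<in> measurable borel (count_space UNIV)" and lN: "\<And>x. l x < N"
  shows "(\<integral>\<^sup>+\<omega>. (\<Sum>x\<in>\<eta> \<omega>. g (l x) (\<lambda>i\<in>{..<N}. counts l (\<eta> \<omega> - {x}) i)) \<partial>P)
    = (\<integral>\<^sup>+x. \<integral>\<^sup>+\<omega>. g (l x) (\<lambda>i\<in>{..<N}. counts l (\<eta> \<omega>) i) \<partial>P \<partial>intensity)"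
proof -
  let ?c = "\<lambda>\<omega>. \<lambda>i\<in>{..<N}. counts l (\<eta> \<omega>) i"
  let ?H = "\<lambda>j. \<integral>\<^sup>+\<omega>. g j (?c \<omega>) \<partial>P"
  have lb: "l -` {i} \<in> sets borel" for i using measurable_sets[OF l, of "{i}"] by simp
  have cm: "?c \<in> measurable P (count_space (count_vectors N))"
    by (rule measurable_compose[OF \<eta>_measurable measurable_counts[OF l]])
  have "(\<integral>\<^sup>+\<omega>. (\<Sum>x\<in>\<eta> \<omega>. g (l x) (\<lambda>i\<in>{..<N}. counts l (\<eta> \<omega> - {x}) i)) \<partial>P)
      = (\<integral>\<^sup>+\<omega>. (\<Sum>j<N. of_nat (counts l (\<eta> \<omega>) j) * g j ((?c \<omega>)(j := counts l (\<eta> \<omega>) j - 1))) \<partial>P)"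
  proof (rule nn_integral_cong)
    fix \<omega> assume w: "\<omega> \<in> space P"
    have "(\<Sum>x\<in>\<eta> \<omega>. g (l x) (\<lambda>i\<in>{..<N}. counts l (\<eta> \<omega> - {x}) i))
        = (\<Sum>x\<in>\<eta> \<omega>. (\<lambda>j. g j ((?c \<omega>)(j := counts l (\<eta> \<omega>) j - 1))) (l x))"
    proof (rule sum.cong[OF refl])
      fix x assume "x \<in> \<eta> \<omega>"
      then have "(\<lambda>i\<in>{..<N}. counts l (\<eta> \<omega> - {x}) i) = (?c \<omega>)(l x := counts l (\<eta> \<omega>) (l x) - 1)"
        using \<eta>_finite[OF w] lN by (auto simp: counts_remove fun_eq_iff)
      then show "g (l x) (\<lambda>i\<in>{..<N}. counts l (\<eta> \<omega> - {x}) i)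
        = (\<lambda>j. g j ((?c \<omega>)(j := counts l (\<eta> \<omega>) j - 1))) (l x)" by simp
    qed
    also have "\<dots> = (\<Sum>j<N. of_nat (counts l (\<eta> \<omega>) j) * g j ((?c \<omega>)(j := counts l (\<eta> \<omega>) j - 1)))"
      using \<eta>_finite[OF w] lN by (rule sum_label)
    finally show "(\<Sum>x\<in>\<eta> \<omega>. g (l x) (\<lambda>i\<in>{..<N}. counts l (\<eta> \<omega> - {x}) i))
      = (\<Sum>j<N. of_nat (counts l (\<eta> \<omega>) j) * g j ((?c \<omega>)(j := counts l (\<eta> \<omega>) j - 1)))" .
  qed
  also have "\<dots> = (\<Sum>j<N. \<integral>\<^sup>+\<omega>. of_nat (counts l (\<eta> \<omega>) j) * g j ((?c \<omega>)(j := counts l (\<eta> \<omega>) j - 1)) \<partial>P)"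
  proof (rule nn_integral_sum)
    fix j assume "j \<in> {..<N}"
    then have "(\<lambda>\<omega>. of_nat (counts l (\<eta> \<omega>) j) * g j ((?c \<omega>)(j := counts l (\<eta> \<omega>) j - 1)))
      = (\<lambda>\<omega>. (\<lambda>k. of_nat (k j) * g j (k(j := k j - 1))) (?c \<omega>))" by auto
    also have "\<dots> \<in> borel_measurable P"
      by (rule measurable_compose[OF cm]) simp
    finally show "(\<lambda>\<omega>. of_nat (counts l (\<eta> \<omega>) j) * g j ((?c \<omega>)(j := counts l (\<eta> \<omega>) j - 1)))
      \<in> borel_measurable P" .
  qed
  also have "\<dots> = (\<Sum>j<N. emeasure intensity (l -` {j}) * ?H j)"
    using mecke_counts_class[OF l] by (intro sum.cong) auto
  also have "\<dots> = (\<Sum>j<N. \<integral>\<^sup>+x. ?H j * indicator (l -` {j}) x \<partial>intensity)"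
    using lb by (intro sum.cong refl, subst nn_integral_cmult_indicator) (auto simp: mult.commute)
  also have "\<dots> = (\<integral>\<^sup>+x. (\<Sum>j<N. ?H j * indicator (l -` {j}) x) \<partial>intensity)"
    using lb by (intro nn_integral_sum[symmetric]) auto
  also have "\<dots> = (\<integral>\<^sup>+x. ?H (l x) \<partial>intensity)"
  proof (rule nn_integral_cong)
    fix x
    have "(\<Sum>j<N. ?H j * indicator (l -` {j}) x) = (\<Sum>j<N. if l x = j then ?H j else 0)"
      by (intro sum.cong) auto
    then show "(\<Sum>j<N. ?H j * indicator (l -` {j}) x) = ?H (l x)" using lN by simp
  qed
  finally show ?thesis .
qed

text \<open>
  Both sides are finite measures of \<open>C\<close>, so it suffices to compare them on products of a
  Borel set \<open>A\<close> and a label event. If the partition is refined by \<open>A\<close>, then the summand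
  depends only on the label of the point and on the counts of the other points.
\<close>

lemma mecke_indicator:
  assumes C: "C \<in> sets (borel \<Otimes>\<^sub>M configurations W)"
  shows "(\<integral>\<^sup>+\<omega>. (\<Sum>x\<in>\<eta> \<omega>. indicator C (x, \<eta> \<omega> - {x})) \<partial>P)
    = (\<integral>\<^sup>+x. \<integral>\<^sup>+\<omega>. indicator C (x, \<eta> \<omega>) \<partial>P \<partial>intensity)"
proof -
  let ?\<Omega> = "space borel \<times> space (configurations W)"
  let ?G = "{A \<times> E | A E. A \<in> sets (borel :: 'a measure) \<and> E \<in> label_events W}"
  define L R where "L C = (\<integral>\<^sup>+\<omega>. (\<Sum>x\<in>\<eta> \<omega>. indicator C (x, \<eta> \<omega> - {x})) \<partial>P)"
    and "R C = (\<integral>\<^sup>+x. \<integral>\<^sup>+\<omega>. indicator C (x, \<eta> \<omega>) \<partial>P \<partial>intensity)" for C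
  have top: "space (configurations W) \<in> label_events W"
    unfolding label_events_def
    by (intro CollectI exI[of _ "\<lambda>_. 0"] exI[of _ 1] exI[of _ "\<lambda>_. True"]) auto
  have sub: "label_events W \<subseteq> Pow (space (configurations W))"
    by (auto simp: label_events_def)
  have GG: "?G \<subseteq> Pow ?\<Omega>" using sub by auto
  have sets: "sets (borel \<Otimes>\<^sub>M configurations W) = sigma_sets ?\<Omega> ?G"
  proof -
    have "sets (borel \<Otimes>\<^sub>M configurations W) = sets (sigma ?\<Omega> ?G)"
      using top sub
      by (intro sets_pair_eq[where Ca = "{UNIV}" and Cb = "{space (configurations W)}"]
            sets_configurations_label_events)
         (auto simp: sets.sigma_sets_eq[of borel, simplified])
    then show ?thesis using GG by simp
  qed
  have stable: "Int_stable ?G"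
  proof (rule Int_stableI)
    fix X Y assume "X \<in> ?G" "Y \<in> ?G"
    then obtain A E A' E' where "X = A \<times> E" "Y = A' \<times> E'" "A \<in> sets borel" "A' \<in> sets borel"
      "E \<in> label_events W" "E' \<in> label_events W" by auto
    then show "X \<inter> Y \<in> ?G"
      using Int_stable_label_events[of W, unfolded Int_stable_def]
      by (auto simp: Times_Int_Times intro!: exI[of _ "A \<inter> A'"] exI[of _ "E \<inter> E'"])
  qed
  have measL: "(\<lambda>\<omega>. \<Sum>x\<in>\<eta> \<omega>. indicator C (x, \<eta> \<omega> - {x}) :: ennreal) \<in> borel_measurable P"
    if "C \<in> sets (borel \<Otimes>\<^sub>M configurations W)" for C
  proof (rule measurable_sum_points[OF \<eta>_measurable])
    have "(\<lambda>z. (fst z, \<eta> (snd z) - {fst z})) \<in> measurable (borel \<Otimes>\<^sub>M P) (borel \<Otimes>\<^sub>M configurations W)"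
      by (intro measurable_Pair measurable_remove_point) measurable
    from measurable_compose[OF this borel_measurable_indicator[OF that]]
    show "(\<lambda>(x, z). indicator C (x, \<eta> z - {x}) :: ennreal) \<in> borel_measurable (borel \<Otimes>\<^sub>M P)"
      by (simp add: split_beta')
  qed
  have pairm: "(\<lambda>(x, \<omega>). indicator C (x, \<eta> \<omega>) :: ennreal) \<in> borel_measurable (borel \<Otimes>\<^sub>M P)"
    if "C \<in> sets (borel \<Otimes>\<^sub>M configurations W)" for C
    using that by measurable
  have measR1: "(\<lambda>\<omega>. indicator C (x, \<eta> \<omega>) :: ennreal) \<in> borel_measurable P"
    if "C \<in> sets (borel \<Otimes>\<^sub>M configurations W)" for C x
    using that by measurable
  have measR: "(\<lambda>x. \<integral>\<^sup>+\<omega>. indicator C (x, \<eta> \<omega>) \<partial>P) \<in> borel_measurable intensity"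
    if "C \<in> sets (borel \<Otimes>\<^sub>M configurations W)" for C
  proof -
    have "(\<lambda>x. \<integral>\<^sup>+\<omega>. indicator C (x, \<eta> \<omega>) \<partial>P) \<in> borel_measurable borel"
      using borel_measurable_nn_integral_fst[OF pairm[OF that]] by simp
    then show ?thesis by simp
  qed
  have RC: "R ?\<Omega> = emeasure intensity UNIV"
    using measurable_space[OF \<eta>_measurable]
    by (simp add: R_def cong: nn_integral_cong) (simp add: emeasure_space_1 nn_integral_cong[where v = "\<lambda>_. 1"])
  have "C \<in> sigma_sets ?\<Omega> ?G" using C unfolding sets .
  from stable GG this have "L C = R C"
  proof (induction rule: sigma_sets_induct_disjoint)
    case (basic C)
    then obtain A l N \<Phi> where A: "A \<in> sets borel"
      and l: "l \<in> measurable borel (count_space UNIV)" "\<And>x. l x < N"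
      and C: "C = A \<times> {S \<in> space (configurations W). \<Phi> (\<lambda>i\<in>{..<N}. counts l S i)}"
      by (auto simp: label_events_def)
    \<comment> \<open>the parity of the refined label tells whether the point is in A\<close>
    define l' where "l' x = 2 * l x + of_bool (x \<in> A)" for x
    have l'm: "l' \<in> measurable borel (count_space UNIV)" unfolding l'_def using A l(1) by measurable
    have l'N: "l' x < 2 * N" for x using l(2)[of x] by (auto simp: l'_def)
    have ll': "l x = l' x div 2" for x by (auto simp: l'_def)
    define g :: "nat \<Rightarrow> (nat \<Rightarrow> nat) \<Rightarrow> ennreal" where
      "g j c = of_bool (odd j \<and> \<Phi> (\<lambda>i\<in>{..<N}. \<Sum>k | k < 2 * N \<and> k div 2 = i. c k))" for j c
    have ind: "indicator C (x, S) = g (l' x) (\<lambda>i\<in>{..<2 * N}. counts l' S i)"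
      if "S \<in> space (configurations W)" for x S
    proof -
      have S: "finite S" using that by (simp add: space_configurations)
      have "(\<lambda>i\<in>{..<N}. counts l S i)
          = (\<lambda>i\<in>{..<N}. \<Sum>k | k < 2 * N \<and> k div 2 = i. (\<lambda>i\<in>{..<2 * N}. counts l' S i) k)"
        unfolding counts_coarsen[of S l' "2 * N", OF S l'N, of l "\<lambda>k. k div 2", OF ll'] by (auto simp: fun_eq_iff intro!: sum.cong)
      moreover have "odd (l' x) \<longleftrightarrow> x \<in> A" by (simp add: l'_def)
      ultimately show ?thesis using that by (simp add: g_def C indicator_def)
    qed
    have sp: "\<eta> \<omega> \<in> space (configurations W)" "\<eta> \<omega> - {x} \<in> space (configurations W)"
      if "\<omega> \<in> space P" for \<omega> x
      using measurable_space[OF \<eta>_measurable that] by (auto simp: space_configurations)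
    have "L C = (\<integral>\<^sup>+\<omega>. (\<Sum>x\<in>\<eta> \<omega>. g (l' x) (\<lambda>i\<in>{..<2 * N}. counts l' (\<eta> \<omega> - {x}) i)) \<partial>P)"
      unfolding L_def by (intro nn_integral_cong sum.cong ind sp refl)
    also have "\<dots> = (\<integral>\<^sup>+x. \<integral>\<^sup>+\<omega>. g (l' x) (\<lambda>i\<in>{..<2 * N}. counts l' (\<eta> \<omega>) i) \<partial>P \<partial>intensity)"
      by (rule mecke_counts[OF l'm l'N])
    also have "\<dots> = R C"
      unfolding R_def by (intro nn_integral_cong ind[symmetric] sp)
    finally show ?case .
  next
    case empty
    show ?case by (simp add: L_def R_def)
  next
    case (compl C)
    have C: "C \<in> sets (borel \<Otimes>\<^sub>M configurations W)" using compl(1) by (simp add: sets)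
    have C': "?\<Omega> - C \<in> sets (borel \<Otimes>\<^sub>M configurations W)"
      using sets.compl_sets[OF C] by (simp add: space_pair_measure)
    have "L ?\<Omega> = R ?\<Omega>"
    proof -
      have "L ?\<Omega> = (\<integral>\<^sup>+\<omega>. (\<Sum>x\<in>\<eta> \<omega>. (\<lambda>_ _. 1) ((\<lambda>_. 0) x) (\<lambda>i\<in>{..<1}. counts (\<lambda>_. 0) (\<eta> \<omega> - {x}) i)) \<partial>P)"
        unfolding L_def using \<eta>_finite \<eta>_subset
        by (intro nn_integral_cong sum.cong) (auto simp: indicator_def space_configurations)
      also have "\<dots> = (\<integral>\<^sup>+x. \<integral>\<^sup>+\<omega>. 1 \<partial>P \<partial>intensity)"
        by (subst mecke_counts) auto
      also have "\<dots> = R ?\<Omega>" using RC by (simp add: emeasure_space_1)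
      finally show ?thesis .
    qed
    moreover have "L ?\<Omega> = L C + L (?\<Omega> - C)"
    proof -
      have "L ?\<Omega> = (\<integral>\<^sup>+\<omega>. (\<Sum>x\<in>\<eta> \<omega>. indicator C (x, \<eta> \<omega> - {x})) + (\<Sum>x\<in>\<eta> \<omega>. indicator (?\<Omega> - C) (x, \<eta> \<omega> - {x})) \<partial>P)"
        unfolding L_def sum.distrib[symmetric]
        using sets.sets_into_space[OF C]
        by (intro nn_integral_cong sum.cong) (auto simp: indicator_def space_pair_measure)
      also have "\<dots> = L C + L (?\<Omega> - C)"
        unfolding L_def by (rule nn_integral_add[OF measL[OF C] measL[OF C']])
      finally show ?thesis .
    qed
    moreover have "R ?\<Omega> = R C + R (?\<Omega> - C)"
    proof -
      have "R ?\<Omega> = (\<integral>\<^sup>+x. \<integral>\<^sup>+\<omega>. indicator C (x, \<eta> \<omega>) + indicator (?\<Omega> - C) (x, \<eta> \<omega>) \<partial>P \<partial>intensity)"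
        unfolding R_def using sets.sets_into_space[OF C]
        by (intro nn_integral_cong) (auto simp: indicator_def space_pair_measure)
      also have "\<dots> = (\<integral>\<^sup>+x. (\<integral>\<^sup>+\<omega>. indicator C (x, \<eta> \<omega>) \<partial>P) + (\<integral>\<^sup>+\<omega>. indicator (?\<Omega> - C) (x, \<eta> \<omega>) \<partial>P) \<partial>intensity)"
        by (rule nn_integral_cong) (rule nn_integral_add[OF measR1[OF C] measR1[OF C']])
      also have "\<dots> = R C + R (?\<Omega> - C)"
        unfolding R_def by (rule nn_integral_add[OF measR[OF C] measR[OF C']])
      finally show ?thesis .
    qed
    \<comment> \<open>the mean number of points is finite, so R C can be cancelled\<close>
    moreover have "R C \<noteq> \<infinity>"
    proof -
      have "R C \<le> R ?\<Omega>" using \<open>R ?\<Omega> = R C + R (?\<Omega> - C)\<close> by simp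
      then show ?thesis unfolding RC using intensity.emeasure_finite[of UNIV] by (auto simp: top_unique)
    qed
    ultimately show ?case using compl(2) by (metis ennreal_add_left_cancel)
  next
    case (union C)
    have C: "C i \<in> sets (borel \<Otimes>\<^sub>M configurations W)" for i using union(2) by (auto simp: sets)
    have "L (\<Union>i. C i) = (\<Sum>i. L (C i))"
    proof -
      have "L (\<Union>i. C i) = (\<integral>\<^sup>+\<omega>. (\<Sum>i. \<Sum>x\<in>\<eta> \<omega>. indicator (C i) (x, \<eta> \<omega> - {x})) \<partial>P)"
        unfolding L_def
        by (intro nn_integral_cong, subst suminf_sum) (auto simp: suminf_indicator[OF union(1)])
      also have "\<dots> = (\<Sum>i. L (C i))"
        unfolding L_def by (rule nn_integral_suminf[OF measL[OF C]])
      finally show ?thesis .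
    qed
    moreover have "R (\<Union>i. C i) = (\<Sum>i. R (C i))"
    proof -
      have "R (\<Union>i. C i) = (\<integral>\<^sup>+x. \<integral>\<^sup>+\<omega>. (\<Sum>i. indicator (C i) (x, \<eta> \<omega>)) \<partial>P \<partial>intensity)"
        unfolding R_def by (simp add: suminf_indicator[OF union(1)])
      also have "\<dots> = (\<integral>\<^sup>+x. (\<Sum>i. \<integral>\<^sup>+\<omega>. indicator (C i) (x, \<eta> \<omega>) \<partial>P) \<partial>intensity)"
        by (rule nn_integral_cong) (rule nn_integral_suminf[OF measR1[OF C]])
      also have "\<dots> = (\<Sum>i. R (C i))"
        unfolding R_def by (rule nn_integral_suminf[OF measR[OF C]])
      finally show ?thesis .
    qed
    ultimately show ?case using union(3) by simp
  qed
  then show ?thesis unfolding L_def R_def .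
qed

end

lemma measurable_sum_removed:
  fixes F :: "'a::euclidean_space \<Rightarrow> 'z \<Rightarrow> 'a set \<Rightarrow> ennreal"
  assumes S: "S \<in> measurable M (configurations W)"
    and F: "(\<lambda>(x, z, T). F x z T) \<in> borel_measurable (borel \<Otimes>\<^sub>M M \<Otimes>\<^sub>M configurations W)"
  shows "(\<lambda>z. \<Sum>x\<in>S z. F x z (S z - {x})) \<in> borel_measurable M"
proof (rule measurable_sum_points[OF S])
  have "(\<lambda>w. S (snd w) - {fst w}) \<in> measurable (borel \<Otimes>\<^sub>M M) (configurations W)"
  proof (rule measurable_remove_point)
    show "(\<lambda>w. S (snd w)) \<in> measurable (borel \<Otimes>\<^sub>M M) (configurations W)" using S by measurable
  qed measurable
  then have "(\<lambda>w. (fst w, snd w, S (snd w) - {fst w}))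
      \<in> measurable (borel \<Otimes>\<^sub>M M) (borel \<Otimes>\<^sub>M M \<Otimes>\<^sub>M configurations W)"
    by measurable
  from measurable_compose[OF this F]
  show "(\<lambda>(x, z). F x z (S z - {x})) \<in> borel_measurable (borel \<Otimes>\<^sub>M M)"
    by (simp add: split_beta')
qed

context poisson_points
begin

text \<open>
  The Mecke formula, by monotone approximation from indicators.
\<close>

theorem mecke:
  assumes "(\<lambda>(x, S). F x S) \<in> borel_measurable (borel \<Otimes>\<^sub>M configurations W)"
  shows "(\<integral>\<^sup>+\<omega>. (\<Sum>x\<in>\<eta> \<omega>. F x (\<eta> \<omega> - {x})) \<partial>P)
    = (\<integral>\<^sup>+x. \<integral>\<^sup>+\<omega>. F x (\<eta> \<omega>) \<partial>P \<partial>intensity)"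
proof -
  have measL: "(\<lambda>\<omega>. \<Sum>x\<in>\<eta> \<omega>. u (x, \<eta> \<omega> - {x})) \<in> borel_measurable P"
    if "u \<in> borel_measurable (borel \<Otimes>\<^sub>M configurations W)" for u :: "'a \<times> 'a set \<Rightarrow> ennreal"
  proof (rule measurable_sum_removed[OF \<eta>_measurable, of "\<lambda>x z T. u (x, T)"])
    have "(\<lambda>q. u (fst q, snd (snd q))) \<in> borel_measurable (borel \<Otimes>\<^sub>M P \<Otimes>\<^sub>M configurations W)"
      by (rule measurable_compose[OF _ that]) measurable
    then show "(\<lambda>(x, z, T). u (x, T)) \<in> borel_measurable (borel \<Otimes>\<^sub>M P \<Otimes>\<^sub>M configurations W)"
      by (simp add: split_beta')
  qed
  have measR1: "(\<lambda>\<omega>. u (x, \<eta> \<omega>)) \<in> borel_measurable P"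
    if "u \<in> borel_measurable (borel \<Otimes>\<^sub>M configurations W)" for u :: "'a \<times> 'a set \<Rightarrow> ennreal" and x
    using that by measurable
  have measR: "(\<lambda>x. \<integral>\<^sup>+\<omega>. u (x, \<eta> \<omega>) \<partial>P) \<in> borel_measurable intensity"
    if "u \<in> borel_measurable (borel \<Otimes>\<^sub>M configurations W)" for u :: "'a \<times> 'a set \<Rightarrow> ennreal"
  proof -
    have "(\<lambda>(x, \<omega>). u (x, \<eta> \<omega>)) \<in> borel_measurable (borel \<Otimes>\<^sub>M P)" using that by measurable
    then have "(\<lambda>x. \<integral>\<^sup>+\<omega>. u (x, \<eta> \<omega>) \<partial>P) \<in> borel_measurable borel"
      using borel_measurable_nn_integral_fst by fastforce
    then show ?thesis by simp
  qed
  have main: "(\<integral>\<^sup>+\<omega>. (\<Sum>x\<in>\<eta> \<omega>. u (x, \<eta> \<omega> - {x})) \<partial>P) = (\<integral>\<^sup>+x. \<integral>\<^sup>+\<omega>. u (x, \<eta> \<omega>) \<partial>P \<partial>intensity)"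
    if "u \<in> borel_measurable (borel \<Otimes>\<^sub>M configurations W)" for u :: "'a \<times> 'a set \<Rightarrow> ennreal"
    using that
  proof (induction rule: borel_measurable_induct)
    case (cong f g)
    have sp: "(x, \<eta> \<omega> - A) \<in> space (borel \<Otimes>\<^sub>M configurations W)" if "\<omega> \<in> space P" for \<omega> x A
      using \<eta>_finite[OF that] \<eta>_subset[OF that] by (auto simp: space_pair_measure space_configurations)
    have "(\<integral>\<^sup>+\<omega>. (\<Sum>x\<in>\<eta> \<omega>. f (x, \<eta> \<omega> - {x})) \<partial>P) = (\<integral>\<^sup>+\<omega>. (\<Sum>x\<in>\<eta> \<omega>. g (x, \<eta> \<omega> - {x})) \<partial>P)"
      by (intro nn_integral_cong sum.cong refl cong(3) sp)
    moreover have "(\<integral>\<^sup>+x. \<integral>\<^sup>+\<omega>. f (x, \<eta> \<omega>) \<partial>P \<partial>intensity) = (\<integral>\<^sup>+x. \<integral>\<^sup>+\<omega>. g (x, \<eta> \<omega>) \<partial>P \<partial>intensity)"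
      using sp[of _ _ "{}"] by (intro nn_integral_cong cong(3)) simp
    ultimately show ?case using cong(4) by simp
  next
    case (set C)
    then show ?case by (rule mecke_indicator)
  next
    case (mult u c)
    then show ?case
      by (simp add: sum_distrib_left[symmetric] nn_integral_cmult measL measR measR1)
  next
    case (add u v)
    then show ?case
      by (simp add: sum.distrib nn_integral_add measL measR measR1)
  next
    case (seq U)
    have U: "U i \<in> borel_measurable (borel \<Otimes>\<^sub>M configurations W)" for i by (rule seq.hyps)
    have mono: "U m z \<le> U n z" if "m \<le> n" for m n z
      using \<open>incseq U\<close> that unfolding incseq_def le_fun_def by blast
    have "(\<integral>\<^sup>+\<omega>. (\<Sum>x\<in>\<eta> \<omega>. (SUP i. U i) (x, \<eta> \<omega> - {x})) \<partial>P)
        = (\<integral>\<^sup>+\<omega>. (SUP i. \<Sum>x\<in>\<eta> \<omega>. U i (x, \<eta> \<omega> - {x})) \<partial>P)"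
      using mono by (intro nn_integral_cong, subst ennreal_SUP_sum)
        (auto simp: incseq_def image_comp intro!: sum_mono)
    also have "\<dots> = (SUP i. \<integral>\<^sup>+\<omega>. (\<Sum>x\<in>\<eta> \<omega>. U i (x, \<eta> \<omega> - {x})) \<partial>P)"
      using mono by (intro nn_integral_monotone_convergence_SUP measL U)
        (auto simp: incseq_def le_fun_def intro!: sum_mono)
    also have "\<dots> = (SUP i. \<integral>\<^sup>+x. \<integral>\<^sup>+\<omega>. U i (x, \<eta> \<omega>) \<partial>P \<partial>intensity)"
      by (simp add: seq.IH)
    also have "\<dots> = (\<integral>\<^sup>+x. (SUP i. \<integral>\<^sup>+\<omega>. U i (x, \<eta> \<omega>) \<partial>P) \<partial>intensity)"
      using mono by (intro nn_integral_monotone_convergence_SUP[symmetric] measR U)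
        (auto simp: incseq_def le_fun_def intro!: nn_integral_mono)
    also have "\<dots> = (\<integral>\<^sup>+x. \<integral>\<^sup>+\<omega>. (SUP i. U i) (x, \<eta> \<omega>) \<partial>P \<partial>intensity)"
    proof (rule nn_integral_cong)
      fix x
      have "(SUP i. \<integral>\<^sup>+\<omega>. U i (x, \<eta> \<omega>) \<partial>P) = (\<integral>\<^sup>+\<omega>. (SUP i. U i (x, \<eta> \<omega>)) \<partial>P)"
        using mono by (intro nn_integral_monotone_convergence_SUP[symmetric] measR1 U)
          (auto simp: incseq_def le_fun_def)
      then show "(SUP i. \<integral>\<^sup>+\<omega>. U i (x, \<eta> \<omega>) \<partial>P) = (\<integral>\<^sup>+\<omega>. (SUP i. U i) (x, \<eta> \<omega>) \<partial>P)"
        by (simp add: image_comp)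
    qed
    finally show ?case .
  qed
  show ?thesis using main[OF assms] by simp
qed

lemma mecke2:
  assumes F: "(\<lambda>(x, y, S). F x y S) \<in> borel_measurable (borel \<Otimes>\<^sub>M borel \<Otimes>\<^sub>M configurations W)"
  shows "(\<integral>\<^sup>+\<omega>. (\<Sum>x\<in>\<eta> \<omega>. \<Sum>y\<in>\<eta> \<omega> - {x}. F x y (\<eta> \<omega> - {x} - {y})) \<partial>P)
    = (\<integral>\<^sup>+x. \<integral>\<^sup>+y. \<integral>\<^sup>+\<omega>. F x y (\<eta> \<omega>) \<partial>P \<partial>intensity \<partial>intensity)"
proof -
  have "(\<integral>\<^sup>+\<omega>. (\<Sum>x\<in>\<eta> \<omega>. \<Sum>y\<in>\<eta> \<omega> - {x}. F x y (\<eta> \<omega> - {x} - {y})) \<partial>P)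
    = (\<integral>\<^sup>+x. \<integral>\<^sup>+\<omega>. (\<Sum>y\<in>\<eta> \<omega>. F x y (\<eta> \<omega> - {y})) \<partial>P \<partial>intensity)"
  proof (rule mecke)
    have "(\<lambda>z. \<Sum>y\<in>snd z. F (fst z) y (snd z - {y})) \<in> borel_measurable (borel \<Otimes>\<^sub>M configurations W)"
    proof (rule measurable_sum_removed)
      show "snd \<in> measurable (borel \<Otimes>\<^sub>M configurations W) (configurations W)" by simp
      have "(\<lambda>w. (\<lambda>(x, y, S). F x y S) (fst (fst (snd w)), fst w, snd (snd w)))
        \<in> borel_measurable (borel \<Otimes>\<^sub>M (borel \<Otimes>\<^sub>M configurations W) \<Otimes>\<^sub>M configurations W)"
        using F by measurable
      then show "(\<lambda>(y, z, T). F (fst z) y T)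
        \<in> borel_measurable (borel \<Otimes>\<^sub>M (borel \<Otimes>\<^sub>M configurations W) \<Otimes>\<^sub>M configurations W)"
        by (simp add: split_beta')
    qed
    then show "(\<lambda>(x, S). \<Sum>y\<in>S. F x y (S - {y})) \<in> borel_measurable (borel \<Otimes>\<^sub>M configurations W)"
      by (simp add: split_beta')
  qed
  also have "\<dots> = (\<integral>\<^sup>+x. \<integral>\<^sup>+y. \<integral>\<^sup>+\<omega>. F x y (\<eta> \<omega>) \<partial>P \<partial>intensity \<partial>intensity)"
  proof (rule nn_integral_cong, rule mecke)
    fix x
    have "(\<lambda>w. (\<lambda>(x, y, S). F x y S) (x, fst w, snd w)) \<in> borel_measurable (borel \<Otimes>\<^sub>M configurations W)"
      using F by measurable
    then show "(\<lambda>(y, S). F x y S) \<in> borel_measurable (borel \<Otimes>\<^sub>M configurations W)"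
      by (simp add: split_beta')
  qed
  finally show ?thesis .
qed

lemma mecke4:
  assumes F: "(\<lambda>(v, w, x, y, S). F v w x y S)
    \<in> borel_measurable (borel \<Otimes>\<^sub>M borel \<Otimes>\<^sub>M borel \<Otimes>\<^sub>M borel \<Otimes>\<^sub>M configurations W)"
  shows "(\<integral>\<^sup>+\<omega>. (\<Sum>v\<in>\<eta> \<omega>. \<Sum>w\<in>\<eta> \<omega> - {v}. \<Sum>x\<in>\<eta> \<omega> - {v} - {w}. \<Sum>y\<in>\<eta> \<omega> - {v} - {w} - {x}.
      F v w x y (\<eta> \<omega> - {v} - {w} - {x} - {y})) \<partial>P)
    = (\<integral>\<^sup>+v. \<integral>\<^sup>+w. \<integral>\<^sup>+x. \<integral>\<^sup>+y. \<integral>\<^sup>+\<omega>. F v w x y (\<eta> \<omega>) \<partial>P \<partial>intensity \<partial>intensity \<partial>intensity \<partial>intensity)"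
proof -
  have "(\<integral>\<^sup>+\<omega>. (\<Sum>v\<in>\<eta> \<omega>. \<Sum>w\<in>\<eta> \<omega> - {v}. \<Sum>x\<in>\<eta> \<omega> - {v} - {w}. \<Sum>y\<in>\<eta> \<omega> - {v} - {w} - {x}.
      F v w x y (\<eta> \<omega> - {v} - {w} - {x} - {y})) \<partial>P)
    = (\<integral>\<^sup>+v. \<integral>\<^sup>+w. \<integral>\<^sup>+\<omega>. (\<Sum>x\<in>\<eta> \<omega>. \<Sum>y\<in>\<eta> \<omega> - {x}. F v w x y (\<eta> \<omega> - {x} - {y})) \<partial>P \<partial>intensity \<partial>intensity)"
  proof (rule mecke2)
    let ?M = "borel \<Otimes>\<^sub>M borel \<Otimes>\<^sub>M configurations W :: ('a \<times> 'a \<times> 'a set) measure"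
    let ?N = "borel \<Otimes>\<^sub>M ?M \<Otimes>\<^sub>M configurations W :: ('a \<times> ('a \<times> 'a \<times> 'a set) \<times> 'a set) measure"
    have "(\<lambda>z. \<Sum>x\<in>snd (snd z). \<Sum>y\<in>snd (snd z) - {x}. F (fst z) (fst (snd z)) x y (snd (snd z) - {x} - {y}))
      \<in> borel_measurable ?M"
    proof (rule measurable_sum_removed[where F = "\<lambda>x z T. \<Sum>y\<in>T. F (fst z) (fst (snd z)) x y (T - {y})"])
      show "(\<lambda>z. snd (snd z)) \<in> measurable ?M (configurations W)" by measurable
      have "(\<lambda>u. \<Sum>y\<in>snd (snd u). F (fst (fst (snd u))) (fst (snd (fst (snd u)))) (fst u) y (snd (snd u) - {y}))
        \<in> borel_measurable ?N"
      proof (rule measurable_sum_removed)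
        show "(\<lambda>u. snd (snd u)) \<in> measurable ?N (configurations W)" by measurable
        have "(\<lambda>p. (\<lambda>(v, w, x, y, S). F v w x y S)
            (fst (fst (snd (fst (snd p)))), fst (snd (fst (snd (fst (snd p))))), fst (fst (snd p)), fst p, snd (snd p)))
          \<in> borel_measurable (borel \<Otimes>\<^sub>M ?N \<Otimes>\<^sub>M configurations W)"
          using F by measurable
        then show "(\<lambda>(y, u, T). F (fst (fst (snd u))) (fst (snd (fst (snd u)))) (fst u) y T)
          \<in> borel_measurable (borel \<Otimes>\<^sub>M ?N \<Otimes>\<^sub>M configurations W)"
          by (simp add: split_beta')
      qed
      then show "(\<lambda>(x, z, T). \<Sum>y\<in>T. F (fst z) (fst (snd z)) x y (T - {y})) \<in> borel_measurable ?N"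
        by (simp add: split_beta')
    qed
    then show "(\<lambda>(v, w, S). \<Sum>x\<in>S. \<Sum>y\<in>S - {x}. F v w x y (S - {x} - {y})) \<in> borel_measurable ?M"
      by (simp add: split_beta')
  qed
  also have "\<dots> = (\<integral>\<^sup>+v. \<integral>\<^sup>+w. \<integral>\<^sup>+x. \<integral>\<^sup>+y. \<integral>\<^sup>+\<omega>. F v w x y (\<eta> \<omega>) \<partial>P \<partial>intensity \<partial>intensity \<partial>intensity \<partial>intensity)"
  proof (intro nn_integral_cong, rule mecke2)
    fix v w
    have "(\<lambda>p. (\<lambda>(v, w, x, y, S). F v w x y S) (v, w, fst p, fst (snd p), snd (snd p)))
      \<in> borel_measurable (borel \<Otimes>\<^sub>M borel \<Otimes>\<^sub>M configurations W)"
      using F by measurable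
    then show "(\<lambda>(x, y, S). F v w x y S) \<in> borel_measurable (borel \<Otimes>\<^sub>M borel \<Otimes>\<^sub>M configurations W)"
      by (simp add: split_beta')
  qed
  finally show ?thesis .
qed

lemma campbell:
  assumes h: "h \<in> borel_measurable borel"
  shows "(\<integral>\<^sup>+\<omega>. (\<Sum>x\<in>\<eta> \<omega>. h x) \<partial>P) = (\<integral>\<^sup>+x. h x \<partial>intensity)"
  using mecke[of "\<lambda>x S. h x"] h by (simp add: emeasure_space_1)

text \<open>
  The Mecke formula runs over pairs of distinct points; as \<open>h\<close> vanishes on the diagonal,
  pairs of equal points may be included.
\<close>

lemma campbell2:
  assumes h: "(\<lambda>(x, y). h x y) \<in> borel_measurable (borel \<Otimes>\<^sub>M borel)" and diag: "\<And>x. h x x = 0"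
  shows "(\<integral>\<^sup>+\<omega>. (\<Sum>x\<in>\<eta> \<omega>. \<Sum>y\<in>\<eta> \<omega>. h x y) \<partial>P) = (\<integral>\<^sup>+x. \<integral>\<^sup>+y. h x y \<partial>intensity \<partial>intensity)"
proof -
  have "(\<integral>\<^sup>+\<omega>. (\<Sum>x\<in>\<eta> \<omega>. \<Sum>y\<in>\<eta> \<omega>. h x y) \<partial>P) = (\<integral>\<^sup>+\<omega>. (\<Sum>x\<in>\<eta> \<omega>. \<Sum>y\<in>\<eta> \<omega> - {x}. h x y) \<partial>P)"
    using \<eta>_finite diag by (intro nn_integral_cong sum.cong refl sum.mono_neutral_right) auto
  also have "\<dots> = (\<integral>\<^sup>+x. \<integral>\<^sup>+y. \<integral>\<^sup>+\<omega>. h x y \<partial>P \<partial>intensity \<partial>intensity)"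
  proof (rule mecke2)
    have "(\<lambda>p. (\<lambda>(x, y). h x y) (fst p, fst (snd p))) \<in> borel_measurable (borel \<Otimes>\<^sub>M borel \<Otimes>\<^sub>M configurations W)"
      using h by measurable
    then show "(\<lambda>(x, y, S). h x y) \<in> borel_measurable (borel \<Otimes>\<^sub>M borel \<Otimes>\<^sub>M configurations W)"
      by (simp add: split_beta')
  qed
  finally show ?thesis by (simp add: emeasure_space_1)
qed

lemma campbell3:
  assumes h: "(\<lambda>(x, y, z). h x y z) \<in> borel_measurable (borel \<Otimes>\<^sub>M borel \<Otimes>\<^sub>M borel)"
    and diag: "\<And>x y z. \<not> distinct [x, y, z] \<Longrightarrow> h x y z = 0"
  shows "(\<integral>\<^sup>+\<omega>. (\<Sum>x\<in>\<eta> \<omega>. \<Sum>y\<in>\<eta> \<omega>. \<Sum>z\<in>\<eta> \<omega>. h x y z) \<partial>P)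
    = (\<integral>\<^sup>+x. \<integral>\<^sup>+y. \<integral>\<^sup>+z. h x y z \<partial>intensity \<partial>intensity \<partial>intensity)"
proof -
  have "(\<integral>\<^sup>+\<omega>. (\<Sum>x\<in>\<eta> \<omega>. \<Sum>y\<in>\<eta> \<omega>. \<Sum>z\<in>\<eta> \<omega>. h x y z) \<partial>P)
      = (\<integral>\<^sup>+\<omega>. (\<Sum>x\<in>\<eta> \<omega>. \<Sum>y\<in>\<eta> \<omega> - {x}. \<Sum>z\<in>\<eta> \<omega> - {x}. h x y z) \<partial>P)"
  proof (rule nn_integral_cong, rule sum.cong[OF refl])
    fix \<omega> x assume w: "\<omega> \<in> space P" "x \<in> \<eta> \<omega>"
    have "(\<Sum>y\<in>\<eta> \<omega>. \<Sum>z\<in>\<eta> \<omega>. h x y z) = (\<Sum>y\<in>\<eta> \<omega> - {x}. \<Sum>z\<in>\<eta> \<omega>. h x y z)"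
      using \<eta>_finite[OF w(1)] by (intro sum.mono_neutral_right) (auto simp: diag)
    also have "\<dots> = (\<Sum>y\<in>\<eta> \<omega> - {x}. \<Sum>z\<in>\<eta> \<omega> - {x}. h x y z)"
      using \<eta>_finite[OF w(1)] by (intro sum.cong refl sum.mono_neutral_right) (auto simp: diag)
    finally show "(\<Sum>y\<in>\<eta> \<omega>. \<Sum>z\<in>\<eta> \<omega>. h x y z) = (\<Sum>y\<in>\<eta> \<omega> - {x}. \<Sum>z\<in>\<eta> \<omega> - {x}. h x y z)" .
  qed
  also have "\<dots> = (\<integral>\<^sup>+x. \<integral>\<^sup>+\<omega>. (\<Sum>y\<in>\<eta> \<omega>. \<Sum>z\<in>\<eta> \<omega>. h x y z) \<partial>P \<partial>intensity)"
  proof (rule mecke)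
    let ?M = "borel \<Otimes>\<^sub>M configurations W :: ('a \<times> 'a set) measure"
    have "(\<lambda>p. \<Sum>y\<in>snd p. \<Sum>z\<in>snd p. h (fst p) y z) \<in> borel_measurable ?M"
    proof (rule measurable_sum_points)
      show "snd \<in> measurable ?M (configurations W)" by measurable
      have "(\<lambda>u. \<Sum>z\<in>snd (snd u). h (fst (snd u)) (fst u) z) \<in> borel_measurable (borel \<Otimes>\<^sub>M ?M)"
      proof (rule measurable_sum_points)
        show "(\<lambda>u. snd (snd u)) \<in> measurable (borel \<Otimes>\<^sub>M ?M) (configurations W)" by measurable
        have "(\<lambda>q. (\<lambda>(x, y, z). h x y z) (fst (snd (snd q)), fst (snd q), fst q))
          \<in> borel_measurable (borel \<Otimes>\<^sub>M borel \<Otimes>\<^sub>M ?M)" using h by measurable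
        then show "(\<lambda>(z, u). h (fst (snd u)) (fst u) z) \<in> borel_measurable (borel \<Otimes>\<^sub>M borel \<Otimes>\<^sub>M ?M)"
          by (simp add: split_beta')
      qed
      then show "(\<lambda>(y, p). \<Sum>z\<in>snd p. h (fst p) y z) \<in> borel_measurable (borel \<Otimes>\<^sub>M ?M)"
        by (simp add: split_beta')
    qed
    then show "(\<lambda>(x, S). \<Sum>y\<in>S. \<Sum>z\<in>S. h x y z) \<in> borel_measurable ?M"
      by (simp add: split_beta')
  qed
  also have "\<dots> = (\<integral>\<^sup>+x. \<integral>\<^sup>+y. \<integral>\<^sup>+z. h x y z \<partial>intensity \<partial>intensity \<partial>intensity)"
  proof (rule nn_integral_cong, rule campbell2)
    fix x
    have "(\<lambda>q. (\<lambda>(x, y, z). h x y z) (x, q)) \<in> borel_measurable (borel \<Otimes>\<^sub>M borel)" using h by measurable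
    then show "(\<lambda>(y, z). h x y z) \<in> borel_measurable (borel \<Otimes>\<^sub>M borel)" by (simp add: split_beta')
  qed (simp add: diag)
  finally show ?thesis .
qed

end

section \<open>A solution of the Stein equation\<close>

text \<open>
  On the positive integers this is the solution of the Stein equation of the Poisson
  distribution for the event that the count is zero. With Pochhammer symbols in place of
  factorials the argument may be any positive real, and so it can be applied to one eighth
  of a tuple count without knowing that this is an integer.
\<close>

definition stein :: "real \<Rightarrow> real \<Rightarrow> real" where
  "stein m x = exp (- m) * (\<Sum>i. m ^ i / pochhammer x (Suc i))"

lemma pochhammer_ge_fact:
  fixes x :: real assumes "x > 0" shows "x * fact i \<le> pochhammer x (Suc i)"
proof (induction i)
  case (Suc i)
  have "x * fact (Suc i) = (x * fact i) * real (Suc i)" by simp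
  also have "\<dots> \<le> pochhammer x (Suc i) * (x + real (Suc i))"
    using Suc assms pochhammer_pos[of x "Suc i"] by (intro mult_mono) (auto simp: less_imp_le)
  finally show ?case by (simp add: pochhammer_Suc)
qed simp

lemma pochhammer_mono_real:
  fixes x y :: real assumes "0 < x" "x \<le> y" shows "pochhammer x n \<le> pochhammer y n"
proof (induction n)
  case (Suc n)
  then show ?case using assms pochhammer_pos[of x n]
    by (auto simp: pochhammer_Suc intro!: mult_mono pochhammer_nonneg)
qed simp

context
  fixes m :: real assumes nonneg: "m \<ge> 0"
begin

lemma stein_term_le:
  assumes "x > 0" shows "m ^ i / pochhammer x (Suc i) \<le> (1 / x) * (m ^ i / fact i)"
proof -
  have "m ^ i / pochhammer x (Suc i) \<le> m ^ i / (x * fact i)"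
    using assms nonneg pochhammer_ge_fact[OF assms, of i] pochhammer_pos[OF assms, of "Suc i"]
    by (intro divide_left_mono mult_pos_pos) (auto simp del: pochhammer_Suc)
  then show ?thesis by (simp add: field_simps)
qed

lemma sums_exp_real: "(\<lambda>i. m ^ i / fact i) sums exp m"
  using exp_converges[of m] by (simp add: field_simps)

lemma stein_summable:
  assumes "x > 0" shows "summable (\<lambda>i. m ^ i / pochhammer x (Suc i))"
proof (rule summable_comparison_test)
  show "\<exists>N. \<forall>i\<ge>N. norm (m ^ i / pochhammer x (Suc i)) \<le> (1 / x) * (m ^ i / fact i)"
    using stein_term_le[OF assms] nonneg pochhammer_pos[OF assms] by (auto simp: abs_mult less_imp_le)
  show "summable (\<lambda>i. (1 / x) * (m ^ i / fact i))"
    using sums_exp_real by (intro summable_mult) (rule sums_summable)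
qed

lemma stein_equation:
  assumes "x > 0" shows "x * stein m x = m * stein m (x + 1) + exp (- m)"
proof -
  have "(\<Sum>i. m ^ i / pochhammer x (Suc i)) = 1 / x + (\<Sum>i. m ^ Suc i / pochhammer x (Suc (Suc i)))"
    using suminf_split_head[OF stein_summable[OF assms]] by simp
  also have "(\<lambda>i. m ^ Suc i / pochhammer x (Suc (Suc i)))
      = (\<lambda>i. (m / x) * (m ^ i / pochhammer (x + 1) (Suc i)))"
    by (simp add: pochhammer_rec[of x "Suc _"] fun_eq_iff del: pochhammer_Suc)
  also have "(\<Sum>i. (m / x) * (m ^ i / pochhammer (x + 1) (Suc i)))
      = (m / x) * (\<Sum>i. m ^ i / pochhammer (x + 1) (Suc i))"
    using assms by (intro suminf_mult stein_summable) simp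
  finally have "x * (\<Sum>i. m ^ i / pochhammer x (Suc i))
      = 1 + m * (\<Sum>i. m ^ i / pochhammer (x + 1) (Suc i))"
    using assms by (simp add: field_simps)
  then have "exp (- m) * (x * (\<Sum>i. m ^ i / pochhammer x (Suc i)))
      = exp (- m) * (1 + m * (\<Sum>i. m ^ i / pochhammer (x + 1) (Suc i)))" by simp
  then show ?thesis unfolding stein_def by (simp add: algebra_simps)
qed

text \<open>
  Monotonicity makes the lower bound of the Poisson approximation free of an error: any
  points beyond the expected ones only decrease the value.
\<close>

lemma stein_antimono:
  assumes "0 < x" "x \<le> y" shows "stein m y \<le> stein m x"
  unfolding stein_def using assms nonneg
  by (intro mult_left_mono suminf_le stein_summable divide_left_mono pochhammer_mono_real)
     (auto intro!: pochhammer_pos mult_pos_pos)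

lemma stein_nonneg: "0 < x \<Longrightarrow> 0 \<le> stein m x"
  unfolding stein_def using nonneg
  by (intro mult_nonneg_nonneg suminf_nonneg stein_summable divide_nonneg_nonneg)
     (auto intro!: pochhammer_nonneg)

lemma stein_le_1:
  assumes "1 \<le> x" shows "stein m x \<le> 1"
proof -
  have "stein m x \<le> stein m 1" using assms by (intro stein_antimono) auto
  also have "(\<Sum>i. m ^ i / pochhammer 1 (Suc i)) \<le> (\<Sum>i. m ^ i / fact i)"
    using stein_term_le[of 1] sums_exp_real stein_summable[of 1]
    by (intro suminf_le) (auto simp: sums_iff)
  then have "stein m 1 \<le> exp (- m) * exp m"
    using sums_exp_real unfolding stein_def by (intro mult_left_mono) (auto simp: sums_iff)
  finally show ?thesis by (simp add: exp_minus)
qed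

text \<open>
  For \<open>x = 0\<close> the function \<open>stein\<close> is irrelevant on the left, and the right side is the
  exponential series. Taking expectations, the identity turns the probability of a zero into
  a difference that the Mecke formula can evaluate.
\<close>

lemma stein_identity:
  assumes "x \<ge> 0"
  shows "of_bool (x = 0) + x * stein m x = m * stein m (x + 1) + exp (- m)"
proof (cases "x = 0")
  case True
  have "m * stein m 1 + exp (- m) = 1"
  proof -
    have "exp m = 1 + (\<Sum>i. m ^ Suc i / fact (Suc i))"
      using sums_exp_real suminf_split_head[of "\<lambda>i. m ^ i / fact i"] by (auto simp: sums_iff)
    also have "(\<lambda>i. m ^ Suc i / fact (Suc i)) = (\<lambda>i. m * (m ^ i / pochhammer 1 (Suc i)))"
      by (simp add: pochhammer_fact[symmetric] fun_eq_iff del: pochhammer_Suc fact_Suc)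
    also have "(\<Sum>i. m * (m ^ i / pochhammer 1 (Suc i))) = m * (\<Sum>i. m ^ i / pochhammer 1 (Suc i))"
      by (intro suminf_mult stein_summable) simp
    finally have "exp (- m) * exp m = exp (- m) + m * stein m 1"
      unfolding stein_def by (simp add: field_simps)
    then show ?thesis by (simp add: exp_minus)
  qed
  then show ?thesis using True by simp
next
  case False
  then show ?thesis using assms stein_equation[of x] by simp
qed

end

section \<open>Counting tuples of two exchangeable pairs\<close>

text \<open>
  Four separate sets are needed because mixed tuples, with some entries among inserted
  points and the others in the process, have to be counted.
\<close>

definition tuple_count :: "('a \<Rightarrow> 'a \<Rightarrow> 'a \<Rightarrow> 'a \<Rightarrow> bool) \<Rightarrow> 'a set \<Rightarrow> 'a set \<Rightarrow> 'a set \<Rightarrow> 'a set \<Rightarrow> nat" where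
  "tuple_count K A B C D = (\<Sum>a\<in>A. \<Sum>b\<in>B. \<Sum>c\<in>C. \<Sum>d\<in>D. of_bool (K a b c d))"

definition sum_extra :: "'a \<Rightarrow> 'a \<Rightarrow> 'a \<Rightarrow> 'a \<Rightarrow> 'a set \<Rightarrow> ('a \<Rightarrow> nat) \<Rightarrow> nat" where
  "sum_extra v w x y S h = (\<Sum>a\<in>S. h a) + (h v + h w + h x + h y)"

text \<open>
  The tuples over \<open>S\<close> with the points \<open>v, w, x, y\<close> inserted. Summing over the new points
  with multiplicity agrees with the count over the union when the points are distinct and
  not in \<open>S\<close>, and it is jointly measurable without a case distinction.
\<close>

definition extended_count :: "('a \<Rightarrow> 'a \<Rightarrow> 'a \<Rightarrow> 'a \<Rightarrow> bool) \<Rightarrow> 'a \<Rightarrow> 'a \<Rightarrow> 'a \<Rightarrow> 'a \<Rightarrow> 'a set \<Rightarrow> nat" where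
  "extended_count K v w x y S =
     sum_extra v w x y S (\<lambda>a. sum_extra v w x y S (\<lambda>b.
       sum_extra v w x y S (\<lambda>c. sum_extra v w x y S (\<lambda>d. of_bool (K a b c d)))))"

lemma measurable_sum_extra:
  fixes h :: "'a::euclidean_space \<times> 'z \<Rightarrow> nat"
  assumes S: "S \<in> measurable M (configurations W)"
    and v: "v \<in> borel_measurable M" and w: "w \<in> borel_measurable M"
    and x: "x \<in> borel_measurable M" and y: "y \<in> borel_measurable M"
    and h: "h \<in> measurable (borel \<Otimes>\<^sub>M M) (count_space UNIV)"
  shows "(\<lambda>z. sum_extra (v z) (w z) (x z) (y z) (S z) (\<lambda>a. h (a, z))) \<in> measurable M (count_space UNIV)"
proof -
  have [measurable]: "(\<lambda>z. h (u z, z)) \<in> measurable M (count_space UNIV)" if "u \<in> borel_measurable M" for u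
    by (rule measurable_compose[OF _ h]) (use that in measurable)
  have "(\<lambda>z. \<Sum>a\<in>S z. h (a, z)) \<in> measurable M (count_space UNIV)"
    using h by (intro measurable_sum_points_nat[OF S]) simp
  then show ?thesis unfolding sum_extra_def using v w x y by measurable
qed

lemma measurable_extended_count:
  assumes K: "Measurable.pred (borel \<Otimes>\<^sub>M borel \<Otimes>\<^sub>M borel \<Otimes>\<^sub>M borel) (\<lambda>(v, w, x, y). K v w x (y :: 'a::euclidean_space))"
    and S: "S \<in> measurable M (configurations W)"
    and v: "v \<in> borel_measurable M" and w: "w \<in> borel_measurable M"
    and x: "x \<in> borel_measurable M" and y: "y \<in> borel_measurable M"
  shows "(\<lambda>z. extended_count K (v z) (w z) (x z) (y z) (S z)) \<in> measurable M (count_space UNIV)"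
proof -
  note [measurable] = S v w x y
  let ?B = "borel :: 'a measure"
  define h4 :: "'a \<times> 'a \<times> 'a \<times> 'a \<times> 'b \<Rightarrow> nat"
    where "h4 p = (case p of (d, c, b, a, z) \<Rightarrow> of_bool (K a b c d))" for p
  define h3 where "h3 p = sum_extra (v (snd (snd (snd p)))) (w (snd (snd (snd p)))) (x (snd (snd (snd p))))
    (y (snd (snd (snd p)))) (S (snd (snd (snd p)))) (\<lambda>d. h4 (d, p))" for p
  define h2 where "h2 p = sum_extra (v (snd (snd p))) (w (snd (snd p))) (x (snd (snd p)))
    (y (snd (snd p))) (S (snd (snd p))) (\<lambda>d. h3 (d, p))" for p
  define h1 where "h1 p = sum_extra (v (snd p)) (w (snd p)) (x (snd p))
    (y (snd p)) (S (snd p)) (\<lambda>d. h2 (d, p))" for p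
  have "Measurable.pred (?B \<Otimes>\<^sub>M ?B \<Otimes>\<^sub>M ?B \<Otimes>\<^sub>M ?B \<Otimes>\<^sub>M M) (\<lambda>p. (\<lambda>(v, w, x, y). K v w x y)
      (fst (snd (snd (snd p))), fst (snd (snd p)), fst (snd p), fst p))"
    by (rule measurable_compose[OF _ K]) measurable
  then have "h4 \<in> measurable (?B \<Otimes>\<^sub>M ?B \<Otimes>\<^sub>M ?B \<Otimes>\<^sub>M ?B \<Otimes>\<^sub>M M) (count_space UNIV)"
    unfolding h4_def by (simp add: split_beta')
  then have "h3 \<in> measurable (?B \<Otimes>\<^sub>M ?B \<Otimes>\<^sub>M ?B \<Otimes>\<^sub>M M) (count_space UNIV)"
    unfolding h3_def by (intro measurable_sum_extra[where W = W]) measurable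
  then have "h2 \<in> measurable (?B \<Otimes>\<^sub>M ?B \<Otimes>\<^sub>M M) (count_space UNIV)"
    unfolding h2_def by (intro measurable_sum_extra[where W = W]) measurable
  then have "h1 \<in> measurable (?B \<Otimes>\<^sub>M M) (count_space UNIV)"
    unfolding h1_def by (intro measurable_sum_extra[where W = W]) measurable
  then have "(\<lambda>z. sum_extra (v z) (w z) (x z) (y z) (S z) (\<lambda>a. h1 (a, z))) \<in> measurable M (count_space UNIV)"
    by (intro measurable_sum_extra[where W = W]) measurable
  then show ?thesis
    by (simp add: extended_count_def h1_def h2_def h3_def h4_def)
qed

lemma measurable_tuple_count:
  assumes K: "Measurable.pred (borel \<Otimes>\<^sub>M borel \<Otimes>\<^sub>M borel \<Otimes>\<^sub>M borel \<Otimes>\<^sub>M N) (\<lambda>(v, w, x, y, z). K z v w x (y :: 'a::euclidean_space))"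
    and S: "S \<in> measurable N (configurations W)"
  shows "(\<lambda>z. tuple_count (K z) (S z) (S z) (S z) (S z)) \<in> measurable N (count_space UNIV)"
proof -
  note [measurable] = S
  let ?B = "borel :: 'a measure"
  have "Measurable.pred (?B \<Otimes>\<^sub>M ?B \<Otimes>\<^sub>M ?B \<Otimes>\<^sub>M ?B \<Otimes>\<^sub>M N) (\<lambda>p. (\<lambda>(v, w, x, y, z). K z v w x y)
      (fst (snd (snd (snd p))), fst (snd (snd p)), fst (snd p), fst p, snd (snd (snd (snd p)))))"
    by (rule measurable_compose[OF _ K]) measurable
  then have 4: "(\<lambda>(d, p). of_bool (K (snd (snd (snd p))) (fst (snd (snd p))) (fst (snd p)) (fst p) d) :: nat)
      \<in> measurable (?B \<Otimes>\<^sub>M ?B \<Otimes>\<^sub>M ?B \<Otimes>\<^sub>M ?B \<Otimes>\<^sub>M N) (count_space UNIV)"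
    by (simp add: split_beta')
  have 3: "(\<lambda>p. \<Sum>d\<in>S (snd (snd (snd p))). of_bool (K (snd (snd (snd p))) (fst (snd (snd p))) (fst (snd p)) (fst p) d) :: nat)
      \<in> measurable (?B \<Otimes>\<^sub>M ?B \<Otimes>\<^sub>M ?B \<Otimes>\<^sub>M N) (count_space UNIV)"
    by (rule measurable_sum_points_nat[OF _ 4, where W = W]) measurable
  have 2: "(\<lambda>p. \<Sum>c\<in>S (snd (snd p)). \<Sum>d\<in>S (snd (snd p)). of_bool (K (snd (snd p)) (fst (snd p)) (fst p) c d) :: nat)
      \<in> measurable (?B \<Otimes>\<^sub>M ?B \<Otimes>\<^sub>M N) (count_space UNIV)"
    by (rule measurable_sum_points_nat[where W = W]) (use 3 in \<open>simp_all add: split_beta'\<close>)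
  have 1: "(\<lambda>p. \<Sum>b\<in>S (snd p). \<Sum>c\<in>S (snd p). \<Sum>d\<in>S (snd p). of_bool (K (snd p) (fst p) b c d) :: nat)
      \<in> measurable (?B \<Otimes>\<^sub>M N) (count_space UNIV)"
    by (rule measurable_sum_points_nat[where W = W]) (use 2 in \<open>simp_all add: split_beta'\<close>)
  show ?thesis unfolding tuple_count_def
    by (rule measurable_sum_points_nat[where W = W]) (use 1 in \<open>simp_all add: split_beta'\<close>)
qed

text \<open>
  A relation on two unordered pairs of points in which the pairs can be exchanged; these
  symmetries form a group of order eight. The relation \<open>near\<close> confines the two points of a
  pair to each other, the relation \<open>close\<close> confines one pair to the other.
\<close>

locale pair_kernel =
  fixes K :: "'a::euclidean_space \<Rightarrow> 'a \<Rightarrow> 'a \<Rightarrow> 'a \<Rightarrow> bool"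
    and near close :: "'a \<Rightarrow> 'a \<Rightarrow> bool"
  assumes K_pred: "Measurable.pred (borel \<Otimes>\<^sub>M borel \<Otimes>\<^sub>M borel \<Otimes>\<^sub>M borel) (\<lambda>(v, w, x, y). K v w x y)"
    and near_pred: "Measurable.pred (borel \<Otimes>\<^sub>M borel) (\<lambda>(x, y). near x y)"
    and close_pred: "Measurable.pred (borel \<Otimes>\<^sub>M borel) (\<lambda>(x, y). close x y)"
    and K_distinct: "K v w x y \<Longrightarrow> distinct [v, w, x, y]"
    and K_swap: "K v w x y \<Longrightarrow> K w v x y"
    and K_exchange: "K v w x y \<Longrightarrow> K x y v w"
    and K_near: "K v w x y \<Longrightarrow> near v w"
    and K_close: "K v w x y \<Longrightarrow> close v x"
    and near_commute: "near x y \<Longrightarrow> near y x"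
begin

lemma K_near2: "K v w x y \<Longrightarrow> near x y"
  using K_exchange K_near by blast

lemma tuple_count_swap: "tuple_count K A B C D = tuple_count K B A C D"
proof -
  have "K a b = K b a" for a b using K_swap by (auto simp: fun_eq_iff)
  then show ?thesis unfolding tuple_count_def by (subst sum.swap) simp
qed

lemma tuple_count_exchange: "tuple_count K A B C D = tuple_count K C D A B"
proof -
  have "K a b c d = K c d a b" for a b c d using K_exchange by blast
  then have "tuple_count K A B C D = (\<Sum>a\<in>A. \<Sum>b\<in>B. \<Sum>c\<in>C. \<Sum>d\<in>D. of_bool (K c d a b))"
    unfolding tuple_count_def by simp
  also have "\<dots> = (\<Sum>a\<in>A. \<Sum>c\<in>C. \<Sum>b\<in>B. \<Sum>d\<in>D. of_bool (K c d a b))"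
    by (intro sum.cong refl sum.swap)
  also have "\<dots> = (\<Sum>c\<in>C. \<Sum>a\<in>A. \<Sum>b\<in>B. \<Sum>d\<in>D. of_bool (K c d a b))"
    by (rule sum.swap)
  also have "\<dots> = (\<Sum>c\<in>C. \<Sum>a\<in>A. \<Sum>d\<in>D. \<Sum>b\<in>B. of_bool (K c d a b))"
    by (intro sum.cong refl sum.swap)
  also have "\<dots> = tuple_count K C D A B"
    unfolding tuple_count_def by (intro sum.cong refl sum.swap)
  finally show ?thesis .
qed

text \<open>
  Each of the four positions is filled from \<open>S\<close> or from \<open>T\<close>. The symmetries reduce the
  sixteen cases to six.
\<close>

lemma extended_count_expand:
  assumes d: "distinct [v, w, x, y]" and T: "T = {v, w, x, y}"
  shows "extended_count K v w x y S = tuple_count K S S S S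
    + (4 * tuple_count K T T T S + 2 * tuple_count K T T S S + 4 * tuple_count K T S T S
       + 4 * tuple_count K T S S S) + tuple_count K T T T T"
proof -
  have se: "sum_extra v w x y S h = sum h S + sum h T" for h
    unfolding sum_extra_def using d by (simp add: T)
  have "extended_count K v w x y S =
      tuple_count K S S S S + tuple_count K S S S T + tuple_count K S S T S + tuple_count K S S T T
    + tuple_count K S T S S + tuple_count K S T S T + tuple_count K S T T S + tuple_count K S T T T
    + tuple_count K T S S S + tuple_count K T S S T + tuple_count K T S T S + tuple_count K T S T T
    + tuple_count K T T S S + tuple_count K T T S T + tuple_count K T T T S + tuple_count K T T T T"
    unfolding extended_count_def se tuple_count_def by (simp only: sum.distrib add_ac)
  moreover have "tuple_count K T T S T = tuple_count K T T T S" "tuple_count K T S T T = tuple_count K T T T S"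
    "tuple_count K S T T T = tuple_count K T T T S"
    by (metis tuple_count_swap tuple_count_exchange)+
  moreover have "tuple_count K S S T T = tuple_count K T T S S"
    by (rule tuple_count_exchange)
  moreover have "tuple_count K S T S T = tuple_count K T S T S" "tuple_count K S T T S = tuple_count K T S T S"
    "tuple_count K T S S T = tuple_count K T S T S"
    by (metis tuple_count_swap tuple_count_exchange)+
  moreover have "tuple_count K S T S S = tuple_count K T S S S" "tuple_count K S S T S = tuple_count K T S S S"
    "tuple_count K S S S T = tuple_count K T S S S"
    by (metis tuple_count_swap tuple_count_exchange)+
  ultimately show ?thesis by simp
qed

lemma extended_count_removed:
  assumes "finite R" "{v, w, x, y} \<subseteq> R" "distinct [v, w, x, y]"
  shows "extended_count K v w x y (R - {v} - {w} - {x} - {y}) = tuple_count K R R R R"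
proof -
  have "sum_extra v w x y (R - {v} - {w} - {x} - {y}) h = sum h R" for h
  proof -
    have "sum h R = h v + sum h (R - {v})" using assms by (intro sum.remove) auto
    also have "sum h (R - {v}) = h w + sum h (R - {v} - {w})" using assms by (intro sum.remove) auto
    also have "sum h (R - {v} - {w}) = h x + sum h (R - {v} - {w} - {x})" using assms by (intro sum.remove) auto
    also have "sum h (R - {v} - {w} - {x}) = h y + sum h (R - {v} - {w} - {x} - {y})"
      using assms by (intro sum.remove) auto
    finally show ?thesis unfolding sum_extra_def by simp
  qed
  then show ?thesis unfolding extended_count_def tuple_count_def by simp
qed

lemma tuple_count_card:
  assumes "finite T"
  shows "tuple_count K T T T T = card {(a, b, c, d) \<in> T \<times> T \<times> T \<times> T. K a b c d}"
proof -
  have "tuple_count K T T T T = (\<Sum>(a, b, c, d) \<in> T \<times> T \<times> T \<times> T. of_bool (K a b c d))"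
    unfolding tuple_count_def by (simp add: sum.cartesian_product)
  also have "\<dots> = (\<Sum>p \<in> T \<times> T \<times> T \<times> T. of_bool (case p of (a, b, c, d) \<Rightarrow> K a b c d))"
    by (intro sum.cong) auto
  also have "\<dots> = card (T \<times> T \<times> T \<times> T \<inter> {p. case p of (a, b, c, d) \<Rightarrow> K a b c d})"
    using assms by (subst sum_of_bool_eq) auto
  also have "T \<times> T \<times> T \<times> T \<inter> {p. case p of (a, b, c, d) \<Rightarrow> K a b c d} = {(a, b, c, d) \<in> T \<times> T \<times> T \<times> T. K a b c d}"
    by auto
  finally show ?thesis .
qed

text \<open>
  The orbit of a quadruple under the symmetry group.
\<close>

lemma orbit_card:
  assumes "distinct [v, w, x, y]"
  shows "card {(v, w, x, y), (w, v, x, y), (v, w, y, x), (w, v, y, x),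
    (x, y, v, w), (y, x, v, w), (x, y, w, v), (y, x, w, v)} = 8"
  using assms by (simp add: card_insert_if)

lemma eight_le_tuple_count:
  assumes K: "K v w x y" and T: "T = {v, w, x, y}"
  shows "8 \<le> tuple_count K T T T T"
proof -
  have fin: "finite T" unfolding T by simp
  have "K w v x y" "K x y v w" by (fact K_swap[OF K] K_exchange[OF K])+
  moreover have "K y x v w" by (rule K_swap[OF K_exchange[OF K]])
  moreover have "K x y w v" by (rule K_exchange[OF K_swap[OF K]])
  moreover have "K y x w v" by (rule K_swap[OF K_exchange[OF K_swap[OF K]]])
  moreover have "K v w y x" by (rule K_exchange[OF K_swap[OF K_exchange[OF K]]])
  moreover have "K w v y x" by (rule K_exchange[OF K_swap[OF K_exchange[OF K_swap[OF K]]]])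
  ultimately have "{(v, w, x, y), (w, v, x, y), (v, w, y, x), (w, v, y, x),
    (x, y, v, w), (y, x, v, w), (x, y, w, v), (y, x, w, v)}
    \<subseteq> {(a, b, c, d) \<in> T \<times> T \<times> T \<times> T. K a b c d}"
    using K unfolding T by simp
  then have "card {(v, w, x, y), (w, v, x, y), (v, w, y, x), (w, v, y, x),
    (x, y, v, w), (y, x, v, w), (x, y, w, v), (y, x, w, v)}
    \<le> card {(a, b, c, d) \<in> T \<times> T \<times> T \<times> T. K a b c d}"
    using fin by (intro card_mono) (auto intro: finite_subset[of _ "T \<times> T \<times> T \<times> T"])
  then show ?thesis unfolding orbit_card[OF K_distinct[OF K]] tuple_count_card[OF fin] .
qed

text \<open>
  If \<open>x\<close> is near neither \<open>v\<close> nor \<open>w\<close>, then \<open>{v, w}\<close> and \<open>{x, y}\<close> are the only possible pairs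
  of a tuple, and just the eight reorderings remain. Otherwise all \<open>4 ^ 4 = 256\<close> quadruples
  of the four points are allowed for.
\<close>

lemma tuple_count_le:
  assumes K: "K v w x y" and T: "T = {v, w, x, y}"
  shows "tuple_count K T T T T \<le> 8 + 256 * of_bool (near v x \<or> near w x)"
proof (cases "near v x \<or> near w x")
  case True
  have fin: "finite T" unfolding T by simp
  have "card T = 4" using K_distinct[OF K] T by simp
  then have c: "card (T \<times> T \<times> T \<times> T) = 256" by (simp only: card_cartesian_product)
  have "card {(a, b, c, d) \<in> T \<times> T \<times> T \<times> T. K a b c d} \<le> card (T \<times> T \<times> T \<times> T)"
    using fin by (intro card_mono) auto
  then show ?thesis unfolding c tuple_count_card[OF fin] using True by simp
next
  case False
  have "{(a, b, c, d) \<in> T \<times> T \<times> T \<times> T. K a b c d}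
    \<subseteq> {(v, w, x, y), (w, v, x, y), (v, w, y, x), (w, v, y, x),
    (x, y, v, w), (y, x, v, w), (x, y, w, v), (y, x, w, v)}"
  proof
    fix p assume "p \<in> {(a, b, c, d) \<in> T \<times> T \<times> T \<times> T. K a b c d}"
    then obtain a b c d where p: "p = (a, b, c, d)"
      and abcd: "a \<in> T" "b \<in> T" "c \<in> T" "d \<in> T" and Kabcd: "K a b c d" by blast
    have d: "distinct [a, b, c, d]" by (rule K_distinct[OF Kabcd])
    have n: "near a b" "near b a" "near c d" "near d c"
      using Kabcd K_near K_near2 near_commute by blast+
    have nn: "\<not> near v x" "\<not> near x v" "\<not> near w x" "\<not> near x w"
      using False near_commute by blast+
    show "p \<in> {(v, w, x, y), (w, v, x, y), (v, w, y, x), (w, v, y, x),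
    (x, y, v, w), (y, x, v, w), (x, y, w, v), (y, x, w, v)}"
      using abcd d n nn unfolding T p by auto
  qed
  then have "card {(a, b, c, d) \<in> T \<times> T \<times> T \<times> T. K a b c d} \<le> 8"
    unfolding orbit_card[OF K_distinct[OF K], symmetric] by (intro card_mono) auto
  moreover have "finite T" unfolding T by simp
  ultimately show ?thesis by (simp add: tuple_count_card)
qed

end

section \<open>Poisson approximation of tuple counts\<close>

text \<open>
  The constants \<open>\<alpha>\<close> and \<open>\<beta>\<close> bound the mean numbers of points of the process that are near,
  respectively close, to a given point.
\<close>

locale poisson_kernel = poisson_points P t W \<eta> + pair_kernel K near close
  for P :: "'w measure" and t :: real and W :: "'a::euclidean_space set" and \<eta> :: "'w \<Rightarrow> 'a set"
    and K :: "'a \<Rightarrow> 'a \<Rightarrow> 'a \<Rightarrow> 'a \<Rightarrow> bool" and near close :: "'a \<Rightarrow> 'a \<Rightarrow> bool" +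
  fixes \<alpha> \<beta> :: real
  assumes \<alpha>_nonneg: "0 \<le> \<alpha>" and \<beta>_nonneg: "0 \<le> \<beta>"
    and near_bound: "(\<integral>\<^sup>+y. of_bool (near x y) \<partial>intensity) \<le> ennreal \<alpha>"
    and close_bound: "(\<integral>\<^sup>+y. of_bool (close x y) \<partial>intensity) \<le> ennreal \<beta>"
begin

abbreviation k :: "'a \<Rightarrow> 'a \<Rightarrow> 'a \<Rightarrow> 'a \<Rightarrow> ennreal" where "k v w x y \<equiv> of_bool (K v w x y)"
abbreviation n :: "'a \<Rightarrow> 'a \<Rightarrow> ennreal" where "n x y \<equiv> of_bool (near x y)"
abbreviation cl :: "'a \<Rightarrow> 'a \<Rightarrow> ennreal" where "cl x y \<equiv> of_bool (close x y)"

lemma k_measurable [measurable (raw)]: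
  assumes "v \<in> borel_measurable M" "w \<in> borel_measurable M" "x \<in> borel_measurable M" "y \<in> borel_measurable M"
  shows "(\<lambda>z. k (v z) (w z) (x z) (y z)) \<in> borel_measurable M"
proof -
  have "Measurable.pred M (\<lambda>z. (\<lambda>(v, w, x, y). K v w x y) (v z, w z, x z, y z))"
    by (rule measurable_compose[OF _ K_pred]) (use assms in measurable)
  then show ?thesis by simp
qed

lemma n_measurable [measurable (raw)]:
  assumes "x \<in> borel_measurable M" "y \<in> borel_measurable M"
  shows "(\<lambda>z. n (x z) (y z)) \<in> borel_measurable M"
proof -
  have "Measurable.pred M (\<lambda>z. (\<lambda>(x, y). near x y) (x z, y z))"
    by (rule measurable_compose[OF _ near_pred]) (use assms in measurable)
  then show ?thesis by simp
qed

lemma cl_measurable [measurable (raw)]: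
  assumes "x \<in> borel_measurable M" "y \<in> borel_measurable M"
  shows "(\<lambda>z. cl (x z) (y z)) \<in> borel_measurable M"
proof -
  have "Measurable.pred M (\<lambda>z. (\<lambda>(x, y). close x y) (x z, y z))"
    by (rule measurable_compose[OF _ close_pred]) (use assms in measurable)
  then show ?thesis by simp
qed

text \<open>
  In the names of the following bounds the letters are the positions that are integrated
  out. Each position contributes \<open>\<alpha>\<close> if its partner in the pair is already present, and \<open>\<beta>\<close>
  if it is the first one of the second pair.
\<close>

lemma bound_d: "(\<integral>\<^sup>+d. k a b c d \<partial>intensity) \<le> ennreal \<alpha>"
proof -
  have "(\<integral>\<^sup>+d. k a b c d \<partial>intensity) \<le> (\<integral>\<^sup>+d. n c d \<partial>intensity)"
    using K_near2 by (intro nn_integral_mono) auto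
  also note near_bound
  finally show ?thesis .
qed

lemma bound_cd: "(\<integral>\<^sup>+c. \<integral>\<^sup>+d. k a b c d \<partial>intensity \<partial>intensity) \<le> ennreal (\<alpha> * \<beta>)"
proof -
  have "(\<integral>\<^sup>+c. \<integral>\<^sup>+d. k a b c d \<partial>intensity \<partial>intensity) \<le> (\<integral>\<^sup>+c. ennreal \<alpha> * cl a c \<partial>intensity)"
  proof (rule nn_integral_mono)
    fix c
    show "(\<integral>\<^sup>+d. k a b c d \<partial>intensity) \<le> ennreal \<alpha> * cl a c"
    proof (cases "close a c")
      case True then show ?thesis using bound_d by simp
    next
      case False
      then have "\<not> K a b c d" for d using K_close by blast
      then show ?thesis by simp
    qed
  qed
  also have "\<dots> = ennreal \<alpha> * (\<integral>\<^sup>+c. cl a c \<partial>intensity)"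
    by (rule nn_integral_cmult) (simp add: intensity_cong)
  also have "\<dots> \<le> ennreal \<alpha> * ennreal \<beta>" by (intro mult_left_mono close_bound) simp
  finally show ?thesis using \<alpha>_nonneg by (simp add: ennreal_mult')
qed

lemma bound_bd: "(\<integral>\<^sup>+b. \<integral>\<^sup>+d. k a b c d \<partial>intensity \<partial>intensity) \<le> ennreal (\<alpha> * \<alpha>)"
proof -
  have "(\<integral>\<^sup>+b. \<integral>\<^sup>+d. k a b c d \<partial>intensity \<partial>intensity) \<le> (\<integral>\<^sup>+b. ennreal \<alpha> * n a b \<partial>intensity)"
  proof (rule nn_integral_mono)
    fix b
    show "(\<integral>\<^sup>+d. k a b c d \<partial>intensity) \<le> ennreal \<alpha> * n a b"
    proof (cases "near a b")
      case True then show ?thesis using bound_d by simp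
    next
      case False
      then have "\<not> K a b c d" for d using K_near by blast
      then show ?thesis by simp
    qed
  qed
  also have "\<dots> = ennreal \<alpha> * (\<integral>\<^sup>+b. n a b \<partial>intensity)"
    by (rule nn_integral_cmult) (simp add: intensity_cong)
  also have "\<dots> \<le> ennreal \<alpha> * ennreal \<alpha>" by (intro mult_left_mono near_bound) simp
  finally show ?thesis using \<alpha>_nonneg by (simp add: ennreal_mult')
qed

lemma bound_bcd: "(\<integral>\<^sup>+b. \<integral>\<^sup>+c. \<integral>\<^sup>+d. k a b c d \<partial>intensity \<partial>intensity \<partial>intensity) \<le> ennreal (\<alpha> * \<alpha> * \<beta>)"
proof -
  have "(\<integral>\<^sup>+b. \<integral>\<^sup>+c. \<integral>\<^sup>+d. k a b c d \<partial>intensity \<partial>intensity \<partial>intensity)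
      \<le> (\<integral>\<^sup>+b. ennreal (\<alpha> * \<beta>) * n a b \<partial>intensity)"
  proof (rule nn_integral_mono)
    fix b
    show "(\<integral>\<^sup>+c. \<integral>\<^sup>+d. k a b c d \<partial>intensity \<partial>intensity) \<le> ennreal (\<alpha> * \<beta>) * n a b"
    proof (cases "near a b")
      case True then show ?thesis using bound_cd by simp
    next
      case False
      then have "\<not> K a b c d" for c d using K_near by blast
      then show ?thesis by simp
    qed
  qed
  also have "\<dots> = ennreal (\<alpha> * \<beta>) * (\<integral>\<^sup>+b. n a b \<partial>intensity)"
    by (rule nn_integral_cmult) (simp add: intensity_cong)
  also have "\<dots> \<le> ennreal (\<alpha> * \<beta>) * ennreal \<alpha>" by (intro mult_left_mono near_bound) simp
  finally show ?thesis using \<alpha>_nonneg \<beta>_nonneg by (simp add: ennreal_mult' mult_ac)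
qed

definition k_integral :: ennreal where
  "k_integral = (\<integral>\<^sup>+v. \<integral>\<^sup>+w. \<integral>\<^sup>+x. \<integral>\<^sup>+y. k v w x y \<partial>intensity \<partial>intensity \<partial>intensity \<partial>intensity)"

lemma k_integral_le: "k_integral \<le> ennreal (\<alpha> * \<alpha> * \<beta>) * emeasure intensity UNIV"
proof -
  have "k_integral \<le> (\<integral>\<^sup>+v. ennreal (\<alpha> * \<alpha> * \<beta>) \<partial>intensity)"
    unfolding k_integral_def by (intro nn_integral_mono bound_bcd)
  then show ?thesis by simp
qed

lemma k_integral_finite: "k_integral < \<infinity>"
  by (rule le_less_trans[OF k_integral_le])
     (simp add: intensity.emeasure_eq_measure ennreal_mult_less_top)

text \<open>
  If the pairs are near to each other, then all four points form a chain of near neighbours,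
  which gives three factors \<open>\<alpha>\<close>.
\<close>

lemma near_integral:
  "(\<integral>\<^sup>+v. \<integral>\<^sup>+w. \<integral>\<^sup>+x. \<integral>\<^sup>+y. k v w x y * of_bool (near v x \<or> near w x)
      \<partial>intensity \<partial>intensity \<partial>intensity \<partial>intensity)
    \<le> ennreal (2 * \<alpha> ^ 3) * emeasure intensity UNIV"
proof -
  have nx: "(\<integral>\<^sup>+x. n v x + n w x \<partial>intensity) \<le> ennreal (2 * \<alpha>)" for v w
  proof -
    have "(\<integral>\<^sup>+x. n v x + n w x \<partial>intensity) = (\<integral>\<^sup>+x. n v x \<partial>intensity) + (\<integral>\<^sup>+x. n w x \<partial>intensity)"
      by (rule nn_integral_add) (simp_all add: intensity_cong)
    also have "\<dots> \<le> ennreal \<alpha> + ennreal \<alpha>" by (intro add_mono near_bound)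
    finally show ?thesis using \<alpha>_nonneg by (simp add: ennreal_plus[symmetric] del: ennreal_plus)
  qed
  have y: "(\<integral>\<^sup>+y. k v w x y * of_bool (near v x \<or> near w x) \<partial>intensity)
      \<le> n v w * (ennreal \<alpha> * (n v x + n w x))" for v w x
  proof (cases "near v w \<and> (near v x \<or> near w x)")
    case True
    have "(\<integral>\<^sup>+y. k v w x y * of_bool (near v x \<or> near w x) \<partial>intensity) \<le> ennreal \<alpha> * 1"
      using True bound_d by simp
    also have "\<dots> \<le> ennreal \<alpha> * (n v x + n w x)" using True by (intro mult_left_mono) auto
    finally show ?thesis using True by simp
  next
    case False
    then have "k v w x y * of_bool (near v x \<or> near w x) = 0" for y using K_near by auto
    then have "(\<integral>\<^sup>+y. k v w x y * of_bool (near v x \<or> near w x) \<partial>intensity) = 0"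
      by (simp only: nn_integral_const) simp
    then show ?thesis by (simp only: zero_le)
  qed
  have x: "(\<integral>\<^sup>+x. \<integral>\<^sup>+y. k v w x y * of_bool (near v x \<or> near w x) \<partial>intensity \<partial>intensity)
      \<le> ennreal (2 * \<alpha> * \<alpha>) * n v w" for v w
  proof -
    have "(\<integral>\<^sup>+x. \<integral>\<^sup>+y. k v w x y * of_bool (near v x \<or> near w x) \<partial>intensity \<partial>intensity)
        \<le> (\<integral>\<^sup>+x. n v w * (ennreal \<alpha> * (n v x + n w x)) \<partial>intensity)"
      by (intro nn_integral_mono y)
    also have "\<dots> = n v w * (ennreal \<alpha> * (\<integral>\<^sup>+x. n v x + n w x \<partial>intensity))"
      by (subst nn_integral_cmult, simp add: intensity_cong, subst nn_integral_cmult) (simp_all add: intensity_cong)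
    also have "\<dots> \<le> n v w * (ennreal \<alpha> * ennreal (2 * \<alpha>))" by (intro mult_left_mono nx) simp_all
    finally show ?thesis using \<alpha>_nonneg by (simp add: ennreal_mult' mult_ac)
  qed
  have "(\<integral>\<^sup>+v. \<integral>\<^sup>+w. \<integral>\<^sup>+x. \<integral>\<^sup>+y. k v w x y * of_bool (near v x \<or> near w x)
      \<partial>intensity \<partial>intensity \<partial>intensity \<partial>intensity)
    \<le> (\<integral>\<^sup>+v. \<integral>\<^sup>+w. ennreal (2 * \<alpha> * \<alpha>) * n v w \<partial>intensity \<partial>intensity)"
    by (intro nn_integral_mono x)
  also have "\<dots> = (\<integral>\<^sup>+v. ennreal (2 * \<alpha> * \<alpha>) * (\<integral>\<^sup>+w. n v w \<partial>intensity) \<partial>intensity)"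
    by (intro nn_integral_cong nn_integral_cmult) (simp add: intensity_cong)
  also have "\<dots> \<le> (\<integral>\<^sup>+v. ennreal (2 * \<alpha> * \<alpha>) * ennreal \<alpha> \<partial>intensity)"
    by (intro nn_integral_mono mult_left_mono near_bound) simp
  also have "\<dots> = ennreal (2 * \<alpha> ^ 3) * emeasure intensity UNIV"
    using \<alpha>_nonneg by (simp add: ennreal_mult'[symmetric] power3_eq_cube mult_ac)
  finally show ?thesis .
qed

lemma nn_integral_sum_le:
  assumes "finite T" "\<And>a. a \<in> T \<Longrightarrow> g a \<in> borel_measurable P" "\<And>a. a \<in> T \<Longrightarrow> (\<integral>\<^sup>+\<omega>. g a \<omega> \<partial>P) \<le> B"
  shows "(\<integral>\<^sup>+\<omega>. (\<Sum>a\<in>T. g a \<omega>) \<partial>P) \<le> of_nat (card T) * B"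
proof -
  have "(\<integral>\<^sup>+\<omega>. (\<Sum>a\<in>T. g a \<omega>) \<partial>P) = (\<Sum>a\<in>T. \<integral>\<^sup>+\<omega>. g a \<omega> \<partial>P)"
    using assms(2) by (rule nn_integral_sum)
  also have "\<dots> \<le> (\<Sum>a\<in>T. B)" using assms(3) by (rule sum_mono)
  finally show ?thesis by simp
qed

lemma sum1_measurable: "(\<lambda>\<omega>. \<Sum>d\<in>\<eta> \<omega>. k a b c d) \<in> borel_measurable P"
  by (rule measurable_sum_points[OF \<eta>_measurable]) (simp add: split_beta')

lemma sum2_measurable:
  assumes "(\<lambda>(x, y). h x y) \<in> borel_measurable (borel \<Otimes>\<^sub>M borel)"
  shows "(\<lambda>\<omega>. \<Sum>x\<in>\<eta> \<omega>. \<Sum>y\<in>\<eta> \<omega>. h x y :: ennreal) \<in> borel_measurable P"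
proof (rule measurable_sum_points[OF \<eta>_measurable])
  have "(\<lambda>p. \<Sum>y\<in>\<eta> (snd p). h (fst p) y) \<in> borel_measurable (borel \<Otimes>\<^sub>M P)"
  proof (rule measurable_sum_points)
    show "(\<lambda>p. \<eta> (snd p)) \<in> measurable (borel \<Otimes>\<^sub>M P) (configurations W)" by measurable
    have "(\<lambda>q. (\<lambda>(x, y). h x y) (fst (snd q), fst q)) \<in> borel_measurable (borel \<Otimes>\<^sub>M borel \<Otimes>\<^sub>M P)"
      by (rule measurable_compose[OF _ assms]) measurable
    then show "(\<lambda>(y, p). h (fst p) y) \<in> borel_measurable (borel \<Otimes>\<^sub>M borel \<Otimes>\<^sub>M P)"
      by (simp add: split_beta')
  qed
  then show "(\<lambda>(x, \<omega>). \<Sum>y\<in>\<eta> \<omega>. h x y) \<in> borel_measurable (borel \<Otimes>\<^sub>M P)"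
    by (simp add: split_beta')
qed

text \<open>
  The expected numbers of mixed tuples. In the names, \<open>T\<close> is a position filled from a fixed
  set of four points and \<open>S\<close> one filled from the process.
\<close>

lemma expectation_TTTS:
  assumes T: "finite T" "card T = 4"
  shows "(\<integral>\<^sup>+\<omega>. of_nat (tuple_count K T T T (\<eta> \<omega>)) \<partial>P) \<le> ennreal (64 * \<alpha>)"
proof -
  have "(\<integral>\<^sup>+\<omega>. of_nat (tuple_count K T T T (\<eta> \<omega>)) \<partial>P)
      = (\<integral>\<^sup>+\<omega>. (\<Sum>(a, b, c)\<in>T \<times> T \<times> T. \<Sum>d\<in>\<eta> \<omega>. k a b c d) \<partial>P)"
    by (simp add: tuple_count_def sum.cartesian_product[symmetric])
  also have "\<dots> \<le> of_nat (card (T \<times> T \<times> T)) * ennreal \<alpha>"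
    using T bound_d sum1_measurable by (intro nn_integral_sum_le) (auto simp: campbell)
  also have "\<dots> = ennreal (64 * \<alpha>)"
    using \<alpha>_nonneg by (simp add: card_cartesian_product T ennreal_mult' )
  finally show ?thesis .
qed

lemma expectation_TTSS:
  assumes T: "finite T" "card T = 4"
  shows "(\<integral>\<^sup>+\<omega>. of_nat (tuple_count K T T (\<eta> \<omega>) (\<eta> \<omega>)) \<partial>P) \<le> ennreal (16 * (\<alpha> * \<beta>))"
proof -
  have "(\<integral>\<^sup>+\<omega>. of_nat (tuple_count K T T (\<eta> \<omega>) (\<eta> \<omega>)) \<partial>P)
      = (\<integral>\<^sup>+\<omega>. (\<Sum>(a, b)\<in>T \<times> T. \<Sum>c\<in>\<eta> \<omega>. \<Sum>d\<in>\<eta> \<omega>. k a b c d) \<partial>P)"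
    by (simp add: tuple_count_def sum.cartesian_product[symmetric])
  also have "\<dots> \<le> of_nat (card (T \<times> T)) * ennreal (\<alpha> * \<beta>)"
  proof (rule nn_integral_sum_le)
    fix p assume "p \<in> T \<times> T"
    have m: "(\<lambda>(c, d). k (fst p) (snd p) c d) \<in> borel_measurable (borel \<Otimes>\<^sub>M borel)"
      by (simp add: split_beta')
    show "(\<lambda>\<omega>. case p of (a, b) \<Rightarrow> \<Sum>c\<in>\<eta> \<omega>. \<Sum>d\<in>\<eta> \<omega>. k a b c d) \<in> borel_measurable P"
      using sum2_measurable[OF m] by (simp add: split_beta')
    show "(\<integral>\<^sup>+\<omega>. (case p of (a, b) \<Rightarrow> \<Sum>c\<in>\<eta> \<omega>. \<Sum>d\<in>\<eta> \<omega>. k a b c d) \<partial>P) \<le> ennreal (\<alpha> * \<beta>)"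
      using campbell2[OF m] bound_cd K_distinct by (fastforce simp add: split_beta')
  qed (use T in auto)
  also have "\<dots> = ennreal (16 * (\<alpha> * \<beta>))"
    using \<alpha>_nonneg \<beta>_nonneg by (simp add: card_cartesian_product T ennreal_mult')
  finally show ?thesis .
qed

lemma expectation_TSSS:
  assumes T: "finite T" "card T = 4"
  shows "(\<integral>\<^sup>+\<omega>. of_nat (tuple_count K T (\<eta> \<omega>) (\<eta> \<omega>) (\<eta> \<omega>)) \<partial>P) \<le> ennreal (4 * (\<alpha> * \<alpha> * \<beta>))"
proof -
  have "(\<integral>\<^sup>+\<omega>. of_nat (tuple_count K T (\<eta> \<omega>) (\<eta> \<omega>) (\<eta> \<omega>)) \<partial>P)
      = (\<integral>\<^sup>+\<omega>. (\<Sum>a\<in>T. \<Sum>b\<in>\<eta> \<omega>. \<Sum>c\<in>\<eta> \<omega>. \<Sum>d\<in>\<eta> \<omega>. k a b c d) \<partial>P)"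
    by (simp add: tuple_count_def)
  also have "\<dots> \<le> of_nat (card T) * ennreal (\<alpha> * \<alpha> * \<beta>)"
  proof (rule nn_integral_sum_le)
    fix a assume "a \<in> T"
    have m: "(\<lambda>(b, c, d). k a b c d) \<in> borel_measurable (borel \<Otimes>\<^sub>M borel \<Otimes>\<^sub>M borel)"
      by (simp add: split_beta')
    show "(\<lambda>\<omega>. \<Sum>b\<in>\<eta> \<omega>. \<Sum>c\<in>\<eta> \<omega>. \<Sum>d\<in>\<eta> \<omega>. k a b c d) \<in> borel_measurable P"
    proof (rule measurable_sum_points[OF \<eta>_measurable])
      have "(\<lambda>p. \<Sum>c\<in>\<eta> (snd p). \<Sum>d\<in>\<eta> (snd p). k a (fst p) c d) \<in> borel_measurable (borel \<Otimes>\<^sub>M P)"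
      proof (rule measurable_sum_points)
        show "(\<lambda>p. \<eta> (snd p)) \<in> measurable (borel \<Otimes>\<^sub>M P) (configurations W)" by measurable
        have "(\<lambda>q. \<Sum>d\<in>\<eta> (snd (snd q)). k a (fst (snd q)) (fst q) d) \<in> borel_measurable (borel \<Otimes>\<^sub>M borel \<Otimes>\<^sub>M P)"
          by (rule measurable_sum_points[where W = W]) (simp_all add: split_beta')
        then show "(\<lambda>(c, p). \<Sum>d\<in>\<eta> (snd p). k a (fst p) c d) \<in> borel_measurable (borel \<Otimes>\<^sub>M borel \<Otimes>\<^sub>M P)"
          by (simp add: split_beta')
      qed
      then show "(\<lambda>(b, \<omega>). \<Sum>c\<in>\<eta> \<omega>. \<Sum>d\<in>\<eta> \<omega>. k a b c d) \<in> borel_measurable (borel \<Otimes>\<^sub>M P)"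
        by (simp add: split_beta')
    qed
    have "(\<integral>\<^sup>+\<omega>. (\<Sum>b\<in>\<eta> \<omega>. \<Sum>c\<in>\<eta> \<omega>. \<Sum>d\<in>\<eta> \<omega>. k a b c d) \<partial>P)
      = (\<integral>\<^sup>+b. \<integral>\<^sup>+c. \<integral>\<^sup>+d. k a b c d \<partial>intensity \<partial>intensity \<partial>intensity)"
      using K_distinct by (intro campbell3[OF m]) fastforce
    then show "(\<integral>\<^sup>+\<omega>. (\<Sum>b\<in>\<eta> \<omega>. \<Sum>c\<in>\<eta> \<omega>. \<Sum>d\<in>\<eta> \<omega>. k a b c d) \<partial>P) \<le> ennreal (\<alpha> * \<alpha> * \<beta>)"
      using bound_bcd by simp
  qed (use T in auto)
  also have "\<dots> = ennreal (4 * (\<alpha> * \<alpha> * \<beta>))"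
    using \<alpha>_nonneg \<beta>_nonneg by (simp add: T ennreal_mult')
  finally show ?thesis .
qed

lemma expectation_TSTS:
  assumes T: "finite T" "card T = 4"
  shows "(\<integral>\<^sup>+\<omega>. of_nat (tuple_count K T (\<eta> \<omega>) T (\<eta> \<omega>)) \<partial>P) \<le> ennreal (16 * (\<alpha> * \<alpha>))"
proof -
  have "(\<integral>\<^sup>+\<omega>. of_nat (tuple_count K T (\<eta> \<omega>) T (\<eta> \<omega>)) \<partial>P)
      = (\<integral>\<^sup>+\<omega>. (\<Sum>(a, c)\<in>T \<times> T. \<Sum>b\<in>\<eta> \<omega>. \<Sum>d\<in>\<eta> \<omega>. k a b c d) \<partial>P)"
    unfolding tuple_count_def
    by (subst sum.swap) (simp add: sum.cartesian_product[symmetric])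
  also have "\<dots> \<le> of_nat (card (T \<times> T)) * ennreal (\<alpha> * \<alpha>)"
  proof (rule nn_integral_sum_le)
    fix p assume "p \<in> T \<times> T"
    have m: "(\<lambda>(b, d). k (fst p) b (snd p) d) \<in> borel_measurable (borel \<Otimes>\<^sub>M borel)"
      by (simp add: split_beta')
    show "(\<lambda>\<omega>. case p of (a, c) \<Rightarrow> \<Sum>b\<in>\<eta> \<omega>. \<Sum>d\<in>\<eta> \<omega>. k a b c d) \<in> borel_measurable P"
      using sum2_measurable[OF m] by (simp add: split_beta')
    show "(\<integral>\<^sup>+\<omega>. (case p of (a, c) \<Rightarrow> \<Sum>b\<in>\<eta> \<omega>. \<Sum>d\<in>\<eta> \<omega>. k a b c d) \<partial>P) \<le> ennreal (\<alpha> * \<alpha>)"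
      using campbell2[OF m] bound_bd K_distinct by (fastforce simp add: split_beta')
  qed (use T in auto)
  also have "\<dots> = ennreal (16 * (\<alpha> * \<alpha>))"
    using \<alpha>_nonneg by (simp add: card_cartesian_product T ennreal_mult')
  finally show ?thesis .
qed

end

context poisson_points
begin

lemma measurable_integral_last:
  assumes "(\<lambda>(z, y). g z y) \<in> borel_measurable (M \<Otimes>\<^sub>M borel)"
  shows "(\<lambda>z. \<integral>\<^sup>+y. g z y \<partial>intensity) \<in> borel_measurable M"
proof (rule intensity.borel_measurable_nn_integral)
  show "(\<lambda>(z, y). g z y) \<in> borel_measurable (M \<Otimes>\<^sub>M intensity)"
    using assms by (simp cong: measurable_cong_sets sets_pair_measure_cong)
qed

lemma nn_integral_add_4:
  fixes g h :: "'a \<Rightarrow> 'a \<Rightarrow> 'a \<Rightarrow> 'a \<Rightarrow> ennreal"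
  assumes "(\<lambda>(v, w, x, y). g v w x y) \<in> borel_measurable (borel \<Otimes>\<^sub>M borel \<Otimes>\<^sub>M borel \<Otimes>\<^sub>M borel)"
    and "(\<lambda>(v, w, x, y). h v w x y) \<in> borel_measurable (borel \<Otimes>\<^sub>M borel \<Otimes>\<^sub>M borel \<Otimes>\<^sub>M borel)"
  shows "(\<integral>\<^sup>+v. \<integral>\<^sup>+w. \<integral>\<^sup>+x. \<integral>\<^sup>+y. g v w x y + h v w x y \<partial>intensity \<partial>intensity \<partial>intensity \<partial>intensity)
    = (\<integral>\<^sup>+v. \<integral>\<^sup>+w. \<integral>\<^sup>+x. \<integral>\<^sup>+y. g v w x y \<partial>intensity \<partial>intensity \<partial>intensity \<partial>intensity)
    + (\<integral>\<^sup>+v. \<integral>\<^sup>+w. \<integral>\<^sup>+x. \<integral>\<^sup>+y. h v w x y \<partial>intensity \<partial>intensity \<partial>intensity \<partial>intensity)"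
proof -
  have meas: "(\<lambda>y. g v w x y) \<in> borel_measurable intensity"
    "(\<lambda>x. \<integral>\<^sup>+y. g v w x y \<partial>intensity) \<in> borel_measurable intensity"
    "(\<lambda>w. \<integral>\<^sup>+x. \<integral>\<^sup>+y. g v w x y \<partial>intensity \<partial>intensity) \<in> borel_measurable intensity"
    "(\<lambda>v. \<integral>\<^sup>+w. \<integral>\<^sup>+x. \<integral>\<^sup>+y. g v w x y \<partial>intensity \<partial>intensity \<partial>intensity) \<in> borel_measurable intensity"
    if g: "(\<lambda>(v, w, x, y). g v w x y) \<in> borel_measurable (borel \<Otimes>\<^sub>M borel \<Otimes>\<^sub>M borel \<Otimes>\<^sub>M borel)"
    for g :: "'a \<Rightarrow> 'a \<Rightarrow> 'a \<Rightarrow> 'a \<Rightarrow> ennreal" and v w x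
  proof -
    have 3: "(\<lambda>z. \<integral>\<^sup>+y. g (fst (fst z)) (snd (fst z)) (snd z) y \<partial>intensity) \<in> borel_measurable ((borel \<Otimes>\<^sub>M borel) \<Otimes>\<^sub>M borel)"
    proof (rule measurable_integral_last)
      have "(\<lambda>q. (\<lambda>(v, w, x, y). g v w x y) (fst (fst (fst q)), snd (fst (fst q)), snd (fst q), snd q))
        \<in> borel_measurable (((borel \<Otimes>\<^sub>M borel) \<Otimes>\<^sub>M borel) \<Otimes>\<^sub>M borel)"
        by (rule measurable_compose[OF _ g]) measurable
      then show "(\<lambda>(z, y). g (fst (fst z)) (snd (fst z)) (snd z) y)
        \<in> borel_measurable (((borel \<Otimes>\<^sub>M borel) \<Otimes>\<^sub>M borel) \<Otimes>\<^sub>M borel)"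
        by (simp add: split_beta')
    qed
    have 2: "(\<lambda>z. \<integral>\<^sup>+x. \<integral>\<^sup>+y. g (fst z) (snd z) x y \<partial>intensity \<partial>intensity) \<in> borel_measurable (borel \<Otimes>\<^sub>M borel)"
      by (rule measurable_integral_last) (use 3 in \<open>simp add: split_beta'\<close>)
    have 1: "(\<lambda>v. \<integral>\<^sup>+w. \<integral>\<^sup>+x. \<integral>\<^sup>+y. g v w x y \<partial>intensity \<partial>intensity \<partial>intensity) \<in> borel_measurable borel"
      by (rule measurable_integral_last) (use 2 in \<open>simp add: split_beta'\<close>)
    show "(\<lambda>v. \<integral>\<^sup>+w. \<integral>\<^sup>+x. \<integral>\<^sup>+y. g v w x y \<partial>intensity \<partial>intensity \<partial>intensity) \<in> borel_measurable intensity"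
      using 1 by (simp add: intensity_cong)
    have "(\<lambda>w. (v, w)) \<in> measurable borel (borel \<Otimes>\<^sub>M borel)" by measurable
    from measurable_compose[OF this 2]
    show "(\<lambda>w. \<integral>\<^sup>+x. \<integral>\<^sup>+y. g v w x y \<partial>intensity \<partial>intensity) \<in> borel_measurable intensity"
      by (simp add: intensity_cong)
    have "(\<lambda>x. ((v, w), x)) \<in> measurable borel ((borel \<Otimes>\<^sub>M borel) \<Otimes>\<^sub>M borel)" by measurable
    from measurable_compose[OF this 3]
    show "(\<lambda>x. \<integral>\<^sup>+y. g v w x y \<partial>intensity) \<in> borel_measurable intensity"
      by (simp add: intensity_cong)
    have "(\<lambda>y. (v, w, x, y)) \<in> measurable borel (borel \<Otimes>\<^sub>M borel \<Otimes>\<^sub>M borel \<Otimes>\<^sub>M borel)" by measurable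
    from measurable_compose[OF this g]
    show "(\<lambda>y. g v w x y) \<in> borel_measurable intensity"
      by (simp add: intensity_cong)
  qed
  show ?thesis
    by (simp only: nn_integral_add[OF meas(1)[OF assms(1)] meas(1)[OF assms(2)]]
        nn_integral_add[OF meas(2)[OF assms(1)] meas(2)[OF assms(2)]]
        nn_integral_add[OF meas(3)[OF assms(1)] meas(3)[OF assms(2)]]
        nn_integral_add[OF meas(4)[OF assms(1)] meas(4)[OF assms(2)]])
qed

end

text \<open>
  The first summand bounds the mixed tuples, the second one the tuples with two pairs near
  to each other; \<open>\<mu>\<close> is the mean number of points.
\<close>

definition approximation_error :: "real \<Rightarrow> real \<Rightarrow> real \<Rightarrow> real \<Rightarrow> real" where
  "approximation_error mean \<alpha> \<beta> \<mu> =
     mean * (256 * \<alpha> + 32 * \<alpha> * \<beta> + 64 * \<alpha> * \<alpha> + 16 * \<alpha> * \<alpha> * \<beta>) + 64 * \<alpha> ^ 3 * \<mu>"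

context poisson_kernel
begin

text \<open>
  The eight reorderings of a tuple count as one.
\<close>

definition mean :: real where "mean = enn2real k_integral / 8"

lemma mean_nonneg: "0 \<le> mean" by (simp add: mean_def)

lemma k_integral_eq: "k_integral = ennreal (8 * mean)"
  using k_integral_finite by (simp add: mean_def)

abbreviation Y :: "'w \<Rightarrow> nat" where "Y \<omega> \<equiv> tuple_count K (\<eta> \<omega>) (\<eta> \<omega>) (\<eta> \<omega>) (\<eta> \<omega>)"

lemma Y_measurable [measurable]: "Y \<in> measurable P (count_space UNIV)"
proof (rule measurable_tuple_count[where K = "\<lambda>_. K", OF _ \<eta>_measurable])
  let ?B = "borel :: 'a measure"
  have "Measurable.pred (?B \<Otimes>\<^sub>M ?B \<Otimes>\<^sub>M ?B \<Otimes>\<^sub>M ?B \<Otimes>\<^sub>M P)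
    (\<lambda>p. (\<lambda>(v, w, x, y). K v w x y) (fst p, fst (snd p), fst (snd (snd p)), fst (snd (snd (snd p)))))"
    by (rule measurable_compose[OF _ K_pred]) measurable
  then show "Measurable.pred (?B \<Otimes>\<^sub>M ?B \<Otimes>\<^sub>M ?B \<Otimes>\<^sub>M ?B \<Otimes>\<^sub>M P) (\<lambda>(v, w, x, y, z). K v w x y)"
    by (simp add: split_beta')
qed

abbreviation f :: "nat \<Rightarrow> real" where "f j \<equiv> stein mean (real j / 8)"

text \<open>
  Expand \<open>Y\<close> as a sum over tuples. In each term the process is the rest of the process with
  the tuple inserted, to which the Mecke formula applies.
\<close>

lemma tuple_mecke:
  fixes g :: "nat \<Rightarrow> ennreal"
  shows "(\<integral>\<^sup>+\<omega>. of_nat (Y \<omega>) * g (Y \<omega>) \<partial>P)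
   = (\<integral>\<^sup>+v. \<integral>\<^sup>+w. \<integral>\<^sup>+x. \<integral>\<^sup>+y. \<integral>\<^sup>+\<omega>. k v w x y * g (extended_count K v w x y (\<eta> \<omega>))
        \<partial>P \<partial>intensity \<partial>intensity \<partial>intensity \<partial>intensity)"
proof -
  define F where "F v w x y S = k v w x y * g (extended_count K v w x y S)" for v w x y S
  have "of_nat (Y \<omega>) * g (Y \<omega>) = (\<Sum>v\<in>\<eta> \<omega>. \<Sum>w\<in>\<eta> \<omega> - {v}. \<Sum>x\<in>\<eta> \<omega> - {v} - {w}.
      \<Sum>y\<in>\<eta> \<omega> - {v} - {w} - {x}. F v w x y (\<eta> \<omega> - {v} - {w} - {x} - {y}))" if w: "\<omega> \<in> space P" for \<omega>
  proof -
    let ?R = "\<eta> \<omega>"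
    have R: "finite ?R" by (rule \<eta>_finite[OF w])
    let ?c = "g (Y \<omega>)"
    have "(\<Sum>v\<in>?R. \<Sum>w\<in>?R - {v}. \<Sum>x\<in>?R - {v} - {w}. \<Sum>y\<in>?R - {v} - {w} - {x}.
        F v w x y (?R - {v} - {w} - {x} - {y}))
      = (\<Sum>v\<in>?R. \<Sum>w\<in>?R - {v}. \<Sum>x\<in>?R - {v} - {w}. \<Sum>y\<in>?R - {v} - {w} - {x}. k v w x y * ?c)"
      unfolding F_def using R by (intro sum.cong refl) (auto simp: extended_count_removed)
    also have "\<dots> = (\<Sum>v\<in>?R. \<Sum>w\<in>?R - {v}. \<Sum>x\<in>?R - {v} - {w}. \<Sum>y\<in>?R. k v w x y * ?c)"
      using R K_distinct by (intro sum.cong refl sum.mono_neutral_left) fastforce+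
    also have "\<dots> = (\<Sum>v\<in>?R. \<Sum>w\<in>?R - {v}. \<Sum>x\<in>?R. \<Sum>y\<in>?R. k v w x y * ?c)"
      using R K_distinct by (intro sum.cong refl sum.mono_neutral_left) (fastforce intro!: sum.neutral)+
    also have "\<dots> = (\<Sum>v\<in>?R. \<Sum>w\<in>?R. \<Sum>x\<in>?R. \<Sum>y\<in>?R. k v w x y * ?c)"
      using R K_distinct by (intro sum.cong refl sum.mono_neutral_left) (fastforce intro!: sum.neutral)+
    also have "\<dots> = of_nat (Y \<omega>) * ?c"
      by (simp add: tuple_count_def sum_distrib_right)
    finally show ?thesis by simp
  qed
  then have "(\<integral>\<^sup>+\<omega>. of_nat (Y \<omega>) * g (Y \<omega>) \<partial>P)
      = (\<integral>\<^sup>+\<omega>. (\<Sum>v\<in>\<eta> \<omega>. \<Sum>w\<in>\<eta> \<omega> - {v}. \<Sum>x\<in>\<eta> \<omega> - {v} - {w}.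
      \<Sum>y\<in>\<eta> \<omega> - {v} - {w} - {x}. F v w x y (\<eta> \<omega> - {v} - {w} - {x} - {y})) \<partial>P)"
    by (rule nn_integral_cong)
  also have "\<dots> = (\<integral>\<^sup>+v. \<integral>\<^sup>+w. \<integral>\<^sup>+x. \<integral>\<^sup>+y. \<integral>\<^sup>+\<omega>. F v w x y (\<eta> \<omega>) \<partial>P \<partial>intensity \<partial>intensity \<partial>intensity \<partial>intensity)"
  proof (rule mecke4)
    let ?B = "borel :: 'a measure"
    let ?M = "?B \<Otimes>\<^sub>M ?B \<Otimes>\<^sub>M ?B \<Otimes>\<^sub>M ?B \<Otimes>\<^sub>M configurations W"
    have "(\<lambda>p. extended_count K (fst p) (fst (snd p)) (fst (snd (snd p))) (fst (snd (snd (snd p)))) (snd (snd (snd (snd p)))))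
      \<in> measurable ?M (count_space UNIV)"
      by (rule measurable_extended_count[OF K_pred, where W = W]) measurable
    then have "(\<lambda>p. F (fst p) (fst (snd p)) (fst (snd (snd p))) (fst (snd (snd (snd p)))) (snd (snd (snd (snd p)))))
      \<in> borel_measurable ?M"
      unfolding F_def by measurable
    then show "(\<lambda>(v, w, x, y, S). F v w x y S) \<in> borel_measurable ?M"
      by (simp add: split_beta')
  qed
  finally show ?thesis unfolding F_def .
qed

lemma stein_mecke:
  "(\<integral>\<^sup>+\<omega>. ennreal (real (Y \<omega>) / 8 * f (Y \<omega>)) \<partial>P)
   = (\<integral>\<^sup>+v. \<integral>\<^sup>+w. \<integral>\<^sup>+x. \<integral>\<^sup>+y. \<integral>\<^sup>+\<omega>. k v w x y * ennreal (f (extended_count K v w x y (\<eta> \<omega>)) / 8)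
        \<partial>P \<partial>intensity \<partial>intensity \<partial>intensity \<partial>intensity)"
proof -
  have "ennreal (real (Y \<omega>) / 8 * f (Y \<omega>)) = of_nat (Y \<omega>) * ennreal (f (Y \<omega>) / 8)" for \<omega>
    by (simp add: ennreal_of_nat_eq_real_of_nat ennreal_mult'[symmetric])
  then show ?thesis using tuple_mecke[of "\<lambda>j. ennreal (f j / 8)"] by simp
qed

lemma expectation_Y: "(\<integral>\<^sup>+\<omega>. of_nat (Y \<omega>) \<partial>P) = k_integral"
  using tuple_mecke[of "\<lambda>_. 1"] by (simp add: k_integral_def emeasure_space_1)

abbreviation error :: real where
  "error \<equiv> approximation_error mean \<alpha> \<beta> (measure intensity UNIV)"

lemma extended_measurable [measurable]:
  "(\<lambda>\<omega>. extended_count K v w x y (\<eta> \<omega>)) \<in> measurable P (count_space UNIV)"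
  by (rule measurable_extended_count[OF K_pred \<eta>_measurable]) auto

text \<open>
  A new tuple brings with it at least its eight reorderings.
\<close>

lemma f_extended_le:
  assumes K: "K v w x y"
  shows "f (extended_count K v w x y (\<eta> \<omega>)) \<le> stein mean (real (Y \<omega>) / 8 + 1)"
proof -
  have "Y \<omega> + 8 \<le> extended_count K v w x y (\<eta> \<omega>)"
    using extended_count_expand[OF K_distinct[OF K] refl] eight_le_tuple_count[OF K refl] by simp
  then have "real (Y \<omega>) / 8 + 1 \<le> real (extended_count K v w x y (\<eta> \<omega>)) / 8" by simp
  then show ?thesis by (intro stein_antimono[OF mean_nonneg]) auto
qed

text \<open>
  The new tuple adds exactly its eight reorderings unless it takes part in a mixed tuple or
  its pairs are near to each other. In these cases the number \<open>?D\<close> is at least one and the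
  bound \<open>stein \<le> 1\<close> suffices.
\<close>

lemma f_extended_ge:
  assumes K: "K v w x y" and T: "T = {v, w, x, y}"
  shows "stein mean (real (Y \<omega>) / 8 + 1) \<le> f (extended_count K v w x y (\<eta> \<omega>))
    + real (4 * tuple_count K T T T (\<eta> \<omega>) + 2 * tuple_count K T T (\<eta> \<omega>) (\<eta> \<omega>) + 4 * tuple_count K T (\<eta> \<omega>) T (\<eta> \<omega>)
       + 4 * tuple_count K T (\<eta> \<omega>) (\<eta> \<omega>) (\<eta> \<omega>) + 256 * of_bool (near v x \<or> near w x))" (is "_ \<le> _ + real ?D")
proof (cases "?D = 0")
  case True
  then have "extended_count K v w x y (\<eta> \<omega>) = Y \<omega> + 8"
    using extended_count_expand[OF K_distinct[OF K] T] eight_le_tuple_count[OF K T] tuple_count_le[OF K T] by simp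
  then have eq: "real (extended_count K v w x y (\<eta> \<omega>)) / 8 = real (Y \<omega>) / 8 + 1" by simp
  show ?thesis unfolding eq by (simp only: le_add_same_cancel1 of_nat_0_le_iff)
next
  case False
  have "stein mean (real (Y \<omega>) / 8 + 1) \<le> 1" by (intro stein_le_1[OF mean_nonneg]) simp
  moreover have "1 \<le> real ?D" using False by linarith
  moreover have "0 \<le> f (extended_count K v w x y (\<eta> \<omega>))"
    using extended_count_expand[OF K_distinct[OF K] T] eight_le_tuple_count[OF K T]
    by (intro stein_nonneg[OF mean_nonneg]) simp
  ultimately show ?thesis by linarith
qed

lemma tuple_count_measurable_TTTS [measurable]:
  "(\<lambda>\<omega>. of_nat (tuple_count K A B C (\<eta> \<omega>)) :: ennreal) \<in> borel_measurable P"
  unfolding tuple_count_def using sum1_measurable by simp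

lemma tuple_count_measurable_TTSS [measurable]:
  "(\<lambda>\<omega>. of_nat (tuple_count K A B (\<eta> \<omega>) (\<eta> \<omega>)) :: ennreal) \<in> borel_measurable P"
  unfolding tuple_count_def of_nat_sum of_nat_of_bool
  by (intro borel_measurable_sum sum2_measurable) (simp add: split_beta')

lemma tuple_count_measurable_TSTS [measurable]:
  "(\<lambda>\<omega>. of_nat (tuple_count K A (\<eta> \<omega>) C (\<eta> \<omega>)) :: ennreal) \<in> borel_measurable P"
proof -
  have "(\<lambda>\<omega>. \<Sum>a\<in>A. \<Sum>b\<in>\<eta> \<omega>. \<Sum>d\<in>\<eta> \<omega>. \<Sum>c\<in>C. k a b c d) \<in> borel_measurable P"
    by (intro borel_measurable_sum sum2_measurable) (simp add: split_beta')
  also have "(\<lambda>\<omega>. \<Sum>a\<in>A. \<Sum>b\<in>\<eta> \<omega>. \<Sum>d\<in>\<eta> \<omega>. \<Sum>c\<in>C. k a b c d)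
      = (\<lambda>\<omega>. \<Sum>a\<in>A. \<Sum>b\<in>\<eta> \<omega>. \<Sum>c\<in>C. \<Sum>d\<in>\<eta> \<omega>. k a b c d)"
    by (intro ext sum.cong refl sum.swap)
  finally show ?thesis unfolding tuple_count_def of_nat_sum of_nat_of_bool .
qed

lemma tuple_count_measurable_TSSS [measurable]:
  assumes "finite T"
  shows "(\<lambda>\<omega>. of_nat (tuple_count K T (\<eta> \<omega>) (\<eta> \<omega>) (\<eta> \<omega>)) :: ennreal) \<in> borel_measurable P"
  unfolding tuple_count_def of_nat_sum of_nat_of_bool
proof (intro borel_measurable_sum measurable_sum_points[OF \<eta>_measurable])
  fix a
  have "(\<lambda>p. \<Sum>c\<in>\<eta> (snd p). \<Sum>d\<in>\<eta> (snd p). k a (fst p) c d) \<in> borel_measurable (borel \<Otimes>\<^sub>M P)"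
  proof (rule measurable_sum_points)
    show "(\<lambda>p. \<eta> (snd p)) \<in> measurable (borel \<Otimes>\<^sub>M P) (configurations W)" by measurable
    have "(\<lambda>q. \<Sum>d\<in>\<eta> (snd (snd q)). k a (fst (snd q)) (fst q) d) \<in> borel_measurable (borel \<Otimes>\<^sub>M borel \<Otimes>\<^sub>M P)"
      by (rule measurable_sum_points[where W = W]) (simp_all add: split_beta')
    then show "(\<lambda>(c, p). \<Sum>d\<in>\<eta> (snd p). k a (fst p) c d) \<in> borel_measurable (borel \<Otimes>\<^sub>M borel \<Otimes>\<^sub>M P)"
      by (simp add: split_beta')
  qed
  then show "(\<lambda>(b, \<omega>). \<Sum>c\<in>\<eta> \<omega>. \<Sum>d\<in>\<eta> \<omega>. k a b c d) \<in> borel_measurable (borel \<Otimes>\<^sub>M P)"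
    by (simp add: split_beta')
qed

text \<open>
  The expectation of the Stein identity at \<open>Y / 8\<close> is \<open>balance\<close> below. By the Mecke formula,
  \<open>A\<close> is the integral over all tuples of the expectation of \<open>f / 8\<close> after insertion of the
  tuple, and \<open>mean * B\<close> is the same integral with exactly eight ordered tuples added. Their
  difference is nonnegative, and at most the error.
\<close>

theorem poisson_approximation:
  "exp (- mean) \<le> prob {\<omega> \<in> space P. Y \<omega> = 0}" (is ?lower)
  "prob {\<omega> \<in> space P. Y \<omega> = 0} \<le> exp (- mean) + error" (is ?upper)
proof -
  let ?s = "\<lambda>\<omega>. stein mean (real (Y \<omega>) / 8 + 1)"
  let ?I = "\<lambda>G. \<integral>\<^sup>+v. \<integral>\<^sup>+w. \<integral>\<^sup>+x. \<integral>\<^sup>+y. G v w x y \<partial>intensity \<partial>intensity \<partial>intensity \<partial>intensity"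
  define p where "p = prob {\<omega> \<in> space P. Y \<omega> = 0}"
  define A where "A = (\<integral>\<^sup>+\<omega>. ennreal (real (Y \<omega>) / 8 * f (Y \<omega>)) \<partial>P)"
  define B where "B = (\<integral>\<^sup>+\<omega>. ennreal (?s \<omega>) \<partial>P)"
  have s0: "0 \<le> ?s \<omega>" "?s \<omega> \<le> 1" for \<omega>
    using stein_nonneg[OF mean_nonneg, of "real (Y \<omega>) / 8 + 1"] stein_le_1[OF mean_nonneg, of "real (Y \<omega>) / 8 + 1"]
    by auto
  have f0: "0 \<le> real j * f j" for j
    using stein_nonneg[OF mean_nonneg, of "real j / 8"] by (cases "j = 0") auto
  have "B \<le> 1"
  proof -
    have "B \<le> (\<integral>\<^sup>+\<omega>. 1 \<partial>P)" unfolding B_def using s0 by (intro nn_integral_mono) auto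
    then show ?thesis by (simp add: emeasure_space_1)
  qed
  then obtain b where b: "B = ennreal b" "0 \<le> b" by (cases B) (auto simp: top_unique)
  have balance: "ennreal p + A = ennreal mean * B + ennreal (exp (- mean))"
  proof -
    have "ennreal p + A = (\<integral>\<^sup>+\<omega>. indicator {\<omega> \<in> space P. Y \<omega> = 0} \<omega> + ennreal (real (Y \<omega>) / 8 * f (Y \<omega>)) \<partial>P)"
      unfolding p_def A_def by (subst nn_integral_add) (auto simp: emeasure_eq_measure)
    also have "\<dots> = (\<integral>\<^sup>+\<omega>. ennreal mean * ennreal (?s \<omega>) + ennreal (exp (- mean)) \<partial>P)"
    proof (rule nn_integral_cong)
      fix \<omega> assume w: "\<omega> \<in> space P"
      have "indicator {\<omega> \<in> space P. Y \<omega> = 0} \<omega> + ennreal (real (Y \<omega>) / 8 * f (Y \<omega>))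
          = ennreal (of_bool (real (Y \<omega>) / 8 = 0) + real (Y \<omega>) / 8 * f (Y \<omega>))"
        using w f0[of "Y \<omega>"] by (subst ennreal_plus) (auto simp: indicator_def)
      also have "\<dots> = ennreal (mean * ?s \<omega> + exp (- mean))"
        by (subst stein_identity[OF mean_nonneg]) auto
      finally show "indicator {\<omega> \<in> space P. Y \<omega> = 0} \<omega> + ennreal (real (Y \<omega>) / 8 * f (Y \<omega>))
        = ennreal mean * ennreal (?s \<omega>) + ennreal (exp (- mean))"
        using s0 mean_nonneg by (simp add: ennreal_mult ennreal_plus)
    qed
    also have "\<dots> = ennreal mean * B + ennreal (exp (- mean))"
      unfolding B_def by (subst nn_integral_add) (auto simp: nn_integral_cmult emeasure_space_1)
    finally show ?thesis .
  qed
  \<comment> \<open>a constant integrand turns into the mean: the factors 8 and 1/8 cancel\<close>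
  have I_const: "?I (\<lambda>v w x y. k v w x y * (ennreal (1/8) * c)) = ennreal mean * c" for c
  proof -
    have "?I (\<lambda>v w x y. k v w x y * (ennreal (1/8) * c)) = k_integral * (ennreal (1/8) * c)"
      unfolding k_integral_def by (simp add: nn_integral_multc intensity_cong)
    also have "\<dots> = (ennreal (8 * mean) * ennreal (1/8)) * c"
      by (simp add: k_integral_eq mult.assoc)
    also have "ennreal (8 * mean) * ennreal (1/8) = ennreal mean"
      using mean_nonneg by (subst ennreal_mult[symmetric]) auto
    finally show ?thesis .
  qed
  define G where "G v w x y = (\<integral>\<^sup>+\<omega>. k v w x y * ennreal (f (extended_count K v w x y (\<eta> \<omega>)) / 8) \<partial>P)" for v w x y
  have A: "A = ?I G"
    unfolding A_def G_def by (rule stein_mecke)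
  have "G v w x y \<le> k v w x y * (ennreal (1/8) * B)" for v w x y
  proof (cases "K v w x y")
    case True
    have "G v w x y \<le> (\<integral>\<^sup>+\<omega>. ennreal (1/8) * ennreal (?s \<omega>) \<partial>P)"
      unfolding G_def using True f_extended_le[OF True]
      by (intro nn_integral_mono) (simp add: ennreal_mult'[symmetric] ennreal_leI divide_right_mono)
    also have "\<dots> = ennreal (1/8) * B"
      unfolding B_def by (rule nn_integral_cmult) measurable
    finally show ?thesis using True by simp
  qed (simp add: G_def)
  then have "A \<le> ?I (\<lambda>v w x y. k v w x y * (ennreal (1/8) * B))"
    unfolding A by (intro nn_integral_mono)
  then have AB: "A \<le> ennreal mean * B" unfolding I_const .
  define c where "c = 256 * \<alpha> + 32 * \<alpha> * \<beta> + 64 * \<alpha> * \<alpha> + 16 * \<alpha> * \<alpha> * \<beta>"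
  have c0: "0 \<le> c" unfolding c_def using \<alpha>_nonneg \<beta>_nonneg by simp
  \<comment> \<open>the number 32 is one eighth of 256\<close>
  have "k v w x y * (ennreal (1/8) * B) \<le> G v w x y + (k v w x y * (ennreal (1/8) * ennreal c)
      + ennreal 32 * (k v w x y * of_bool (near v x \<or> near w x)))" for v w x y
  proof (cases "K v w x y")
    case True
    define T where "T = {v, w, x, y}"
    have T: "finite T" "card T = 4" using K_distinct[OF True] by (auto simp: T_def)
    let ?D1 = "\<lambda>\<omega>. of_nat (tuple_count K T T T (\<eta> \<omega>)) :: ennreal"
    let ?D2 = "\<lambda>\<omega>. of_nat (tuple_count K T T (\<eta> \<omega>) (\<eta> \<omega>)) :: ennreal"
    let ?D3 = "\<lambda>\<omega>. of_nat (tuple_count K T (\<eta> \<omega>) T (\<eta> \<omega>)) :: ennreal"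
    let ?D4 = "\<lambda>\<omega>. of_nat (tuple_count K T (\<eta> \<omega>) (\<eta> \<omega>) (\<eta> \<omega>)) :: ennreal"
    let ?b = "of_bool (near v x \<or> near w x) :: ennreal"
    let ?f = "\<lambda>\<omega>. ennreal (f (extended_count K v w x y (\<eta> \<omega>)))"
    have "B \<le> (\<integral>\<^sup>+\<omega>. ?f \<omega> + (4 * ?D1 \<omega> + (2 * ?D2 \<omega> + (4 * ?D3 \<omega> + (4 * ?D4 \<omega> + 256 * ?b)))) \<partial>P)"
      unfolding B_def
    proof (rule nn_integral_mono)
      fix \<omega>
      have f: "0 \<le> f (extended_count K v w x y (\<eta> \<omega>))"
        using extended_count_expand[OF K_distinct[OF True] T_def] eight_le_tuple_count[OF True T_def]
        by (intro stein_nonneg[OF mean_nonneg]) simp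
      have "ennreal (?s \<omega>) \<le> ennreal (f (extended_count K v w x y (\<eta> \<omega>))
    + real (4 * tuple_count K T T T (\<eta> \<omega>) + 2 * tuple_count K T T (\<eta> \<omega>) (\<eta> \<omega>) + 4 * tuple_count K T (\<eta> \<omega>) T (\<eta> \<omega>)
       + 4 * tuple_count K T (\<eta> \<omega>) (\<eta> \<omega>) (\<eta> \<omega>) + 256 * of_bool (near v x \<or> near w x)))"
        by (rule ennreal_leI[OF f_extended_ge[OF True T_def]])
      also have "\<dots> = ?f \<omega> + of_nat (4 * tuple_count K T T T (\<eta> \<omega>) + 2 * tuple_count K T T (\<eta> \<omega>) (\<eta> \<omega>) + 4 * tuple_count K T (\<eta> \<omega>) T (\<eta> \<omega>)
       + 4 * tuple_count K T (\<eta> \<omega>) (\<eta> \<omega>) (\<eta> \<omega>) + 256 * of_bool (near v x \<or> near w x))"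
        using f by (simp only: ennreal_plus ennreal_of_nat_eq_real_of_nat[symmetric] of_nat_0_le_iff)
      finally show "ennreal (?s \<omega>) \<le> ?f \<omega> + (4 * ?D1 \<omega> + (2 * ?D2 \<omega> + (4 * ?D3 \<omega> + (4 * ?D4 \<omega> + 256 * ?b))))"
        by (simp only: of_nat_add of_nat_mult of_nat_numeral of_nat_of_bool add.assoc)
    qed
    also have "\<dots> = (\<integral>\<^sup>+\<omega>. ?f \<omega> \<partial>P) + (4 * (\<integral>\<^sup>+\<omega>. ?D1 \<omega> \<partial>P) + (2 * (\<integral>\<^sup>+\<omega>. ?D2 \<omega> \<partial>P)
        + (4 * (\<integral>\<^sup>+\<omega>. ?D3 \<omega> \<partial>P) + (4 * (\<integral>\<^sup>+\<omega>. ?D4 \<omega> \<partial>P) + 256 * ?b))))"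
      using tuple_count_measurable_TSSS[OF T(1)]
      by (simp add: nn_integral_add nn_integral_cmult emeasure_space_1)
    also have "\<dots> \<le> (\<integral>\<^sup>+\<omega>. ?f \<omega> \<partial>P) + (4 * ennreal (64 * \<alpha>) + (2 * ennreal (16 * (\<alpha> * \<beta>))
        + (4 * ennreal (16 * (\<alpha> * \<alpha>)) + (4 * ennreal (4 * (\<alpha> * \<alpha> * \<beta>)) + 256 * ?b))))"
      by (intro add_mono mult_left_mono order_refl expectation_TTTS[OF T] expectation_TTSS[OF T]
          expectation_TSTS[OF T] expectation_TSSS[OF T]) simp_all
    also have "\<dots> = (\<integral>\<^sup>+\<omega>. ?f \<omega> \<partial>P) + (ennreal c + ennreal 256 * ?b)"
    proof -
      have "ennreal c = 4 * ennreal (64 * \<alpha>) + 2 * ennreal (16 * (\<alpha> * \<beta>))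
        + 4 * ennreal (16 * (\<alpha> * \<alpha>)) + 4 * ennreal (4 * (\<alpha> * \<alpha> * \<beta>))"
        unfolding c_def ennreal_numeral[symmetric] using \<alpha>_nonneg \<beta>_nonneg
        by (simp add: ennreal_mult[symmetric] ennreal_plus[symmetric] mult_ac del: ennreal_plus ennreal_numeral)
      then show ?thesis by (simp add: add_ac)
    qed
    finally have "ennreal (1/8) * B \<le> ennreal (1/8) * ((\<integral>\<^sup>+\<omega>. ?f \<omega> \<partial>P) + (ennreal c + ennreal 256 * ?b))"
      by (rule mult_left_mono) simp
    also have "\<dots> = (\<integral>\<^sup>+\<omega>. ennreal (1/8) * ?f \<omega> \<partial>P) + (ennreal (1/8) * ennreal c + (ennreal (1/8) * ennreal 256) * ?b)"
      by (simp only: distrib_left mult.assoc) (subst nn_integral_cmult, measurable)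
    also have "ennreal (1/8) * ennreal 256 = ennreal 32"
      by (subst ennreal_mult[symmetric]) simp_all
    also have "(\<integral>\<^sup>+\<omega>. ennreal (1/8) * ?f \<omega> \<partial>P) = G v w x y"
      unfolding G_def using True by (simp add: ennreal_mult'[symmetric])
    finally show ?thesis using True by simp
  qed simp
  then have "ennreal mean * B \<le> ?I (\<lambda>v w x y. G v w x y + (k v w x y * (ennreal (1/8) * ennreal c)
      + ennreal 32 * (k v w x y * of_bool (near v x \<or> near w x))))"
    unfolding I_const[symmetric] by (intro nn_integral_mono)
  also have "\<dots> = ?I G + (?I (\<lambda>v w x y. k v w x y * (ennreal (1/8) * ennreal c))
      + ennreal 32 * ?I (\<lambda>v w x y. k v w x y * of_bool (near v x \<or> near w x)))"
  proof -
    have Gm: "(\<lambda>(v, w, x, y). G v w x y) \<in> borel_measurable (borel \<Otimes>\<^sub>M borel \<Otimes>\<^sub>M borel \<Otimes>\<^sub>M borel)"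
    proof -
      let ?B = "borel :: 'a measure"
      let ?M = "(?B \<Otimes>\<^sub>M ?B \<Otimes>\<^sub>M ?B \<Otimes>\<^sub>M ?B) \<Otimes>\<^sub>M P"
      have [measurable]: "(\<lambda>q. extended_count K (fst (fst q)) (fst (snd (fst q))) (fst (snd (snd (fst q))))
          (snd (snd (snd (fst q)))) (\<eta> (snd q))) \<in> measurable ?M (count_space UNIV)"
        by (rule measurable_extended_count[OF K_pred, where W = W]) measurable
      show ?thesis unfolding G_def split_beta' by measurable
    qed
    have [measurable]: "(\<lambda>z. of_bool (near (v z) (x z) \<or> near (w z) (x z)) :: ennreal) \<in> borel_measurable M"
      if [measurable]: "v \<in> borel_measurable M" "x \<in> borel_measurable M" "w \<in> borel_measurable M" for v w x M
    proof -
      have "(\<lambda>z. max (n (v z) (x z)) (n (w z) (x z))) \<in> borel_measurable M" by measurable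
      also have "(\<lambda>z. max (n (v z) (x z)) (n (w z) (x z))) = (\<lambda>z. of_bool (near (v z) (x z) \<or> near (w z) (x z)))"
        by (auto simp: fun_eq_iff)
      finally show ?thesis .
    qed
    have m32: "?I (\<lambda>v w x y. ennreal 32 * (k v w x y * of_bool (near v x \<or> near w x)))
      = ennreal 32 * ?I (\<lambda>v w x y. k v w x y * of_bool (near v x \<or> near w x))"
      by (simp add: nn_integral_cmult intensity_cong)
    let ?B = "borel :: 'a measure"
    have a1: "(\<lambda>(v, w, x, y). k v w x y * (ennreal (1/8) * ennreal c))
        \<in> borel_measurable (?B \<Otimes>\<^sub>M ?B \<Otimes>\<^sub>M ?B \<Otimes>\<^sub>M ?B)"
      unfolding split_beta' by measurable
    have a2: "(\<lambda>(v, w, x, y). ennreal 32 * (k v w x y * of_bool (near v x \<or> near w x)))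
        \<in> borel_measurable (?B \<Otimes>\<^sub>M ?B \<Otimes>\<^sub>M ?B \<Otimes>\<^sub>M ?B)"
      unfolding split_beta' by measurable
    have a3: "(\<lambda>(v, w, x, y). k v w x y * (ennreal (1/8) * ennreal c)
          + ennreal 32 * (k v w x y * of_bool (near v x \<or> near w x)))
        \<in> borel_measurable (?B \<Otimes>\<^sub>M ?B \<Otimes>\<^sub>M ?B \<Otimes>\<^sub>M ?B)"
      unfolding split_beta' by measurable
    show ?thesis unfolding m32[symmetric] nn_integral_add_4[OF Gm a3] nn_integral_add_4[OF a1 a2] ..
  qed
  also have "\<dots> \<le> A + (ennreal mean * ennreal c + ennreal 32 * (ennreal (2 * \<alpha> ^ 3) * emeasure intensity UNIV))"
    unfolding I_const A by (intro add_mono order_refl mult_left_mono near_integral) simp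
  also have "\<dots> = A + ennreal error"
  proof -
    have 1: "ennreal mean * ennreal c = ennreal (mean * c)"
      using mean_nonneg c0 by (simp only: ennreal_mult)
    have 2: "ennreal 32 * (ennreal (2 * \<alpha> ^ 3) * emeasure intensity UNIV)
        = ennreal (32 * (2 * \<alpha> ^ 3 * measure intensity UNIV))"
      using \<alpha>_nonneg by (simp only: intensity.emeasure_eq_measure ennreal_mult[symmetric] measure_nonneg
          zero_le_power mult_nonneg_nonneg zero_le_numeral)
    have "error = mean * c + 32 * (2 * \<alpha> ^ 3 * measure intensity UNIV)"
      by (simp add: approximation_error_def c_def)
    then show ?thesis unfolding 1 2
      using mean_nonneg c0 \<alpha>_nonneg by (simp only: ennreal_plus mult_nonneg_nonneg measure_nonneg
          zero_le_power zero_le_numeral)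
  qed
  finally have BA: "ennreal mean * B \<le> A + ennreal error" .
  obtain a where a: "A = ennreal a" "0 \<le> a"
    using AB b mean_nonneg by (cases A) (auto simp: ennreal_mult'[symmetric] top_unique)
  have e0: "0 \<le> error" unfolding approximation_error_def using mean_nonneg \<alpha>_nonneg \<beta>_nonneg by simp
  have p0: "0 \<le> p" by (simp add: p_def)
  have "p + a = mean * b + exp (- mean)"
    using balance a b mean_nonneg p0
    by (simp add: ennreal_mult[symmetric] ennreal_plus[symmetric] del: ennreal_plus)
  moreover have "a \<le> mean * b"
    using AB a b mean_nonneg by (simp add: ennreal_mult[symmetric])
  moreover have "mean * b \<le> a + error"
    using BA a b mean_nonneg e0 by (simp add: ennreal_mult[symmetric] ennreal_plus[symmetric] del: ennreal_plus)
  ultimately show ?lower ?upper unfolding p_def by linarith+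
qed

end

section \<open>Linear changes of variables\<close>

text \<open>
  The uniqueness argument for Haar measure. In the double integral of
  \<open>indicator A x * indicator B (x + y)\<close> over \<open>\<mu>\<close> and Lebesgue measure, integrating over \<open>y\<close>
  first gives one side. Shifting \<open>x\<close> by \<open>- y\<close> before that gives the other one.
\<close>

lemma translation_invariant_proportional:
  fixes \<mu> :: "'a::euclidean_space measure"
  assumes \<mu>: "sigma_finite_measure \<mu>" "sets \<mu> = sets borel"
    and shift: "\<And>y. distr \<mu> borel (\<lambda>x. x + y) = \<mu>"
    and A: "A \<in> sets borel" and B: "B \<in> sets borel"
  shows "emeasure \<mu> A * emeasure lborel B = emeasure \<mu> B * emeasure lborel A"
proof -
  interpret \<mu>: sigma_finite_measure \<mu> by fact
  interpret pair: pair_sigma_finite \<mu> lborel ..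
  have [measurable_cong]: "sets \<mu> = sets borel" by fact
  note [measurable] = A B
  have lborel_shift: "(\<integral>\<^sup>+y. g (c + y) \<partial>lborel) = (\<integral>\<^sup>+y. g y \<partial>lborel)"
    if "g \<in> borel_measurable borel" for g :: "'a \<Rightarrow> ennreal" and c
    using that by (subst (2) lborel_distr_plus[of c, symmetric]) (simp add: nn_integral_distr)
  have lborel_reflect: "(\<integral>\<^sup>+y. g (c - y) \<partial>lborel) = (\<integral>\<^sup>+y. g y \<partial>lborel)"
    if "g \<in> borel_measurable borel" for g :: "'a \<Rightarrow> ennreal" and c
    using that by (subst (2) lborel_affine[of "-1" c]) (simp_all add: nn_integral_density nn_integral_distr)
  have \<mu>_shift: "(\<integral>\<^sup>+x. g x \<partial>\<mu>) = (\<integral>\<^sup>+x. g (x + c) \<partial>\<mu>)"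
    if "g \<in> borel_measurable borel" for g :: "'a \<Rightarrow> ennreal" and c
    using that by (subst (1) shift[of c, symmetric], subst nn_integral_distr) (auto simp: \<mu>(2))
  have "emeasure \<mu> A * emeasure lborel B = (\<integral>\<^sup>+x. indicator A x * (\<integral>\<^sup>+y. indicator B y \<partial>lborel) \<partial>\<mu>)"
    by (simp add: nn_integral_multc \<mu>(2))
  also have "\<dots> = (\<integral>\<^sup>+x. \<integral>\<^sup>+y. indicator A x * indicator B (x + y) \<partial>lborel \<partial>\<mu>)"
  proof (rule nn_integral_cong)
    fix x
    have "(\<integral>\<^sup>+y. indicator B y \<partial>lborel) = (\<integral>\<^sup>+y. indicator B (x + y) \<partial>lborel)"
      by (rule lborel_shift[symmetric]) measurable
    then show "indicator A x * (\<integral>\<^sup>+y. indicator B y \<partial>lborel)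
        = (\<integral>\<^sup>+y. indicator A x * indicator B (x + y) \<partial>lborel)"
      by (subst nn_integral_cmult) auto
  qed
  also have "\<dots> = (\<integral>\<^sup>+y. \<integral>\<^sup>+x. indicator A x * indicator B (x + y) \<partial>\<mu> \<partial>lborel)"
    by (rule pair.Fubini'[symmetric]) measurable
  also have "\<dots> = (\<integral>\<^sup>+y. \<integral>\<^sup>+x. indicator A (x - y) * indicator B x \<partial>\<mu> \<partial>lborel)"
  proof (rule nn_integral_cong)
    fix y
    show "(\<integral>\<^sup>+x. indicator A x * indicator B (x + y) \<partial>\<mu>) = (\<integral>\<^sup>+x. indicator A (x - y) * indicator B x \<partial>\<mu>)"
      by (subst (2) \<mu>_shift[of _ y]) (auto intro!: nn_integral_cong)
  qed
  also have "\<dots> = (\<integral>\<^sup>+x. \<integral>\<^sup>+y. indicator A (x - y) * indicator B x \<partial>lborel \<partial>\<mu>)"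
    by (rule pair.Fubini') measurable
  also have "\<dots> = (\<integral>\<^sup>+x. emeasure lborel A * indicator B x \<partial>\<mu>)"
  proof (rule nn_integral_cong)
    fix x
    have "(\<integral>\<^sup>+y. indicator A (x - y) \<partial>lborel) = emeasure lborel A"
      by (subst lborel_reflect) auto
    then show "(\<integral>\<^sup>+y. indicator A (x - y) * indicator B x \<partial>lborel) = emeasure lborel A * indicator B x"
      by (subst nn_integral_multc) auto
  qed
  also have "\<dots> = emeasure lborel A * emeasure \<mu> B"
    by (simp add: nn_integral_cmult_indicator \<mu>(2))
  finally show ?thesis by (simp add: mult.commute)
qed

text \<open>
  The image of Lebesgue measure is again translation invariant, hence a multiple of it. The
  factor is left unspecified: in the applications it either cancels or multiplies zero.
\<close>

lemma linear_change_of_variables: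
  fixes A :: "'a::euclidean_space \<Rightarrow> 'a"
  assumes A: "linear A" "bij A"
  obtains c :: ennreal where
    "\<And>f. f \<in> borel_measurable borel \<Longrightarrow> (\<integral>\<^sup>+x. f (A x) \<partial>lborel) = c * (\<integral>\<^sup>+x. f x \<partial>lborel)"
proof -
  define \<mu> where "\<mu> = distr lborel borel A"
  let ?U = "box 0 One :: 'a set"
  have Am [measurable]: "A \<in> borel_measurable borel"
    using A(1) by (simp add: borel_measurable_continuous_onI linear_continuous_on linear_conv_bounded_linear)
  have Ainv: "linear (inv A)" using A by (simp add: bij_def inj_linear_imp_inv_linear)
  have sets: "sets \<mu> = sets borel" by (simp add: \<mu>_def)
  have U: "emeasure lborel ?U = 1" by simp
  have sf: "sigma_finite_measure \<mu>"
  proof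
    have "emeasure \<mu> (ball 0 (real n)) \<noteq> \<infinity>" for n
    proof -
      have "A -` ball 0 (real n) = inv A ` ball 0 (real n)"
        using A(2) by (simp add: bij_vimage_eq_inv_image)
      moreover have "bounded (inv A ` ball 0 (real n))"
        using Ainv by (intro bounded_linear_image) (auto simp: linear_conv_bounded_linear)
      ultimately show ?thesis unfolding \<mu>_def
        by (subst emeasure_distr) (auto dest: emeasure_bounded_finite)
    qed
    moreover have "(\<Union>n. ball (0::'a) (real n)) = UNIV"
      by (auto simp: dist_norm) (use reals_Archimedean2 in blast)
    ultimately show "\<exists>S. countable S \<and> S \<subseteq> sets \<mu> \<and> \<Union> S = space \<mu> \<and> (\<forall>a\<in>S. emeasure \<mu> a \<noteq> \<infinity>)"
      by (intro exI[of _ "range (\<lambda>n::nat. ball 0 (real n))"]) (auto simp: sets \<mu>_def)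
  qed
  have shift: "distr \<mu> borel (\<lambda>x. x + y) = \<mu>" for y
  proof -
    have "distr \<mu> borel (\<lambda>x. x + y) = distr lborel borel (\<lambda>x. A x + y)"
      unfolding \<mu>_def by (subst distr_distr) (auto simp: comp_def)
    also have "(\<lambda>x. A x + y) = A \<circ> (\<lambda>x. inv A y + x)"
      using A by (auto simp: fun_eq_iff linear_add bij_is_surj surj_f_inv_f)
    also have "distr lborel borel (A \<circ> (\<lambda>x. inv A y + x)) = distr (distr lborel borel (\<lambda>x. inv A y + x)) borel A"
      by (subst distr_distr) auto
    also have "\<dots> = \<mu>" unfolding \<mu>_def by (simp add: lborel_distr_plus)
    finally show ?thesis .
  qed
  define c where "c = emeasure \<mu> ?U"
  have \<mu>_eq: "\<mu> = scale_measure c lborel"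
  proof (rule measure_eqI)
    fix B assume "B \<in> sets \<mu>"
    then have B: "B \<in> sets borel" by (simp add: sets)
    have "emeasure \<mu> ?U * emeasure lborel B = emeasure \<mu> B * emeasure lborel ?U"
      using B by (intro translation_invariant_proportional sf sets shift) auto
    then show "emeasure \<mu> B = emeasure (scale_measure c lborel) B" by (simp add: c_def U)
  qed (simp add: sets)
  have "(\<integral>\<^sup>+x. f (A x) \<partial>lborel) = c * (\<integral>\<^sup>+x. f x \<partial>lborel)" if "f \<in> borel_measurable borel" for f
  proof -
    have "(\<integral>\<^sup>+x. f (A x) \<partial>lborel) = (\<integral>\<^sup>+x. f x \<partial>\<mu>)"
      unfolding \<mu>_def using that by (subst nn_integral_distr) auto
    then show ?thesis using that by (simp add: \<mu>_eq nn_integral_scale_measure)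
  qed
  then show ?thesis by (rule that)
qed

text \<open>
  The natural coordinates for the displacement between two crossing segments of length \<open>r\<close>:
  it is of order \<open>r\<close> in the directions of \<open>L\<close>, where the projections have to meet, and
  unrestricted in the orthogonal directions.
\<close>

definition squeeze :: "'a::euclidean_space set \<Rightarrow> real \<Rightarrow> 'a \<Rightarrow> 'a" where
  "squeeze L r u = r *\<^sub>R orth_proj L u + (u - orth_proj L u)"

text \<open>
  A linear map that takes a basis of \<open>L\<close> and one of its orthogonal complement to coordinate
  vectors.
\<close>

lemma adapted_basis:
  fixes L :: "'a::euclidean_space set"
  assumes L: "subspace L"
  obtains A :: "'a \<Rightarrow> 'a" and E where "linear A" "bij A" "E \<subseteq> Basis" "card E = dim L"
    "\<And>b. A b \<in> E \<Longrightarrow> b \<in> L" "\<And>b. A b \<in> Basis - E \<Longrightarrow> (\<forall>z\<in>L. orthogonal b z)"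
proof -
  define L' where "L' = {y. \<forall>z\<in>L. orthogonal z y}"
  have L': "subspace L'" unfolding L'_def by (rule subspace_orthogonal_to_vectors)
  obtain B1 where B1: "B1 \<subseteq> L" "independent B1" "L \<subseteq> span B1" "card B1 = dim L" "finite B1"
    by (metis basis_exists independent_imp_finite)
  obtain B2 where B2: "B2 \<subseteq> L'" "independent B2" "L' \<subseteq> span B2" "card B2 = dim L'" "finite B2"
    by (metis basis_exists independent_imp_finite)
  have dims: "dim L' + dim L = DIM('a)"
    using dim_subspace_orthogonal_to_vectors[of L UNIV] L by (simp add: L'_def)
  have disj: "B1 \<inter> B2 = {}"
  proof (rule ccontr)
    assume "B1 \<inter> B2 \<noteq> {}"
    then obtain b where b: "b \<in> B1" "b \<in> B2" by auto
    then have "orthogonal b b" using B1(1) B2(1) by (auto simp: L'_def)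
    then have "b = 0" by (simp add: orthogonal_def)
    then show False using b B1(2) dependent_zero by blast
  qed
  let ?B = "B1 \<union> B2"
  have span: "span ?B = UNIV"
  proof -
    have "x \<in> span ?B" for x
    proof -
      have "orth_proj L x \<in> span ?B"
        using orth_proj_in[OF L] B1(3) span_mono[of B1 ?B] by blast
      moreover have "x - orth_proj L x \<in> L'"
        using orth_proj_orthogonal[OF L] by (auto simp: L'_def orthogonal_commute)
      then have "x - orth_proj L x \<in> span ?B"
        using B2(3) span_mono[of B2 ?B] by blast
      ultimately show ?thesis using span_add by fastforce
    qed
    then show ?thesis by auto
  qed
  have card: "card ?B = DIM('a)"
    using B1 B2 disj dims by (simp add: card_Un_disjoint)
  have ind: "independent ?B"
    using span card B1(5) B2(5) by (intro card_le_dim_spanning[of _ UNIV]) auto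
  obtain \<phi> :: "'a \<Rightarrow> 'a" where \<phi>: "bij_betw \<phi> ?B Basis"
    using finite_same_card_bij[of ?B "Basis :: 'a set"] card B1(5) B2(5) by auto
  obtain A where A: "linear A" "\<And>b. b \<in> ?B \<Longrightarrow> A b = \<phi> b"
    using linear_independent_extend[OF ind, of \<phi>] by blast
  have "surj A"
  proof -
    have "span (A ` ?B) = range A" using linear_span_image[OF A(1), of ?B] span by simp
    moreover have "A ` ?B = Basis" using A(2) \<phi> by (auto simp: bij_betw_def)
    ultimately show ?thesis by simp
  qed
  then have bij: "bij A" using linear_surjective_imp_injective[OF A(1)] by (simp add: bij_def)
  have inB: "b \<in> ?B" if b: "A b \<in> Basis" for b
  proof -
    have "A b \<in> \<phi> ` ?B" using b bij_betw_imp_surj_on[OF \<phi>] by simp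
    then obtain b' where b': "b' \<in> ?B" "A b = \<phi> b'" by (rule imageE)
    then have "A b = A b'" using A(2) by simp
    then have "b = b'" using bij by (simp add: bij_def inj_eq)
    then show ?thesis using b' by simp
  qed
  show ?thesis
  proof
    show "linear A" "bij A" by fact+
    show "\<phi> ` B1 \<subseteq> Basis" using \<phi> by (auto simp: bij_betw_def)
    show "card (\<phi> ` B1) = dim L" using \<phi> B1(4)
      by (subst card_image) (auto simp: bij_betw_def inj_on_Un)
    show "b \<in> L" if "A b \<in> \<phi> ` B1" for b
    proof -
      obtain b1 where b1: "b1 \<in> B1" "A b = \<phi> b1" using \<open>A b \<in> \<phi> ` B1\<close> by (rule imageE)
      then have "A b = A b1" using A(2) by simp
      with b1(1) show ?thesis using bij B1(1) by (auto simp: bij_def inj_eq)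
    qed
    show "\<forall>z\<in>L. orthogonal b z" if "A b \<in> Basis - \<phi> ` B1" for b
    proof -
      have "b \<in> ?B" using inB that by blast
      then have "b \<in> B2" using that A(2) by auto
      then show ?thesis using B2(1) by (auto simp: L'_def orthogonal_commute)
    qed
  qed
qed

lemma linear_orth_proj: "subspace L \<Longrightarrow> linear (orth_proj L)"
  using bounded_linear_orth_proj bounded_linear.linear by blast

lemma orth_proj_id: "subspace L \<Longrightarrow> x \<in> L \<Longrightarrow> orth_proj L x = x"
  by (rule orth_proj_unique) (auto simp: orthogonal_def)

lemma orth_proj_0: "subspace L \<Longrightarrow> (\<forall>z\<in>L. orthogonal x z) \<Longrightarrow> orth_proj L x = 0"
  by (rule orth_proj_unique) (auto simp: subspace_0)

lemma linear_squeeze: "subspace L \<Longrightarrow> linear (squeeze L r)"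
  unfolding squeeze_def using linear_orth_proj[of L]
  by (intro linear_compose_add linear_compose_sub linear_compose_scale_right linear_id[unfolded id_def]) 

text \<open>
  In adapted coordinates \<open>squeeze L r\<close> is diagonal, with \<open>dim L\<close> entries \<open>r\<close>. The factor of
  the change to these coordinates cancels on the way back.
\<close>

lemma nn_integral_squeeze:
  fixes L :: "'a::euclidean_space set"
  assumes L: "subspace L" and r: "r > 0" and f: "f \<in> borel_measurable borel"
  shows "(\<integral>\<^sup>+x. f x \<partial>lborel) = ennreal (r ^ dim L) * (\<integral>\<^sup>+x. f (squeeze L r x) \<partial>lborel)"
proof -
  obtain A :: "'a \<Rightarrow> 'a" and E where A: "linear A" "bij A" and E: "E \<subseteq> Basis" "card E = dim L"
    and AE: "\<And>b. A b \<in> E \<Longrightarrow> b \<in> L" "\<And>b. A b \<in> Basis - E \<Longrightarrow> (\<forall>z\<in>L. orthogonal b z)"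
    using adapted_basis[OF L] by metis
  obtain c where c: "\<And>f. f \<in> borel_measurable borel \<Longrightarrow> (\<integral>\<^sup>+x. f (A x) \<partial>lborel) = c * (\<integral>\<^sup>+x. f x \<partial>lborel)"
    using linear_change_of_variables[OF A] by metis
  define s where "s j = (if j \<in> E then r else 1)" for j
  define \<Delta> where "\<Delta> x = (\<Sum>j\<in>Basis. (s j * (x \<bullet> j)) *\<^sub>R j)" for x :: 'a
  have lin\<Delta>: "linear \<Delta>"
    unfolding \<Delta>_def by (intro linearI) (simp_all add: algebra_simps sum.distrib scaleR_sum_right)
  have \<Delta>b: "\<Delta> j = s j *\<^sub>R j" if "j \<in> Basis" for j
    using that unfolding \<Delta>_def by (subst sum.remove[of _ j]) (auto simp: inner_Basis intro!: sum.neutral split: if_splits)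
  have Ainv: "linear (inv A)" using A by (simp add: bij_def inj_linear_imp_inv_linear)
  have [measurable]: "inv A \<in> borel_measurable borel" "\<Delta> \<in> borel_measurable borel" "A \<in> borel_measurable borel"
    using Ainv lin\<Delta> A(1)
    by (simp_all add: borel_measurable_continuous_onI linear_continuous_on linear_conv_bounded_linear)
  note [measurable] = f
  have conj: "squeeze L r x = inv A (\<Delta> (A x))" for x
  proof -
    have "squeeze L r (inv A j) = inv A (\<Delta> j)" if j: "j \<in> Basis" for j
    proof (cases "j \<in> E")
      case True
      then have "inv A j \<in> L" using AE(1)[of "inv A j"] A(2) by (simp add: bij_is_surj surj_f_inv_f)
      then show ?thesis using True j L Ainv
        by (simp add: squeeze_def orth_proj_id \<Delta>b s_def linear_scale)
    next
      case False
      then have "\<forall>z\<in>L. orthogonal (inv A j) z"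
        using AE(2)[of "inv A j"] A(2) j by (simp add: bij_is_surj surj_f_inv_f)
      then have "orth_proj L (inv A j) = 0" by (rule orth_proj_0[OF L])
      then show ?thesis using False j by (simp add: squeeze_def \<Delta>b s_def)
    qed
    then have "(\<lambda>y. squeeze L r (inv A y)) = (\<lambda>y. inv A (\<Delta> y))"
      using linear_compose[OF Ainv linear_squeeze[OF L, of r]] linear_compose[OF lin\<Delta> Ainv]
      by (intro linear_eq_stdbasis) (auto simp: o_def)
    from fun_cong[OF this, of "A x"] show ?thesis using A(2) by (simp add: bij_is_inj)
  qed
  have \<Delta>: "(\<integral>\<^sup>+y. g y \<partial>lborel) = ennreal (r ^ dim L) * (\<integral>\<^sup>+y. g (\<Delta> y) \<partial>lborel)"
    if "g \<in> borel_measurable borel" for g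
  proof -
    have prod: "(\<Prod>j\<in>Basis. \<bar>s j\<bar>) = r ^ dim L"
      using r E by (simp add: s_def if_distrib prod.If_cases Int_absorb1 cong: if_cong)
    have "lborel = density (distr lborel borel \<Delta>) (\<lambda>_. \<Prod>j\<in>Basis. \<bar>s j\<bar>)"
      using lborel_affine_euclidean[of s 0] r by (simp add: \<Delta>_def[abs_def] s_def)
    then have "(\<integral>\<^sup>+y. g y \<partial>lborel) = (\<integral>\<^sup>+y. g y \<partial>density (distr lborel borel \<Delta>) (\<lambda>_. \<Prod>j\<in>Basis. \<bar>s j\<bar>))"
      by simp
    also have "\<dots> = ennreal (r ^ dim L) * (\<integral>\<^sup>+y. g (\<Delta> y) \<partial>lborel)"
      unfolding prod using that
      by (subst nn_integral_density, simp, simp, subst nn_integral_cmult, simp, subst nn_integral_distr) auto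
    finally show ?thesis .
  qed
  have "(\<integral>\<^sup>+x. f x \<partial>lborel) = (\<integral>\<^sup>+x. (f \<circ> inv A) (A x) \<partial>lborel)"
    using A(2) by (simp add: bij_is_inj)
  also have "\<dots> = c * (\<integral>\<^sup>+y. (f \<circ> inv A) y \<partial>lborel)" by (rule c) (simp add: o_def)
  also have "\<dots> = c * (ennreal (r ^ dim L) * (\<integral>\<^sup>+y. (f \<circ> inv A) (\<Delta> y) \<partial>lborel))"
    by (subst \<Delta>) (simp_all add: o_def)
  also have "\<dots> = ennreal (r ^ dim L) * (c * (\<integral>\<^sup>+y. (f \<circ> inv A \<circ> \<Delta>) y \<partial>lborel))"
    by (simp add: mult_ac)
  also have "c * (\<integral>\<^sup>+y. (f \<circ> inv A \<circ> \<Delta>) y \<partial>lborel) = (\<integral>\<^sup>+x. (f \<circ> inv A \<circ> \<Delta>) (A x) \<partial>lborel)"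
    by (rule c[symmetric]) (simp add: o_def)
  finally show ?thesis by (simp add: conj)
qed

section \<open>Crossings of projected segments\<close>

lemma norm_orth_proj_le: assumes "subspace L" shows "norm (orth_proj L x) \<le> norm x"
proof -
  have "orthogonal (x - orth_proj L x) (orth_proj L x)"
    by (rule orth_proj_orthogonal[OF assms orth_proj_in[OF assms]])
  then have "x \<bullet> orth_proj L x = orth_proj L x \<bullet> orth_proj L x"
    by (simp add: orthogonal_def inner_diff_left)
  then have "norm (orth_proj L x) * norm (orth_proj L x) \<le> norm x * norm (orth_proj L x)"
    using norm_cauchy_schwarz[of x "orth_proj L x"] by (simp add: dot_square_norm power2_eq_square)
  then show ?thesis using norm_ge_zero mult_right_le_imp_le by (cases "orth_proj L x = 0") fastforce+
qed

lemma norm_orth_rest_le: assumes "subspace L" shows "norm (x - orth_proj L x) \<le> norm x"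
proof -
  let ?z = "x - orth_proj L x"
  have "orthogonal ?z (orth_proj L x)"
    by (rule orth_proj_orthogonal[OF assms orth_proj_in[OF assms]])
  then have "x \<bullet> ?z = ?z \<bullet> ?z"
    by (simp add: orthogonal_def inner_diff_left inner_diff_right inner_commute)
  then have "norm ?z * norm ?z \<le> norm x * norm ?z"
    using norm_cauchy_schwarz[of x ?z] by (simp add: dot_square_norm power2_eq_square)
  then show ?thesis using norm_ge_zero mult_right_le_imp_le by (cases "?z = 0") fastforce+
qed

context
  fixes L :: "'a::euclidean_space set" assumes L: "subspace L"
begin

lemma orth_proj_simps:
  "orth_proj L (x + y) = orth_proj L x + orth_proj L y"
  "orth_proj L (x - y) = orth_proj L x - orth_proj L y"
  "orth_proj L (c *\<^sub>R x) = c *\<^sub>R orth_proj L x"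
  "orth_proj L 0 = 0"
  using linear_orth_proj[OF L] by (simp_all add: linear_add linear_diff linear_scale linear_0)

lemma orth_proj_squeeze: "orth_proj L (squeeze L r u) = r *\<^sub>R orth_proj L u"
  by (simp add: squeeze_def orth_proj_simps orth_proj_id[OF L orth_proj_in[OF L]])

lemma squeeze_rest: "squeeze L r u - orth_proj L (squeeze L r u) = u - orth_proj L u"
  unfolding orth_proj_squeeze by (simp add: squeeze_def)

lemma crossing_pair_iff:
  "crossing_pair r L v w x y \<longleftrightarrow> norm (v - w) \<le> r \<and> norm (x - y) \<le> r \<and>
    (\<exists>s\<in>{0..1}. \<exists>t\<in>{0..1}. orth_proj L ((v + s *\<^sub>R (w - v)) - (x + t *\<^sub>R (y - x))) = 0)"
proof -
  have "orth_proj L ` closed_segment v w \<inter> orth_proj L ` closed_segment x y \<noteq> {} \<longleftrightarrow>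
    (\<exists>s\<in>{0..1}. \<exists>t\<in>{0..1}. orth_proj L ((1 - s) *\<^sub>R v + s *\<^sub>R w) = orth_proj L ((1 - t) *\<^sub>R x + t *\<^sub>R y))"
    by (auto simp: closed_segment_def) blast
  also have "\<dots> \<longleftrightarrow> (\<exists>s\<in>{0..1}. \<exists>t\<in>{0..1}. orth_proj L ((v + s *\<^sub>R (w - v)) - (x + t *\<^sub>R (y - x))) = 0)"
    by (intro bex_cong refl) (auto simp: orth_proj_simps algebra_simps)
  finally show ?thesis unfolding crossing_pair_def by simp
qed

text \<open>
  The projected segments have a common point and length at most \<open>r\<close>.
\<close>

lemma crossing_pair_close:
  assumes "crossing_pair r L v w x y" shows "norm (orth_proj L (v - x)) \<le> 2 * r"
proof -
  obtain s t where st: "s \<in> {0..1}" "t \<in> {0..1}" and n: "norm (v - w) \<le> r" "norm (x - y) \<le> r"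
    and eq: "orth_proj L ((v + s *\<^sub>R (w - v)) - (x + t *\<^sub>R (y - x))) = 0"
    using assms unfolding crossing_pair_iff by blast
  have "orth_proj L (v - x) = t *\<^sub>R orth_proj L (y - x) - s *\<^sub>R orth_proj L (w - v)"
    using eq by (simp add: orth_proj_simps algebra_simps)
  also have "norm \<dots> \<le> \<bar>t\<bar> * norm (orth_proj L (y - x)) + \<bar>s\<bar> * norm (orth_proj L (w - v))"
    by (metis norm_scaleR norm_triangle_ineq4)
  also have "\<dots> \<le> 1 * norm (y - x) + 1 * norm (w - v)"
    using st norm_orth_proj_le[OF L] by (intro add_mono mult_mono) auto
  finally show ?thesis using n by (simp add: norm_minus_commute)
qed

text \<open>
  Only projections onto \<open>L\<close> matter for the intersection, and there \<open>squeeze L r\<close> is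
  multiplication by \<open>r\<close>.
\<close>

lemma crossing_pair_rescale:
  assumes r: "r > 0"
  shows "crossing_pair r L v (v + r *\<^sub>R a) (v + squeeze L r u) (v + squeeze L r u + r *\<^sub>R b)
    \<longleftrightarrow> crossing_pair 1 L 0 a u (u + b)"
proof -
  have "norm (v - (v + r *\<^sub>R a)) \<le> r \<longleftrightarrow> norm (0 - a) \<le> 1"
    using r by (simp add: mult_le_cancel_left1)
  moreover have "norm (v + squeeze L r u - (v + squeeze L r u + r *\<^sub>R b)) \<le> r \<longleftrightarrow> norm (u - (u + b)) \<le> 1"
    using r by (simp add: mult_le_cancel_left1)
  moreover have "orth_proj L ((v + s *\<^sub>R ((v + r *\<^sub>R a) - v))
      - (v + squeeze L r u + t *\<^sub>R ((v + squeeze L r u + r *\<^sub>R b) - (v + squeeze L r u)))) = 0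
    \<longleftrightarrow> orth_proj L ((0 + s *\<^sub>R (a - 0)) - (u + t *\<^sub>R ((u + b) - u))) = 0" for s t
  proof -
    have "orth_proj L ((v + s *\<^sub>R ((v + r *\<^sub>R a) - v))
      - (v + squeeze L r u + t *\<^sub>R ((v + squeeze L r u + r *\<^sub>R b) - (v + squeeze L r u))))
      = r *\<^sub>R orth_proj L ((0 + s *\<^sub>R (a - 0)) - (u + t *\<^sub>R ((u + b) - u)))"
      by (simp add: orth_proj_simps orth_proj_squeeze algebra_simps)
    then show ?thesis using r by simp
  qed
  ultimately show ?thesis unfolding crossing_pair_iff by simp
qed

text \<open>
  Expresses the intersection of the projected segments by countably many conditions, which
  makes it measurable. A grid that is fine enough comes close to a common point, and
  conversely the distance function attains its minimum on the compact square.
\<close>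

lemma crossing_grid:
  fixes v w x y :: 'a
  defines "g \<equiv> \<lambda>s t. norm (orth_proj L ((v + s *\<^sub>R (w - v)) - (x + t *\<^sub>R (y - x))))"
  shows "(\<exists>s\<in>{0..1}. \<exists>t\<in>{0..1}. orth_proj L ((v + s *\<^sub>R (w - v)) - (x + t *\<^sub>R (y - x))) = 0)
    \<longleftrightarrow> (\<forall>n. \<exists>N i j. i \<le> N \<and> j \<le> N \<and> g (real i / real N) (real j / real N) < 1 / real (Suc n))"
proof
  assume "\<exists>s\<in>{0..1}. \<exists>t\<in>{0..1}. orth_proj L ((v + s *\<^sub>R (w - v)) - (x + t *\<^sub>R (y - x))) = 0"
  then obtain s t where st: "s \<in> {0..1}" "t \<in> {0..1}" and eq: "g s t = 0"
    by (auto simp: g_def)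
  show "\<forall>n. \<exists>N i j. i \<le> N \<and> j \<le> N \<and> g (real i / real N) (real j / real N) < 1 / real (Suc n)"
  proof
    fix n
    let ?c = "norm (w - v) + norm (y - x)"
    obtain N where N: "?c * real (Suc n) < real N" using reals_Archimedean2 by blast
    have Npos: "real N > 0" using N by (smt (verit) mult_nonneg_nonneg norm_ge_zero of_nat_0_le_iff)
    have approx: "\<exists>i\<le>N. \<bar>real i / real N - u\<bar> \<le> 1 / real N" if u: "u \<in> {0..1}" for u
    proof (intro exI conjI)
      let ?i = "nat \<lfloor>u * real N\<rfloor>"
      have f: "0 \<le> \<lfloor>u * real N\<rfloor>" using u by simp
      have un: "u * real N \<le> real N" using u Npos by (simp add: mult_left_le_one_le)
      then have "\<lfloor>u * real N\<rfloor> \<le> int N" by (simp add: floor_le_iff)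
      then show "?i \<le> N" by linarith
      have "\<bar>real ?i - u * real N\<bar> \<le> 1" using f by linarith
      moreover have "real ?i / real N - u = (real ?i - u * real N) / real N"
        using Npos by (simp add: diff_divide_distrib)
      ultimately show "\<bar>real ?i / real N - u\<bar> \<le> 1 / real N"
        by (simp add: abs_divide divide_right_mono)
    qed
    obtain i where i: "i \<le> N" "\<bar>real i / real N - s\<bar> \<le> 1 / real N" using approx[OF st(1)] by blast
    obtain j where j: "j \<le> N" "\<bar>real j / real N - t\<bar> \<le> 1 / real N" using approx[OF st(2)] by blast
    let ?s = "real i / real N" and ?t = "real j / real N"
    have "orth_proj L ((v + ?s *\<^sub>R (w - v)) - (x + ?t *\<^sub>R (y - x)))
        = orth_proj L ((v + s *\<^sub>R (w - v)) - (x + t *\<^sub>R (y - x)))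
          + orth_proj L ((?s - s) *\<^sub>R (w - v) - (?t - t) *\<^sub>R (y - x))"
      unfolding orth_proj_simps(1)[symmetric] by (simp add: algebra_simps)
    then have "g ?s ?t \<le> g s t + norm (orth_proj L ((?s - s) *\<^sub>R (w - v) - (?t - t) *\<^sub>R (y - x)))"
      unfolding g_def by (metis norm_triangle_ineq)
    also have "\<dots> \<le> norm ((?s - s) *\<^sub>R (w - v) - (?t - t) *\<^sub>R (y - x))"
      using norm_orth_proj_le[OF L] eq by simp
    also have "\<dots> \<le> \<bar>?s - s\<bar> * norm (w - v) + \<bar>?t - t\<bar> * norm (y - x)"
      by (metis norm_scaleR norm_triangle_ineq4)
    also have "\<dots> \<le> (1 / real N) * norm (w - v) + (1 / real N) * norm (y - x)"
      using i j by (intro add_mono mult_right_mono) auto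
    also have "\<dots> = ?c / real N" by (simp add: add_divide_distrib)
    also have "\<dots> < 1 / real (Suc n)" using N Npos by (simp add: field_simps)
    finally show "\<exists>N i j. i \<le> N \<and> j \<le> N \<and> g (real i / real N) (real j / real N) < 1 / real (Suc n)"
      using i j by blast
  qed
next
  assume *: "\<forall>n. \<exists>N i j. i \<le> N \<and> j \<le> N \<and> g (real i / real N) (real j / real N) < 1 / real (Suc n)"
  let ?h = "\<lambda>p. g (fst p) (snd p)"
  have "continuous_on ({0..1} \<times> {0..1}) ?h"
    unfolding g_def using linear_orth_proj[OF L]
    by (intro continuous_intros linear_continuous_on_compose[of _ _ "orth_proj L"])
  then obtain p where p: "p \<in> {0..1} \<times> {0..1}" and min: "\<And>q. q \<in> {0..1} \<times> {0..1} \<Longrightarrow> ?h p \<le> ?h q"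
    using continuous_attains_inf[of "{0..1::real} \<times> {0..1::real}" ?h] by (auto simp: compact_Times)
  have "?h p \<le> 0"
  proof (rule ccontr)
    assume "\<not> ?h p \<le> 0"
    then obtain n where n: "1 / real (Suc n) < ?h p"
      using reals_Archimedean[of "?h p"] by (auto simp: inverse_eq_divide)
    obtain N i j where ij: "i \<le> N" "j \<le> N" "g (real i / real N) (real j / real N) < 1 / real (Suc n)"
      using * by blast
    have "(real i / real N, real j / real N) \<in> {0..1} \<times> {0..1}"
      using ij by (auto simp: divide_le_eq_1)
    from min[OF this] show False using ij n by simp
  qed
  then have "orth_proj L ((v + fst p *\<^sub>R (w - v)) - (x + snd p *\<^sub>R (y - x))) = 0"
    by (simp add: g_def)
  then show "\<exists>s\<in>{0..1}. \<exists>t\<in>{0..1}. orth_proj L ((v + s *\<^sub>R (w - v)) - (x + t *\<^sub>R (y - x))) = 0"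
    using p by (intro bexI[of _ "fst p"] bexI[of _ "snd p"]) (auto simp: mem_Times_iff)
qed

end

lemma crossing_pair_swap: "crossing_pair r L v w x y \<Longrightarrow> crossing_pair r L w v x y"
  by (simp add: crossing_pair_def norm_minus_commute closed_segment_commute)

lemma crossing_pair_exchange: "crossing_pair r L v w x y \<Longrightarrow> crossing_pair r L x y v w"
  by (auto simp add: crossing_pair_def)

lemma crossing_pair_mono: "crossing_pair r L v w x y \<Longrightarrow> r \<le> r' \<Longrightarrow> crossing_pair r' L v w x y"
  by (auto simp add: crossing_pair_def)

lemma planesD: "L \<in> planes \<Longrightarrow> subspace L" "L \<in> planes \<Longrightarrow> dim L = 2"
  by (auto simp: planes_def)

lemma space_borel_planes [simp]: "space borel_planes = planes"
  by (simp add: borel_planes_def)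

lemma measurable_Blinfun_orth_proj:
  "(\<lambda>L. Blinfun (orth_proj L)) \<in> borel_measurable (borel_planes :: 'a::euclidean_space set measure)"
  unfolding borel_planes_def by (rule measurable_vimage_algebra1) auto

lemma measurable_orth_proj [measurable (raw)]:
  fixes v :: "'z \<Rightarrow> 'a::euclidean_space"
  assumes X: "X \<in> measurable M borel_planes" and v: "v \<in> borel_measurable M"
  shows "(\<lambda>z. orth_proj (X z) (v z)) \<in> borel_measurable M"
proof -
  have proj: "(\<lambda>z. orth_proj (X z) b) \<in> borel_measurable M" for b
  proof -
    have "(\<lambda>T. blinfun_apply T b) \<in> borel_measurable (borel :: ('a \<Rightarrow>\<^sub>L 'a) measure)"
      by (intro borel_measurable_continuous_onI continuous_intros)
    from measurable_compose[OF measurable_compose[OF X measurable_Blinfun_orth_proj] this]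
    have "(\<lambda>z. blinfun_apply (Blinfun (orth_proj (X z))) b) \<in> borel_measurable M" .
    moreover have "blinfun_apply (Blinfun (orth_proj (X z))) b = orth_proj (X z) b" if "z \<in> space M" for z
    proof -
      have "subspace (X z)" using measurable_space[OF X that] by (simp add: planesD)
      then show ?thesis by (simp add: bounded_linear_Blinfun_apply bounded_linear_orth_proj)
    qed
    ultimately show ?thesis by (subst measurable_cong) auto
  qed
  have "(\<lambda>z. \<Sum>b\<in>Basis. (v z \<bullet> b) *\<^sub>R orth_proj (X z) b) \<in> borel_measurable M"
    using proj v by measurable
  moreover have "(\<Sum>b\<in>Basis. (v z \<bullet> b) *\<^sub>R orth_proj (X z) b) = orth_proj (X z) (v z)" if "z \<in> space M" for z
  proof -
    have lin: "linear (orth_proj (X z))"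
      using measurable_space[OF X that] by (simp add: linear_orth_proj planesD)
    have "orth_proj (X z) (v z) = orth_proj (X z) (\<Sum>b\<in>Basis. (v z \<bullet> b) *\<^sub>R b)"
      by (simp add: euclidean_representation)
    also have "\<dots> = (\<Sum>b\<in>Basis. (v z \<bullet> b) *\<^sub>R orth_proj (X z) b)"
      by (simp add: linear_sum[OF lin] linear_scale[OF lin])
    finally show ?thesis by simp
  qed
  ultimately show ?thesis by (subst measurable_cong) auto
qed

lemma pred_crossing_pair [measurable (raw)]:
  fixes v w x y :: "'z \<Rightarrow> 'a::euclidean_space"
  assumes [measurable]: "X \<in> measurable M borel_planes" "v \<in> borel_measurable M" "w \<in> borel_measurable M"
    "x \<in> borel_measurable M" "y \<in> borel_measurable M"
  shows "Measurable.pred M (\<lambda>z. crossing_pair r (X z) (v z) (w z) (x z) (y z))"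
proof -
  have g: "(\<lambda>z. norm (orth_proj (X z) ((v z + s *\<^sub>R (w z - v z)) - (x z + t *\<^sub>R (y z - x z))))) \<in> borel_measurable M" for s t
    by (intro measurable_compose[OF measurable_orth_proj[OF assms(1)] borel_measurable_norm]) measurable
  have n: "Measurable.pred M (\<lambda>z. norm (v z - w z) \<le> r)" "Measurable.pred M (\<lambda>z. norm (x z - y z) \<le> r)"
    by measurable
  have c: "Measurable.pred M (\<lambda>z. \<forall>n. \<exists>N i j. i \<le> N \<and> j \<le> N \<and> norm (orth_proj (X z) ((v z + (real i / real N) *\<^sub>R (w z - v z))
      - (x z + (real j / real N) *\<^sub>R (y z - x z)))) < 1 / real (Suc n))"
    by (intro pred_intros_countable pred_intros_logic borel_measurable_pred_less g borel_measurable_const) simp_all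
  have pred: "Measurable.pred M (\<lambda>z. norm (v z - w z) \<le> r \<and> norm (x z - y z) \<le> r \<and>
    (\<forall>n. \<exists>N i j. i \<le> N \<and> j \<le> N \<and> norm (orth_proj (X z) ((v z + (real i / real N) *\<^sub>R (w z - v z))
      - (x z + (real j / real N) *\<^sub>R (y z - x z)))) < 1 / real (Suc n)))"
    by (intro pred_intros_logic n c)
  have eq: "(norm (v z - w z) \<le> r \<and> norm (x z - y z) \<le> r \<and>
    (\<forall>n. \<exists>N i j. i \<le> N \<and> j \<le> N \<and> norm (orth_proj (X z) ((v z + (real i / real N) *\<^sub>R (w z - v z))
      - (x z + (real j / real N) *\<^sub>R (y z - x z)))) < 1 / real (Suc n)))
     \<longleftrightarrow> crossing_pair r (X z) (v z) (w z) (x z) (y z)" if "z \<in> space M" for z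
  proof -
    have L: "subspace (X z)" using measurable_space[OF assms(1) that] by (simp add: planesD)
    show ?thesis unfolding crossing_pair_iff[OF L] crossing_grid[OF L] ..
  qed
  show ?thesis by (rule measurable_cong[THEN iffD1, OF eq pred])
qed

lemma near_volume:
  fixes x :: "'a::euclidean_space"
  assumes "r \<ge> 0"
  shows "(\<integral>\<^sup>+y. of_bool (norm (x - y) \<le> r) \<partial>lborel) = ennreal (unit_ball_vol (DIM('a)) * r ^ DIM('a))"
proof -
  have "(\<integral>\<^sup>+y. of_bool (norm (x - y) \<le> r) \<partial>lborel) = (\<integral>\<^sup>+y. indicator (cball x r) y \<partial>lborel)"
    by (intro nn_integral_cong) (auto simp: indicator_def dist_norm)
  then show ?thesis using assms by (simp add: emeasure_cball)
qed

text \<open>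
  After squeezing, the strip around \<open>x\<close> has width of order one and the extent of \<open>W\<close> in the
  orthogonal directions is unchanged, so a fixed ball contains it.
\<close>

lemma close_volume:
  fixes L :: "'a::euclidean_space set"
  assumes L: "subspace L" and r: "r > 0" and W: "W \<subseteq> cball 0 R" "W \<in> sets borel" and R: "R \<ge> 0"
  shows "(\<integral>\<^sup>+y\<in>W. of_bool (norm (orth_proj L (x - y)) \<le> 2 * r) \<partial>lborel)
    \<le> ennreal (r ^ dim L * (unit_ball_vol (DIM('a)) * (R + 2) ^ DIM('a)))"
proof -
  let ?f = "\<lambda>y. of_bool (norm (orth_proj L (x - y)) \<le> 2 * r) * indicator W y :: ennreal"
  have [measurable]: "orth_proj L \<in> borel_measurable borel"
    using linear_orth_proj[OF L] by (simp add: borel_measurable_continuous_onI linear_continuous_on linear_conv_bounded_linear)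
  note [measurable] = W(2)
  have "(\<integral>\<^sup>+y. ?f y \<partial>lborel) = ennreal (r ^ dim L) * (\<integral>\<^sup>+u. ?f (squeeze L r u) \<partial>lborel)"
    by (rule nn_integral_squeeze[OF L r]) measurable
  also have "(\<integral>\<^sup>+u. ?f (squeeze L r u) \<partial>lborel)
      \<le> (\<integral>\<^sup>+u. indicator (cball ((1 / r) *\<^sub>R orth_proj L x) (R + 2)) u \<partial>lborel)"
  proof (rule nn_integral_mono)
    fix u
    have "u \<in> cball ((1 / r) *\<^sub>R orth_proj L x) (R + 2)"
      if c: "norm (orth_proj L (x - squeeze L r u)) \<le> 2 * r" and w: "squeeze L r u \<in> W"
    proof -
      have "norm (u - orth_proj L u) \<le> norm (squeeze L r u)"
        using norm_orth_rest_le[OF L, of "squeeze L r u"] by (simp only: squeeze_rest[OF L])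
      also have "\<dots> \<le> R" using w W(1) by auto
      finally have 1: "norm (u - orth_proj L u) \<le> R" .
      have "orth_proj L (x - squeeze L r u) = r *\<^sub>R ((1 / r) *\<^sub>R orth_proj L x - orth_proj L u)"
        using r by (simp add: orth_proj_simps[OF L] orth_proj_squeeze[OF L] scaleR_diff_right)
      then have "r * norm ((1 / r) *\<^sub>R orth_proj L x - orth_proj L u) \<le> r * 2" using c r by simp
      then have 2: "norm ((1 / r) *\<^sub>R orth_proj L x - orth_proj L u) \<le> 2" using r by simp
      have "norm ((1 / r) *\<^sub>R orth_proj L x - u)
        \<le> norm ((1 / r) *\<^sub>R orth_proj L x - orth_proj L u) + norm (orth_proj L u - u)"
        using norm_triangle_ineq[of "(1 / r) *\<^sub>R orth_proj L x - orth_proj L u" "orth_proj L u - u"] by simp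
      then show ?thesis using 1 2 by (simp add: dist_norm norm_minus_commute)
    qed
    then show "?f (squeeze L r u) \<le> indicator (cball ((1 / r) *\<^sub>R orth_proj L x) (R + 2)) u"
      by (auto simp: indicator_def)
  qed
  also have "\<dots> = ennreal (unit_ball_vol (DIM('a)) * (R + 2) ^ DIM('a))"
    using R by (simp add: emeasure_cball)
  finally show ?thesis using r by (simp add: ennreal_mult' mult_left_mono)
qed

section \<open>Rescaled volumes of sets of quadruples\<close>

lemma measurable_lborel_integral:
  fixes g :: "'z \<Rightarrow> 'a::euclidean_space \<Rightarrow> ennreal"
  assumes "(\<lambda>(z, y). g z y) \<in> borel_measurable (M \<Otimes>\<^sub>M borel)"
  shows "(\<lambda>z. \<integral>\<^sup>+y. g z y \<partial>lborel) \<in> borel_measurable M"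
proof (rule lborel.borel_measurable_nn_integral)
  show "(\<lambda>(z, y). g z y) \<in> borel_measurable (M \<Otimes>\<^sub>M lborel)"
    using assms by (simp cong: measurable_cong_sets sets_pair_measure_cong)
qed

lemma nn_integral_lborel_shift_scale:
  fixes g :: "'a::euclidean_space \<Rightarrow> ennreal"
  assumes "g \<in> borel_measurable borel" "r > 0"
  shows "(\<integral>\<^sup>+y. g y \<partial>lborel) = ennreal (r ^ DIM('a)) * (\<integral>\<^sup>+b. g (c + r *\<^sub>R b) \<partial>lborel)"
proof -
  have "(\<integral>\<^sup>+y. g y \<partial>lborel) = (\<integral>\<^sup>+y. g y \<partial>density (distr lborel borel (\<lambda>x. c + r *\<^sub>R x)) (\<lambda>_. \<bar>r\<bar> ^ DIM('a)))"
    using lborel_affine[of r c] assms by simp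
  also have "\<dots> = ennreal (r ^ DIM('a)) * (\<integral>\<^sup>+b. g (c + r *\<^sub>R b) \<partial>lborel)"
    using assms by (subst nn_integral_density, simp, simp, subst nn_integral_cmult, simp, subst nn_integral_distr) auto
  finally show ?thesis .
qed

lemma squeeze_measurable [measurable]: "subspace L \<Longrightarrow> squeeze L r \<in> borel_measurable borel"
  using linear_squeeze[of L r]
  by (simp add: borel_measurable_continuous_onI linear_continuous_on linear_conv_bounded_linear)

lemma nn_integral_lborel_shift_squeeze:
  fixes g :: "'a::euclidean_space \<Rightarrow> ennreal"
  assumes g: "g \<in> borel_measurable borel" and r: "r > 0" and L: "subspace L"
  shows "(\<integral>\<^sup>+y. g y \<partial>lborel) = ennreal (r ^ dim L) * (\<integral>\<^sup>+b. g (c + squeeze L r b) \<partial>lborel)"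
proof -
  have "(\<integral>\<^sup>+y. g y \<partial>lborel) = (\<integral>\<^sup>+y. g (c + y) \<partial>lborel)"
    using nn_integral_lborel_shift_scale[OF g, of 1 c] by simp
  also have "\<dots> = ennreal (r ^ dim L) * (\<integral>\<^sup>+b. g (c + squeeze L r b) \<partial>lborel)"
    by (intro nn_integral_squeeze[OF L r] measurable_compose[OF _ g]) measurable
  finally show ?thesis .
qed

lemma nn_integral_lborel_4:
  fixes F :: "'a::euclidean_space \<Rightarrow> 'a \<Rightarrow> 'a \<Rightarrow> 'a \<Rightarrow> ennreal"
  assumes F: "(\<lambda>(v, a, u, b). F v a u b) \<in> borel_measurable (borel \<Otimes>\<^sub>M borel \<Otimes>\<^sub>M borel \<Otimes>\<^sub>M borel)"
  shows "(\<integral>\<^sup>+v. \<integral>\<^sup>+a. \<integral>\<^sup>+u. \<integral>\<^sup>+b. F v a u b \<partial>lborel \<partial>lborel \<partial>lborel \<partial>lborel)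
    = (\<integral>\<^sup>+(v, a, u, b). F v a u b \<partial>lborel)"
proof -
  have 1: "(\<lambda>(a, u, b). F v a u b) \<in> borel_measurable (lborel \<Otimes>\<^sub>M lborel)" for v
  proof -
    have "(\<lambda>q. (\<lambda>(v, a, u, b). F v a u b) (v, q)) \<in> borel_measurable (borel \<Otimes>\<^sub>M borel \<Otimes>\<^sub>M borel)"
      by (rule measurable_compose[OF _ F]) measurable
    moreover have "sets (borel \<Otimes>\<^sub>M borel \<Otimes>\<^sub>M borel :: ('a \<times> 'a \<times> 'a) measure) = sets (lborel \<Otimes>\<^sub>M lborel)"
      by (simp only: borel_prod lborel_prod sets_lborel)
    ultimately show ?thesis by (simp cong: measurable_cong_sets)
  qed
  have 2: "(\<lambda>(u, b). F v a u b) \<in> borel_measurable (lborel \<Otimes>\<^sub>M lborel)" for v a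
  proof -
    have "(\<lambda>q. (\<lambda>(v, a, u, b). F v a u b) (v, a, q)) \<in> borel_measurable (borel \<Otimes>\<^sub>M borel)"
      by (rule measurable_compose[OF _ F]) measurable
    then show ?thesis by (simp cong: measurable_cong_sets sets_pair_measure_cong)
  qed
  have 0: "(\<lambda>(v, a, u, b). F v a u b) \<in> borel_measurable (lborel \<Otimes>\<^sub>M lborel)"
  proof -
    have "sets (borel \<Otimes>\<^sub>M borel \<Otimes>\<^sub>M borel \<Otimes>\<^sub>M borel :: ('a \<times> 'a \<times> 'a \<times> 'a) measure)
        = sets (lborel \<Otimes>\<^sub>M lborel)"
      by (simp only: borel_prod lborel_prod sets_lborel)
    then show ?thesis using F by (simp cong: measurable_cong_sets)
  qed
  have "(\<integral>\<^sup>+u. \<integral>\<^sup>+b. F v a u b \<partial>lborel \<partial>lborel) = (\<integral>\<^sup>+(u, b). F v a u b \<partial>lborel)" for v a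
    using lborel.nn_integral_fst[OF 2[of v a]] by (simp add: lborel_prod)
  moreover have "(\<integral>\<^sup>+a. \<integral>\<^sup>+q. (case q of (u, b) \<Rightarrow> F v a u b) \<partial>lborel \<partial>lborel) = (\<integral>\<^sup>+(a, u, b). F v a u b \<partial>lborel)" for v
    using lborel.nn_integral_fst[OF 1[of v]] by (simp add: lborel_prod)
  moreover have "(\<integral>\<^sup>+v. \<integral>\<^sup>+q. (case q of (a, u, b) \<Rightarrow> F v a u b) \<partial>lborel \<partial>lborel) = (\<integral>\<^sup>+(v, a, u, b). F v a u b \<partial>lborel)"
    using lborel.nn_integral_fst[OF 0] by (simp add: lborel_prod)
  ultimately show ?thesis by simp
qed

text \<open>
  The two displacements inside the pairs contribute \<open>r ^ DIM('a)\<close> each, the displacement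
  between the pairs contributes \<open>r ^ dim L\<close>.
\<close>

lemma nn_integral_rescale_4:
  fixes f :: "'a::euclidean_space \<Rightarrow> 'a \<Rightarrow> 'a \<Rightarrow> 'a \<Rightarrow> ennreal"
  assumes f: "(\<lambda>(v, w, x, y). f v w x y) \<in> borel_measurable (borel \<Otimes>\<^sub>M borel \<Otimes>\<^sub>M borel \<Otimes>\<^sub>M borel)"
    and r: "r > 0" and L: "subspace L"
  shows "(\<integral>\<^sup>+v. \<integral>\<^sup>+w. \<integral>\<^sup>+x. \<integral>\<^sup>+y. f v w x y \<partial>lborel \<partial>lborel \<partial>lborel \<partial>lborel)
    = ennreal (r ^ (2 * DIM('a) + dim L)) *
      (\<integral>\<^sup>+(v, a, u, b). f v (v + r *\<^sub>R a) (v + squeeze L r u) (v + squeeze L r u + r *\<^sub>R b) \<partial>lborel)"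
proof -
  note [measurable] = squeeze_measurable[OF L]
  let ?B = "borel :: 'a measure"
  have f1: "(\<lambda>y. f v w x y) \<in> borel_measurable borel" for v w x
  proof -
    have "(\<lambda>q. (\<lambda>(v, a, u, b). f v a u b) (v, w, x, q)) \<in> borel_measurable borel"
      by (rule measurable_compose[OF _ f]) measurable
    then show ?thesis by simp
  qed
  define f3 where "f3 v w x = (\<integral>\<^sup>+b. f v w x (x + r *\<^sub>R b) \<partial>lborel)" for v w x
  have f3m: "(\<lambda>z. f3 (fst (fst z)) (snd (fst z)) (snd z)) \<in> borel_measurable ((?B \<Otimes>\<^sub>M ?B) \<Otimes>\<^sub>M ?B)"
    unfolding f3_def
  proof (rule measurable_lborel_integral)
    have "(\<lambda>q. (\<lambda>(v, w, x, y). f v w x y) (fst (fst (fst q)), snd (fst (fst q)), snd (fst q), snd (fst q) + r *\<^sub>R snd q))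
      \<in> borel_measurable (((?B \<Otimes>\<^sub>M ?B) \<Otimes>\<^sub>M ?B) \<Otimes>\<^sub>M ?B)"
      by (rule measurable_compose[OF _ f]) measurable
    then show "(\<lambda>(z, b). f (fst (fst z)) (snd (fst z)) (snd z) (snd z + r *\<^sub>R b))
      \<in> borel_measurable (((?B \<Otimes>\<^sub>M ?B) \<Otimes>\<^sub>M ?B) \<Otimes>\<^sub>M ?B)"
      by (simp add: split_beta')
  qed
  have f3m1: "(\<lambda>x. f3 v w x) \<in> borel_measurable borel" for v w
    using measurable_compose[OF _ f3m, of "\<lambda>x. ((v, w), x)" borel] by simp
  define f2 where "f2 v w = (\<integral>\<^sup>+u. f3 v w (v + squeeze L r u) \<partial>lborel)" for v w
  have f2m: "(\<lambda>z. f2 (fst z) (snd z)) \<in> borel_measurable (?B \<Otimes>\<^sub>M ?B)"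
    unfolding f2_def
  proof (rule measurable_lborel_integral)
    have "(\<lambda>q. (\<lambda>z. f3 (fst (fst z)) (snd (fst z)) (snd z)) (fst q, fst (fst q) + squeeze L r (snd q)))
      \<in> borel_measurable ((?B \<Otimes>\<^sub>M ?B) \<Otimes>\<^sub>M ?B)"
      by (rule measurable_compose[OF _ f3m]) measurable
    then show "(\<lambda>(z, u). f3 (fst z) (snd z) (fst z + squeeze L r u)) \<in> borel_measurable ((?B \<Otimes>\<^sub>M ?B) \<Otimes>\<^sub>M ?B)"
      by (simp add: split_beta')
  qed
  have f2m1: "(\<lambda>w. f2 v w) \<in> borel_measurable borel" for v
    using measurable_compose[OF _ f2m, of "\<lambda>w. (v, w)" borel] by simp
  define f1 where "f1 v = (\<integral>\<^sup>+a. f2 v (v + r *\<^sub>R a) \<partial>lborel)" for v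
  have f1m: "f1 \<in> borel_measurable borel"
    unfolding f1_def[abs_def]
  proof (rule measurable_lborel_integral)
    have "(\<lambda>q. (\<lambda>z. f2 (fst z) (snd z)) (fst q, fst q + r *\<^sub>R snd q)) \<in> borel_measurable (?B \<Otimes>\<^sub>M ?B)"
      by (rule measurable_compose[OF _ f2m]) measurable
    then show "(\<lambda>(v, a). f2 v (v + r *\<^sub>R a)) \<in> borel_measurable (?B \<Otimes>\<^sub>M ?B)"
      by (simp add: split_beta')
  qed
  let ?c = "ennreal (r ^ DIM('a))" and ?k = "ennreal (r ^ dim L)"
  have y: "(\<integral>\<^sup>+y. f v w x y \<partial>lborel) = ?c * f3 v w x" for v w x
    unfolding f3_def by (rule nn_integral_lborel_shift_scale[OF f1 r])
  have x: "(\<integral>\<^sup>+x. ?c * f3 v w x \<partial>lborel) = ?c * (?k * f2 v w)" for v w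
    unfolding f2_def nn_integral_lborel_shift_squeeze[OF f3m1 r L, symmetric]
    using f3m1 by (intro nn_integral_cmult) simp
  have w: "(\<integral>\<^sup>+w. ?c * (?k * f2 v w) \<partial>lborel) = ?c * (?k * (?c * f1 v))" for v
    unfolding f1_def nn_integral_lborel_shift_scale[OF f2m1 r, symmetric]
    using f2m1 by (simp add: nn_integral_cmult)
  have v: "(\<integral>\<^sup>+v. ?c * (?k * (?c * f1 v)) \<partial>lborel) = ?c * (?k * (?c * (\<integral>\<^sup>+v. f1 v \<partial>lborel)))"
    using f1m by (simp add: nn_integral_cmult)
  have "(\<integral>\<^sup>+v. f1 v \<partial>lborel)
    = (\<integral>\<^sup>+(v, a, u, b). f v (v + r *\<^sub>R a) (v + squeeze L r u) (v + squeeze L r u + r *\<^sub>R b) \<partial>lborel)"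
    unfolding f1_def f2_def f3_def
  proof (rule nn_integral_lborel_4)
    have "(\<lambda>q. (\<lambda>(v, w, x, y). f v w x y) (fst q, fst q + r *\<^sub>R fst (snd q), fst q + squeeze L r (fst (snd (snd q))),
        fst q + squeeze L r (fst (snd (snd q))) + r *\<^sub>R snd (snd (snd q))))
      \<in> borel_measurable (?B \<Otimes>\<^sub>M ?B \<Otimes>\<^sub>M ?B \<Otimes>\<^sub>M ?B)"
      by (rule measurable_compose[OF _ f]) measurable
    then show "(\<lambda>(v, a, u, b). f v (v + r *\<^sub>R a) (v + squeeze L r u) (v + squeeze L r u + r *\<^sub>R b))
      \<in> borel_measurable (?B \<Otimes>\<^sub>M ?B \<Otimes>\<^sub>M ?B \<Otimes>\<^sub>M ?B)"
      by (simp add: split_beta')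
  qed
  moreover have "ennreal (r ^ (2 * DIM('a) + dim L)) = ?c * (?k * ?c)"
  proof -
    have "r ^ (2 * DIM('a) + dim L) = r ^ DIM('a) * (r ^ dim L * r ^ DIM('a))"
      by (simp add: power_add mult_2)
    then show ?thesis using r by (simp only: ennreal_mult zero_le_power less_imp_le mult_nonneg_nonneg)
  qed
  ultimately show ?thesis unfolding y x w v by (simp only: mult.assoc)
qed

definition tuple_volume :: "'a::euclidean_space set \<Rightarrow> ('a \<Rightarrow> 'a \<Rightarrow> 'a \<Rightarrow> 'a \<Rightarrow> bool) \<Rightarrow> ennreal" where
  "tuple_volume W G = (\<integral>\<^sup>+v. \<integral>\<^sup>+w. \<integral>\<^sup>+x. \<integral>\<^sup>+y.
     indicator W v * indicator W w * indicator W x * indicator W y * of_bool (G v w x y)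
     \<partial>lborel \<partial>lborel \<partial>lborel \<partial>lborel)"

text \<open>
  As \<open>r\<close> tends to zero, the rescaled points \<open>v\<close> and \<open>w\<close> both tend to \<open>v\<close>, and \<open>x\<close> and \<open>y\<close>
  both tend to \<open>v\<close> plus the component of \<open>u\<close> orthogonal to \<open>L\<close>.
\<close>

definition limit_integrand :: "'a::euclidean_space set \<Rightarrow> 'a set \<Rightarrow> 'a \<times> 'a \<times> 'a \<times> 'a \<Rightarrow> real" where
  "limit_integrand W L = (\<lambda>(v, a, u, b). indicator W v * indicator W (v + (u - orth_proj L u)))"

lemma AE_not_frontier:
  fixes W :: "'a::euclidean_space set"
  assumes "convex W"
  shows "AE p in lborel. fst (p :: 'a \<times> 'b::euclidean_space) \<notin> frontier W"
proof -
  have "frontier W \<in> null_sets lborel"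
    using negligible_convex_frontier[OF assms] borel_closed[OF frontier_closed[of W]]
    by (simp add: negligible_iff_null_sets null_sets_completion_iff)
  then have "frontier W \<times> (UNIV :: 'b set) \<in> null_sets lborel"
    by (subst lborel_prod[symmetric]) (auto simp: null_sets_def lborel.emeasure_pair_measure_Times)
  then show ?thesis by (rule AE_I') auto
qed

text \<open>
  A shear is a linear bijection, so it preserves null sets.
\<close>

lemma AE_not_frontier_shear:
  fixes W :: "'a::euclidean_space set" and g :: "'b::euclidean_space \<Rightarrow> 'a"
  assumes W: "convex W" and g: "linear g"
  shows "AE p in lborel. fst p + g (snd p) \<notin> frontier W"
proof -
  define S where "S p = (fst p + g (snd p), snd p)" for p :: "'a \<times> 'b"
  have S: "linear S" unfolding S_def using g
    by (intro linearI) (auto simp: linear_add linear_scale algebra_simps)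
  have bij: "bij S"
    by (rule bij_betw_byWitness[where f' = "\<lambda>p. (fst p - g (snd p), snd p)"]) (auto simp: S_def)
  obtain c :: ennreal where c: "\<And>f. f \<in> borel_measurable borel \<Longrightarrow> (\<integral>\<^sup>+x. f (S x) \<partial>lborel) = c * (\<integral>\<^sup>+x. f x \<partial>lborel)"
    using linear_change_of_variables[OF S bij] by metis
  have [measurable]: "S \<in> borel_measurable borel"
    using S by (simp add: borel_measurable_continuous_onI linear_continuous_on linear_conv_bounded_linear)
  define F where "F = {p :: 'a \<times> 'b. fst p \<in> frontier W}"
  have "closed F"
    using closed_vimage[OF frontier_closed[of W] continuous_on_fst[OF continuous_on_id]]
    by (simp add: F_def vimage_def)
  then have Fm [measurable]: "F \<in> sets borel" by (rule borel_closed)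
  have "(\<integral>\<^sup>+p. indicator F p \<partial>lborel) = 0"
  proof -
    have "AE p in lborel. p \<notin> F" using AE_not_frontier[OF W, where 'b = 'b] by (simp add: F_def)
    then show ?thesis using Fm by (subst nn_integral_0_iff_AE) auto
  qed
  then have "(\<integral>\<^sup>+p. indicator F (S p) \<partial>lborel) = 0" by (subst c) auto
  then have "AE p in lborel. indicator F (S p) = (0 :: ennreal)"
    by (subst (asm) nn_integral_0_iff_AE) auto
  then show ?thesis
    by (rule eventually_mono) (auto simp: F_def S_def indicator_def split: if_splits)
qed

lemma of_bool_measurable:
  "Measurable.pred M Q \<Longrightarrow> (\<lambda>z. of_bool (Q z) :: 'b::{second_countable_topology, zero_neq_one}) \<in> borel_measurable M"
  by simp

text \<open>
  Dominated convergence for the rescaled integrand \<open>U\<close>: crossings keep it inside a fixed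
  ball, and the indicators of \<open>W\<close> converge at all points for which the limits avoid the
  frontier of \<open>W\<close>. That frontier is a null set because \<open>W\<close> is convex.
\<close>

lemma rescaled_volume_limit:
  fixes W L :: "'a::euclidean_space set" and G :: "nat \<Rightarrow> 'a \<Rightarrow> 'a \<Rightarrow> 'a \<Rightarrow> 'a \<Rightarrow> bool"
  assumes L: "subspace L" and W: "compact W" "convex W"
    and r: "\<And>n. 0 < r n" "\<And>n. r n \<le> 1" "r \<longlonglongrightarrow> 0"
    and G: "\<And>n. Measurable.pred (borel \<Otimes>\<^sub>M borel \<Otimes>\<^sub>M borel \<Otimes>\<^sub>M borel) (\<lambda>(v, w, x, y). G n v w x y)"
    and cross: "\<And>n v w x y. G n v w x y \<Longrightarrow> crossing_pair (r n) L v w x y"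
    and g: "g \<in> borel_measurable lborel"
    and lim: "AE p in lborel. case p of (v, a, u, b) \<Rightarrow>
      (\<lambda>n. of_bool (G n v (v + r n *\<^sub>R a) (v + squeeze L (r n) u) (v + squeeze L (r n) u + r n *\<^sub>R b)) :: real)
        \<longlonglongrightarrow> g (v, a, u, b)"
  shows "tuple_volume W (G n) < \<infinity>"
    and "(\<lambda>n. enn2real (tuple_volume W (G n)) / r n ^ (2 * DIM('a) + dim L))
      \<longlonglongrightarrow> (\<integral>p. limit_integrand W L p * g p \<partial>lborel)"
    and "integrable lborel (\<lambda>p. limit_integrand W L p * g p)"
proof -
  let ?B = "borel :: 'a measure"
  have Wc: "closed W" using W(1) by (rule compact_imp_closed)
  have [measurable]: "W \<in> sets borel" using Wc by (rule borel_closed)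
  note [measurable] = squeeze_measurable[OF L]
  obtain R where R: "W \<subseteq> cball 0 R" "0 \<le> R"
  proof -
    obtain a where a: "\<forall>x\<in>W. norm x \<le> a" using compact_imp_bounded[OF W(1)] bounded_iff by blast
    show ?thesis by (rule that[of "\<bar>a\<bar>"]) (use a in force)+
  qed
  define U where "U n = (\<lambda>(v, a, u, b). indicator W v * indicator W (v + r n *\<^sub>R a) * indicator W (v + squeeze L (r n) u)
      * indicator W (v + squeeze L (r n) u + r n *\<^sub>R b)
      * of_bool (G n v (v + r n *\<^sub>R a) (v + squeeze L (r n) u) (v + squeeze L (r n) u + r n *\<^sub>R b)) :: real)" for n
  have borel4: "borel_measurable (?B \<Otimes>\<^sub>M ?B \<Otimes>\<^sub>M ?B \<Otimes>\<^sub>M ?B) = (borel_measurable lborel :: ('a \<times> 'a \<times> 'a \<times> 'a \<Rightarrow> real) set)"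
    by (simp only: borel_prod) simp
  have G4: "Measurable.pred M (\<lambda>z. G n (v z) (w z) (x z) (y z))"
    if "v \<in> borel_measurable M" "w \<in> borel_measurable M" "x \<in> borel_measurable M" "y \<in> borel_measurable M"
    for v w x y n and M :: "('a \<times> 'a \<times> 'a \<times> 'a) measure"
  proof -
    have "Measurable.pred M (\<lambda>z. (\<lambda>(v, w, x, y). G n v w x y) (v z, w z, x z, y z))"
      by (rule measurable_compose[OF _ G]) (use that in measurable)
    then show ?thesis by simp
  qed
  have Um: "U n \<in> borel_measurable lborel" for n
  proof -
    have "U n \<in> borel_measurable (?B \<Otimes>\<^sub>M ?B \<Otimes>\<^sub>M ?B \<Otimes>\<^sub>M ?B)"
      unfolding U_def split_beta'
      by (intro borel_measurable_times G4[THEN of_bool_measurable]) measurable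
    then show ?thesis by (simp only: borel4)
  qed
  \<comment> \<open>the radius bounds the sum of the norms of v, a, u, b, which are at most R,
      1, 2 R + 2, 1\<close>
  have U01: "0 \<le> U n p" "U n p \<le> indicator (cball 0 (3 * R + 4)) p" for n p
  proof -
    obtain v a u b where p: "p = (v, a, u, b)" by (cases p) auto
    show "0 \<le> U n p" by (simp add: U_def p)
    show "U n p \<le> indicator (cball 0 (3 * R + 4)) p"
    proof (cases "U n p = 0")
      case False
      then have v: "v \<in> W" and x: "v + squeeze L (r n) u \<in> W"
        and c: "crossing_pair (r n) L v (v + r n *\<^sub>R a) (v + squeeze L (r n) u) (v + squeeze L (r n) u + r n *\<^sub>R b)"
        using cross by (auto simp: U_def p indicator_def split: if_splits)
      have c1: "crossing_pair 1 L 0 a u (u + b)" using c crossing_pair_rescale[OF L r(1)] by simp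
      have ab: "norm a \<le> 1" "norm b \<le> 1" using c1 by (simp_all add: crossing_pair_def)
      have Pu: "norm (orth_proj L u) \<le> 2"
        using crossing_pair_close[OF L c1] by (simp add: linear_neg[OF linear_orth_proj[OF L]])
      have nv: "norm v \<le> R" and nx: "norm (v + squeeze L (r n) u) \<le> R" using v x R(1) by auto
      have "norm (u - orth_proj L u) \<le> norm (squeeze L (r n) u)"
        using norm_orth_rest_le[OF L, of "squeeze L (r n) u"] by (simp only: squeeze_rest[OF L])
      also have "\<dots> \<le> 2 * R"
        using norm_triangle_ineq4[of "v + squeeze L (r n) u" v] nv nx by simp
      finally have "norm u \<le> 2 * R + 2"
        using Pu norm_triangle_ineq[of "orth_proj L u" "u - orth_proj L u"] by simp
      moreover have "norm p \<le> norm v + (norm a + (norm u + norm b))"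
        unfolding p by (intro order_trans[OF norm_Pair_le] add_mono order_refl)
      ultimately have "norm p \<le> 3 * R + 4" using nv ab by linarith
      then show ?thesis by (auto simp: U_def p indicator_def)
    qed simp
  qed
  have int_bound: "integrable lborel (indicator (cball 0 (3 * R + 4)) :: 'a \<times> 'a \<times> 'a \<times> 'a \<Rightarrow> real)"
    using emeasure_lborel_cball_finite by (intro integrable_real_indicator) auto
  have intU: "integrable lborel (U n)" for n
    by (rule Bochner_Integration.integrable_bound[OF int_bound Um]) (use U01 in auto)
  have vol: "tuple_volume W (G n) = ennreal (r n ^ (2 * DIM('a) + dim L) * (\<integral>p. U n p \<partial>lborel))" for n
  proof -
    have "tuple_volume W (G n) = ennreal (r n ^ (2 * DIM('a) + dim L)) *
      (\<integral>\<^sup>+(v, a, u, b). indicator W v * indicator W (v + r n *\<^sub>R a) * indicator W (v + squeeze L (r n) u)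
        * indicator W (v + squeeze L (r n) u + r n *\<^sub>R b)
        * of_bool (G n v (v + r n *\<^sub>R a) (v + squeeze L (r n) u) (v + squeeze L (r n) u + r n *\<^sub>R b)) \<partial>lborel)"
      unfolding tuple_volume_def
    proof (rule nn_integral_rescale_4[OF _ r(1) L])
      show "(\<lambda>(v, w, x, y). indicator W v * indicator W w * indicator W x * indicator W y * of_bool (G n v w x y) :: ennreal)
        \<in> borel_measurable (?B \<Otimes>\<^sub>M ?B \<Otimes>\<^sub>M ?B \<Otimes>\<^sub>M ?B)"
        unfolding split_beta'
        by (intro borel_measurable_times_ennreal G4[THEN of_bool_measurable]) measurable
    qed
    also have "(\<integral>\<^sup>+(v, a, u, b). indicator W v * indicator W (v + r n *\<^sub>R a) * indicator W (v + squeeze L (r n) u)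
        * indicator W (v + squeeze L (r n) u + r n *\<^sub>R b)
        * of_bool (G n v (v + r n *\<^sub>R a) (v + squeeze L (r n) u) (v + squeeze L (r n) u + r n *\<^sub>R b)) \<partial>lborel)
      = (\<integral>\<^sup>+p. ennreal (U n p) \<partial>lborel)"
      by (intro nn_integral_cong) (auto simp: U_def indicator_def)
    also have "\<dots> = ennreal (\<integral>p. U n p \<partial>lborel)"
      using intU U01(1) by (intro nn_integral_eq_integral) auto
    finally show ?thesis using r(1)[of n] by (simp add: ennreal_mult')
  qed
  show "tuple_volume W (G n) < \<infinity>" by (simp add: vol)
  have quot: "enn2real (tuple_volume W (G n)) / r n ^ (2 * DIM('a) + dim L) = (\<integral>p. U n p \<partial>lborel)" for n
    unfolding vol using r(1)[of n] U01(1) by (simp add: enn2real_ennreal integral_nonneg)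
  have lm: "limit_integrand W L \<in> borel_measurable lborel"
  proof -
    have [measurable]: "orth_proj L \<in> borel_measurable borel"
      using linear_orth_proj[OF L] by (simp add: borel_measurable_continuous_onI linear_continuous_on linear_conv_bounded_linear)
    have "limit_integrand W L \<in> borel_measurable (?B \<Otimes>\<^sub>M ?B \<Otimes>\<^sub>M ?B \<Otimes>\<^sub>M ?B)"
      unfolding limit_integrand_def split_beta' by measurable
    then show ?thesis by (simp only: borel4)
  qed
  have "linear (\<lambda>q :: 'a \<times> 'a \<times> 'a. fst (snd q) - orth_proj L (fst (snd q)))"
    by (intro linearI) (auto simp: orth_proj_simps[OF L] algebra_simps)
  from AE_not_frontier_shear[OF W(2) this] AE_not_frontier[OF W(2)] lim
  have *: "AE p in lborel. (\<lambda>n. U n p) \<longlonglongrightarrow> limit_integrand W L p * g p"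
  proof eventually_elim
    case (elim p)
    obtain v a u b where p: "p = (v, a, u, b)" by (cases p) auto
    have sq: "(\<lambda>n. squeeze L (r n) u) \<longlonglongrightarrow> u - orth_proj L u"
      unfolding squeeze_def by (auto intro!: tendsto_eq_intros r(3))
    have v: "isCont (indicator W :: 'a \<Rightarrow> real) v" and x: "isCont (indicator W :: 'a \<Rightarrow> real) (v + (u - orth_proj L u))"
      using elim by (auto simp: isCont_indicator p)
    have ra: "(\<lambda>n. v + r n *\<^sub>R a) \<longlonglongrightarrow> v"
      by (auto intro!: tendsto_eq_intros r(3))
    have xs: "(\<lambda>n. v + squeeze L (r n) u) \<longlonglongrightarrow> v + (u - orth_proj L u)"
      by (intro tendsto_add tendsto_const sq)
    have "(\<lambda>n. v + squeeze L (r n) u + r n *\<^sub>R b) \<longlonglongrightarrow> v + (u - orth_proj L u) + 0 *\<^sub>R b"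
      by (intro tendsto_intros xs r(3))
    then have ys: "(\<lambda>n. v + squeeze L (r n) u + r n *\<^sub>R b) \<longlonglongrightarrow> v + (u - orth_proj L u)" by simp
    have "(\<lambda>n. U n p) \<longlonglongrightarrow> indicator W v * indicator W v * indicator W (v + (u - orth_proj L u))
        * indicator W (v + (u - orth_proj L u)) * g (v, a, u, b)"
      unfolding U_def p prod.case
      using elim(3) unfolding p prod.case
      by (intro tendsto_mult tendsto_const isCont_tendsto_compose[OF v ra]
          isCont_tendsto_compose[OF x xs] isCont_tendsto_compose[OF x ys])
    moreover have "indicator W v * indicator W v * indicator W (v + (u - orth_proj L u))
        * indicator W (v + (u - orth_proj L u)) * g (v, a, u, b) = limit_integrand W L p * g p"
      by (simp add: limit_integrand_def p indicator_def)
    ultimately show ?case by simp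
  qed
  then show "integrable lborel (\<lambda>p. limit_integrand W L p * g p)"
    by (intro integrable_dominated_convergence[OF _ Um int_bound]) (use lm g U01 in auto)
  from * have "(\<lambda>n. \<integral>p. U n p \<partial>lborel) \<longlonglongrightarrow> (\<integral>p. limit_integrand W L p * g p \<partial>lborel)"
    by (intro integral_dominated_convergence[OF _ Um int_bound]) (use lm g U01 in auto)
  then show "(\<lambda>n. enn2real (tuple_volume W (G n)) / r n ^ (2 * DIM('a) + dim L))
      \<longlonglongrightarrow> (\<integral>p. limit_integrand W L p * g p \<partial>lborel)"
    unfolding quot .
qed

section \<open>The limiting rate of crossings\<close>

definition crosses :: "real \<Rightarrow> 'a::euclidean_space set \<Rightarrow> 'a \<Rightarrow> 'a \<Rightarrow> 'a \<Rightarrow> 'a \<Rightarrow> bool" where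
  "crosses r L v w x y \<longleftrightarrow> crossing_pair r L v w x y \<and> distinct [v, w, x, y]"

text \<open>
  Ordered quadruples are integrated, so every crossing is counted eight times.
\<close>

definition limit_rate :: "'a::euclidean_space set \<Rightarrow> 'a set \<Rightarrow> real" where
  "limit_rate W L = (\<integral>p. limit_integrand W L p *
     (case p of (v, a, u, b) \<Rightarrow> of_bool (crossing_pair 1 L 0 a u (u + b))) \<partial>lborel) / 8"

lemma pred_distinct4 [measurable]:
  fixes v w x y :: "'z \<Rightarrow> 'a::euclidean_space"
  assumes [measurable]: "v \<in> borel_measurable M" "w \<in> borel_measurable M"
    "x \<in> borel_measurable M" "y \<in> borel_measurable M"
  shows "Measurable.pred M (\<lambda>z. distinct [v z, w z, x z, y z])"
proof -
  have "Measurable.pred M (\<lambda>z. norm (a z - b z) = 0)"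
    if "a \<in> borel_measurable M" "b \<in> borel_measurable M" for a b :: "'z \<Rightarrow> 'a"
    using that by measurable
  then have "Measurable.pred M (\<lambda>z. a z = b z)"
    if "a \<in> borel_measurable M" "b \<in> borel_measurable M" for a b :: "'z \<Rightarrow> 'a"
    using that by simp
  note [measurable] = this
  show ?thesis by simp
qed

lemma pred_crosses [measurable (raw)]:
  fixes v w x y :: "'z \<Rightarrow> 'a::euclidean_space"
  assumes [measurable]: "X \<in> measurable M borel_planes" "v \<in> borel_measurable M" "w \<in> borel_measurable M"
    "x \<in> borel_measurable M" "y \<in> borel_measurable M"
  shows "Measurable.pred M (\<lambda>z. crosses r (X z) (v z) (w z) (x z) (y z))"
  unfolding crosses_def by (intro pred_intros_logic pred_crossing_pair pred_distinct4 assms)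

lemma pred_crosses4:
  assumes "L \<in> planes"
  shows "Measurable.pred (borel \<Otimes>\<^sub>M borel \<Otimes>\<^sub>M borel \<Otimes>\<^sub>M borel) (\<lambda>(v, w, x, y). crosses r L v w x y)"
  unfolding split_beta' using assms by (intro pred_crosses measurable_const) auto

text \<open>
  The kernel is a proper subspace.
\<close>

lemma AE_linear_nonzero:
  fixes h :: "'a::euclidean_space \<Rightarrow> 'b::real_vector"
  assumes h: "linear h" and x: "h x \<noteq> 0"
  shows "AE p in lborel. h p \<noteq> 0"
proof -
  let ?V = "{p. h p = 0}"
  have V: "subspace ?V" using h by (rule linear_subspace_kernel)
  have "?V \<noteq> UNIV" using x by auto
  then have "dim ?V < DIM('a)"
    using V dim_eq_full[of ?V] dim_subset_UNIV[of ?V] by (metis le_neq_implies_less span_eq_iff)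
  then have "negligible ?V" by (rule negligible_lowdim)
  moreover have "?V \<in> sets borel" using closed_subspace[OF V] by (rule borel_closed)
  ultimately have "?V \<in> null_sets lborel"
    by (simp add: negligible_iff_null_sets null_sets_completion_iff)
  then show ?thesis by (rule AE_I') auto
qed

lemma exists_orthogonal_to_plane:
  fixes L :: "'a::euclidean_space set"
  assumes "L \<in> planes" "DIM('a) \<ge> 3"
  obtains g where "norm g = 1" "\<And>z. z \<in> L \<Longrightarrow> g \<bullet> z = 0"
proof -
  have "span L \<subset> span UNIV"
    using assms by (metis planesD dim_UNIV dim_span nat_neq_iff not_less_eq_eq numeral_2_eq_2 numeral_3_eq_3
        order_refl psubsetI span_UNIV subset_UNIV)
  then obtain g where g: "g \<noteq> 0" "\<And>y. y \<in> span L \<Longrightarrow> orthogonal g y"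
    using orthogonal_to_subspace_exists_gen[of L UNIV] by blast
  show ?thesis
  proof (rule that[of "g /\<^sub>R norm g"])
    show "norm (g /\<^sub>R norm g) = 1" using g(1) by simp
    show "(g /\<^sub>R norm g) \<bullet> z = 0" if "z \<in> L" for z
      using g(2)[of z] that by (simp add: orthogonal_def span_base)
  qed
qed

text \<open>
  Points that coincide for arbitrarily small radii would force \<open>a = 0\<close>, \<open>b = 0\<close> or \<open>u\<close> in
  \<open>L\<close>. The last set is a null set as there is a direction orthogonal to \<open>L\<close>.
\<close>

lemma AE_rescaled_distinct:
  fixes L :: "'a::euclidean_space set"
  assumes L: "L \<in> planes" "DIM('a) \<ge> 3" and r: "\<And>n. 0 < r n" "r \<longlonglongrightarrow> 0"
  shows "AE p in lborel. case p of (v, a, u, b) \<Rightarrow> eventually (\<lambda>n.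
    distinct [v, v + r n *\<^sub>R a, v + squeeze L (r n) u, v + squeeze L (r n) u + r n *\<^sub>R (b :: 'a)]) sequentially"
proof -
  note sL = planesD(1)[OF L(1)]
  obtain g where g: "norm g = 1" "\<And>z. z \<in> L \<Longrightarrow> g \<bullet> z = 0" using exists_orthogonal_to_plane[OF L] by blast
  have Pg: "orth_proj L g = 0" using g(2) by (intro orth_proj_0[OF sL]) (simp add: orthogonal_def)
  have "g \<noteq> 0" using g(1) by auto
  have 1: "AE p :: 'a \<times> 'a \<times> 'a \<times> 'a in lborel. fst (snd p) \<noteq> 0"
    by (rule AE_linear_nonzero[of "\<lambda>p. fst (snd p)" "(0, g, 0, 0)"]) (auto intro: linearI simp: \<open>g \<noteq> 0\<close>)
  have 2: "AE p :: 'a \<times> 'a \<times> 'a \<times> 'a in lborel. snd (snd (snd p)) \<noteq> 0"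
    by (rule AE_linear_nonzero[of "\<lambda>p. snd (snd (snd p))" "(0, 0, 0, g)"]) (auto intro: linearI simp: \<open>g \<noteq> 0\<close>)
  have 3: "AE p :: 'a \<times> 'a \<times> 'a \<times> 'a in lborel. fst (snd (snd p)) - orth_proj L (fst (snd (snd p))) \<noteq> 0"
    by (rule AE_linear_nonzero[of "\<lambda>p. fst (snd (snd p)) - orth_proj L (fst (snd (snd p)))" "(0, 0, g, 0)"])
      (auto intro!: linearI simp: \<open>g \<noteq> 0\<close> Pg orth_proj_simps[OF sL] algebra_simps)
  from 1 2 3 show ?thesis
  proof eventually_elim
    case (elim p)
    obtain v a u b where p: "p = (v, a, u, b)" by (cases p) auto
    have nz: "a \<noteq> 0" "b \<noteq> 0" "u - orth_proj L u \<noteq> 0" using elim by (auto simp: p)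
    have sq: "(\<lambda>n. squeeze L (r n) u) \<longlonglongrightarrow> u - orth_proj L u"
      unfolding squeeze_def by (auto intro!: tendsto_eq_intros r(2))
    have ev: "\<forall>\<^sub>F n in sequentially. squeeze L (r n) u + r n *\<^sub>R c \<noteq> 0" for c
    proof -
      have "(\<lambda>n. squeeze L (r n) u + r n *\<^sub>R c) \<longlonglongrightarrow> (u - orth_proj L u) + 0 *\<^sub>R c"
        by (intro tendsto_intros sq r(2))
      then show ?thesis using nz(3) by (intro tendsto_imp_eventually_ne) auto
    qed
    have "\<forall>\<^sub>F n in sequentially. distinct [v, v + r n *\<^sub>R a, v + squeeze L (r n) u, v + squeeze L (r n) u + r n *\<^sub>R b]"
      using ev[of 0] ev[of b] ev[of "- a"] ev[of "b - a"]
    proof eventually_elim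
      case (elim n)
      have "r n \<noteq> 0" using r(1)[of n] by simp
      have "v + r n *\<^sub>R a \<noteq> v + squeeze L (r n) u"
        using elim(3) by (auto simp: scaleR_minus_right)
      moreover have "v + r n *\<^sub>R a \<noteq> v + squeeze L (r n) u + r n *\<^sub>R b"
      proof
        assume "v + r n *\<^sub>R a = v + squeeze L (r n) u + r n *\<^sub>R b"
        then have "r n *\<^sub>R a = squeeze L (r n) u + r n *\<^sub>R b" by (simp add: add.assoc)
        then show False using elim(4) by (simp add: scaleR_diff_right)
      qed
      moreover have "v \<noteq> v + squeeze L (r n) u + r n *\<^sub>R b"
        using elim(2) by (simp add: add.assoc)
      ultimately show ?case using nz elim(1) \<open>r n \<noteq> 0\<close> by simp
    qed
    then show ?case by (simp only: p prod.case)
  qed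
qed

lemma rescaled_crossing_measurable:
  fixes L :: "'a::euclidean_space set"
  assumes L: "L \<in> planes"
  shows "(\<lambda>p. case p of (v, a, u, b) \<Rightarrow> (of_bool (crossing_pair 1 L 0 a u (u + b)) :: real))
    \<in> borel_measurable (lborel :: ('a \<times> 'a \<times> 'a \<times> 'a) measure)"
proof -
  have "Measurable.pred (borel \<Otimes>\<^sub>M borel \<Otimes>\<^sub>M borel \<Otimes>\<^sub>M borel :: ('a \<times> 'a \<times> 'a \<times> 'a) measure)
    (\<lambda>p. crossing_pair 1 L 0 (fst (snd p)) (fst (snd (snd p))) (fst (snd (snd p)) + snd (snd (snd p))))"
    using L by (intro pred_crossing_pair measurable_const) (auto intro: measurable_compose)
  from of_bool_measurable[OF this, where 'b = real] show ?thesis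
    by (simp only: split_beta' borel_prod) simp
qed

context
  fixes W L :: "'a::euclidean_space set" and r :: "nat \<Rightarrow> real"
  assumes d: "DIM('a) \<ge> 3" and W: "compact W" "convex W" and L: "L \<in> planes"
    and r: "\<And>n. 0 < r n" "\<And>n. r n \<le> 1" "r \<longlonglongrightarrow> 0"
begin

lemma single_volume_limit:
  "tuple_volume W (crosses (r n) L) < \<infinity>"
  "(\<lambda>n. enn2real (tuple_volume W (crosses (r n) L)) / r n ^ (2 * DIM('a) + 2)) \<longlonglongrightarrow> 8 * limit_rate W L"
  "integrable lborel (\<lambda>p. limit_integrand W L p * (case p of (v, a, u, b) \<Rightarrow> of_bool (crossing_pair 1 L 0 a u (u + b))))"
proof -
  note sL = planesD(1)[OF L]
  have lim: "AE p in lborel. case p of (v, a, u, b) \<Rightarrow>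
      (\<lambda>n. of_bool (crosses (r n) L v (v + r n *\<^sub>R a) (v + squeeze L (r n) u) (v + squeeze L (r n) u + r n *\<^sub>R b)) :: real)
        \<longlonglongrightarrow> (case (v, a, u, b) of (v, a, u, b) \<Rightarrow> of_bool (crossing_pair 1 L 0 a u (u + b)))"
    using AE_rescaled_distinct[OF L d r(1) r(3)]
  proof eventually_elim
    case (elim p)
    obtain v a u b where p: "p = (v, a, u, b)" by (cases p) auto
    have "\<forall>\<^sub>F n in sequentially. of_bool (crosses (r n) L v (v + r n *\<^sub>R a) (v + squeeze L (r n) u) (v + squeeze L (r n) u + r n *\<^sub>R b))
      = (of_bool (crossing_pair 1 L 0 a u (u + b)) :: real)"
      using elim unfolding p prod.case
      by eventually_elim (simp add: crosses_def crossing_pair_rescale[OF sL r(1)])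
    then show ?case unfolding p prod.case by (rule tendsto_eventually)
  qed
  note R = rescaled_volume_limit[OF sL W r pred_crosses4[OF L] _ rescaled_crossing_measurable[OF L] lim]
  show "tuple_volume W (crosses (r n) L) < \<infinity>"
    by (rule R(1)) (simp add: crosses_def)
  show "(\<lambda>n. enn2real (tuple_volume W (crosses (r n) L)) / r n ^ (2 * DIM('a) + 2)) \<longlonglongrightarrow> 8 * limit_rate W L"
  proof -
    have "(\<lambda>n. enn2real (tuple_volume W (crosses (r n) L)) / r n ^ (2 * DIM('a) + dim L))
      \<longlonglongrightarrow> (\<integral>p. limit_integrand W L p * (case p of (v, a, u, b) \<Rightarrow> of_bool (crossing_pair 1 L 0 a u (u + b))) \<partial>lborel)"
      by (rule R(2)) (simp add: crosses_def)
    then show ?thesis by (simp only: limit_rate_def planesD(2)[OF L]) simp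
  qed
  show "integrable lborel (\<lambda>p. limit_integrand W L p * (case p of (v, a, u, b) \<Rightarrow> of_bool (crossing_pair 1 L 0 a u (u + b))))"
    by (rule R(3)) (simp add: crosses_def)
qed

text \<open>
  In the coordinates of \<open>L\<close>, the displacement between the pairs tends to the component of
  \<open>u\<close> orthogonal to \<open>L\<close>. As \<open>L'\<close> is not contained in \<open>L\<close>, this has a nonzero projection onto
  \<open>L'\<close> for almost all \<open>u\<close>, whereas a crossing on \<open>L'\<close> bounds that projection by \<open>2 * r\<close>.
\<close>

lemma double_volume_limit:
  assumes L': "L' \<in> planes" and neq: "L \<noteq> L'"
  shows "tuple_volume W (\<lambda>v w x y. crosses (r n) L v w x y \<and> crosses (r n) L' v w x y) < \<infinity>"
    "(\<lambda>n. enn2real (tuple_volume W (\<lambda>v w x y. crosses (r n) L v w x y \<and> crosses (r n) L' v w x y))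
      / r n ^ (2 * DIM('a) + 2)) \<longlonglongrightarrow> 0"
proof -
  note sL = planesD(1)[OF L] and sL' = planesD(1)[OF L']
  define h where "h u = orth_proj L' (u - orth_proj L u)" for u
  have lin: "linear h" unfolding h_def
    by (intro linearI) (auto simp: orth_proj_simps[OF sL] orth_proj_simps[OF sL'] algebra_simps)
  have "\<exists>u. h u \<noteq> 0"
  proof (rule ccontr)
    assume "\<not> (\<exists>u. h u \<noteq> 0)"
    then have h0: "orth_proj L' (u - orth_proj L u) = 0" for u by (simp add: h_def)
    have "L' \<subseteq> L"
    proof
      fix z assume z: "z \<in> L'"
      let ?y = "z - orth_proj L z"
      have "?y \<bullet> z = 0" using orth_proj_orthogonal[OF sL' z, of ?y] h0[of z] by (simp add: orthogonal_def)
      moreover have "?y \<bullet> orth_proj L z = 0"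
        using orth_proj_orthogonal[OF sL orth_proj_in[OF sL, of z], of z] by (simp add: orthogonal_def)
      ultimately have "?y \<bullet> ?y = 0" by (simp add: inner_diff_right)
      then have "z = orth_proj L z" by simp
      then show "z \<in> L" using orth_proj_in[OF sL, of z] by simp
    qed
    then have "L' = L" using sL sL' planesD(2)[OF L] planesD(2)[OF L']
      by (intro subspace_dim_equal) auto
    then show False using neq by simp
  qed
  then obtain u0 where u0: "h u0 \<noteq> 0" by blast
  have AEh: "AE p :: 'a \<times> 'a \<times> 'a \<times> 'a in lborel. h (fst (snd (snd p))) \<noteq> 0"
    by (rule AE_linear_nonzero[of "\<lambda>p. h (fst (snd (snd p)))" "(0, 0, u0, 0)"])
      (auto intro!: linearI simp: u0 linear_add[OF lin] linear_scale[OF lin])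
  let ?G = "\<lambda>n v w x y. crosses (r n) L v w x y \<and> crosses (r n) L' v w x y"
  have lim: "AE p in lborel. case p of (v, a, u, b) \<Rightarrow>
      (\<lambda>n. of_bool (?G n v (v + r n *\<^sub>R a) (v + squeeze L (r n) u) (v + squeeze L (r n) u + r n *\<^sub>R b)) :: real)
        \<longlonglongrightarrow> 0"
    using AEh
  proof eventually_elim
    case (elim p)
    obtain v a u b where p: "p = (v, a, u, b)" by (cases p) auto
    have hu: "h u \<noteq> 0" using elim by (simp add: p)
    have sq: "(\<lambda>n. squeeze L (r n) u) \<longlonglongrightarrow> u - orth_proj L u"
      unfolding squeeze_def by (auto intro!: tendsto_eq_intros r(3))
    have "(\<lambda>n. norm (orth_proj L' (squeeze L (r n) u)) - 2 * r n) \<longlonglongrightarrow> norm (h u) - 2 * 0"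
      unfolding h_def
      by (intro tendsto_intros r(3) bounded_linear.tendsto[OF bounded_linear_orth_proj[OF sL']] sq)
    then have "\<forall>\<^sub>F n in sequentially. 0 < norm (orth_proj L' (squeeze L (r n) u)) - 2 * r n"
      using hu by (intro order_tendstoD(1)) auto
    then have "\<forall>\<^sub>F n in sequentially. of_bool (?G n v (v + r n *\<^sub>R a) (v + squeeze L (r n) u) (v + squeeze L (r n) u + r n *\<^sub>R b)) = (0 :: real)"
    proof eventually_elim
      case (elim n)
      have "\<not> crossing_pair (r n) L' v (v + r n *\<^sub>R a) (v + squeeze L (r n) u) (v + squeeze L (r n) u + r n *\<^sub>R b)"
        using crossing_pair_close[OF sL', of "r n" v "v + r n *\<^sub>R a" "v + squeeze L (r n) u" "v + squeeze L (r n) u + r n *\<^sub>R b"] elim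
        by (auto simp: linear_neg[OF linear_orth_proj[OF sL']])
      then show ?case by (simp add: crosses_def)
    qed
    then show ?case unfolding p prod.case by (rule tendsto_eventually)
  qed
  have G: "Measurable.pred (borel \<Otimes>\<^sub>M borel \<Otimes>\<^sub>M borel \<Otimes>\<^sub>M borel) (\<lambda>(v, w, x, y). ?G n v w x y)" for n
    using pred_intros_logic(3)[OF pred_crosses4[OF L, of "r n"] pred_crosses4[OF L', of "r n"]]
    by (simp add: split_beta')
  note R = rescaled_volume_limit[OF sL W r, of ?G "\<lambda>_. 0", OF G]
  show "tuple_volume W (?G n) < \<infinity>"
    by (rule R(1)) (use lim in \<open>auto simp: crosses_def\<close>)
  have "(\<lambda>n. enn2real (tuple_volume W (?G n)) / r n ^ (2 * DIM('a) + dim L)) \<longlonglongrightarrow> (\<integral>p. limit_integrand W L p * 0 \<partial>lborel)"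
    by (rule R(2)) (use lim in \<open>auto simp: crosses_def\<close>)
  then show "(\<lambda>n. enn2real (tuple_volume W (?G n)) / r n ^ (2 * DIM('a) + 2)) \<longlonglongrightarrow> 0"
    by (simp add: planesD(2)[OF L])
qed

end

lemma tuple_volume_eq:
  fixes W :: "'a::euclidean_space set"
  assumes "W \<in> sets borel"
    and G: "Measurable.pred (borel \<Otimes>\<^sub>M borel \<Otimes>\<^sub>M borel \<Otimes>\<^sub>M borel) (\<lambda>(v, w, x, y). G v w x y)"
  defines "D \<equiv> \<lambda>p. case p of (v, w, x, y) \<Rightarrow> (indicator W v * indicator W w * indicator W x * indicator W y * of_bool (G v w x y) :: ennreal)"
  shows "tuple_volume W G = (\<integral>\<^sup>+p. D p \<partial>lborel)" "D \<in> borel_measurable lborel"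
proof -
  let ?B = "borel :: 'a measure"
  note [measurable] = assms(1)
  have "(\<lambda>p. (case p of (v, w, x, y) \<Rightarrow> indicator W v * indicator W w * indicator W x * indicator W y) * of_bool (case p of (v, w, x, y) \<Rightarrow> G v w x y) :: ennreal)
    \<in> borel_measurable (?B \<Otimes>\<^sub>M ?B \<Otimes>\<^sub>M ?B \<Otimes>\<^sub>M ?B)"
    by (intro borel_measurable_times_ennreal of_bool_measurable[OF G]) measurable
  also have "(\<lambda>p. (case p of (v, w, x, y) \<Rightarrow> indicator W v * indicator W w * indicator W x * indicator W y) * of_bool (case p of (v, w, x, y) \<Rightarrow> G v w x y) :: ennreal) = D"
    by (auto simp: D_def fun_eq_iff)
  finally have m: "D \<in> borel_measurable (?B \<Otimes>\<^sub>M ?B \<Otimes>\<^sub>M ?B \<Otimes>\<^sub>M ?B)" .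
  then show "D \<in> borel_measurable lborel" by (simp only: borel_prod) simp
  show "tuple_volume W G = (\<integral>\<^sup>+p. D p \<partial>lborel)"
    unfolding tuple_volume_def D_def using m unfolding D_def by (rule nn_integral_lborel_4)
qed

lemma tuple_volume_Un:
  fixes W :: "'a::euclidean_space set"
  assumes W: "W \<in> sets borel"
    and G: "Measurable.pred (borel \<Otimes>\<^sub>M borel \<Otimes>\<^sub>M borel \<Otimes>\<^sub>M borel) (\<lambda>(v, w, x, y). G v w x y)"
    and H: "Measurable.pred (borel \<Otimes>\<^sub>M borel \<Otimes>\<^sub>M borel \<Otimes>\<^sub>M borel) (\<lambda>(v, w, x, y). H v w x y)"
  shows "tuple_volume W (\<lambda>v w x y. G v w x y \<or> H v w x y) + tuple_volume W (\<lambda>v w x y. G v w x y \<and> H v w x y)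
    = tuple_volume W G + tuple_volume W H"
proof -
  have GH: "Measurable.pred (borel \<Otimes>\<^sub>M borel \<Otimes>\<^sub>M borel \<Otimes>\<^sub>M borel) (\<lambda>(v, w, x, y). G v w x y \<and> H v w x y)"
    "Measurable.pred (borel \<Otimes>\<^sub>M borel \<Otimes>\<^sub>M borel \<Otimes>\<^sub>M borel) (\<lambda>(v, w, x, y). G v w x y \<or> H v w x y)"
    using pred_intros_logic(3)[OF G H] pred_intros_logic(5)[OF G H] by (simp_all add: split_beta')
  show ?thesis
    unfolding tuple_volume_eq(1)[OF W G] tuple_volume_eq(1)[OF W H] tuple_volume_eq(1)[OF W GH(1)] tuple_volume_eq(1)[OF W GH(2)]
      nn_integral_add[OF tuple_volume_eq(2)[OF W G] tuple_volume_eq(2)[OF W H], symmetric]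
      nn_integral_add[OF tuple_volume_eq(2)[OF W GH(2)] tuple_volume_eq(2)[OF W GH(1)], symmetric]
    by (intro nn_integral_cong) auto
qed

lemma plane_basis:
  fixes L :: "'a::euclidean_space set"
  assumes "L \<in> planes"
  obtains f1 f2 where "f1 \<in> L" "f2 \<in> L" "f1 \<bullet> f1 = 1" "f2 \<bullet> f2 = 1" "f1 \<bullet> f2 = 0" "f2 \<bullet> f1 = 0"
    "\<And>z. orth_proj L z = (z \<bullet> f1) *\<^sub>R f1 + (z \<bullet> f2) *\<^sub>R f2"
proof -
  obtain B where B: "B \<subseteq> L" "pairwise orthogonal B" "\<And>x. x \<in> B \<Longrightarrow> norm x = 1"
    "independent B" "card B = dim L" "span B = L"
    using orthonormal_basis_subspace[OF planesD(1)[OF assms]] by metis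
  obtain f1 f2 where f: "B = {f1, f2}" "f1 \<noteq> f2"
    using B(5) planesD(2)[OF assms] by (metis card_2_iff)
  have 1: "f1 \<bullet> f1 = 1" "f2 \<bullet> f2 = 1" using B(3) f by (simp_all add: dot_square_norm)
  have 0: "f1 \<bullet> f2 = 0" "f2 \<bullet> f1 = 0" using B(2) f by (auto simp: pairwise_def orthogonal_def)
  have "orth_proj L z = (z \<bullet> f1) *\<^sub>R f1 + (z \<bullet> f2) *\<^sub>R f2" for z
  proof (rule orth_proj_unique[OF planesD(1)[OF assms]])
    show "(z \<bullet> f1) *\<^sub>R f1 + (z \<bullet> f2) *\<^sub>R f2 \<in> L"
      using B(1) f planesD(1)[OF assms] by (auto intro!: subspace_add subspace_scale)
    fix y assume "y \<in> L"
    then have "y \<in> span {f1, f2}" using B(6) f by simp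
    then obtain c1 c2 where "y = c1 *\<^sub>R f1 + c2 *\<^sub>R f2"
      by (auto simp: span_insert span_singleton) (metis add_diff_cancel_left' diff_add_cancel)
    then show "orthogonal (z - ((z \<bullet> f1) *\<^sub>R f1 + (z \<bullet> f2) *\<^sub>R f2)) y"
      by (simp add: orthogonal_def inner_diff_left inner_add_left inner_add_right 0 1)
  qed
  then show ?thesis using that[of f1 f2] B(1) f 0 1 by simp
qed

text \<open>
  By Cramer's rule, the lines through the projected segments meet at the parameters
  \<open>sn / det\<close> and \<open>tn / det\<close>. The condition that they lie strictly between 0 and 1, with
  \<open>det < 0\<close>, is open, and it holds at an explicit point.
\<close>

lemma limit_rate_pos:
  fixes W L :: "'a::euclidean_space set"
  assumes d: "DIM('a) \<ge> 3" and W: "convex_body W" and L: "L \<in> planes"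
  shows "0 < limit_rate W L"
proof -
  note sL = planesD(1)[OF L]
  have Wc: "compact W" "convex W" "interior W \<noteq> {}" using W by (auto simp: convex_body_def)
  obtain f1 f2 where f: "f1 \<in> L" "f2 \<in> L" "f1 \<bullet> f1 = 1" "f2 \<bullet> f2 = 1" "f1 \<bullet> f2 = 0" "f2 \<bullet> f1 = 0"
    and P: "\<And>z. orth_proj L z = (z \<bullet> f1) *\<^sub>R f1 + (z \<bullet> f2) *\<^sub>R f2"
    using plane_basis[OF L] by metis
  obtain v0 where v0: "v0 \<in> interior W" using Wc(3) by blast
  define det where "det p = (case p of (v :: 'a, a, u :: 'a, b) \<Rightarrow> (b \<bullet> f1) * (a \<bullet> f2) - (a \<bullet> f1) * (b \<bullet> f2))" for p
  define sn where "sn p = (case p of (v :: 'a, a :: 'a, u, b) \<Rightarrow> (b \<bullet> f1) * (u \<bullet> f2) - (u \<bullet> f1) * (b \<bullet> f2))" for p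
  define tn where "tn p = (case p of (v :: 'a, a, u, b :: 'a) \<Rightarrow> (a \<bullet> f1) * (u \<bullet> f2) - (a \<bullet> f2) * (u \<bullet> f1))" for p
  define X where "X p = (case p of (v, a :: 'a, u, b :: 'a) \<Rightarrow> v + (u - orth_proj L u))" for p
  have cont: "continuous_on UNIV det" "continuous_on UNIV sn" "continuous_on UNIV tn" "continuous_on UNIV X"
    unfolding det_def sn_def tn_def X_def split_beta' P by (intro continuous_intros)+
  define Op where "Op = (fst -` interior W) \<inter> (X -` interior W) \<inter> {p. det p < sn p} \<inter> {p. sn p < 0}
    \<inter> {p. det p < tn p} \<inter> {p. tn p < 0} \<inter> {p. norm (fst (snd p)) < 1} \<inter> {p. norm (snd (snd (snd p))) < 1}"
  have "open Op"
    unfolding Op_def using cont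
    by (intro open_Int open_Collect_less open_vimage open_interior continuous_intros)
  \<comment> \<open>the projected segments run from 0 to f1/2 and from (f1 - f2)/4 to (f1 +
      f2)/4; their midpoints coincide\<close>
  define p0 where "p0 = (v0, (1/2) *\<^sub>R f1, (1/4) *\<^sub>R f1 - (1/4) *\<^sub>R f2, (1/2) *\<^sub>R f2)"
  have n: "norm f1 = 1" "norm f2 = 1" using f by (simp_all add: norm_eq_sqrt_inner)
  have "p0 \<in> Op"
    using v0 n by (simp add: Op_def p0_def det_def sn_def tn_def X_def P f inner_diff_left)
  then obtain e where e: "e > 0" "ball p0 e \<subseteq> Op" using \<open>open Op\<close> open_contains_ball by blast
  let ?F = "\<lambda>p. limit_integrand W L p * (case p of (v, a, u, b) \<Rightarrow> of_bool (crossing_pair 1 L 0 a u (u + b)))"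
  have ge: "indicator (ball p0 e) p \<le> ?F p" for p
  proof (cases "p \<in> ball p0 e")
    case True
    then have p: "p \<in> Op" using e(2) by blast
    obtain v a u b where pe: "p = (v, a, u, b)" by (cases p) auto
    have D: "det p < sn p" "sn p < 0" "det p < tn p" "tn p < 0" using p by (auto simp: Op_def)
    define s where "s = sn p / det p"
    define t where "t = tn p / det p"
    have s01: "s \<in> {0..1}" using D by (auto simp: s_def zero_le_divide_iff divide_le_eq_1)
    have t01: "t \<in> {0..1}" using D by (auto simp: t_def zero_le_divide_iff divide_le_eq_1)
    have sd: "s * det p = sn p" "t * det p = tn p" using D by (simp_all add: s_def t_def)
    have c1: "s * (a \<bullet> f1) - t * (b \<bullet> f1) - u \<bullet> f1 = 0"
    proof -
      have "det p * (s * (a \<bullet> f1) - t * (b \<bullet> f1) - u \<bullet> f1)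
          = (s * det p) * (a \<bullet> f1) - (t * det p) * (b \<bullet> f1) - det p * (u \<bullet> f1)"
        by (simp add: algebra_simps)
      also have "\<dots> = 0" unfolding sd by (simp add: det_def sn_def tn_def pe algebra_simps)
      finally show ?thesis using D by simp
    qed
    have c2: "s * (a \<bullet> f2) - t * (b \<bullet> f2) - u \<bullet> f2 = 0"
    proof -
      have "det p * (s * (a \<bullet> f2) - t * (b \<bullet> f2) - u \<bullet> f2)
          = (s * det p) * (a \<bullet> f2) - (t * det p) * (b \<bullet> f2) - det p * (u \<bullet> f2)"
        by (simp add: algebra_simps)
      also have "\<dots> = 0" unfolding sd by (simp add: det_def sn_def tn_def pe algebra_simps)
      finally show ?thesis using D by simp
    qed
    have "orth_proj L ((0 + s *\<^sub>R (a - 0)) - (u + t *\<^sub>R ((u + b) - u))) = 0"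
      using c1 c2 by (simp add: P inner_diff_left inner_add_left algebra_simps)
    then have "\<exists>s\<in>{0..1}. \<exists>t\<in>{0..1}. orth_proj L ((0 + s *\<^sub>R (a - 0)) - (u + t *\<^sub>R ((u + b) - u))) = 0"
      using s01 t01 by blast
    then have "crossing_pair 1 L 0 a u (u + b)"
      unfolding crossing_pair_iff[OF sL] using p by (simp add: Op_def pe)
    moreover have "v \<in> W" "v + (u - orth_proj L u) \<in> W"
      using p interior_subset[of W] by (auto simp: Op_def pe X_def)
    ultimately show ?thesis using True by (simp add: pe limit_integrand_def)
  next
    case False
    then show ?thesis by (cases p) (simp add: limit_integrand_def)
  qed
  have int: "integrable lborel ?F"
    using single_volume_limit(3)[OF d Wc(1,2) L, of "\<lambda>n. 1 / real (Suc n)"] LIMSEQ_inverse_real_of_nat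
    by (simp add: inverse_eq_divide)
  have "0 < measure lborel (ball p0 e)" using e(1) by (simp add: content_ball_pos)
  also have "\<dots> = (\<integral>p. indicator (ball p0 e) p \<partial>lborel)" by simp
  also have "\<dots> \<le> (\<integral>p. ?F p \<partial>lborel)"
    using ge int emeasure_lborel_ball_finite by (intro integral_mono integrable_real_indicator) auto
  finally show ?thesis by (simp add: limit_rate_def)
qed

section \<open>The uniform distribution on planes\<close>

lemma planes_eqI:
  assumes "L \<in> planes" "L' \<in> planes" "orth_proj L = orth_proj L'"
  shows "L = (L' :: 'a::euclidean_space set)"
proof -
  have "X = {x. orth_proj X x = x}" if "X \<in> planes" for X :: "'a set"
    using orth_proj_id[OF planesD(1)[OF that]] orth_proj_in[OF planesD(1)[OF that]] by auto metis
  from this[OF assms(1)] this[OF assms(2)] assms(3) show ?thesis by simp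
qed

lemma singleton_borel_planes:
  assumes L: "L \<in> planes" shows "{L} \<in> sets borel_planes"
proof -
  have "{L} = (\<lambda>L. Blinfun (orth_proj L)) -` {Blinfun (orth_proj L)} \<inter> space borel_planes"
  proof -
    have "X = L" if X: "X \<in> planes" and eq: "Blinfun (orth_proj X) = Blinfun (orth_proj L)" for X
    proof -
      have "blinfun_apply (Blinfun (orth_proj X)) = blinfun_apply (Blinfun (orth_proj L))" using eq by simp
      then show ?thesis
        using planes_eqI[OF X L] bounded_linear_orth_proj[OF planesD(1)[OF X]] bounded_linear_orth_proj[OF planesD(1)[OF L]]
        by (simp add: bounded_linear_Blinfun_apply)
    qed
    then show ?thesis using L by auto
  qed
  also have "\<dots> \<in> sets borel_planes"
    by (rule measurable_sets[OF measurable_Blinfun_orth_proj]) simp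
  finally show ?thesis .
qed

context
  fixes Q :: "'a::euclidean_space \<Rightarrow> 'a" assumes Q: "orthogonal_transformation Q"
begin

lemma image_planes: "L \<in> planes \<Longrightarrow> Q ` L \<in> planes"
  using dim_image_eq[OF orthogonal_transformation_linear[OF Q]
      inj_on_subset[OF orthogonal_transformation_inj[OF Q] subset_UNIV], of L]
    linear_subspace_image[OF orthogonal_transformation_linear[OF Q], of L]
  by (simp add: planes_def)

lemma orth_proj_image:
  assumes L: "L \<in> planes" shows "orth_proj (Q ` L) x = Q (orth_proj L (inv Q x))"
proof (rule orth_proj_unique)
  have s: "subspace L" using L by (rule planesD)
  show "subspace (Q ` L)" using image_planes[OF L] by (rule planesD)
  show "Q (orth_proj L (inv Q x)) \<in> Q ` L" using orth_proj_in[OF s] by simp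
  fix z assume "z \<in> Q ` L"
  then obtain y where y: "y \<in> L" "z = Q y" by auto
  have "x = Q (inv Q x)" using orthogonal_transformation_surj[OF Q] by (simp add: surj_f_inv_f)
  then have "(x - Q (orth_proj L (inv Q x))) \<bullet> z = Q (inv Q x - orth_proj L (inv Q x)) \<bullet> Q y"
    using y by (simp add: linear_diff[OF orthogonal_transformation_linear[OF Q]])
  also have "\<dots> = (inv Q x - orth_proj L (inv Q x)) \<bullet> y"
    using Q by (simp add: orthogonal_transformation_def)
  also have "\<dots> = 0" using orth_proj_orthogonal[OF s y(1)] by (simp add: orthogonal_def)
  finally show "orthogonal (x - Q (orth_proj L (inv Q x))) z" by (simp add: orthogonal_def)
qed

lemma measurable_image_planes: "(\<lambda>L. Q ` L) \<in> measurable borel_planes borel_planes"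
proof -
  have lQ: "bounded_linear Q" using orthogonal_transformation_linear[OF Q] by (simp add: linear_conv_bounded_linear)
  have liQ: "bounded_linear (inv Q)"
    using orthogonal_transformation_linear[OF orthogonal_transformation_inv[OF Q]] by (simp add: linear_conv_bounded_linear)
  have "(\<lambda>T. Blinfun Q o\<^sub>L (T o\<^sub>L Blinfun (inv Q))) \<in> borel_measurable borel"
    by (intro borel_measurable_continuous_onI continuous_intros)
  from measurable_compose[OF measurable_Blinfun_orth_proj this]
  have "(\<lambda>L. Blinfun Q o\<^sub>L (Blinfun (orth_proj L) o\<^sub>L Blinfun (inv Q))) \<in> borel_measurable borel_planes" .
  moreover have "Blinfun Q o\<^sub>L (Blinfun (orth_proj L) o\<^sub>L Blinfun (inv Q)) = Blinfun (orth_proj (Q ` L))"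
    if L: "L \<in> planes" for L
  proof (rule blinfun_eqI)
    fix x
    show "blinfun_apply (Blinfun Q o\<^sub>L (Blinfun (orth_proj L) o\<^sub>L Blinfun (inv Q))) x
      = blinfun_apply (Blinfun (orth_proj (Q ` L))) x"
      using bounded_linear_orth_proj[OF planesD(1)[OF L]] bounded_linear_orth_proj[OF planesD(1)[OF image_planes[OF L]]]
      by (simp add: bounded_linear_Blinfun_apply lQ liQ orth_proj_image[OF L])
  qed
  ultimately have m: "(\<lambda>L. Blinfun (orth_proj (Q ` L))) \<in> borel_measurable borel_planes"
    by (subst measurable_cong[symmetric]) auto
  have "(\<lambda>L. Q ` L) \<in> measurable borel_planes (vimage_algebra planes (\<lambda>L. Blinfun (orth_proj L)) borel)"
    by (rule measurable_vimage_algebra2) (use m image_planes in auto)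
  then show ?thesis by (simp only: borel_planes_def[symmetric])
qed

end

text \<open>
  Reflections along the vectors \<open>f1 + s g\<close>, with \<open>f1\<close> in the plane, \<open>g\<close> orthogonal to it and
  \<open>s > 0\<close>, take the plane to infinitely many distinct planes. By invariance all of them have
  the same mass.
\<close>

lemma uniform_on_planes_atomless:
  fixes \<nu> :: "'a::euclidean_space set measure"
  assumes \<nu>: "uniform_on_planes \<nu>" and d: "DIM('a) \<ge> 3" and L: "L \<in> planes"
  shows "emeasure \<nu> {L} = 0"
proof -
  interpret \<nu>: prob_space \<nu> using \<nu> by (simp add: uniform_on_planes_def)
  have sets: "sets \<nu> = sets borel_planes" using \<nu> by (simp add: uniform_on_planes_def)
  have space: "space \<nu> = planes" using sets_eq_imp_space_eq[OF sets] by simp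
  have inv: "emeasure \<nu> {Q ` L} = emeasure \<nu> {L}" if Q: "orthogonal_transformation Q" for Q
  proof -
    have m: "(\<lambda>L. Q ` L) \<in> measurable \<nu> borel_planes"
      using measurable_image_planes[OF Q] sets by (simp cong: measurable_cong_sets)
    have "emeasure \<nu> {Q ` L} = emeasure (distr \<nu> borel_planes (\<lambda>L. Q ` L)) {Q ` L}"
      using \<nu> Q by (simp add: uniform_on_planes_def)
    also have "\<dots> = emeasure \<nu> ((\<lambda>L. Q ` L) -` {Q ` L} \<inter> space \<nu>)"
      by (rule emeasure_distr[OF m singleton_borel_planes[OF image_planes[OF Q L]]])
    also have "(\<lambda>L. Q ` L) -` {Q ` L} \<inter> space \<nu> = {L}"
      using orthogonal_transformation_inj[OF Q] L by (auto simp: space inj_image_eq_iff)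
    finally show ?thesis .
  qed
  obtain f1 f2 where f: "f1 \<in> L" "f2 \<in> L" "f1 \<bullet> f1 = 1" using plane_basis[OF L] by metis
  obtain g where g: "norm g = 1" "\<And>z. z \<in> L \<Longrightarrow> g \<bullet> z = 0" using exists_orthogonal_to_plane[OF L d] by blast
  have gg: "g \<bullet> g = 1" using g(1) by (simp add: dot_square_norm)
  have fg: "g \<bullet> f1 = 0" "f1 \<bullet> g = 0" using g(2)[OF f(1)] by (simp_all add: inner_commute)
  define w where "w s = f1 + s *\<^sub>R g" for s :: real
  \<comment> \<open>the reflection in the hyperplane orthogonal to w s\<close>
  define Q where "Q s x = x - (2 * (x \<bullet> w s) / (w s \<bullet> w s)) *\<^sub>R w s" for s x
  have ww: "w s \<bullet> w s = 1 + s * s" for s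
    by (simp add: w_def inner_add_left inner_add_right f gg fg)
  have wpos: "w s \<bullet> w s > 0" for s unfolding ww by (smt (verit) zero_le_square)
  have Q: "orthogonal_transformation (Q s)" for s
    unfolding orthogonal_transformation_def
  proof (intro conjI allI)
    show "linear (Q s)" unfolding Q_def
      by (intro linearI) (simp_all add: algebra_simps add_divide_distrib scaleR_add_left inner_add_left)
    fix x y
    have "Q s x \<bullet> Q s y = x \<bullet> y - 2 * (y \<bullet> w s) / (w s \<bullet> w s) * (x \<bullet> w s) - 2 * (x \<bullet> w s) / (w s \<bullet> w s) * (w s \<bullet> y)
      + 2 * (x \<bullet> w s) / (w s \<bullet> w s) * (2 * (y \<bullet> w s) / (w s \<bullet> w s)) * (w s \<bullet> w s)"
      by (simp add: Q_def inner_diff_left inner_diff_right algebra_simps)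
    also have "\<dots> = x \<bullet> y" using wpos[of s] by (simp add: inner_commute field_simps)
    finally show "Q s x \<bullet> Q s y = x \<bullet> y" .
  qed
  have QQ: "Q s (Q s x) = x" for s x
  proof -
    have "Q s x \<bullet> w s = - (x \<bullet> w s)" using wpos[of s] by (simp add: Q_def inner_diff_left)
    then show ?thesis by (simp add: Q_def[of s "Q s x"]) (simp add: Q_def)
  qed
  \<comment> \<open>the reflections are involutions, so if the images agreed, then reflecting f1
      twice would lead back to L, and the component along g of the result would vanish\<close>
  have distinct: "Q s ` L \<noteq> Q s' ` L" if ss: "0 < s" "0 < s'" "s \<noteq> s'" for s s'
  proof
    assume eq: "Q s ` L = Q s' ` L"
    have "Q s f1 \<in> Q s' ` L" using eq f(1) by blast
    then obtain y where "y \<in> L" "Q s f1 = Q s' y" by auto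
    then have "Q s' (Q s f1) \<in> L" using QQ by simp
    then have 0: "Q s' (Q s f1) \<bullet> g = 0" using g(2)[of "Q s' (Q s f1)"] by (simp add: inner_commute)
    have fw: "f1 \<bullet> w s = 1" by (simp add: w_def inner_add_right f fg)
    have wg: "w s \<bullet> g = s" for s by (simp add: w_def inner_add_left fg gg)
    have wws: "w s \<bullet> w s' = 1 + s * s'" by (simp add: w_def inner_add_left inner_add_right f gg fg)
    have fw': "f1 \<bullet> w s' = 1" by (simp add: w_def inner_add_right f fg)
    have p: "1 + s * s > 0" "1 + s' * s' > 0" using wpos[of s] wpos[of s'] by (simp_all add: ww)
    have "Q s f1 \<bullet> g = - 2 * s / (1 + s * s)"
      by (simp add: Q_def inner_diff_left fg fw wg ww)
    moreover have "Q s f1 \<bullet> w s' = 1 - 2 * (1 + s * s') / (1 + s * s)"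
      by (simp add: Q_def inner_diff_left fw fw' wws ww)
    ultimately have "- 2 * s / (1 + s * s) - 2 * (1 - 2 * (1 + s * s') / (1 + s * s)) / (1 + s' * s') * s' = 0"
      using 0 by (simp add: Q_def[of s' "Q s f1"] inner_diff_left wg ww)
    then have "- 2 * s * (1 + s' * s') - 2 * ((1 + s * s) - 2 * (1 + s * s')) * s' = 0"
    proof -
      have alg: "(- 2 * s / A - 2 * (1 - 2 * C / A) / B * s') * (A * B) = - 2 * s * B - 2 * (A - 2 * C) * s'"
        if "A \<noteq> 0" "B \<noteq> 0" for A B C :: real
        using that by (simp add: field_simps)
      assume "- 2 * s / (1 + s * s) - 2 * (1 - 2 * (1 + s * s') / (1 + s * s)) / (1 + s' * s') * s' = 0"
      then show ?thesis using alg[of "1 + s * s" "1 + s' * s'" "1 + s * s'"] p by simp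
    qed
    then have "2 * ((s' - s) * (1 + s * s')) = 0" by (simp add: algebra_simps)
    moreover have "1 + s * s' > 0" using ss by (simp add: add_pos_pos)
    ultimately show False using ss by simp
  qed
  define m where "m = measure \<nu> {L}"
  have "real N * m \<le> 1" for N
  proof -
    have "(\<Sum>i<N. measure \<nu> {Q (real (Suc i)) ` L}) = measure \<nu> (\<Union>i<N. {Q (real (Suc i)) ` L})"
      using singleton_borel_planes[OF image_planes[OF Q L]] distinct
      by (intro \<nu>.finite_measure_finite_Union[symmetric]) (auto simp: sets disjoint_family_on_def)
    also have "\<dots> \<le> 1" by simp
    also have "(\<Sum>i<N. measure \<nu> {Q (real (Suc i)) ` L}) = (\<Sum>i<N. m)"
      by (simp add: measure_def inv[OF Q] m_def)
    finally show ?thesis by simp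
  qed
  then have "m \<le> 0" by (meson not_le reals_Archimedean3 not_less)
  then have "m = 0" unfolding m_def using measure_nonneg[of \<nu> "{L}"] by simp
  then show ?thesis by (simp add: m_def \<nu>.emeasure_eq_measure)
qed

section \<open>Crossings in a Poisson process\<close>

text \<open>
  The three terms of the crossing kernel are permutations of one another and have equal sums
  over all quadruples, which gives the factor \<open>3 / 24\<close>.
\<close>

lemma crossings_eq_tuple_count:
  fixes S :: "'a::euclidean_space set"
  assumes S: "finite S"
  shows "crossings r S L = real (tuple_count (crosses r L) S S S S) / 8"
proof -
  define D where "D = {(v1, v2, v3, v4). {v1, v2, v3, v4} \<subseteq> S \<and> distinct [v1, v2, v3, v4]}"
  let ?g = "\<lambda>v w x y. of_bool (crossing_pair r L v w x y) :: real"
  let ?I = "\<Sum>(v, w, x, y)\<in>D. ?g v w x y"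
  have 2: "(\<Sum>(v, w, x, y)\<in>D. ?g v x w y) = ?I"
  proof -
    have "bij_betw (\<lambda>(v, w, x, y). (v, x, w, y)) D D"
      by (rule bij_betw_byWitness[where f' = "\<lambda>(v, w, x, y). (v, x, w, y)"]) (auto simp: D_def)
    from sum.reindex_bij_betw[OF this, of "\<lambda>(v, w, x, y). ?g v w x y"]
    show ?thesis by (simp add: split_beta')
  qed
  have 3: "(\<Sum>(v, w, x, y)\<in>D. ?g v y w x) = ?I"
  proof -
    have "bij_betw (\<lambda>(v, w, x, y). (v, y, w, x)) D D"
      by (rule bij_betw_byWitness[where f' = "\<lambda>(v, w, x, y). (v, x, y, w)"]) (auto simp: D_def)
    from sum.reindex_bij_betw[OF this, of "\<lambda>(v, w, x, y). ?g v w x y"]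
    show ?thesis by (simp add: split_beta')
  qed
  have "crossings r S L = 1 / 24 * (?I + (\<Sum>(v, w, x, y)\<in>D. ?g v x w y) + (\<Sum>(v, w, x, y)\<in>D. ?g v y w x))"
    unfolding crossings_def crossing_kernel_def D_def[symmetric]
    by (simp add: split_beta' sum.distrib)
  also have "\<dots> = ?I / 8" unfolding 2 3 by simp
  also have "?I = (\<Sum>(v, w, x, y)\<in>S \<times> S \<times> S \<times> S. of_bool (crosses r L v w x y))"
    by (rule sum.mono_neutral_cong_left) (use S in \<open>auto simp: D_def crosses_def\<close>)
  also have "\<dots> = real (tuple_count (crosses r L) S S S S)"
    unfolding tuple_count_def by (simp add: sum.cartesian_product[symmetric])
  finally show ?thesis .
qed

lemma tuple_count_eq_0_iff:
  "finite S \<Longrightarrow> tuple_count K S S S S = 0 \<longleftrightarrow> (\<forall>v\<in>S. \<forall>w\<in>S. \<forall>x\<in>S. \<forall>y\<in>S. \<not> K v w x y)"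
  unfolding tuple_count_def by auto

lemma crossings_eq_0_iff:
  "finite S \<Longrightarrow> crossings r S L = 0 \<longleftrightarrow> (\<forall>v\<in>S. \<forall>w\<in>S. \<forall>x\<in>S. \<forall>y\<in>S. \<not> crosses r L v w x y)"
  by (simp add: crossings_eq_tuple_count tuple_count_eq_0_iff)

lemma crossings_eq_0_mono:
  "finite S \<Longrightarrow> r' \<le> r \<Longrightarrow> crossings r S L = 0 \<Longrightarrow> crossings r' S L = 0"
  using crossing_pair_mono[of r' L _ _ _ _ r] by (auto simp: crossings_eq_0_iff crosses_def)

lemma measurable_crossings [measurable (raw)]:
  assumes S: "S \<in> measurable M (configurations W)" and X: "X \<in> measurable M borel_planes"
  shows "(\<lambda>z. crossings r (S z) (X z)) \<in> borel_measurable M"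
proof -
  have "Measurable.pred (borel \<Otimes>\<^sub>M borel \<Otimes>\<^sub>M borel \<Otimes>\<^sub>M borel \<Otimes>\<^sub>M M) (\<lambda>(v, w, x, y, z). crosses r (X z) v w x y)"
    unfolding split_beta'
    by (intro pred_crosses measurable_compose[OF _ X]) measurable
  from measurable_compose[OF measurable_tuple_count[OF this S], of "\<lambda>n. real n / 8" borel]
  have "(\<lambda>z. real (tuple_count (crosses r (X z)) (S z) (S z) (S z) (S z)) / 8) \<in> borel_measurable M" by simp
  moreover have "finite (S z)" if "z \<in> space M" for z
    using measurable_space[OF S that] by (simp add: space_configurations)
  ultimately show ?thesis by (subst measurable_cong) (auto simp: crossings_eq_tuple_count)
qed

text \<open>
  No crossing on two planes is no tuple of the union of the two relations. Equal planes give
  the case of a single plane.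
\<close>

definition crosses_either :: "real \<Rightarrow> 'a::euclidean_space set \<Rightarrow> 'a set \<Rightarrow> 'a \<Rightarrow> 'a \<Rightarrow> 'a \<Rightarrow> 'a \<Rightarrow> bool" where
  "crosses_either r X X' v w x y \<longleftrightarrow> crosses r X v w x y \<or> crosses r X' v w x y"

lemma crosses_swap: "crosses r X v w x y \<Longrightarrow> crosses r X w v x y"
  using crossing_pair_swap by (auto simp: crosses_def)

lemma crosses_exchange: "crosses r X v w x y \<Longrightarrow> crosses r X x y v w"
  using crossing_pair_exchange by (auto simp: crosses_def)

lemma pred_crosses_either:
  assumes "X \<in> planes" "X' \<in> planes"
  shows "Measurable.pred (borel \<Otimes>\<^sub>M borel \<Otimes>\<^sub>M borel \<Otimes>\<^sub>M borel) (\<lambda>(v, w, x, y). crosses_either r X X' v w x y)"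
  using pred_intros_logic(5)[OF pred_crosses4[OF assms(1), of r] pred_crosses4[OF assms(2), of r]]
  by (simp add: split_beta' crosses_either_def)

lemma (in poisson_points) nn_integral_intensity_4:
  fixes k :: "'a \<Rightarrow> 'a \<Rightarrow> 'a \<Rightarrow> 'a \<Rightarrow> ennreal"
  assumes k: "(\<lambda>(v, w, x, y). k v w x y) \<in> borel_measurable (borel \<Otimes>\<^sub>M borel \<Otimes>\<^sub>M borel \<Otimes>\<^sub>M borel)"
  shows "(\<integral>\<^sup>+v. \<integral>\<^sup>+w. \<integral>\<^sup>+x. \<integral>\<^sup>+y. k v w x y \<partial>intensity \<partial>intensity \<partial>intensity \<partial>intensity)
    = ennreal (t ^ 4) * (\<integral>\<^sup>+v. \<integral>\<^sup>+w. \<integral>\<^sup>+x. \<integral>\<^sup>+y.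
        indicator W v * indicator W w * indicator W x * indicator W y * k v w x y \<partial>lborel \<partial>lborel \<partial>lborel \<partial>lborel)"
proof -
  let ?B = "borel :: 'a measure"
  let ?e = "\<lambda>x. ennreal t * indicator W x"
  have dens: "(\<integral>\<^sup>+x. f x \<partial>intensity) = (\<integral>\<^sup>+x. ?e x * f x \<partial>lborel)" if "f \<in> borel_measurable borel" for f
    unfolding intensity_def using that by (subst nn_integral_density) auto
  have k1: "(\<lambda>y. k v w x y) \<in> borel_measurable borel" for v w x
    using measurable_compose[OF _ k, of "\<lambda>y. (v, w, x, y)" ?B] by simp
  define F3 where "F3 v w x = (\<integral>\<^sup>+y. ?e y * k v w x y \<partial>lborel)" for v w x
  define F2 where "F2 v w = (\<integral>\<^sup>+x. ?e x * F3 v w x \<partial>lborel)" for v w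
  define F1 where "F1 v = (\<integral>\<^sup>+w. ?e w * F2 v w \<partial>lborel)" for v
  have m3: "(\<lambda>z. F3 (fst (fst z)) (snd (fst z)) (snd z)) \<in> borel_measurable ((?B \<Otimes>\<^sub>M ?B) \<Otimes>\<^sub>M ?B)"
    unfolding F3_def
  proof (rule measurable_lborel_integral)
    have "(\<lambda>q. (\<lambda>(v, w, x, y). k v w x y) (fst (fst (fst q)), snd (fst (fst q)), snd (fst q), snd q))
      \<in> borel_measurable (((?B \<Otimes>\<^sub>M ?B) \<Otimes>\<^sub>M ?B) \<Otimes>\<^sub>M ?B)"
      by (rule measurable_compose[OF _ k]) measurable
    then have [measurable]: "(\<lambda>q. k (fst (fst (fst q))) (snd (fst (fst q))) (snd (fst q)) (snd q))
      \<in> borel_measurable (((?B \<Otimes>\<^sub>M ?B) \<Otimes>\<^sub>M ?B) \<Otimes>\<^sub>M ?B)" by simp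
    show "(\<lambda>(z, y). ?e y * k (fst (fst z)) (snd (fst z)) (snd z) y)
      \<in> borel_measurable (((?B \<Otimes>\<^sub>M ?B) \<Otimes>\<^sub>M ?B) \<Otimes>\<^sub>M ?B)"
      unfolding split_beta' by measurable
  qed
  have m2: "(\<lambda>z. F2 (fst z) (snd z)) \<in> borel_measurable (?B \<Otimes>\<^sub>M ?B)"
    unfolding F2_def
  proof (rule measurable_lborel_integral)
    note [measurable] = m3
    show "(\<lambda>(z, x). ?e x * F3 (fst z) (snd z) x) \<in> borel_measurable ((?B \<Otimes>\<^sub>M ?B) \<Otimes>\<^sub>M ?B)"
      unfolding split_beta' by measurable
  qed
  have m1: "F1 \<in> borel_measurable ?B"
    unfolding F1_def[abs_def]
  proof (rule measurable_lborel_integral)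
    note [measurable] = m2
    show "(\<lambda>(v, w). ?e w * F2 v w) \<in> borel_measurable (?B \<Otimes>\<^sub>M ?B)"
      unfolding split_beta' by measurable
  qed
  have F3m: "(\<lambda>x. F3 v w x) \<in> borel_measurable ?B" for v w
    using measurable_compose[OF _ m3, of "\<lambda>x. ((v, w), x)" ?B] by simp
  have F2m: "(\<lambda>w. F2 v w) \<in> borel_measurable ?B" for v
    using measurable_compose[OF _ m2, of "\<lambda>w. (v, w)" ?B] by simp
  note [measurable] = k1 F3m F2m m1
  have "(\<integral>\<^sup>+v. \<integral>\<^sup>+w. \<integral>\<^sup>+x. \<integral>\<^sup>+y. k v w x y \<partial>intensity \<partial>intensity \<partial>intensity \<partial>intensity) = (\<integral>\<^sup>+v. ?e v * F1 v \<partial>lborel)"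
  proof -
    have "(\<integral>\<^sup>+y. k v w x y \<partial>intensity) = F3 v w x" for v w x unfolding F3_def by (rule dens[OF k1])
    moreover have "(\<integral>\<^sup>+x. F3 v w x \<partial>intensity) = F2 v w" for v w unfolding F2_def by (rule dens[OF F3m])
    moreover have "(\<integral>\<^sup>+w. F2 v w \<partial>intensity) = F1 v" for v unfolding F1_def by (rule dens[OF F2m])
    moreover have "(\<integral>\<^sup>+v. F1 v \<partial>intensity) = (\<integral>\<^sup>+v. ?e v * F1 v \<partial>lborel)" by (rule dens[OF m1])
    ultimately show ?thesis by simp
  qed
  also have "\<dots> = (\<integral>\<^sup>+v. \<integral>\<^sup>+w. \<integral>\<^sup>+x. \<integral>\<^sup>+y. ?e v * (?e w * (?e x * (?e y * k v w x y))) \<partial>lborel \<partial>lborel \<partial>lborel \<partial>lborel)"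
  proof (rule nn_integral_cong)
    fix v
    have "?e x * F3 v w x = (\<integral>\<^sup>+y. ?e x * (?e y * k v w x y) \<partial>lborel)" for w x
      unfolding F3_def by (subst nn_integral_cmult) auto
    moreover have "?e w * F2 v w = (\<integral>\<^sup>+x. ?e w * (?e x * F3 v w x) \<partial>lborel)" for w
      unfolding F2_def by (subst nn_integral_cmult) auto
    moreover have "?e v * F1 v = (\<integral>\<^sup>+w. ?e v * (?e w * F2 v w) \<partial>lborel)"
      unfolding F1_def by (subst nn_integral_cmult) auto
    moreover have "?e w * (\<integral>\<^sup>+y. ?e x * (?e y * k v w x y) \<partial>lborel) = (\<integral>\<^sup>+y. ?e w * (?e x * (?e y * k v w x y)) \<partial>lborel)" for w x
      by (subst nn_integral_cmult) auto
    moreover have "?e v * (\<integral>\<^sup>+y. ?e w * (?e x * (?e y * k v w x y)) \<partial>lborel) = (\<integral>\<^sup>+y. ?e v * (?e w * (?e x * (?e y * k v w x y))) \<partial>lborel)" for w x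
      by (subst nn_integral_cmult) auto
    moreover have "?e v * (\<integral>\<^sup>+x. ?e w * (?e x * F3 v w x) \<partial>lborel) = (\<integral>\<^sup>+x. ?e v * (?e w * (?e x * F3 v w x)) \<partial>lborel)" for w
      by (subst nn_integral_cmult) auto
    ultimately show "?e v * F1 v = (\<integral>\<^sup>+w. \<integral>\<^sup>+x. \<integral>\<^sup>+y. ?e v * (?e w * (?e x * (?e y * k v w x y))) \<partial>lborel \<partial>lborel \<partial>lborel)"
      by simp
  qed
  also have "\<dots> = (\<integral>\<^sup>+v. \<integral>\<^sup>+w. \<integral>\<^sup>+x. \<integral>\<^sup>+y. ennreal (t ^ 4) *
      (indicator W v * indicator W w * indicator W x * indicator W y * k v w x y) \<partial>lborel \<partial>lborel \<partial>lborel \<partial>lborel)"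
  proof -
    have "ennreal (t ^ 4) = ennreal t * (ennreal t * (ennreal t * ennreal t))"
      using t_pos by (simp add: ennreal_mult[symmetric] eval_nat_numeral)
    then show ?thesis by (simp only: mult_ac)
  qed
  also have "\<dots> = ennreal (t ^ 4) * (\<integral>\<^sup>+v. \<integral>\<^sup>+w. \<integral>\<^sup>+x. \<integral>\<^sup>+y.
        indicator W v * indicator W w * indicator W x * indicator W y * k v w x y \<partial>lborel \<partial>lborel \<partial>lborel \<partial>lborel)"
  proof -
    have [measurable]: "(\<lambda>q. k (fst q) (fst (snd q)) (fst (snd (snd q))) (snd (snd (snd q)))) \<in> borel_measurable (?B \<Otimes>\<^sub>M ?B \<Otimes>\<^sub>M ?B \<Otimes>\<^sub>M ?B)"
      using k by (simp add: split_beta')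
    have m: "(\<lambda>(v, w, x, y). indicator W v * indicator W w * indicator W x * indicator W y * k v w x y) \<in> borel_measurable (?B \<Otimes>\<^sub>M ?B \<Otimes>\<^sub>M ?B \<Otimes>\<^sub>M ?B)"
      "(\<lambda>(v, w, x, y). ennreal (t ^ 4) * (indicator W v * indicator W w * indicator W x * indicator W y * k v w x y)) \<in> borel_measurable (?B \<Otimes>\<^sub>M ?B \<Otimes>\<^sub>M ?B \<Otimes>\<^sub>M ?B)"
      unfolding split_beta' by measurable
    have m': "(\<lambda>(v, w, x, y). indicator W v * indicator W w * indicator W x * indicator W y * k v w x y) \<in> borel_measurable lborel"
      using m(1) by (simp only: borel_prod) simp
    show ?thesis
      unfolding nn_integral_lborel_4[OF m(1)] nn_integral_lborel_4[OF m(2)]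
      by (subst nn_integral_cmult[OF m', symmetric]) (auto intro!: nn_integral_cong)
  qed
  finally show ?thesis .
qed

text \<open>
  The points of a pair lie in a ball of radius \<open>r\<close> around each other. The pairs lie in a
  strip of width of order \<open>r\<close> around each other, for one of the two planes; this gives the
  factor 2 in \<open>\<beta>\<close>.
\<close>

lemma poisson_crossing_bounds:
  fixes W :: "'a::euclidean_space set" and P :: "'w measure"
  assumes P: "prob_space P" "poisson_process P t W \<eta>" and t: "t > 0" and r: "r > 0"
    and W: "compact W" "measure lborel W > 0" "W \<subseteq> cball 0 R" "R \<ge> 0"
    and X: "X \<in> planes" "X' \<in> planes"
  defines "\<theta> \<equiv> t ^ 4 * enn2real (tuple_volume W (crosses_either r X X')) / 8"
    and "V \<equiv> unit_ball_vol (DIM('a))"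
  defines "\<alpha> \<equiv> t * (V * r ^ DIM('a))" and "\<beta> \<equiv> t * (2 * (r ^ 2 * (V * (R + 2) ^ DIM('a))))"
  shows "exp (- \<theta>) \<le> measure P {\<omega> \<in> space P. crossings r (\<eta> \<omega>) X = 0 \<and> crossings r (\<eta> \<omega>) X' = 0}"
    and "measure P {\<omega> \<in> space P. crossings r (\<eta> \<omega>) X = 0 \<and> crossings r (\<eta> \<omega>) X' = 0}
      \<le> exp (- \<theta>) + approximation_error \<theta> \<alpha> \<beta> (t * measure lborel W)"
    and "X = X' \<Longrightarrow> (\<integral>\<omega>. crossings r (\<eta> \<omega>) X \<partial>P) = \<theta>"
proof -
  interpret prob_space P by (rule P)
  interpret poisson_points P t W \<eta>
    by standard (use P t W in auto)
  let ?K = "crosses_either r X X'"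
  let ?near = "\<lambda>x y :: 'a. norm (x - y) \<le> r"
  let ?close = "\<lambda>x y. norm (orth_proj X (x - y)) \<le> 2 * r \<or> norm (orth_proj X' (x - y)) \<le> 2 * r"
  have V: "0 \<le> V" by (simp add: V_def unit_ball_vol_nonneg)
  have [measurable]: "orth_proj Z \<in> borel_measurable borel" if "Z \<in> planes" for Z :: "'a set"
    using linear_orth_proj[OF planesD(1)[OF that]]
    by (simp add: borel_measurable_continuous_onI linear_continuous_on linear_conv_bounded_linear)
  have closeZ: "(\<integral>\<^sup>+y\<in>W. of_bool (norm (orth_proj Z (x - y)) \<le> 2 * r) \<partial>lborel) \<le> ennreal (r ^ 2 * (V * (R + 2) ^ DIM('a)))"
    if "Z \<in> planes" for Z x
    using close_volume[OF planesD(1)[OF that] r W(3) W_borel W(4), of x] planesD(2)[OF that] by (simp add: V_def)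
  interpret poisson_kernel P t W \<eta> ?K ?near ?close \<alpha> \<beta>
  proof
    show "Measurable.pred (borel \<Otimes>\<^sub>M borel \<Otimes>\<^sub>M borel \<Otimes>\<^sub>M borel) (\<lambda>(v, w, x, y). ?K v w x y)"
      using X by (rule pred_crosses_either)
    show "Measurable.pred (borel \<Otimes>\<^sub>M borel) (\<lambda>(x, y). ?near x y)" by measurable
    show "Measurable.pred (borel \<Otimes>\<^sub>M borel) (\<lambda>(x, y). ?close x y)" using X by measurable
    show "distinct [v, w, x, y]" "?near v w" if "?K v w x y" for v w x y
      using that by (auto simp: crosses_either_def crosses_def crossing_pair_def)
    show "?close v x" if "?K v w x y" for v w x y
      using that crossing_pair_close[OF planesD(1)[OF X(1)]] crossing_pair_close[OF planesD(1)[OF X(2)]]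
      by (auto simp: crosses_either_def crosses_def)
    show "?K w v x y" "?K x y v w" if "?K v w x y" for v w x y
      using that unfolding crosses_either_def by (blast intro: crosses_swap crosses_exchange)+
    show "?near y x" if "?near x y" for x y using that by (simp add: norm_minus_commute)
    show "0 \<le> \<alpha>" "0 \<le> \<beta>" using t r V W(4) by (simp_all add: \<alpha>_def \<beta>_def)
    fix x
    have "(\<integral>\<^sup>+y. of_bool (?near x y) \<partial>intensity) = ennreal t * (\<integral>\<^sup>+y\<in>W. of_bool (?near x y) \<partial>lborel)"
      by (rule nn_integral_intensity) measurable
    also have "\<dots> \<le> ennreal t * (\<integral>\<^sup>+y. of_bool (?near x y) \<partial>lborel)"
      by (intro mult_left_mono nn_integral_mono) (auto simp: indicator_def)
    also have "\<dots> = ennreal \<alpha>"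
      using near_volume[of r x] r t by (simp add: \<alpha>_def V_def ennreal_mult')
    finally show "(\<integral>\<^sup>+y. of_bool (?near x y) \<partial>intensity) \<le> ennreal \<alpha>" .
    have "(\<integral>\<^sup>+y. of_bool (?close x y) \<partial>intensity) = ennreal t * (\<integral>\<^sup>+y\<in>W. of_bool (?close x y) \<partial>lborel)"
      using X by (intro nn_integral_intensity) measurable
    also have "(\<integral>\<^sup>+y\<in>W. of_bool (?close x y) \<partial>lborel)
      \<le> (\<integral>\<^sup>+y. of_bool (norm (orth_proj X (x - y)) \<le> 2 * r) * indicator W y
          + of_bool (norm (orth_proj X' (x - y)) \<le> 2 * r) * indicator W y \<partial>lborel)"
      by (intro nn_integral_mono) (auto simp: indicator_def)
    also have "\<dots> = (\<integral>\<^sup>+y\<in>W. of_bool (norm (orth_proj X (x - y)) \<le> 2 * r) \<partial>lborel)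
      + (\<integral>\<^sup>+y\<in>W. of_bool (norm (orth_proj X' (x - y)) \<le> 2 * r) \<partial>lborel)"
      using X by (intro nn_integral_add) measurable
    also have "\<dots> \<le> ennreal (r ^ 2 * (V * (R + 2) ^ DIM('a))) + ennreal (r ^ 2 * (V * (R + 2) ^ DIM('a)))"
      by (intro add_mono closeZ X)
    also have "\<dots> = ennreal (2 * (r ^ 2 * (V * (R + 2) ^ DIM('a))))"
      using V W(4) by (subst ennreal_plus[symmetric]) auto
    finally show "(\<integral>\<^sup>+y. of_bool (?close x y) \<partial>intensity) \<le> ennreal \<beta>"
      using t by (simp add: \<beta>_def ennreal_mult' mult_left_mono)
  qed
  have kI: "k_integral = ennreal (t ^ 4) * tuple_volume W ?K"
  proof -
    have "(\<lambda>(v, w, x, y). of_bool (?K v w x y) :: ennreal) \<in> borel_measurable (borel \<Otimes>\<^sub>M borel \<Otimes>\<^sub>M borel \<Otimes>\<^sub>M borel)"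
      using of_bool_measurable[OF K_pred] by (simp add: split_beta')
    from nn_integral_intensity_4[OF this] show ?thesis
      unfolding k_integral_def tuple_volume_def .
  qed
  have mean_eq: "\<theta> = poisson_kernel.mean t W ?K"
  proof -
    have "enn2real (ennreal (t ^ 4) * tuple_volume W ?K) = t ^ 4 * enn2real (tuple_volume W ?K)"
      using t by (simp add: enn2real_mult)
    then show ?thesis using kI by (simp add: mean_def \<theta>_def)
  qed
  have err: "error = approximation_error \<theta> \<alpha> \<beta> (t * measure lborel W)"
    by (simp add: mean_eq measure_intensity)
  have ev: "{\<omega> \<in> space P. crossings r (\<eta> \<omega>) X = 0 \<and> crossings r (\<eta> \<omega>) X' = 0}
      = {\<omega> \<in> space P. tuple_count ?K (\<eta> \<omega>) (\<eta> \<omega>) (\<eta> \<omega>) (\<eta> \<omega>) = 0}"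
    using \<eta>_finite by (auto simp: crossings_eq_0_iff tuple_count_eq_0_iff crosses_either_def)
  show "exp (- \<theta>) \<le> measure P {\<omega> \<in> space P. crossings r (\<eta> \<omega>) X = 0 \<and> crossings r (\<eta> \<omega>) X' = 0}"
    "measure P {\<omega> \<in> space P. crossings r (\<eta> \<omega>) X = 0 \<and> crossings r (\<eta> \<omega>) X' = 0}
      \<le> exp (- \<theta>) + approximation_error \<theta> \<alpha> \<beta> (t * measure lborel W)"
    using poisson_approximation unfolding ev mean_eq err[unfolded mean_eq, symmetric] by simp_all
  show "(\<integral>\<omega>. crossings r (\<eta> \<omega>) X \<partial>P) = \<theta>" if eq: "X = X'"
  proof -
    let ?Y = "\<lambda>\<omega>. tuple_count ?K (\<eta> \<omega>) (\<eta> \<omega>) (\<eta> \<omega>) (\<eta> \<omega>)"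
    have K: "?K = crosses r X" using eq by (simp add: crosses_either_def fun_eq_iff)
    have "(\<integral>\<omega>. crossings r (\<eta> \<omega>) X \<partial>P) = (\<integral>\<omega>. real (?Y \<omega>) / 8 \<partial>P)"
      using \<eta>_finite by (intro Bochner_Integration.integral_cong refl) (simp add: crossings_eq_tuple_count K)
    also have "\<dots> = (\<integral>\<omega>. real (?Y \<omega>) \<partial>P) / 8" by simp
    also have "(\<integral>\<omega>. real (?Y \<omega>) \<partial>P) = enn2real (\<integral>\<^sup>+\<omega>. ennreal (real (?Y \<omega>)) \<partial>P)"
      by (rule integral_eq_nn_integral) auto
    also have "(\<integral>\<^sup>+\<omega>. ennreal (real (?Y \<omega>)) \<partial>P) = k_integral"
      unfolding expectation_Y[symmetric] by (simp add: ennreal_of_nat_eq_real_of_nat)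
    finally show ?thesis by (simp add: mean_eq mean_def)
  qed
qed

section \<open>Limits for fixed planes\<close>

definition pair_rate :: "'a::euclidean_space set \<Rightarrow> 'a set \<Rightarrow> 'a set \<Rightarrow> real" where
  "pair_rate W X X' = (if X = X' then limit_rate W X else limit_rate W X + limit_rate W X')"

lemma tendsto_zero_of_power:
  fixes x :: "nat \<Rightarrow> real"
  assumes "(\<lambda>n. x n ^ k) \<longlonglongrightarrow> 0" "0 < k" "\<And>n. 0 \<le> x n"
  shows "x \<longlonglongrightarrow> 0"
proof -
  have "(\<lambda>n. root k (x n ^ k)) \<longlonglongrightarrow> root k 0" by (rule tendsto_real_root[OF assms(1)])
  then show ?thesis using assms by (simp add: real_root_power_cancel)
qed

text \<open>
  Inclusion and exclusion; for distinct planes the joint crossings are negligible.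
\<close>

lemma either_volume_limit:
  fixes W :: "'a::euclidean_space set"
  assumes d: "DIM('a) \<ge> 3" and W: "compact W" "convex W" and X: "X \<in> planes" "X' \<in> planes"
    and r: "\<And>n. 0 < r n" "\<And>n. r n \<le> 1" "r \<longlonglongrightarrow> 0"
  shows "(\<lambda>n. enn2real (tuple_volume W (crosses_either (r n) X X')) / r n ^ (2 * DIM('a) + 2)) \<longlonglongrightarrow> 8 * pair_rate W X X'"
proof (cases "X = X'")
  case True
  then have "crosses_either (r n) X X' = crosses (r n) X" for n by (simp add: crosses_either_def fun_eq_iff)
  then show ?thesis using single_volume_limit(2)[OF d W X(1) r] True by (simp add: pair_rate_def)
next
  case False
  have Wb: "W \<in> sets borel" using W(1) by (simp add: compact_imp_closed borel_closed)
  let ?V = "\<lambda>G. enn2real (tuple_volume W G)"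
  let ?b = "\<lambda>n v w x y. crosses (r n) X v w x y \<and> crosses (r n) X' v w x y"
  have eq: "?V (crosses_either (r n) X X') = ?V (crosses (r n) X) + ?V (crosses (r n) X') - ?V (?b n)" for n
  proof -
    have u: "tuple_volume W (crosses_either (r n) X X') + tuple_volume W (?b n)
        = tuple_volume W (crosses (r n) X) + tuple_volume W (crosses (r n) X')"
      using tuple_volume_Un[OF Wb pred_crosses4[OF X(1)] pred_crosses4[OF X(2)]]
      by (simp add: crosses_either_def[abs_def])
    have fin: "tuple_volume W (crosses (r n) X) < \<infinity>" "tuple_volume W (crosses (r n) X') < \<infinity>"
      "tuple_volume W (?b n) < \<infinity>"
      using single_volume_limit(1)[OF d W X(1) r] single_volume_limit(1)[OF d W X(2) r]
        double_volume_limit(1)[OF d W X(1) r X(2) False] by auto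
    have "tuple_volume W (crosses_either (r n) X X') \<le> tuple_volume W (crosses (r n) X) + tuple_volume W (crosses (r n) X')"
      unfolding u[symmetric] by simp
    also have "\<dots> < \<infinity>" using fin(1,2) by (simp only: ennreal_add_less_top infinity_ennreal_def)
    finally have fin': "tuple_volume W (crosses_either (r n) X X') < \<infinity>" .
    have "?V (crosses_either (r n) X X') + ?V (?b n) = enn2real (tuple_volume W (crosses_either (r n) X X') + tuple_volume W (?b n))"
      using fin(3) fin' by (simp only: enn2real_plus infinity_ennreal_def)
    also have "\<dots> = ?V (crosses (r n) X) + ?V (crosses (r n) X')"
      unfolding u using fin(1,2) by (simp only: enn2real_plus infinity_ennreal_def)
    finally show ?thesis by simp
  qed
  have "(\<lambda>n. ?V (crosses (r n) X) / r n ^ (2 * DIM('a) + 2) + ?V (crosses (r n) X') / r n ^ (2 * DIM('a) + 2)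
      - ?V (?b n) / r n ^ (2 * DIM('a) + 2)) \<longlonglongrightarrow> 8 * limit_rate W X + 8 * limit_rate W X' - 0"
    by (intro tendsto_intros single_volume_limit(2)[OF d W X(1) r] single_volume_limit(2)[OF d W X(2) r]
        double_volume_limit(2)[OF d W X(1) r X(2) False])
  then show ?thesis
    unfolding eq using False by (simp add: pair_rate_def diff_divide_distrib add_divide_distrib)
qed

text \<open>
  The first, second and fourth terms, raised to the powers 4, 2 and 1, are \<open>t\<^sup>4 r\<^sup>2\<^sup>d\<^sup>+\<^sup>2\<close>
  times positive powers of \<open>r\<close>, and the third one has a factor \<open>1 / t\<close>.
\<close>

lemma error_terms_vanish:
  fixes t r :: "nat \<Rightarrow> real"
  assumes d: "d \<ge> 3" and t: "\<And>n. 0 < t n" "filterlim t at_top sequentially"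
    and r: "\<And>n. 0 < r n" "r \<longlonglongrightarrow> 0" and c: "(\<lambda>n. t n ^ 4 * r n ^ (2 * d + 2)) \<longlonglongrightarrow> c"
  shows "(\<lambda>n. t n * r n ^ d) \<longlonglongrightarrow> 0" "(\<lambda>n. t n ^ 2 * r n ^ (d + 2)) \<longlonglongrightarrow> 0"
    "(\<lambda>n. t n ^ 3 * r n ^ (2 * d + 2)) \<longlonglongrightarrow> 0" "(\<lambda>n. t n ^ 4 * r n ^ (3 * d)) \<longlonglongrightarrow> 0"
proof -
  have rp: "(\<lambda>n. r n ^ k) \<longlonglongrightarrow> 0" if "k > 0" for k
    using tendsto_power[OF r(2), of k] that by (simp add: power_0_left)
  have prod: "(\<lambda>n. t n ^ 4 * r n ^ (2 * d + 2 + k)) \<longlonglongrightarrow> 0" if "k > 0" for k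
    using tendsto_mult[OF c rp[OF that]] by (simp add: power_add mult.assoc)
  have "(\<lambda>n. (t n * r n ^ d) ^ 4) \<longlonglongrightarrow> 0"
  proof -
    have "(t n * r n ^ d) ^ 4 = t n ^ 4 * r n ^ (2 * d + 2 + (2 * d - 2))" for n
    proof -
      have "2 * d + 2 + (2 * d - 2) = d * 4" using d by simp
      then show ?thesis by (simp only: power_mult_distrib power_mult[symmetric])
    qed
    then show ?thesis using prod[of "2 * d - 2"] d by simp
  qed
  then show "(\<lambda>n. t n * r n ^ d) \<longlonglongrightarrow> 0"
  proof (rule tendsto_zero_of_power)
    show "0 \<le> t n * r n ^ d" for n using t(1)[of n] r(1)[of n] by simp
  qed simp
  have "(\<lambda>n. (t n ^ 2 * r n ^ (d + 2)) ^ 2) \<longlonglongrightarrow> 0"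
  proof -
    have "(t n ^ 2 * r n ^ (d + 2)) ^ 2 = t n ^ 4 * r n ^ (2 * d + 2 + 2)" for n
    proof -
      have "2 * d + 2 + 2 = (d + 2) * 2" by simp
      then have "r n ^ (2 * d + 2 + 2) = (r n ^ (d + 2)) ^ 2" by (simp only: power_mult)
      moreover have "t n ^ 4 = (t n ^ 2) ^ 2" by (simp only: power_mult[symmetric]) simp
      ultimately show ?thesis by (simp only: power_mult_distrib)
    qed
    then show ?thesis using prod[of 2] by simp
  qed
  then show "(\<lambda>n. t n ^ 2 * r n ^ (d + 2)) \<longlonglongrightarrow> 0"
  proof (rule tendsto_zero_of_power)
    show "0 \<le> t n ^ 2 * r n ^ (d + 2)" for n using t(1)[of n] r(1)[of n] by simp
  qed simp
  have "(\<lambda>n. inverse (t n)) \<longlonglongrightarrow> 0" using t(2) by (rule tendsto_inverse_0_at_top)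
  from tendsto_mult[OF this c]
  have "(\<lambda>n. inverse (t n) * (t n ^ 4 * r n ^ (2 * d + 2))) \<longlonglongrightarrow> 0" by simp
  moreover have "inverse (t n) * (t n ^ 4 * r n ^ (2 * d + 2)) = t n ^ 3 * r n ^ (2 * d + 2)" for n
  proof -
    have "t n ^ 4 = t n * t n ^ 3" by (simp add: eval_nat_numeral)
    then show ?thesis using t(1)[of n] by simp
  qed
  ultimately show "(\<lambda>n. t n ^ 3 * r n ^ (2 * d + 2)) \<longlonglongrightarrow> 0" by (simp only:)
  have "2 * d + 2 + (d - 2) = 3 * d" using d by simp
  then show "(\<lambda>n. t n ^ 4 * r n ^ (3 * d)) \<longlonglongrightarrow> 0" using prod[of "d - 2"] d by simp
qed

lemma no_crossing_limit:
  fixes W :: "'a::euclidean_space set" and P :: "'w measure" and \<eta> :: "nat \<Rightarrow> 'w \<Rightarrow> 'a set"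
  assumes d: "DIM('a) \<ge> 3" and W: "convex_body W" and P: "prob_space P"
    and X: "X \<in> planes" "X' \<in> planes"
    and t: "\<And>n. 0 < t n" "filterlim t at_top sequentially"
    and r: "\<And>n. 0 < r n" "\<And>n. r n \<le> 1" "r \<longlonglongrightarrow> 0"
    and \<eta>: "\<And>n. poisson_process P (t n) W (\<eta> n)"
    and c: "(\<lambda>n. t n ^ 4 * r n ^ (2 * DIM('a) + 2)) \<longlonglongrightarrow> c"
  shows "(\<lambda>n. measure P {\<omega> \<in> space P. crossings (r n) (\<eta> n \<omega>) X = 0 \<and> crossings (r n) (\<eta> n \<omega>) X' = 0})
      \<longlonglongrightarrow> exp (- (c * pair_rate W X X'))"
    and "(\<lambda>n. \<integral>\<omega>. crossings (r n) (\<eta> n \<omega>) X \<partial>P) \<longlonglongrightarrow> c * limit_rate W X"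
proof -
  have Wc: "compact W" "convex W" "interior W \<noteq> {}" using W by (auto simp: convex_body_def)
  obtain R where R: "W \<subseteq> cball 0 R" "0 \<le> R"
  proof -
    obtain a where a: "\<forall>x\<in>W. norm x \<le> a" using compact_imp_bounded[OF Wc(1)] bounded_iff by blast
    show ?thesis by (rule that[of "\<bar>a\<bar>"]) (use a in force)+
  qed
  have Wpos: "0 < measure lborel W"
  proof -
    obtain x e where e: "0 < e" "ball x e \<subseteq> W"
      using Wc(3) by (meson ex_in_conv mem_interior)
    have "0 < measure lborel (ball x e)" using e(1) by (simp add: content_ball_pos)
    also have "\<dots> \<le> measure lborel W"
      using e(2) emeasure_compact_finite[OF Wc(1)] compact_imp_closed[OF Wc(1)]
      by (intro measure_mono_fmeasurable) (auto simp: fmeasurable_def)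
    finally show ?thesis .
  qed
  define V where "V = unit_ball_vol (DIM('a))"
  let ?\<theta> = "\<lambda>X X' n. t n ^ 4 * enn2real (tuple_volume W (crosses_either (r n) X X')) / 8"
  let ?\<alpha> = "\<lambda>n. t n * (V * r n ^ DIM('a))"
  let ?\<beta> = "\<lambda>n. t n * (2 * (r n ^ 2 * (V * (R + 2) ^ DIM('a))))"
  note bounds = poisson_crossing_bounds[OF P \<eta> t(1) r(1) Wc(1) Wpos R, folded V_def]
  have \<theta>: "?\<theta> X X' \<longlonglongrightarrow> c * pair_rate W X X'" if "X \<in> planes" "X' \<in> planes" for X X'
  proof -
    have "(\<lambda>n. (t n ^ 4 * r n ^ (2 * DIM('a) + 2)) * (enn2real (tuple_volume W (crosses_either (r n) X X')) / r n ^ (2 * DIM('a) + 2)) / 8)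
      \<longlonglongrightarrow> c * (8 * pair_rate W X X') / 8"
      by (intro tendsto_intros c either_volume_limit[OF d Wc(1,2) that r]) simp
    moreover have "(t n ^ 4 * r n ^ (2 * DIM('a) + 2)) * (enn2real (tuple_volume W (crosses_either (r n) X X')) / r n ^ (2 * DIM('a) + 2)) / 8
      = ?\<theta> X X' n" for n
      using r(1)[of n] by simp
    ultimately show ?thesis by simp
  qed
  note small = error_terms_vanish[OF d t r(1) r(3) c]
  have \<alpha>0: "?\<alpha> \<longlonglongrightarrow> 0"
    using tendsto_mult_left[OF small(1), of V] by (simp add: mult_ac)
  have \<alpha>\<beta>0: "(\<lambda>n. ?\<alpha> n * ?\<beta> n) \<longlonglongrightarrow> 0"
  proof -
    have "?\<alpha> n * ?\<beta> n = (2 * V * V * (R + 2) ^ DIM('a)) * (t n ^ 2 * r n ^ (DIM('a) + 2))" for n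
      by (simp only: power_add power2_eq_square mult_ac)
    then show ?thesis using tendsto_mult_left[OF small(2), of "2 * V * V * (R + 2) ^ DIM('a)"] by (simp only: mult_zero_right)
  qed
  have \<alpha>\<alpha>\<beta>0: "(\<lambda>n. ?\<alpha> n * ?\<alpha> n * ?\<beta> n) \<longlonglongrightarrow> 0"
  proof -
    have "?\<alpha> n * ?\<alpha> n * ?\<beta> n = (2 * V * V * V * (R + 2) ^ DIM('a)) * (t n ^ 3 * r n ^ (2 * DIM('a) + 2))" for n
    proof -
      have "r n ^ (2 * DIM('a) + 2) = r n ^ DIM('a) * r n ^ DIM('a) * (r n * r n)"
        by (simp add: mult_2 power_add)
      then show ?thesis by (simp only: power2_eq_square power3_eq_cube mult_ac)
    qed
    then show ?thesis using tendsto_mult_left[OF small(3), of "2 * V * V * V * (R + 2) ^ DIM('a)"] by (simp only: mult_zero_right)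
  qed
  have \<alpha>30: "(\<lambda>n. ?\<alpha> n ^ 3 * (t n * measure lborel W)) \<longlonglongrightarrow> 0"
  proof -
    have "?\<alpha> n ^ 3 * (t n * measure lborel W) = (V ^ 3 * measure lborel W) * (t n ^ 4 * r n ^ (3 * DIM('a)))" for n
    proof -
      have "r n ^ (3 * DIM('a)) = (r n ^ DIM('a)) ^ 3" by (simp only: power_mult[symmetric] mult.commute)
      moreover have "t n ^ 4 = t n ^ 3 * t n" by (simp add: eval_nat_numeral)
      ultimately show ?thesis by (simp only: power_mult_distrib mult_ac)
    qed
    then show ?thesis using tendsto_mult_left[OF small(4), of "V ^ 3 * measure lborel W"] by (simp only: mult_zero_right)
  qed
  have err: "(\<lambda>n. approximation_error (?\<theta> X X' n) (?\<alpha> n) (?\<beta> n) (t n * measure lborel W)) \<longlonglongrightarrow> 0"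
  proof -
    have "(\<lambda>n. ?\<theta> X X' n * (256 * ?\<alpha> n + 32 * (?\<alpha> n * ?\<beta> n) + 64 * (?\<alpha> n * ?\<alpha> n) + 16 * (?\<alpha> n * ?\<alpha> n * ?\<beta> n))
        + 64 * (?\<alpha> n ^ 3 * (t n * measure lborel W)))
      \<longlonglongrightarrow> c * pair_rate W X X' * (256 * 0 + 32 * 0 + 64 * (0 * 0) + 16 * 0) + 64 * 0"
      by (intro tendsto_intros \<theta>[OF X] \<alpha>0 \<alpha>\<beta>0 \<alpha>\<alpha>\<beta>0 \<alpha>30)
    then show ?thesis unfolding approximation_error_def by (simp add: mult.assoc)
  qed
  have lower: "(\<lambda>n. exp (- ?\<theta> X X' n)) \<longlonglongrightarrow> exp (- (c * pair_rate W X X'))"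
    by (intro tendsto_intros \<theta>[OF X])
  have upper: "(\<lambda>n. exp (- ?\<theta> X X' n) + approximation_error (?\<theta> X X' n) (?\<alpha> n) (?\<beta> n) (t n * measure lborel W))
      \<longlonglongrightarrow> exp (- (c * pair_rate W X X'))"
    using tendsto_add[OF lower err] by simp
  show "(\<lambda>n. measure P {\<omega> \<in> space P. crossings (r n) (\<eta> n \<omega>) X = 0 \<and> crossings (r n) (\<eta> n \<omega>) X' = 0})
      \<longlonglongrightarrow> exp (- (c * pair_rate W X X'))"
    by (rule tendsto_sandwich[OF _ _ lower upper]) (auto intro!: always_eventually bounds(1,2)[OF X])
  show "(\<lambda>n. \<integral>\<omega>. crossings (r n) (\<eta> n \<omega>) X \<partial>P) \<longlonglongrightarrow> c * limit_rate W X"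
  proof -
    have "(\<integral>\<omega>. crossings (r n) (\<eta> n \<omega>) X \<partial>P) = ?\<theta> X X n" for n
      by (rule bounds(3)[OF X(1) X(1) refl])
    then show ?thesis using \<theta>[OF X(1) X(1)] by (simp only: pair_rate_def simp_thms if_True)
  qed
qed

text \<open>
  Lowering the radius to \<open>s\<close> with \<open>t ^ 4 * s ^ (2 * DIM('a) + 2) = c0\<close> only removes
  crossings, and for large \<open>c0\<close> the limit of the probability is below \<open>\<epsilon>\<close>.
\<close>

lemma no_crossing_limit_infinity:
  fixes W :: "'a::euclidean_space set" and P :: "'w measure" and \<eta> :: "nat \<Rightarrow> 'w \<Rightarrow> 'a set"
  assumes d: "DIM('a) \<ge> 3" and W: "convex_body W" and P: "prob_space P" and X: "X \<in> planes"
    and t: "\<And>n. 0 < t n" "filterlim t at_top sequentially"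
    and r: "\<And>n. 0 < r n" "\<And>n. r n \<le> 1" "r \<longlonglongrightarrow> 0"
    and \<eta>: "\<And>n. poisson_process P (t n) W (\<eta> n)"
    and c: "filterlim (\<lambda>n. t n ^ 4 * r n ^ (2 * DIM('a) + 2)) at_top sequentially"
  shows "(\<lambda>n. measure P {\<omega> \<in> space P. crossings (r n) (\<eta> n \<omega>) X = 0}) \<longlonglongrightarrow> 0"
proof (rule LIMSEQ_I)
  fix \<epsilon> :: real assume \<epsilon>: "\<epsilon> > 0"
  interpret prob_space P by (rule P)
  define \<rho> where "\<rho> = limit_rate W X"
  have \<rho>: "\<rho> > 0" unfolding \<rho>_def by (rule limit_rate_pos[OF d W X])
  define c0 where "c0 = max 1 ((- ln \<epsilon> + 1) / \<rho>)"
  have c0: "c0 > 0" by (simp add: c0_def)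
  have exp_small: "exp (- (c0 * \<rho>)) < \<epsilon>"
  proof -
    have "(- ln \<epsilon> + 1) / \<rho> \<le> c0" by (simp add: c0_def)
    then have "- ln \<epsilon> + 1 \<le> c0 * \<rho>" using \<rho> by (simp add: pos_divide_le_eq)
    then have "- (c0 * \<rho>) < ln \<epsilon>" by linarith
    then show ?thesis using \<epsilon> by (metis exp_less_cancel_iff exp_ln)
  qed
  let ?k = "2 * DIM('a) + 2"
  define s where "s n = min (r n) (root ?k (c0 / t n ^ 4))" for n
  have s: "\<And>n. 0 < s n" "\<And>n. s n \<le> 1" "\<And>n. s n \<le> r n"
  proof -
    fix n
    have "0 < root ?k (c0 / t n ^ 4)" using c0 t(1)[of n] by (intro real_root_gt_zero) auto
    then show "0 < s n" using r(1)[of n] by (simp add: s_def)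
    show "s n \<le> r n" by (simp add: s_def)
    then show "s n \<le> 1" using r(2)[of n] by simp
  qed
  have s0: "s \<longlonglongrightarrow> 0"
    by (rule tendsto_sandwich[OF _ _ tendsto_const r(3)]) (use s in \<open>auto simp: less_imp_le\<close>)
  have ev: "\<forall>\<^sub>F n in sequentially. t n ^ 4 * s n ^ ?k = c0"
  proof -
    have "\<forall>\<^sub>F n in sequentially. c0 \<le> t n ^ 4 * r n ^ ?k" using c by (simp add: filterlim_at_top)
    then show ?thesis
    proof eventually_elim
      case (elim n)
      have tp: "t n ^ 4 > 0" using t(1)[of n] by simp
      have "c0 / t n ^ 4 \<le> r n ^ ?k" using elim tp by (simp add: pos_divide_le_eq mult.commute)
      then have "root ?k (c0 / t n ^ 4) \<le> root ?k (r n ^ ?k)" by (simp add: real_root_le_iff del: power_Suc)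
      also have "\<dots> = r n" using r(1)[of n] by (intro real_root_power_cancel) auto
      finally have "s n = root ?k (c0 / t n ^ 4)" by (simp add: s_def)
      then have "s n ^ ?k = c0 / t n ^ 4"
        using c0 tp by (simp only: ) (rule real_root_pow_pos2, auto)
      moreover have "t n ^ 4 \<noteq> 0" using tp by linarith
      ultimately show ?case by (simp add: nonzero_mult_div_cancel_left del: power_eq_0_iff)
    qed
  qed
  have lim: "(\<lambda>n. measure P {\<omega> \<in> space P. crossings (s n) (\<eta> n \<omega>) X = 0 \<and> crossings (s n) (\<eta> n \<omega>) X = 0})
      \<longlonglongrightarrow> exp (- (c0 * pair_rate W X X))"
    by (rule no_crossing_limit(1)[OF d W P X X t s(1,2) s0 \<eta>]) (rule tendsto_eventually[OF ev])
  then have "\<forall>\<^sub>F n in sequentially. measure P {\<omega> \<in> space P. crossings (s n) (\<eta> n \<omega>) X = 0 \<and> crossings (s n) (\<eta> n \<omega>) X = 0} < \<epsilon>"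
    by (rule order_tendstoD(2)) (use exp_small in \<open>simp add: pair_rate_def \<rho>_def\<close>)
  then obtain N where N: "\<And>n. n \<ge> N \<Longrightarrow> measure P {\<omega> \<in> space P. crossings (s n) (\<eta> n \<omega>) X = 0} < \<epsilon>"
    by (auto simp: eventually_sequentially)
  have "measure P {\<omega> \<in> space P. crossings (r n) (\<eta> n \<omega>) X = 0} < \<epsilon>" if "n \<ge> N" for n
  proof -
    have \<eta>m: "\<eta> n \<in> measurable P (configurations W)" using \<eta> by (simp add: poisson_process_def)
    have fin: "finite (\<eta> n \<omega>)" if "\<omega> \<in> space P" for \<omega>
      using measurable_space[OF \<eta>m that] by (simp add: space_configurations)
    have "(\<lambda>\<omega>. crossings (s n) (\<eta> n \<omega>) X) \<in> borel_measurable P"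
      using X by (intro measurable_crossings[OF \<eta>m] measurable_const) simp
    then have m: "{\<omega> \<in> space P. crossings (s n) (\<eta> n \<omega>) X = 0} \<in> sets P" by measurable
    have "measure P {\<omega> \<in> space P. crossings (r n) (\<eta> n \<omega>) X = 0} \<le> measure P {\<omega> \<in> space P. crossings (s n) (\<eta> n \<omega>) X = 0}"
      by (rule finite_measure_mono[OF _ m]) (use fin crossings_eq_0_mono[OF _ s(3)] in auto)
    also have "\<dots> < \<epsilon>" using N that by simp
    finally show ?thesis .
  qed
  then show "\<exists>N. \<forall>n\<ge>N. norm (measure P {\<omega> \<in> space P. crossings (r n) (\<eta> n \<omega>) X = 0} - 0) < \<epsilon>"
    by auto
qed

section \<open>Limits for random planes\<close>

lemma tendsto_at_top_via_sequences:
  fixes f :: "real \<Rightarrow> real"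
  assumes ev: "eventually Q at_top"
    and seq: "\<And>X. filterlim X at_top sequentially \<Longrightarrow> (\<And>n. Q (X n)) \<Longrightarrow> (\<lambda>n. f (X n)) \<longlonglongrightarrow> l"
  shows "(f \<longlongrightarrow> l) at_top"
proof (rule tendsto_at_topI_sequentially)
  fix X :: "nat \<Rightarrow> real" assume X: "filterlim X at_top sequentially"
  have "\<forall>\<^sub>F n in sequentially. Q (X n)" using X ev by (auto simp: filterlim_iff)
  then obtain N where N: "\<And>n. n \<ge> N \<Longrightarrow> Q (X n)" by (auto simp: eventually_sequentially)
  have "filterlim (\<lambda>n. X (n + N)) at_top sequentially"
    using filterlim_compose[OF X filterlim_add_const_nat_at_top] by simp
  then have "(\<lambda>n. f (X (n + N))) \<longlonglongrightarrow> l" using N by (intro seq) auto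
  then show "(\<lambda>n. f (X n)) \<longlonglongrightarrow> l" by (rule LIMSEQ_offset)
qed

text \<open>
  The two moments give convergence to \<open>\<mu>\<close> in mean square, and the \<open>m\<close>-th power is Lipschitz
  on the unit interval with constant \<open>m\<close>.
\<close>

lemma (in prob_space) power_expectation_limit:
  fixes q :: "nat \<Rightarrow> 'a \<Rightarrow> real"
  assumes q: "\<And>n. q n \<in> borel_measurable M" "\<And>n \<omega>. 0 \<le> q n \<omega>" "\<And>n \<omega>. q n \<omega> \<le> 1"
    and \<mu>: "0 \<le> \<mu>" "\<mu> \<le> 1"
    and 1: "(\<lambda>n. \<integral>\<omega>. q n \<omega> \<partial>M) \<longlonglongrightarrow> \<mu>" and 2: "(\<lambda>n. \<integral>\<omega>. q n \<omega> ^ 2 \<partial>M) \<longlonglongrightarrow> \<mu> ^ 2"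
  shows "(\<lambda>n. 1 - (\<integral>\<omega>. (1 - q n \<omega>) ^ m \<partial>M)) \<longlonglongrightarrow> 1 - (1 - \<mu>) ^ m"
proof -
  note [measurable] = q(1)
  have int: "integrable M (q n)" "integrable M (\<lambda>\<omega>. q n \<omega> ^ 2)" "integrable M (\<lambda>\<omega>. (1 - q n \<omega>) ^ m)" for n
    using q(2,3) by (auto intro!: integrable_const_bound[where B = 1] simp: power_le_one)
  let ?D = "\<lambda>n \<omega>. \<bar>q n \<omega> - \<mu>\<bar>"
  have D1: "?D n \<omega> \<le> 1" for n \<omega> using q(2,3)[of n \<omega>] \<mu> by auto
  have intD: "integrable M (?D n)" "integrable M (\<lambda>\<omega>. ?D n \<omega> ^ 2)" for n
    using D1 by (auto intro!: integrable_const_bound[where B = 1] simp: power_le_one abs_square_le_1)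
  have sq: "(\<integral>\<omega>. ?D n \<omega> ^ 2 \<partial>M) = (\<integral>\<omega>. q n \<omega> ^ 2 \<partial>M) - 2 * \<mu> * (\<integral>\<omega>. q n \<omega> \<partial>M) + \<mu> ^ 2" for n
  proof -
    have "(\<integral>\<omega>. ?D n \<omega> ^ 2 \<partial>M) = (\<integral>\<omega>. q n \<omega> ^ 2 - 2 * \<mu> * q n \<omega> + \<mu> ^ 2 \<partial>M)"
      by (intro Bochner_Integration.integral_cong) (auto simp: power2_eq_square algebra_simps)
    then show ?thesis using int by (simp add: prob_space)
  qed
  have "(\<lambda>n. (\<integral>\<omega>. q n \<omega> ^ 2 \<partial>M) - 2 * \<mu> * (\<integral>\<omega>. q n \<omega> \<partial>M) + \<mu> ^ 2) \<longlonglongrightarrow> \<mu> ^ 2 - 2 * \<mu> * \<mu> + \<mu> ^ 2"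
    by (intro tendsto_intros 1 2)
  then have D2: "(\<lambda>n. \<integral>\<omega>. ?D n \<omega> ^ 2 \<partial>M) \<longlonglongrightarrow> 0"
  proof -
    have "\<mu> ^ 2 - 2 * \<mu> * \<mu> + \<mu> ^ 2 = 0" by (simp add: power2_eq_square)
    then show ?thesis
      using \<open>(\<lambda>n. (\<integral>\<omega>. q n \<omega> ^ 2 \<partial>M) - 2 * \<mu> * (\<integral>\<omega>. q n \<omega> \<partial>M) + \<mu> ^ 2) \<longlonglongrightarrow> _\<close>
      by (simp only: sq)
  qed
  have ED: "(\<integral>\<omega>. ?D n \<omega> \<partial>M) \<le> sqrt (\<integral>\<omega>. ?D n \<omega> ^ 2 \<partial>M)" for n
  proof -
    have "0 \<le> (\<integral>\<omega>. ?D n \<omega> ^ 2 \<partial>M) - (\<integral>\<omega>. ?D n \<omega> \<partial>M) ^ 2"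
      using variance_eq[OF intD] variance_positive[of "?D n"] by simp
    then show ?thesis by (intro real_le_rsqrt) simp
  qed
  have bound: "\<bar>(1 - (\<integral>\<omega>. (1 - q n \<omega>) ^ m \<partial>M)) - (1 - (1 - \<mu>) ^ m)\<bar> \<le> real m * sqrt (\<integral>\<omega>. ?D n \<omega> ^ 2 \<partial>M)" for n
  proof -
    have "\<bar>(1 - (\<integral>\<omega>. (1 - q n \<omega>) ^ m \<partial>M)) - (1 - (1 - \<mu>) ^ m)\<bar> = \<bar>\<integral>\<omega>. (1 - q n \<omega>) ^ m - (1 - \<mu>) ^ m \<partial>M\<bar>"
      using int(3) by (simp add: prob_space abs_minus_commute)
    also have "\<dots> \<le> (\<integral>\<omega>. \<bar>(1 - q n \<omega>) ^ m - (1 - \<mu>) ^ m\<bar> \<partial>M)"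
      by (rule integral_abs_bound)
    also have "\<dots> \<le> (\<integral>\<omega>. real m * ?D n \<omega> \<partial>M)"
    proof (rule integral_mono)
      show "integrable M (\<lambda>\<omega>. \<bar>(1 - q n \<omega>) ^ m - (1 - \<mu>) ^ m\<bar>)" using int(3) by simp
      show "integrable M (\<lambda>\<omega>. real m * ?D n \<omega>)" using intD(1) by simp
      fix \<omega>
      have "norm ((1 - q n \<omega>) ^ m - (1 - \<mu>) ^ m) \<le> real m * norm ((1 - q n \<omega>) - (1 - \<mu>))"
        using q(2,3)[of n \<omega>] \<mu> by (intro norm_power_diff) auto
      then show "\<bar>(1 - q n \<omega>) ^ m - (1 - \<mu>) ^ m\<bar> \<le> real m * ?D n \<omega>"
        by (simp add: abs_minus_commute)
    qed
    also have "\<dots> = real m * (\<integral>\<omega>. ?D n \<omega> \<partial>M)" by simp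
    also have "\<dots> \<le> real m * sqrt (\<integral>\<omega>. ?D n \<omega> ^ 2 \<partial>M)" by (intro mult_left_mono ED) simp
    finally show ?thesis .
  qed
  have "(\<lambda>n. real m * sqrt (\<integral>\<omega>. ?D n \<omega> ^ 2 \<partial>M)) \<longlonglongrightarrow> real m * sqrt 0"
    by (intro tendsto_intros D2)
  then have lim0: "(\<lambda>n. real m * sqrt (\<integral>\<omega>. ?D n \<omega> ^ 2 \<partial>M)) \<longlonglongrightarrow> 0"
    by (simp only: real_sqrt_zero mult_zero_right)
  have "(\<lambda>n. (1 - (\<integral>\<omega>. (1 - q n \<omega>) ^ m \<partial>M)) - (1 - (1 - \<mu>) ^ m)) \<longlonglongrightarrow> 0"
    by (rule Lim_null_comparison[OF always_eventually lim0], rule allI, unfold real_norm_def, rule bound)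
  then show ?thesis by (rule LIM_zero_cancel)
qed

lemma abs_mult_le_1: "0 \<le> a \<Longrightarrow> a \<le> 1 \<Longrightarrow> 0 \<le> b \<Longrightarrow> b \<le> 1 \<Longrightarrow> \<bar>a * b\<bar> \<le> (1 :: real)"
  by (simp add: abs_mult mult_le_one)

definition limit_probability :: "'a::euclidean_space set \<Rightarrow> 'a set measure \<Rightarrow> real \<Rightarrow> real" where
  "limit_probability W \<nu> c = (\<integral>X. exp (- (c * limit_rate W X)) \<partial>\<nu>)"

locale projected_rgg_limit = projected_rgg P W r \<eta> \<nu> L
  for P :: "'w measure" and W :: "'a::euclidean_space set" and r \<eta> \<nu> L +
  assumes dimension: "DIM('a) \<ge> 3" and body: "convex_body W" and uniform: "uniform_on_planes \<nu>"
begin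

sublocale \<nu>: prob_space \<nu>
  using uniform by (simp add: uniform_on_planes_def)

sublocale pair: pair_prob_space P \<nu> ..

lemma sets_\<nu> [measurable_cong]: "sets \<nu> = sets borel_planes"
  using uniform by (simp add: uniform_on_planes_def)

lemma space_\<nu> [simp]: "space \<nu> = planes"
  using sets_eq_imp_space_eq[OF sets_\<nu>] by simp

lemma \<eta>_measurable: "t > 0 \<Longrightarrow> \<eta> t \<in> measurable P (configurations W)"
  using poisson by (simp add: poisson_process_def)

definition free :: "real \<Rightarrow> 'w \<Rightarrow> 'a set \<Rightarrow> real" where
  "free t \<omega> X = of_bool (crossings (r t) (\<eta> t \<omega>) X = 0)"

definition free_prob :: "real \<Rightarrow> 'w \<Rightarrow> real" where
  "free_prob t \<omega> = (\<integral>X. free t \<omega> X \<partial>\<nu>)"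

lemma free_bounds: "0 \<le> free t \<omega> X" "free t \<omega> X \<le> 1" "\<bar>free t \<omega> X\<bar> \<le> 1"
  by (simp_all add: free_def)

lemma free_measurable:
  assumes t: "t > 0" and u: "u \<in> measurable M P" and X: "X \<in> measurable M borel_planes"
  shows "(\<lambda>z. free t (u z) (X z)) \<in> borel_measurable M"
proof -
  have "(\<lambda>z. crossings (r t) (\<eta> t (u z)) (X z)) \<in> borel_measurable M"
    by (rule measurable_crossings[OF measurable_compose[OF u \<eta>_measurable[OF t]] X])
  then have "Measurable.pred M (\<lambda>z. crossings (r t) (\<eta> t (u z)) (X z) = 0)" by measurable
  then show ?thesis unfolding free_def by simp
qed

lemma id_planes: "(\<lambda>X. X) \<in> measurable \<nu> borel_planes"
  using measurable_ident_sets[OF sets_\<nu>] by simp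

lemma free_measurable_pair: "t > 0 \<Longrightarrow> (\<lambda>(\<omega>, X). free t \<omega> X) \<in> borel_measurable (P \<Otimes>\<^sub>M \<nu>)"
  unfolding split_beta'
  by (intro free_measurable measurable_compose[OF measurable_snd id_planes]) auto

lemma free_prob_measurable: "t > 0 \<Longrightarrow> free_prob t \<in> borel_measurable P"
  unfolding free_prob_def[abs_def]
  by (intro \<nu>.borel_measurable_lebesgue_integral free_measurable_pair)

lemma free_prob_bounds: "t > 0 \<Longrightarrow> 0 \<le> free_prob t \<omega>" "t > 0 \<Longrightarrow> free_prob t \<omega> \<le> 1"
proof -
  show "0 \<le> free_prob t \<omega>" unfolding free_prob_def by (intro integral_nonneg_AE) (simp add: free_bounds)
  have "free_prob t \<omega> \<le> (\<integral>X. 1 \<partial>\<nu>)"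
    unfolding free_prob_def by (intro integral_mono' ) (auto simp: free_bounds)
  then show "free_prob t \<omega> \<le> 1" using \<nu>.prob_space by simp
qed

lemma free_integral_\<omega>:
  assumes "t > 0" "X \<in> planes" "X' \<in> planes"
  shows "(\<integral>\<omega>. free t \<omega> X * free t \<omega> X' \<partial>P) =
    measure P {\<omega> \<in> space P. crossings (r t) (\<eta> t \<omega>) X = 0 \<and> crossings (r t) (\<eta> t \<omega>) X' = 0}"
proof -
  have "(\<integral>\<omega>. free t \<omega> X * free t \<omega> X' \<partial>P) =
    (\<integral>\<omega>. indicator {\<omega> \<in> space P. crossings (r t) (\<eta> t \<omega>) X = 0 \<and> crossings (r t) (\<eta> t \<omega>) X' = 0} \<omega> \<partial>P)"
    by (intro Bochner_Integration.integral_cong) (auto simp: free_def)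
  moreover have "{\<omega> \<in> space P. crossings (r t) (\<eta> t \<omega>) X = 0 \<and> crossings (r t) (\<eta> t \<omega>) X' = 0} \<inter> space P
    = {\<omega> \<in> space P. crossings (r t) (\<eta> t \<omega>) X = 0 \<and> crossings (r t) (\<eta> t \<omega>) X' = 0}" by auto
  ultimately show ?thesis by (simp only: Bochner_Integration.integral_indicator)
qed

lemma free_square: "free t \<omega> X * free t \<omega> X = free t \<omega> X"
  by (simp add: free_def)

text \<open>
  The square of the indicator is kept, so that both moments are integrals of the same
  function of two planes.
\<close>

lemma expectation_free_prob:
  assumes t: "t > 0"
  shows "(\<integral>\<omega>. free_prob t \<omega> \<partial>P) = (\<integral>X. \<integral>\<omega>. free t \<omega> X * free t \<omega> X \<partial>P \<partial>\<nu>)"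
  unfolding free_prob_def free_square
  by (rule pair.Fubini_integral[symmetric])
    (use free_measurable_pair[OF t] free_bounds in \<open>auto intro!: pair.P.integrable_const_bound[where B = 1]\<close>)

lemma expectation_free_prob_square:
  assumes t: "t > 0"
  shows "(\<integral>\<omega>. free_prob t \<omega> ^ 2 \<partial>P) = (\<integral>X. \<integral>X'. \<integral>\<omega>. free t \<omega> X * free t \<omega> X' \<partial>P \<partial>\<nu> \<partial>\<nu>)"
proof -
  have m2: "(\<lambda>(\<omega>, X). free t \<omega> X * free_prob t \<omega>) \<in> borel_measurable (P \<Otimes>\<^sub>M \<nu>)"
    using borel_measurable_times[OF free_measurable_pair[OF t] measurable_compose[OF measurable_fst free_prob_measurable[OF t]]]
    by (simp add: split_beta')
  have "(\<integral>\<omega>. free_prob t \<omega> ^ 2 \<partial>P) = (\<integral>\<omega>. \<integral>X. free t \<omega> X * free_prob t \<omega> \<partial>\<nu> \<partial>P)"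
    by (simp add: power2_eq_square free_prob_def)
  also have "\<dots> = (\<integral>X. \<integral>\<omega>. free t \<omega> X * free_prob t \<omega> \<partial>P \<partial>\<nu>)"
    by (rule pair.Fubini_integral[symmetric])
      (use m2 abs_mult_le_1[OF free_bounds(1,2) free_prob_bounds[OF t]] in
        \<open>auto intro!: pair.P.integrable_const_bound[where B = 1]\<close>)
  also have "\<dots> = (\<integral>X. \<integral>X'. \<integral>\<omega>. free t \<omega> X * free t \<omega> X' \<partial>P \<partial>\<nu> \<partial>\<nu>)"
  proof (rule Bochner_Integration.integral_cong[OF refl])
    fix X assume X: "X \<in> space \<nu>"
    have m3: "(\<lambda>(\<omega>, X'). free t \<omega> X * free t \<omega> X') \<in> borel_measurable (P \<Otimes>\<^sub>M \<nu>)"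
    proof -
      have "(\<lambda>\<omega>. free t \<omega> X) \<in> borel_measurable P" using X by (intro free_measurable[OF t]) auto
      then show ?thesis
        using borel_measurable_times[OF measurable_compose[OF measurable_fst] free_measurable_pair[OF t]]
        by (simp add: split_beta')
    qed
    have "(\<integral>\<omega>. free t \<omega> X * free_prob t \<omega> \<partial>P) = (\<integral>\<omega>. \<integral>X'. free t \<omega> X * free t \<omega> X' \<partial>\<nu> \<partial>P)"
      by (simp add: free_prob_def)
    also have "\<dots> = (\<integral>X'. \<integral>\<omega>. free t \<omega> X * free t \<omega> X' \<partial>P \<partial>\<nu>)"
      by (rule pair.Fubini_integral[symmetric])
        (use m3 abs_mult_le_1[OF free_bounds(1,2) free_bounds(1,2)] in
          \<open>auto intro!: pair.P.integrable_const_bound[where B = 1]\<close>)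
    finally show "(\<integral>\<omega>. free t \<omega> X * free_prob t \<omega> \<partial>P) = (\<integral>X'. \<integral>\<omega>. free t \<omega> X * free t \<omega> X' \<partial>P \<partial>\<nu>)" .
  qed
  finally show ?thesis .
qed

lemma L_measurable: "i \<ge> 1 \<Longrightarrow> L i \<in> measurable P borel_planes"
  using planes_indep by (simp add: indep_vars_def)

text \<open>
  By independence the point process may be frozen; then the events that the planes show a
  crossing are independent with equal probabilities.
\<close>

lemma probability_formula:
  assumes t: "t > 0" and m: "m \<ge> 1"
  shows "measure P {\<omega> \<in> space P. \<exists>i\<in>{1..m}. crossings (r t) (\<eta> t \<omega>) (L i \<omega>) = 0}
    = 1 - (\<integral>\<omega>. (1 - free_prob t \<omega>) ^ m \<partial>P)"
proof -
  let ?S = "configurations W" and ?N = "\<Pi>\<^sub>M i\<in>{1::nat..}. (borel_planes :: 'a set measure)"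
  let ?l = "\<lambda>\<omega>. \<lambda>i\<in>{1..}. L i \<omega>"
  have lm: "?l \<in> measurable P ?N"
    by (rule measurable_restrict) (use L_measurable in auto)
  have Zm: "(\<lambda>\<omega>. (\<eta> t \<omega>, ?l \<omega>)) \<in> measurable P (?S \<Otimes>\<^sub>M ?N)"
    using \<eta>_measurable[OF t] lm by (rule measurable_Pair)
  define R where "R = distr P ?N ?l"
  interpret R: prob_space R unfolding R_def by (rule prob_space_distr[OF lm])
  have crm: "(\<lambda>z. crossings (r t) (fst z) (snd z i)) \<in> borel_measurable (?S \<Otimes>\<^sub>M ?N)" if "i \<in> {1..m}" for i
    using that by (intro measurable_crossings measurable_compose[OF measurable_snd measurable_component_singleton]) auto
  define B where "B = {z \<in> space (?S \<Otimes>\<^sub>M ?N). \<forall>i\<in>{1..m}. crossings (r t) (fst z) (snd z i) \<noteq> 0}"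
  have B: "B \<in> sets (?S \<Otimes>\<^sub>M ?N)"
  proof -
    have "Measurable.pred (?S \<Otimes>\<^sub>M ?N) (\<lambda>z. crossings (r t) (fst z) (snd z i) \<noteq> 0)" if "i \<in> {1..m}" for i
      using crm[OF that] by measurable
    then have "Measurable.pred (?S \<Otimes>\<^sub>M ?N) (\<lambda>z. \<forall>i\<in>{1..m}. crossings (r t) (fst z) (snd z i) \<noteq> 0)"
      by (intro pred_intros_finite) auto
    then show ?thesis unfolding B_def by measurable
  qed
  let ?C = "{\<omega> \<in> space P. \<forall>i\<in>{1..m}. crossings (r t) (\<eta> t \<omega>) (L i \<omega>) \<noteq> 0}"
  have pre: "(\<lambda>\<omega>. (\<eta> t \<omega>, ?l \<omega>)) -` B \<inter> space P = ?C"
    using measurable_space[OF Zm] by (auto simp: B_def)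
  have C: "?C \<in> sets P" unfolding pre[symmetric] using Zm B by (rule measurable_sets)
  have slice: "emeasure R (Pair S -` B) = ennreal ((1 - (\<integral>X. of_bool (crossings (r t) S X = 0) \<partial>\<nu>)) ^ m)"
    if S: "S \<in> space ?S" for S
  proof -
    define D where "D = {X \<in> planes. crossings (r t) S X \<noteq> 0}"
    have crS: "(\<lambda>X. crossings (r t) S X) \<in> borel_measurable borel_planes"
      by (rule measurable_crossings[where W = W]) (use S in auto)
    have D: "D \<in> sets borel_planes"
    proof -
      have "{X \<in> space borel_planes. crossings (r t) S X \<noteq> 0} \<in> sets borel_planes" using crS by measurable
      then show ?thesis by (simp add: D_def)
    qed
    have "emeasure R (Pair S -` B) = emeasure P (?l -` (Pair S -` B) \<inter> space P)"
      unfolding R_def by (rule emeasure_distr[OF lm sets_Pair1[OF B]])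
    also have "?l -` (Pair S -` B) \<inter> space P = (\<Inter>i\<in>{1..m}. L i -` D \<inter> space P)"
    proof -
      have "?l \<omega> \<in> space ?N" "\<And>i. i \<ge> 1 \<Longrightarrow> L i \<omega> \<in> planes" if "\<omega> \<in> space P" for \<omega>
        using measurable_space[OF lm that] measurable_space[OF L_measurable that] by simp_all
      then show ?thesis using S m by (auto simp: B_def D_def space_pair_measure)
    qed
    also have "emeasure P \<dots> = ennreal (\<Prod>i\<in>{1..m}. prob (L i -` D \<inter> space P))"
      unfolding emeasure_eq_measure using m D
      by (subst indep_varsD[OF planes_indep, of "{1..m}"]) auto
    also have "(\<Prod>i\<in>{1..m}. prob (L i -` D \<inter> space P)) = (\<Prod>i\<in>{1..m}. measure \<nu> D)"
    proof (rule prod.cong[OF refl])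
      fix i assume i: "i \<in> {1..m}"
      then have "measure \<nu> D = measure (distr P borel_planes (L i)) D" using planes_distr by simp
      also have "\<dots> = prob (L i -` D \<inter> space P)" using i D by (intro measure_distr L_measurable) auto
      finally show "prob (L i -` D \<inter> space P) = measure \<nu> D" by simp
    qed
    also have "(\<Prod>i\<in>{1..m}. measure \<nu> D) = measure \<nu> D ^ m" by simp
    also have "measure \<nu> D = 1 - (\<integral>X. of_bool (crossings (r t) S X = 0) \<partial>\<nu>)"
    proof -
      have D': "D \<in> sets \<nu>" using D by (simp add: sets_\<nu>)
      have "(\<integral>X. of_bool (crossings (r t) S X = 0) \<partial>\<nu>) = (\<integral>X. indicator (space \<nu> - D) X \<partial>\<nu>)"
        by (intro Bochner_Integration.integral_cong) (auto simp: D_def)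
      also have "\<dots> = measure \<nu> (space \<nu> - D)" by (simp add: Int_absorb2)
      also have "\<dots> = 1 - measure \<nu> D" by (rule \<nu>.prob_compl[OF D'])
      finally show ?thesis by simp
    qed
    finally show ?thesis .
  qed
  have "emeasure P ?C = emeasure (distr P (?S \<Otimes>\<^sub>M ?N) (\<lambda>\<omega>. (\<eta> t \<omega>, ?l \<omega>))) B"
    unfolding pre[symmetric] by (rule emeasure_distr[OF Zm B, symmetric])
  also have "\<dots> = emeasure (distr P ?S (\<eta> t) \<Otimes>\<^sub>M R) B"
    unfolding planes_process_indep[OF t] R_def ..
  also have "\<dots> = (\<integral>\<^sup>+S. emeasure R (Pair S -` B) \<partial>distr P ?S (\<eta> t))"
    by (rule R.emeasure_pair_measure_alt) (use B in \<open>simp add: R_def cong: sets_pair_measure_cong\<close>)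
  also have "\<dots> = (\<integral>\<^sup>+S. ennreal ((1 - (\<integral>X. of_bool (crossings (r t) S X = 0) \<partial>\<nu>)) ^ m) \<partial>distr P ?S (\<eta> t))"
    by (intro nn_integral_cong slice) simp
  also have "\<dots> = (\<integral>\<^sup>+\<omega>. ennreal ((1 - free_prob t \<omega>) ^ m) \<partial>P)"
  proof -
    have "(\<lambda>S. \<integral>X. of_bool (crossings (r t) S X = 0) \<partial>\<nu> :: real) \<in> borel_measurable ?S"
    proof (rule \<nu>.borel_measurable_lebesgue_integral)
      have "(\<lambda>z. crossings (r t) (fst z) (snd z)) \<in> borel_measurable (?S \<Otimes>\<^sub>M \<nu>)"
        by (intro measurable_crossings measurable_compose[OF measurable_snd id_planes]) auto
      then have "Measurable.pred (?S \<Otimes>\<^sub>M \<nu>) (\<lambda>z. crossings (r t) (fst z) (snd z) = 0)" by measurable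
      from of_bool_measurable[OF this]
      show "(\<lambda>(S, X). of_bool (crossings (r t) S X = 0) :: real) \<in> borel_measurable (?S \<Otimes>\<^sub>M \<nu>)"
        by (simp add: split_beta')
    qed
    then show ?thesis
      using \<eta>_measurable[OF t] by (subst nn_integral_distr) (auto simp: free_prob_def free_def)
  qed
  also have "\<dots> = ennreal (\<integral>\<omega>. (1 - free_prob t \<omega>) ^ m \<partial>P)"
  proof (rule nn_integral_eq_integral)
    show "integrable P (\<lambda>\<omega>. (1 - free_prob t \<omega>) ^ m)"
      using free_prob_measurable[OF t] free_prob_bounds[OF t]
      by (intro integrable_const_bound[where B = 1]) (auto simp: power_le_one)
  qed (use free_prob_bounds[OF t] in auto)
  finally have "prob ?C = (\<integral>\<omega>. (1 - free_prob t \<omega>) ^ m \<partial>P)"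
    using free_prob_bounds[OF t] by (simp add: emeasure_eq_measure integral_nonneg_AE)
  moreover have "{\<omega> \<in> space P. \<exists>i\<in>{1..m}. crossings (r t) (\<eta> t \<omega>) (L i \<omega>) = 0} = space P - ?C" by auto
  ultimately show ?thesis using prob_compl[OF C] by simp
qed

end

context projected_rgg_limit
begin

lemma free_pair_measurable:
  assumes t: "t > 0"
  shows "(\<lambda>(X, X'). \<integral>\<omega>. free t \<omega> X * free t \<omega> X' \<partial>P) \<in> borel_measurable (\<nu> \<Otimes>\<^sub>M \<nu>)"
proof -
  have "(\<lambda>z. \<integral>\<omega>. free t \<omega> (fst z) * free t \<omega> (snd z) \<partial>P) \<in> borel_measurable (\<nu> \<Otimes>\<^sub>M \<nu>)"
  proof (rule borel_measurable_lebesgue_integral)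
    show "(\<lambda>(z, \<omega>). free t \<omega> (fst z) * free t \<omega> (snd z)) \<in> borel_measurable ((\<nu> \<Otimes>\<^sub>M \<nu>) \<Otimes>\<^sub>M P)"
      unfolding split_beta'
      by (intro borel_measurable_times free_measurable[OF t] measurable_snd
          measurable_compose[OF measurable_compose[OF measurable_fst measurable_fst] id_planes]
          measurable_compose[OF measurable_compose[OF measurable_fst measurable_snd] id_planes])
  qed
  then show ?thesis by (simp add: split_beta')
qed

lemma free_pair_measurable_1:
  assumes t: "t > 0" and X: "X \<in> planes"
  shows "(\<lambda>X'. \<integral>\<omega>. free t \<omega> X * free t \<omega> X' \<partial>P) \<in> borel_measurable \<nu>"
  using measurable_compose[OF _ free_pair_measurable[OF t], of "\<lambda>X'. (X, X')" \<nu>] X by simp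

lemma free_diagonal_measurable:
  assumes t: "t > 0"
  shows "(\<lambda>X. \<integral>\<omega>. free t \<omega> X * free t \<omega> X \<partial>P) \<in> borel_measurable \<nu>"
  using measurable_compose[OF _ free_pair_measurable[OF t], of "\<lambda>X. (X, X)" \<nu>] by simp

lemma free_pair_bounds:
  assumes "t > 0"
  shows "0 \<le> (\<integral>\<omega>. free t \<omega> X * free t \<omega> X' \<partial>P)" "(\<integral>\<omega>. free t \<omega> X * free t \<omega> X' \<partial>P) \<le> 1"
proof -
  show "0 \<le> (\<integral>\<omega>. free t \<omega> X * free t \<omega> X' \<partial>P)"
    by (intro integral_nonneg_AE) (simp add: free_bounds)
  have "(\<integral>\<omega>. free t \<omega> X * free t \<omega> X' \<partial>P) \<le> (\<integral>\<omega>. 1 \<partial>P)"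
    by (intro integral_mono') (auto simp: free_bounds intro: mult_le_one)
  then show "(\<integral>\<omega>. free t \<omega> X * free t \<omega> X' \<partial>P) \<le> 1" by (simp add: prob_space)
qed

lemma integral_limit:
  fixes f :: "nat \<Rightarrow> 'a set \<Rightarrow> real"
  assumes m: "\<And>n. f n \<in> borel_measurable \<nu>" and b: "\<And>n X. 0 \<le> f n X" "\<And>n X. f n X \<le> 1"
    and lim: "\<And>X. X \<in> planes \<Longrightarrow> (\<lambda>n. f n X) \<longlonglongrightarrow> g X"
  shows "(\<lambda>n. \<integral>X. f n X \<partial>\<nu>) \<longlonglongrightarrow> (\<integral>X. g X \<partial>\<nu>)" and "g \<in> borel_measurable \<nu>"
proof -
  show gm: "g \<in> borel_measurable \<nu>"
    using lim by (intro borel_measurable_LIMSEQ_real[OF _ m]) auto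
  show "(\<lambda>n. \<integral>X. f n X \<partial>\<nu>) \<longlonglongrightarrow> (\<integral>X. g X \<partial>\<nu>)"
    by (rule integral_dominated_convergence[where w = "\<lambda>_. 1"])
      (use gm m b lim in \<open>auto intro!: AE_I2\<close>)
qed

context
  fixes t :: "nat \<Rightarrow> real"
  assumes t: "\<And>n. 0 < t n" "filterlim t at_top sequentially" and r1: "\<And>n. r (t n) \<le> 1"
begin

lemma radius_sequence: "0 < r (t n)" "(\<lambda>n. r (t n)) \<longlonglongrightarrow> 0"
  using radius_pos t(1) filterlim_compose[OF radius_tendsto t(2)] by auto

context
  fixes c :: real
  assumes c: "0 \<le> c" and lim: "(\<lambda>n. t n ^ 4 * r (t n) ^ (2 * DIM('a) + 2)) \<longlonglongrightarrow> c"
begin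

lemma free_pair_limit:
  assumes "X \<in> planes" "X' \<in> planes"
  shows "(\<lambda>n. \<integral>\<omega>. free (t n) \<omega> X * free (t n) \<omega> X' \<partial>P) \<longlonglongrightarrow> exp (- (c * pair_rate W X X'))"
  unfolding free_integral_\<omega>[OF t(1) assms]
  by (rule no_crossing_limit(1)[OF dimension body prob_space_axioms assms t radius_sequence(1) r1
        radius_sequence(2) poisson[OF t(1)] lim])

lemma free_diagonal_limit:
  assumes "X \<in> planes"
  shows "(\<lambda>n. \<integral>\<omega>. free (t n) \<omega> X * free (t n) \<omega> X \<partial>P) \<longlonglongrightarrow> exp (- (c * limit_rate W X))"
  using free_pair_limit[OF assms assms] by (simp add: pair_rate_def)

lemma limit_exp_measurable: "(\<lambda>X. exp (- (c * limit_rate W X))) \<in> borel_measurable \<nu>"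
  by (rule integral_limit(2)[OF free_diagonal_measurable[OF t(1)] free_pair_bounds[OF t(1)] free_diagonal_limit])

lemma limit_exp_bounds: "X \<in> planes \<Longrightarrow> exp (- (c * limit_rate W X)) \<le> 1"
  using limit_rate_pos[OF dimension body, of X] c by simp

lemma limit_probability_bounds: "0 \<le> limit_probability W \<nu> c" "limit_probability W \<nu> c \<le> 1"
proof -
  show "0 \<le> limit_probability W \<nu> c" unfolding limit_probability_def by (intro integral_nonneg_AE) simp
  have "limit_probability W \<nu> c \<le> (\<integral>X. 1 \<partial>\<nu>)"
    unfolding limit_probability_def using limit_exp_bounds by (intro integral_mono') auto
  then show "limit_probability W \<nu> c \<le> 1" using \<nu>.prob_space by simp
qed

lemma first_moment_limit:
  "(\<lambda>n. \<integral>\<omega>. free_prob (t n) \<omega> \<partial>P) \<longlonglongrightarrow> limit_probability W \<nu> c"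
  unfolding expectation_free_prob[OF t(1)] limit_probability_def
  by (rule integral_limit(1)[OF free_diagonal_measurable[OF t(1)] free_pair_bounds[OF t(1)] free_diagonal_limit])

text \<open>
  For a fixed plane almost every other one is distinct from it, so the rates add up and the
  limiting exponential factorises.
\<close>

lemma second_moment_limit:
  "(\<lambda>n. \<integral>\<omega>. free_prob (t n) \<omega> ^ 2 \<partial>P) \<longlonglongrightarrow> limit_probability W \<nu> c ^ 2"
proof -
  let ?M = "limit_probability W \<nu> c"
  have inner: "(\<lambda>n. \<integral>X'. \<integral>\<omega>. free (t n) \<omega> X * free (t n) \<omega> X' \<partial>P \<partial>\<nu>) \<longlonglongrightarrow> exp (- (c * limit_rate W X)) * ?M"
    if X: "X \<in> planes" for X
  proof -
    have "emeasure \<nu> {X} = 0" by (rule uniform_on_planes_atomless[OF uniform dimension X])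
    then have "{X} \<in> null_sets \<nu>" using singleton_borel_planes[OF X] by (simp add: null_sets_def sets_\<nu>)
    then have "AE X' in \<nu>. X' \<notin> {X}" by (rule AE_not_in)
    then have ne: "AE X' in \<nu>. (\<lambda>n. \<integral>\<omega>. free (t n) \<omega> X * free (t n) \<omega> X' \<partial>P)
        \<longlonglongrightarrow> exp (- (c * limit_rate W X)) * exp (- (c * limit_rate W X'))"
    proof (rule AE_mp[OF _ AE_I2], intro impI)
      fix X' assume X': "X' \<in> space \<nu>" "X' \<notin> {X}"
      have "exp (- (c * pair_rate W X X')) = exp (- (c * limit_rate W X)) * exp (- (c * limit_rate W X'))"
        using X' by (auto simp: pair_rate_def exp_add[symmetric] algebra_simps)
      then show "(\<lambda>n. \<integral>\<omega>. free (t n) \<omega> X * free (t n) \<omega> X' \<partial>P)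
        \<longlonglongrightarrow> exp (- (c * limit_rate W X)) * exp (- (c * limit_rate W X'))"
        using free_pair_limit[OF X, of X'] X' by simp
    qed
    have "(\<lambda>n. \<integral>X'. \<integral>\<omega>. free (t n) \<omega> X * free (t n) \<omega> X' \<partial>P \<partial>\<nu>)
      \<longlonglongrightarrow> (\<integral>X'. exp (- (c * limit_rate W X)) * exp (- (c * limit_rate W X')) \<partial>\<nu>)"
      by (rule integral_dominated_convergence[where w = "\<lambda>_. 1"])
        (use ne limit_exp_measurable free_pair_measurable_1[OF t(1) X] free_pair_bounds[OF t(1)] in auto)
    then show ?thesis by (simp add: limit_probability_def)
  qed
  have m: "(\<lambda>X. \<integral>X'. \<integral>\<omega>. free (t n) \<omega> X * free (t n) \<omega> X' \<partial>P \<partial>\<nu>) \<in> borel_measurable \<nu>" for n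
    by (rule \<nu>.borel_measurable_lebesgue_integral[OF free_pair_measurable[OF t(1)]])
  have b: "0 \<le> (\<integral>X'. \<integral>\<omega>. free (t n) \<omega> X * free (t n) \<omega> X' \<partial>P \<partial>\<nu>)"
    "(\<integral>X'. \<integral>\<omega>. free (t n) \<omega> X * free (t n) \<omega> X' \<partial>P \<partial>\<nu>) \<le> 1" for n X
  proof -
    show "0 \<le> (\<integral>X'. \<integral>\<omega>. free (t n) \<omega> X * free (t n) \<omega> X' \<partial>P \<partial>\<nu>)"
      by (intro integral_nonneg_AE AE_I2 free_pair_bounds[OF t(1)])
    have "(\<integral>X'. \<integral>\<omega>. free (t n) \<omega> X * free (t n) \<omega> X' \<partial>P \<partial>\<nu>) \<le> (\<integral>X'. 1 \<partial>\<nu>)"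
      by (intro integral_mono') (auto intro: free_pair_bounds[OF t(1)])
    then show "(\<integral>X'. \<integral>\<omega>. free (t n) \<omega> X * free (t n) \<omega> X' \<partial>P \<partial>\<nu>) \<le> 1" using \<nu>.prob_space by simp
  qed
  have "(\<lambda>n. \<integral>X. \<integral>X'. \<integral>\<omega>. free (t n) \<omega> X * free (t n) \<omega> X' \<partial>P \<partial>\<nu> \<partial>\<nu>)
      \<longlonglongrightarrow> (\<integral>X. exp (- (c * limit_rate W X)) * ?M \<partial>\<nu>)"
    by (rule integral_limit(1)[OF m b inner])
  then show ?thesis
    unfolding expectation_free_prob_square[OF t(1)] by (simp add: limit_probability_def power2_eq_square)
qed

lemma probability_limit:
  assumes m: "m \<ge> 1"
  shows "(\<lambda>n. measure P {\<omega> \<in> space P. \<exists>i\<in>{1..m}. crossings (r (t n)) (\<eta> (t n) \<omega>) (L i \<omega>) = 0})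
    \<longlonglongrightarrow> 1 - (1 - limit_probability W \<nu> c) ^ m"
  unfolding probability_formula[OF t(1) m]
  by (rule power_expectation_limit[OF free_prob_measurable[OF t(1)] free_prob_bounds[OF t(1) ] limit_probability_bounds
        first_moment_limit second_moment_limit])

lemma expectation_exp_limit:
  "(\<lambda>n. \<integral>X. exp (- (\<integral>\<omega>. crossings (r (t n)) (\<eta> (t n) \<omega>) X \<partial>P)) \<partial>\<nu>) \<longlonglongrightarrow> limit_probability W \<nu> c"
  unfolding limit_probability_def
proof (rule integral_limit(1))
  fix n
  have "(\<lambda>z. crossings (r (t n)) (\<eta> (t n) (snd z)) (fst z)) \<in> borel_measurable (\<nu> \<Otimes>\<^sub>M P)"
    by (intro measurable_crossings[OF measurable_compose[OF measurable_snd \<eta>_measurable[OF t(1)]]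
          measurable_compose[OF measurable_fst id_planes]])
  then have "(\<lambda>X. \<integral>\<omega>. crossings (r (t n)) (\<eta> (t n) \<omega>) X \<partial>P) \<in> borel_measurable \<nu>"
    by (intro borel_measurable_lebesgue_integral) (simp add: split_beta')
  then show "(\<lambda>X. exp (- (\<integral>\<omega>. crossings (r (t n)) (\<eta> (t n) \<omega>) X \<partial>P))) \<in> borel_measurable \<nu>" by measurable
  fix X
  have "0 \<le> crossings (r (t n)) (\<eta> (t n) \<omega>) X" if "\<omega> \<in> space P" for \<omega>
  proof -
    have "finite (\<eta> (t n) \<omega>)"
      using measurable_space[OF \<eta>_measurable[OF t(1)] that] by (simp add: space_configurations)
    then show ?thesis by (simp add: crossings_eq_tuple_count)
  qed
  then have "0 \<le> (\<integral>\<omega>. crossings (r (t n)) (\<eta> (t n) \<omega>) X \<partial>P)"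
    by (intro integral_nonneg_AE AE_I2)
  then show "exp (- (\<integral>\<omega>. crossings (r (t n)) (\<eta> (t n) \<omega>) X \<partial>P)) \<le> 1" by simp
next
  fix X :: "'a set" assume X: "X \<in> planes"
  have "(\<lambda>n. \<integral>\<omega>. crossings (r (t n)) (\<eta> (t n) \<omega>) X \<partial>P) \<longlonglongrightarrow> c * limit_rate W X"
    by (rule no_crossing_limit(2)[OF dimension body prob_space_axioms X X t radius_sequence(1) r1
        radius_sequence(2) poisson[OF t(1)] lim])
  then show "(\<lambda>n. exp (- (\<integral>\<omega>. crossings (r (t n)) (\<eta> (t n) \<omega>) X \<partial>P))) \<longlonglongrightarrow> exp (- (c * limit_rate W X))"
    by (intro tendsto_intros)
qed simp

end

lemma probability_limit_infinity:
  assumes m: "m \<ge> 1"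
    and lim: "filterlim (\<lambda>n. t n ^ 4 * r (t n) ^ (2 * DIM('a) + 2)) at_top sequentially"
  shows "(\<lambda>n. measure P {\<omega> \<in> space P. \<exists>i\<in>{1..m}. crossings (r (t n)) (\<eta> (t n) \<omega>) (L i \<omega>) = 0}) \<longlonglongrightarrow> 0"
proof -
  have pt: "(\<lambda>n. \<integral>\<omega>. free (t n) \<omega> X * free (t n) \<omega> X \<partial>P) \<longlonglongrightarrow> 0" if X: "X \<in> planes" for X
    unfolding free_integral_\<omega>[OF t(1) X X] conj_absorb
    by (rule no_crossing_limit_infinity[OF dimension body prob_space_axioms X t radius_sequence(1) r1
        radius_sequence(2) poisson[OF t(1)] lim])
  have 1: "(\<lambda>n. \<integral>\<omega>. free_prob (t n) \<omega> \<partial>P) \<longlonglongrightarrow> 0"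
    unfolding expectation_free_prob[OF t(1)]
    using integral_limit(1)[OF free_diagonal_measurable[OF t(1)] free_pair_bounds[OF t(1)] pt] by simp
  have int: "integrable P (free_prob (t n))" "integrable P (\<lambda>\<omega>. free_prob (t n) \<omega> ^ 2)" for n
    using free_prob_measurable[OF t(1)] free_prob_bounds[OF t(1)]
    by (auto intro!: integrable_const_bound[where B = 1] simp: power_le_one)
  have 2: "(\<lambda>n. \<integral>\<omega>. free_prob (t n) \<omega> ^ 2 \<partial>P) \<longlonglongrightarrow> 0"
  proof (rule tendsto_sandwich[OF always_eventually always_eventually tendsto_const 1], safe)
    fix n
    show "0 \<le> (\<integral>\<omega>. free_prob (t n) \<omega> ^ 2 \<partial>P)" by (intro integral_nonneg_AE) simp
    show "(\<integral>\<omega>. free_prob (t n) \<omega> ^ 2 \<partial>P) \<le> (\<integral>\<omega>. free_prob (t n) \<omega> \<partial>P)"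
    proof (rule integral_mono[OF int(2) int(1)])
      fix \<omega>
      show "free_prob (t n) \<omega> ^ 2 \<le> free_prob (t n) \<omega>"
        using free_prob_bounds[OF t(1), of n \<omega>] by (simp add: power2_eq_square mult_left_le)
    qed
  qed
  have "(\<lambda>n. 1 - (\<integral>\<omega>. (1 - free_prob (t n) \<omega>) ^ m \<partial>P)) \<longlonglongrightarrow> 1 - (1 - 0) ^ m"
    by (rule power_expectation_limit) (use free_prob_measurable[OF t(1)] free_prob_bounds[OF t(1)] 1 2 in auto)
  then show ?thesis unfolding probability_formula[OF t(1) m] by simp
qed

end

end

theorem theorem2:
  fixes W :: "'a::euclidean_space set" and \<nu> :: "'a set measure"
  assumes "DIM('a) \<ge> 3"
    and "convex_body W"
    and "uniform_on_planes \<nu>"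
  shows "\<exists>M :: real \<Rightarrow> real.
    \<forall>(P :: 'w measure) r \<eta> L (m :: nat). projected_rgg P W r \<eta> \<nu> L \<and> m \<ge> 1 \<longrightarrow>
      (let a = (\<lambda>t. t ^ 4 * r t ^ (2 * DIM('a) + 2));
           p = (\<lambda>t. measure P
             {\<omega> \<in> space P. \<exists>i\<in>{1..m}. crossings (r t) (\<eta> t \<omega>) (L i \<omega>) = 0})
       in
        ((a \<longlongrightarrow> 0) at_top \<longrightarrow> (p \<longlongrightarrow> 1) at_top) \<and>
        (filterlim a at_top at_top \<longrightarrow> (p \<longlongrightarrow> 0) at_top) \<and>
        (\<forall>c>0. (a \<longlongrightarrow> c) at_top \<longrightarrow>
          ((\<lambda>t. \<integral>X. exp (- (\<integral>\<omega>. crossings (r t) (\<eta> t \<omega>) X \<partial>P)) \<partial>\<nu>) \<longlongrightarrow> M c) at_top \<and>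
          (p \<longlongrightarrow> 1 - (1 - M c) ^ m) at_top))"
proof (intro exI[of _ "limit_probability W \<nu>"] allI impI, elim conjE)
  fix P :: "'w measure" and r \<eta> L and m :: nat
  assume "projected_rgg P W r \<eta> \<nu> L" and m: "m \<ge> 1"
  then interpret projected_rgg_limit P W r \<eta> \<nu> L
    using assms by (simp add: projected_rgg_limit_def projected_rgg_limit_axioms_def)
  define a where "a t = t ^ 4 * r t ^ (2 * DIM('a) + 2)" for t
  define p where "p t = measure P {\<omega> \<in> space P. \<exists>i\<in>{1..m}. crossings (r t) (\<eta> t \<omega>) (L i \<omega>) = 0}" for t
  have ev: "\<forall>\<^sub>F t in at_top. 0 < t \<and> r t \<le> 1"
  proof -
    have "\<forall>\<^sub>F t in at_top. r t < 1" using order_tendstoD(2)[OF radius_tendsto, of 1] by simp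
    with eventually_gt_at_top[of "0::real"] show ?thesis by eventually_elim simp
  qed
  have p_lim: "(p \<longlongrightarrow> 1 - (1 - limit_probability W \<nu> c) ^ m) at_top" if "0 \<le> c" "(a \<longlongrightarrow> c) at_top" for c
    using ev
  proof (rule tendsto_at_top_via_sequences)
    fix t assume t: "filterlim t at_top sequentially" "\<And>n. 0 < t n \<and> r (t n) \<le> 1"
    show "(\<lambda>n. p (t n)) \<longlonglongrightarrow> 1 - (1 - limit_probability W \<nu> c) ^ m"
      unfolding p_def using t filterlim_compose[OF that(2) t(1)]
      by (intro probability_limit[of t] m that(1)) (auto simp: a_def)
  qed
  \<comment> \<open>for c = 0 the limit probability is the total mass of the planes, which is 1\<close>
  have 1: "(a \<longlongrightarrow> 0) at_top \<longrightarrow> (p \<longlongrightarrow> 1) at_top"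
  proof
    assume "(a \<longlongrightarrow> 0) at_top"
    from p_lim[OF _ this] show "(p \<longlongrightarrow> 1) at_top"
      using m \<nu>.prob_space by (simp add: limit_probability_def power_0_left)
  qed
  have 2: "filterlim a at_top at_top \<longrightarrow> (p \<longlongrightarrow> 0) at_top"
  proof
    assume a: "filterlim a at_top at_top"
    show "(p \<longlongrightarrow> 0) at_top"
      using ev
    proof (rule tendsto_at_top_via_sequences)
      fix t assume t: "filterlim t at_top sequentially" "\<And>n. 0 < t n \<and> r (t n) \<le> 1"
      show "(\<lambda>n. p (t n)) \<longlonglongrightarrow> 0"
        unfolding p_def using t filterlim_compose[OF a t(1)]
        by (intro probability_limit_infinity[of t] m) (auto simp: a_def)
    qed
  qed
  have 3: "((\<lambda>t. \<integral>X. exp (- (\<integral>\<omega>. crossings (r t) (\<eta> t \<omega>) X \<partial>P)) \<partial>\<nu>) \<longlongrightarrow> limit_probability W \<nu> c) at_top"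
    if "0 < c" "(a \<longlongrightarrow> c) at_top" for c
    using ev
  proof (rule tendsto_at_top_via_sequences)
    fix t assume t: "filterlim t at_top sequentially" "\<And>n. 0 < t n \<and> r (t n) \<le> 1"
    show "(\<lambda>n. \<integral>X. exp (- (\<integral>\<omega>. crossings (r (t n)) (\<eta> (t n) \<omega>) X \<partial>P)) \<partial>\<nu>) \<longlonglongrightarrow> limit_probability W \<nu> c"
      using t filterlim_compose[OF that(2) t(1)] that(1)
      by (intro expectation_exp_limit[of t]) (auto simp: a_def)
  qed
  show "let a = (\<lambda>t. t ^ 4 * r t ^ (2 * DIM('a) + 2));
           p = (\<lambda>t. measure P
             {\<omega> \<in> space P. \<exists>i\<in>{1..m}. crossings (r t) (\<eta> t \<omega>) (L i \<omega>) = 0})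
       in
        ((a \<longlongrightarrow> 0) at_top \<longrightarrow> (p \<longlongrightarrow> 1) at_top) \<and>
        (filterlim a at_top at_top \<longrightarrow> (p \<longlongrightarrow> 0) at_top) \<and>
        (\<forall>c>0. (a \<longlongrightarrow> c) at_top \<longrightarrow>
          ((\<lambda>t. \<integral>X. exp (- (\<integral>\<omega>. crossings (r t) (\<eta> t \<omega>) X \<partial>P)) \<partial>\<nu>) \<longlongrightarrow> limit_probability W \<nu> c) at_top \<and>
          (p \<longlongrightarrow> 1 - (1 - limit_probability W \<nu> c) ^ m) at_top)"
    unfolding Let_def a_def[symmetric] p_def[symmetric]
    using 1 2 3 p_lim by auto
qed

end
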